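(* Let $n\in\{2,3\}$, $g,L>0$, $0<\rho_-<\rho_+$, and $\Omega=\mathbb T^{n-1}\times(-L,L)$ (with $|\mathbb T|=1$) or $\Omega=(0,1)^{n-1}\times(-L,L)$. Define $$a(r)=\frac{(\rho_+-r)(r-\rho_-)}{\rho_++\rho_--r},\quad r\in[\rho_-,\rho_+].$$ Let $\lambda\in(0,1/2]$ and let $T>0$ be such that $\lambda\frac{\rho_+-\rho_-}{\rho_-}\frac{gT^2}2<L$. Choosing $$m=m(t,\mu)=gt(\mu-\lambda a(\mu))e_n$$ and taking $\mu$ to be the unique entropy solution of the Riemann problem $$\partial_t\mu+\partial_{y_n}m_n(t,\mu)=0,\qquad\mu(\cdot,0)=\rho_0,$$ gives rise to a one-dimensional non-strict subsolution $z$ (with these components $\mu$ and $m$) with a pressure $q$ and dissipation measure $\nu$ given by $$\nu=(1-2\lambda)g(m_n-\mu gt)=\lambda(2\lambda-1)g^2t\,a(\mu)\le0.$$ The associated total energy $E_{tot}(t)=\int_{\Omega+\frac12gt^2e_n}e-m_ngt+\mu gy_n\,dy$ is given by $$E_{tot}(t)=\int_\Omega\rho_0(y)gy_n\,dy+\frac{(\rho_+-\rho_-)^3}{12\rho_+\rho_-}\left(\lambda-\frac12\right)\lambda^2g^3t^4 .$$ All involved quantities $z$, $q$ and $\nu$ are continuous on all of $\overline{\mathscr D}$ except $\mu$ at $\{y_n=t=0\}$.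
   Context: $\rho_0(x)=\rho_+$ for $x_n>0$ and $\rho_0(x)=\rho_-$ for $x_n<0$. Set $\mathscr D(t)=\Omega+\frac12gt^2e_n$, $\mathscr D=\{(y,t):t\in(0,T),\,y\in\mathscr D(t)\}$, $\overline{\mathscr D}^*=\bigcup_{t\in[0,T)}\overline{\mathscr D(t)}\times\{t\}$, $\partial_{rel}\mathscr D=\bigcup_{t\in(0,T)}\partial\mathscr D(t)\times\{t\}$, $\vec n$ the outer unit normal. $\mathcal S_0^{n\times n}$ is the space of symmetric traceless matrices, $Z=\mathbb R\times\mathbb R^n\times\mathbb R^n\times\mathbb R^n\times\mathcal S_0^{n\times n}\times\mathbb R\ni z=(\mu,w,m,h,\sigma,e)$. Let $T_\pm(z)=\frac{\rho_\pm}2\frac{|m-\rho_\mp w|^2}{(\mu-\rho_\mp)^2}$ for $\mu\in(\rho_-,\rho_+)$. A one-dimensional non-strict subsolution is a tuple $z\in L^\infty(\mathscr D;Z)$ with pressure $q\in L^\infty(\mathscr D)\cap L^1(\partial_{rel}\mathscr D)$ and dissipation measure $\nu\in(C_c^\infty(\overline{\mathscr D}^* ))^*$, $\nu[\varphi]\le0$ for $\varphi\ge0$, such that: (1) (linear system $\partial_tm+\mathrm{div}\,\sigma+\nabla(\frac2ne+q)=0$, $\mathrm{div}\,w=0$, $\partial_t\mu+\mathrm{div}\,m=0$, $\partial_te+\mathrm{div}\,h=\nu$ with boundary conditions and initial data $\mu=\rho_0$, $m=0$, $e=0$) for all $\Phi\in C_c^\infty(\overline{\mathscr D}^*;\mathbb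 R^n)$, $\Psi\in C_c^\infty(\overline{\mathscr D}^* )$: $\int_{\mathscr D}[m\cdot\partial_t\Phi+(\sigma+\frac2ne\,\mathrm{id}+q\,\mathrm{id}):\nabla\Phi]-\int_0^T\int_{\partial\mathscr D(t)}q\Phi\cdot\vec n=0$; $\int_{\mathscr D}(w-gte_n)\cdot\nabla\Psi=0$; $\int_{\mathscr D}[\mu\partial_t\Psi+m\cdot\nabla\Psi]+\int_\Omega\rho_0\Psi(\cdot,0)=0$; $\int_{\mathscr D}[e\partial_t\Psi+h\cdot\nabla\Psi]-\int_0^Tgt\int_{\partial\mathscr D(t)}q\Psi e_n\cdot\vec n=-\nu[\Psi]$; (2) $z,q,\nu$ depend only on $(y_n,t)$, $w=gte_n$, $m_j=h_j=0$ for $j=1,\dots,n-1$, and $\sigma=\frac12\mathrm{diag}(-f,f)$ if $n=2$, $\sigma=\frac13\mathrm{diag}(-f,-f,2f)$ if $n=3$, where $f=\frac{\mu\rho_-\rho_+g^2t^2-2\rho_-\rho_+m_ngt+(\rho_++\rho_--\mu)m_n^2}{(\rho_+-\mu)(\mu-\rho_-)}$ where $\mu\in(\rho_-,\rho_+)$ and $f=\mu g^2t^2$ where $\mu\in\{\rho_\pm\}$; (3) there is an open set $\mathscr U\subset\mathscr D$ (mixing zone) such that $z$ is continuous on $\mathscr U$, $q\in L^\infty(\mathscr U)\cap C^0(\mathscr U)$, $T_\pm(z)\in L^\infty(\mathscr U)$, on $\mathscr U$ there holds $\rho_-<\mu<\rho_+$, $e=\frac12f$ and $h=(e+q)w+\frac{T_+(z)-T_-(z)}{\rho_+-\rho_-}(m-\mu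 w)$, and a.e. in $\mathscr D\setminus\mathscr U$: $m=\mu w$, $h=(e+q)w$, $\mu w\otimes w=\sigma+\frac2ne\,\mathrm{id}$, $\mu\in\{\rho_-,\rho_+\}$. *)

theory Defs
  imports "HOL-Analysis.Analysis"
begin

section \<open>Smooth functions\<close>

primrec Ck :: "nat \<Rightarrow> ('a::real_normed_vector \<Rightarrow> 'b::real_normed_vector) \<Rightarrow> bool" where
  "Ck 0 f \<longleftrightarrow> continuous_on UNIV f"
| "Ck (Suc k) f \<longleftrightarrow>
     f differentiable_on UNIV \<and> (\<forall>v. Ck k (\<lambda>x. frechet_derivative f (at x) v))"

definition smooth :: "('a::real_normed_vector \<Rightarrow> 'b::real_normed_vector) \<Rightarrow> bool" where
  "smooth f \<longleftrightarrow> (\<forall>k. Ck k f)"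

text \<open>All partial derivatives up to order \<open>k\<close> are bounded by \<open>B\<close> on \<open>K\<close>.\<close>

primrec Ck_bound ::
  "'a::euclidean_space set \<Rightarrow> real \<Rightarrow> nat \<Rightarrow> ('a \<Rightarrow> 'b::real_normed_vector) \<Rightarrow> bool" where
  "Ck_bound K B 0 f \<longleftrightarrow> (\<forall>x\<in>K. norm (f x) \<le> B)"
| "Ck_bound K B (Suc k) f \<longleftrightarrow> (\<forall>x\<in>K. norm (f x) \<le> B) \<and>
     (\<forall>v\<in>Basis. Ck_bound K B k (\<lambda>x. frechet_derivative f (at x) v))"

section \<open>Entropy solutions of scalar conservation laws\<close>

text \<open>
  Entropy/entropy-flux pairs of \<open>\<partial>\<^sub>t u + \<partial>\<^sub>x F(t,u) = 0\<close> with states in the interval \<open>J\<close>: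
  \<open>\<eta>\<close> is convex and \<open>C\<^sup>1\<close>, and \<open>\<partial>\<^sub>r \<psi>(t,r) = \<eta>'(r) \<partial>\<^sub>r F(t,r)\<close>. Joint continuity of \<open>\<psi>\<close> only
  excludes irregular additive functions of \<open>t\<close>, which the equation leaves free.
\<close>

definition entropy_pair ::
  "(real \<Rightarrow> real \<Rightarrow> real) \<Rightarrow> real set \<Rightarrow> real \<Rightarrow> (real \<Rightarrow> real) \<Rightarrow> (real \<Rightarrow> real \<Rightarrow> real) \<Rightarrow> bool" where
  "entropy_pair F J T \<eta> \<psi> \<longleftrightarrow>
     convex_on J \<eta> \<and> continuous_on ({0..T} \<times> J) (\<lambda>(t, r). \<psi> t r) \<and>
     (\<exists>\<eta>'. continuous_on J \<eta>' \<and>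
        (\<forall>r\<in>J. (\<eta> has_real_derivative \<eta>' r) (at r within J)) \<and>
        (\<forall>t\<in>{0..T}. \<forall>r\<in>J. \<exists>F'. (F t has_real_derivative F') (at r within J) \<and>
           (\<psi> t has_real_derivative \<eta>' r * F') (at r within J)))"

text \<open>
  Bounded entropy solutions on \<open>\<real> \<times> (0,T)\<close> with initial datum \<open>u0\<close>. Points are \<open>(x,t)\<close>; the test
  functions are those of \<open>C\<^sub>c\<^sup>\<infinity>(\<real> \<times> [0,T))\<close>. Taking \<open>\<eta>(r) = \<plusminus>r\<close> gives the weak formulation.
\<close>

definition entropy_solution ::
  "(real \<Rightarrow> real \<Rightarrow> real) \<Rightarrow> real set \<Rightarrow> real \<Rightarrow> (real \<Rightarrow> real) \<Rightarrow> (real \<times> real \<Rightarrow> real) \<Rightarrow> bool" where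
  "entropy_solution F J T u0 u \<longleftrightarrow>
     u \<in> borel_measurable (lebesgue_on (UNIV \<times> {0<..<T})) \<and>
     (AE p in lebesgue_on (UNIV \<times> {0<..<T}). u p \<in> J) \<and>
     (\<forall>\<eta> \<psi> \<phi> K. entropy_pair F J T \<eta> \<psi> \<longrightarrow> smooth \<phi> \<longrightarrow>
        compact K \<longrightarrow> K \<subseteq> UNIV \<times> {0..<T} \<longrightarrow>
        (\<forall>p \<in> UNIV \<times> {0..<T} - K. \<phi> p = 0) \<longrightarrow> (\<forall>p \<in> UNIV \<times> {0..<T}. \<phi> p \<ge> 0) \<longrightarrow>
        (LINT p:UNIV \<times> {0<..<T}|lebesgue.
            \<eta> (u p) * frechet_derivative \<phi> (at p) (0, 1) +
            \<psi> (snd p) (u p) * frechet_derivative \<phi> (at p) (1, 0)) +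
        (LINT x|lebesgue. \<eta> (u0 x) * \<phi> (x, 0)) \<ge> 0)"

section \<open>The moving domain\<close>

text \<open>
  The vertical direction \<open>e\<^sub>n\<close> is \<open>axis N 1\<close> for a distinguished index \<open>N\<close>. For \<open>Periodic\<close> the lateral
  factor is the torus \<open>\<real>\<^sup>n\<^sup>-\<^sup>1/\<int>\<^sup>n\<^sup>-\<^sup>1\<close>: sets and functions on it are represented by their
  laterally \<open>1\<close>-periodic lifts to \<open>\<real>\<^sup>n\<close>, and integrals are taken over \<open>cell N\<close>. For \<open>Walls\<close> it is
  the open cube \<open>(0,1)\<^sup>n\<^sup>-\<^sup>1\<close>, and intersecting with \<open>cell N\<close> has no effect.
\<close>

datatype lateral = Periodic | Walls

definition lateral_lift :: "lateral \<Rightarrow> 'n::finite \<Rightarrow> ((real^'n) \<times> real \<Rightarrow> 'b) \<Rightarrow> bool" where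
  "lateral_lift b N f \<longleftrightarrow>
     (b = Periodic \<longrightarrow> (\<forall>j y t. j \<noteq> N \<longrightarrow> f (y + axis j 1, t) = f (y, t)))"

definition cell :: "'n::finite \<Rightarrow> (real^'n) set" where
  "cell N = {y. \<forall>j. j \<noteq> N \<longrightarrow> 0 \<le> y $ j \<and> y $ j \<le> 1}"

definition Omega :: "lateral \<Rightarrow> 'n::finite \<Rightarrow> real \<Rightarrow> (real^'n) set" where
  "Omega b N L = {x. - L < x $ N \<and> x $ N < L \<and>
     (b = Walls \<longrightarrow> (\<forall>j. j \<noteq> N \<longrightarrow> 0 < x $ j \<and> x $ j < 1))}"

definition Dt :: "lateral \<Rightarrow> 'n::finite \<Rightarrow> real \<Rightarrow> real \<Rightarrow> real \<Rightarrow> (real^'n) set" where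
  "Dt b N g L t = (\<lambda>x. x + (1/2 * g * t\<^sup>2) *\<^sub>R axis N 1) ` Omega b N L"

definition DD :: "lateral \<Rightarrow> 'n::finite \<Rightarrow> real \<Rightarrow> real \<Rightarrow> real \<Rightarrow> ((real^'n) \<times> real) set" where
  "DD b N g L T = {(y, t). t \<in> {0<..<T} \<and> y \<in> Dt b N g L t}"

definition DDstar :: "lateral \<Rightarrow> 'n::finite \<Rightarrow> real \<Rightarrow> real \<Rightarrow> real \<Rightarrow> ((real^'n) \<times> real) set" where
  "DDstar b N g L T = {(y, t). t \<in> {0..<T} \<and> y \<in> closure (Dt b N g L t)}"

definition DDint ::
  "lateral \<Rightarrow> 'n::finite \<Rightarrow> real \<Rightarrow> real \<Rightarrow> real \<Rightarrow> ((real^'n) \<times> real \<Rightarrow> real) \<Rightarrow> real" where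
  "DDint b N g L T F = (LINT p:DD b N g L T \<inter> (cell N \<times> UNIV)|lebesgue. F p)"

text \<open>
  The faces of \<open>\<partial>D(t)\<close>: the pair \<open>(i, up)\<close> is the face orthogonal to \<open>e\<^sub>i\<close> on the upper or lower side,
  with outer unit normal \<open>face_normal (i, up)\<close>. The torus has no lateral faces. \<open>face_point\<close> inserts
  the fixed coordinate into a point \<open>\<omega>\<close> of \<open>\<real>\<^sup>n\<^sup>-\<^sup>1\<close>, whose coordinates are indexed by \<open>UNIV - {i}\<close>.
\<close>

definition faces :: "lateral \<Rightarrow> 'n::finite \<Rightarrow> ('n \<times> bool) set" where
  "faces b N = {(i, up). i = N \<or> b = Walls}"

definition face_normal :: "'n::finite \<times> bool \<Rightarrow> real^'n" where
  "face_normal = (\<lambda>(i, up). (if up then 1 else -1) *\<^sub>R axis i 1)"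

definition face_pos :: "'n::finite \<Rightarrow> real \<Rightarrow> real \<Rightarrow> 'n \<times> bool \<Rightarrow> real \<Rightarrow> real" where
  "face_pos N g L = (\<lambda>(i, up) t.
     if i = N then (if up then L else - L) + 1/2 * g * t\<^sup>2 else (if up then 1 else 0))"

definition face_point :: "'n::finite \<Rightarrow> real \<Rightarrow> ('n \<Rightarrow> real) \<Rightarrow> real^'n" where
  "face_point i c \<omega> = (\<chi> j. if j = i then c else \<omega> j)"

text \<open>
  The measure \<open>dS(y) dt\<close> on one face of \<open>\<partial>\<^sub>r\<^sub>e\<^sub>l D\<close>, where \<open>dS\<close> is \<open>(n-1)\<close>-dimensional Lebesgue measure on
  the face.
\<close>

definition face_measure ::
  "'n::finite \<Rightarrow> real \<Rightarrow> real \<Rightarrow> real \<Rightarrow> 'n \<times> bool \<Rightarrow> ((real^'n) \<times> real) measure" where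
  "face_measure N g L T fc = completion (distr
     (restrict_space (Pi\<^sub>M (UNIV - {fst fc}) (\<lambda>_. lborel) \<Otimes>\<^sub>M lborel)
        {(\<omega>, t). t \<in> {0<..<T} \<and> (\<forall>j. j \<noteq> fst fc \<longrightarrow>
           (if j = N then \<bar>\<omega> j - 1/2 * g * t\<^sup>2\<bar> < L else 0 < \<omega> j \<and> \<omega> j < 1))})
     borel
     (\<lambda>(\<omega>, t). (face_point (fst fc) (face_pos N g L fc t) \<omega>, t)))"

text \<open>\<open>\<integral>\<^sub>0\<^sup>T \<integral>\<^bsub>\<partial>D(t)\<^esub> F \<sqdot> n dS dt\<close>\<close>

definition boundary_flux ::
  "lateral \<Rightarrow> 'n::finite \<Rightarrow> real \<Rightarrow> real \<Rightarrow> real \<Rightarrow> ((real^'n) \<times> real \<Rightarrow> real^'n) \<Rightarrow> real" where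
  "boundary_flux b N g L T F =
     (\<Sum>fc\<in>faces b N. LINT p|face_measure N g L T fc. F p \<bullet> face_normal fc)"

section \<open>Test functions\<close>

text \<open>
  \<open>C\<^sub>c\<^sup>\<infinity>\<close> of the closed-up domain: restrictions of smooth functions on \<open>\<real>\<^sup>n \<times> \<real>\<close> that vanish on it
  outside a compact subset (a compact subset of a cell represents a compact subset of the torus).
\<close>

definition test_in ::
  "lateral \<Rightarrow> 'n::finite \<Rightarrow> real \<Rightarrow> real \<Rightarrow> real \<Rightarrow> ((real^'n) \<times> real) set \<Rightarrow>
   ((real^'n) \<times> real \<Rightarrow> 'b::real_normed_vector) \<Rightarrow> bool" where
  "test_in b N g L T K \<phi> \<longleftrightarrow> smooth \<phi> \<and> lateral_lift b N \<phi> \<and>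
     (\<forall>p \<in> DDstar b N g L T \<inter> (cell N \<times> UNIV) - K. \<phi> p = 0)"

definition test_fun ::
  "lateral \<Rightarrow> 'n::finite \<Rightarrow> real \<Rightarrow> real \<Rightarrow> real \<Rightarrow>
   ((real^'n) \<times> real \<Rightarrow> 'b::real_normed_vector) \<Rightarrow> bool" where
  "test_fun b N g L T \<phi> \<longleftrightarrow>
     (\<exists>K. compact K \<and> K \<subseteq> DDstar b N g L T \<and> test_in b N g L T K \<phi>)"

definition dt :: "('a::real_normed_vector \<times> real \<Rightarrow> 'b::real_normed_vector) \<Rightarrow> 'a \<times> real \<Rightarrow> 'b" where
  "dt \<phi> p = frechet_derivative \<phi> (at p) (0, 1)"

definition grad :: "((real^'n) \<times> real \<Rightarrow> real) \<Rightarrow> (real^'n) \<times> real \<Rightarrow> real^'n" where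
  "grad \<phi> p = (\<chi> j. frechet_derivative \<phi> (at p) (axis j 1, 0))"

definition jac :: "((real^'n) \<times> real \<Rightarrow> real^'n) \<Rightarrow> (real^'n) \<times> real \<Rightarrow> real^'n^'n" where
  "jac \<Phi> p = (\<chi> i j. frechet_derivative \<Phi> (at p) (axis j 1, 0) $ i)"

section \<open>Subsolutions\<close>

text \<open>
  The constraint that \<open>\<sigma>\<close> is symmetric and traceless is imposed in \<open>admissible_class\<close>.
\<close>

type_synonym 'n state =
  "real \<times> (real^'n) \<times> (real^'n) \<times> (real^'n) \<times> (real^'n^'n) \<times> real"

definition z_mu :: "('n::finite) state \<Rightarrow> real" where "z_mu = (\<lambda>(\<mu>, w, m, h, \<sigma>, e). \<mu>)"
definition z_w :: "('n::finite) state \<Rightarrow> real^'n" where "z_w = (\<lambda>(\<mu>, w, m, h, \<sigma>, e). w)"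
definition z_m :: "('n::finite) state \<Rightarrow> real^'n" where "z_m = (\<lambda>(\<mu>, w, m, h, \<sigma>, e). m)"
definition z_h :: "('n::finite) state \<Rightarrow> real^'n" where "z_h = (\<lambda>(\<mu>, w, m, h, \<sigma>, e). h)"
definition z_sigma :: "('n::finite) state \<Rightarrow> real^'n^'n" where
  "z_sigma = (\<lambda>(\<mu>, w, m, h, \<sigma>, e). \<sigma>)"
definition z_e :: "('n::finite) state \<Rightarrow> real" where "z_e = (\<lambda>(\<mu>, w, m, h, \<sigma>, e). e)"

definition rho0 :: "real \<Rightarrow> real \<Rightarrow> real \<Rightarrow> real" where
  "rho0 \<rho>m \<rho>p s = (if s > 0 then \<rho>p else \<rho>m)"

definition T_plus :: "real \<Rightarrow> real \<Rightarrow> ('n::finite) state \<Rightarrow> real" where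
  "T_plus \<rho>m \<rho>p z = \<rho>p / 2 * (norm (z_m z - \<rho>m *\<^sub>R z_w z))\<^sup>2 / (z_mu z - \<rho>m)\<^sup>2"

definition T_minus :: "real \<Rightarrow> real \<Rightarrow> ('n::finite) state \<Rightarrow> real" where
  "T_minus \<rho>m \<rho>p z = \<rho>m / 2 * (norm (z_m z - \<rho>p *\<^sub>R z_w z))\<^sup>2 / (z_mu z - \<rho>p)\<^sup>2"

text \<open>The \<open>else\<close> branch is meant for \<open>\<mu> \<in> {\<rho>m, \<rho>p}\<close>; \<open>mixing_zone\<close> forces \<open>\<mu> \<in> [\<rho>m, \<rho>p]\<close> a.e.\<close>

definition f_fun :: "real \<Rightarrow> real \<Rightarrow> real \<Rightarrow> real \<Rightarrow> real \<Rightarrow> real \<Rightarrow> real" where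
  "f_fun \<rho>m \<rho>p g t \<mu> mn =
     (if \<rho>m < \<mu> \<and> \<mu> < \<rho>p
      then (\<mu> * \<rho>m * \<rho>p * g\<^sup>2 * t\<^sup>2 - 2 * \<rho>m * \<rho>p * mn * g * t + (\<rho>p + \<rho>m - \<mu>) * mn\<^sup>2) /
           ((\<rho>p - \<mu>) * (\<mu> - \<rho>m))
      else \<mu> * g\<^sup>2 * t\<^sup>2)"

definition sigma_of :: "'n::finite \<Rightarrow> real \<Rightarrow> real^'n^'n" where
  "sigma_of N f = (\<chi> i j. if i \<noteq> j then 0
     else if CARD('n) = 2 then 1/2 * (if i = N then f else - f)
     else 1/3 * (if i = N then 2 * f else - f))"

definition ess_bounded :: "('a::euclidean_space) set \<Rightarrow> ('a \<Rightarrow> 'b::real_normed_vector) \<Rightarrow> bool" where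
  "ess_bounded A f \<longleftrightarrow> f \<in> borel_measurable (lebesgue_on A) \<and>
     (\<exists>C. AE p in lebesgue_on A. norm (f p) \<le> C)"

text \<open>\<open>\<nu> \<in> (C\<^sub>c\<^sup>\<infinity>)\<^sup>*\<close> with \<open>\<nu>[\<phi>] \<le> 0\<close> for \<open>\<phi> \<ge> 0\<close>; only the values of \<open>\<nu>\<close> on test functions matter.\<close>

definition dissipation_measure ::
  "lateral \<Rightarrow> 'n::finite \<Rightarrow> real \<Rightarrow> real \<Rightarrow> real \<Rightarrow> (((real^'n) \<times> real \<Rightarrow> real) \<Rightarrow> real) \<Rightarrow> bool" where
  "dissipation_measure b N g L T \<nu> \<longleftrightarrow>
     (\<forall>\<phi> \<psi>. test_fun b N g L T \<phi> \<longrightarrow> test_fun b N g L T \<psi> \<longrightarrow>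
        \<nu> (\<lambda>p. \<phi> p + \<psi> p) = \<nu> \<phi> + \<nu> \<psi>) \<and>
     (\<forall>c \<phi>. test_fun b N g L T \<phi> \<longrightarrow> \<nu> (\<lambda>p. c * \<phi> p) = c * \<nu> \<phi>) \<and>
     (\<forall>K. compact K \<longrightarrow> K \<subseteq> DDstar b N g L T \<longrightarrow>
        (\<exists>k C. \<forall>\<phi> B. test_in b N g L T K \<phi> \<longrightarrow> B \<ge> 0 \<longrightarrow> Ck_bound K B k \<phi> \<longrightarrow> \<bar>\<nu> \<phi>\<bar> \<le> C * B)) \<and>
     (\<forall>\<phi>. test_fun b N g L T \<phi> \<longrightarrow> (\<forall>p \<in> DDstar b N g L T. \<phi> p \<ge> 0) \<longrightarrow> \<nu> \<phi> \<le> 0)"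

definition admissible_class ::
  "lateral \<Rightarrow> 'n::finite \<Rightarrow> real \<Rightarrow> real \<Rightarrow> real \<Rightarrow>
   ((real^'n) \<times> real \<Rightarrow> 'n state) \<Rightarrow> ((real^'n) \<times> real \<Rightarrow> real) \<Rightarrow>
   (((real^'n) \<times> real \<Rightarrow> real) \<Rightarrow> real) \<Rightarrow> bool" where
  "admissible_class b N g L T z q \<nu> \<longleftrightarrow>
     lateral_lift b N z \<and> lateral_lift b N q \<and>
     ess_bounded (DD b N g L T) z \<and>
     (AE p in lebesgue_on (DD b N g L T).
        transpose (z_sigma (z p)) = z_sigma (z p) \<and> trace (z_sigma (z p)) = 0) \<and>
     ess_bounded (DD b N g L T) q \<and>
     (\<forall>fc\<in>faces b N. integrable (face_measure N g L T fc) q) \<and>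
     dissipation_measure b N g L T \<nu>"

definition linear_system ::
  "lateral \<Rightarrow> 'n::finite \<Rightarrow> real \<Rightarrow> real \<Rightarrow> real \<Rightarrow> real \<Rightarrow> real \<Rightarrow>
   ((real^'n) \<times> real \<Rightarrow> 'n state) \<Rightarrow> ((real^'n) \<times> real \<Rightarrow> real) \<Rightarrow>
   (((real^'n) \<times> real \<Rightarrow> real) \<Rightarrow> real) \<Rightarrow> bool" where
  "linear_system b N g L T \<rho>m \<rho>p z q \<nu> \<longleftrightarrow>
     (\<forall>\<Phi> :: (real^'n) \<times> real \<Rightarrow> real^'n. test_fun b N g L T \<Phi> \<longrightarrow>
        DDint b N g L T (\<lambda>p. z_m (z p) \<bullet> dt \<Phi> p +
           (z_sigma (z p) + mat (2 / real CARD('n) * z_e (z p)) + mat (q p)) \<bullet> jac \<Phi> p)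
        - boundary_flux b N g L T (\<lambda>p. q p *\<^sub>R \<Phi> p) = 0) \<and>
     (\<forall>\<Psi> :: (real^'n) \<times> real \<Rightarrow> real. test_fun b N g L T \<Psi> \<longrightarrow>
        DDint b N g L T (\<lambda>p. (z_w (z p) - (g * snd p) *\<^sub>R axis N 1) \<bullet> grad \<Psi> p) = 0 \<and>
        DDint b N g L T (\<lambda>p. z_mu (z p) * dt \<Psi> p + z_m (z p) \<bullet> grad \<Psi> p)
          + (LINT y:Omega b N L \<inter> cell N|lebesgue. rho0 \<rho>m \<rho>p (y $ N) * \<Psi> (y, 0)) = 0 \<and>
        DDint b N g L T (\<lambda>p. z_e (z p) * dt \<Psi> p + z_h (z p) \<bullet> grad \<Psi> p)
          - boundary_flux b N g L T (\<lambda>p. (g * snd p * q p * \<Psi> p) *\<^sub>R axis N 1) = - \<nu> \<Psi>)"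

text \<open>
  A functional depends only on \<open>(y\<^sub>n,t)\<close> if it sees a test function only through the integrals over
  its horizontal slices.
\<close>

definition slice_mean :: "'n::finite \<Rightarrow> ((real^'n) \<times> real \<Rightarrow> real) \<Rightarrow> real \<Rightarrow> real \<Rightarrow> real" where
  "slice_mean N \<phi> s t =
     (LINT \<omega>:{\<omega>. \<forall>j. j \<noteq> N \<longrightarrow> 0 < \<omega> j \<and> \<omega> j < 1}|Pi\<^sub>M (UNIV - {N}) (\<lambda>_. lborel).
        \<phi> (face_point N s \<omega>, t))"

definition one_dimensional ::
  "lateral \<Rightarrow> 'n::finite \<Rightarrow> real \<Rightarrow> real \<Rightarrow> real \<Rightarrow> real \<Rightarrow> real \<Rightarrow>
   ((real^'n) \<times> real \<Rightarrow> 'n state) \<Rightarrow> ((real^'n) \<times> real \<Rightarrow> real) \<Rightarrow>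
   (((real^'n) \<times> real \<Rightarrow> real) \<Rightarrow> real) \<Rightarrow> bool" where
  "one_dimensional b N g L T \<rho>m \<rho>p z q \<nu> \<longleftrightarrow>
     (\<exists>z1. AE p in lebesgue_on (DD b N g L T). z p = z1 (fst p $ N) (snd p)) \<and>
     (\<exists>q1. (AE p in lebesgue_on (DD b N g L T). q p = q1 (fst p $ N) (snd p)) \<and>
        (\<forall>fc\<in>faces b N. AE p in face_measure N g L T fc. q p = q1 (fst p $ N) (snd p))) \<and>
     (\<forall>\<phi> \<psi>. test_fun b N g L T \<phi> \<longrightarrow> test_fun b N g L T \<psi> \<longrightarrow>
        (\<forall>t\<in>{0..<T}. \<forall>s. \<bar>s - 1/2 * g * t\<^sup>2\<bar> \<le> L \<longrightarrow> slice_mean N \<phi> s t = slice_mean N \<psi> s t) \<longrightarrow>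
        \<nu> \<phi> = \<nu> \<psi>) \<and>
     (AE p in lebesgue_on (DD b N g L T).
        z_w (z p) = (g * snd p) *\<^sub>R axis N 1 \<and>
        (\<forall>j. j \<noteq> N \<longrightarrow> z_m (z p) $ j = 0 \<and> z_h (z p) $ j = 0) \<and>
        z_sigma (z p) = sigma_of N (f_fun \<rho>m \<rho>p g (snd p) (z_mu (z p)) (z_m (z p) $ N)))"

text \<open>Continuity on \<open>U\<close> is required on the chosen representatives of \<open>z\<close> and \<open>q\<close>.\<close>

definition mixing_zone ::
  "lateral \<Rightarrow> 'n::finite \<Rightarrow> real \<Rightarrow> real \<Rightarrow> real \<Rightarrow> real \<Rightarrow> real \<Rightarrow>
   ((real^'n) \<times> real \<Rightarrow> 'n state) \<Rightarrow> ((real^'n) \<times> real \<Rightarrow> real) \<Rightarrow> ((real^'n) \<times> real) set \<Rightarrow> bool" where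
  "mixing_zone b N g L T \<rho>m \<rho>p z q U \<longleftrightarrow>
     open U \<and> U \<subseteq> DD b N g L T \<and> lateral_lift b N (\<lambda>p. p \<in> U) \<and>
     continuous_on U z \<and> ess_bounded U q \<and> continuous_on U q \<and>
     ess_bounded U (\<lambda>p. T_plus \<rho>m \<rho>p (z p)) \<and> ess_bounded U (\<lambda>p. T_minus \<rho>m \<rho>p (z p)) \<and>
     (\<forall>p\<in>U. \<rho>m < z_mu (z p) \<and> z_mu (z p) < \<rho>p \<and>
        z_e (z p) = 1/2 * f_fun \<rho>m \<rho>p g (snd p) (z_mu (z p)) (z_m (z p) $ N) \<and>
        z_h (z p) = (z_e (z p) + q p) *\<^sub>R z_w (z p) +
          ((T_plus \<rho>m \<rho>p (z p) - T_minus \<rho>m \<rho>p (z p)) / (\<rho>p - \<rho>m)) *\<^sub>R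
            (z_m (z p) - z_mu (z p) *\<^sub>R z_w (z p))) \<and>
     (AE p in lebesgue_on (DD b N g L T - U).
        z_m (z p) = z_mu (z p) *\<^sub>R z_w (z p) \<and>
        z_h (z p) = (z_e (z p) + q p) *\<^sub>R z_w (z p) \<and>
        z_mu (z p) *\<^sub>R (\<chi> i j. z_w (z p) $ i * z_w (z p) $ j) =
          z_sigma (z p) + mat (2 / real CARD('n) * z_e (z p)) \<and>
        z_mu (z p) \<in> {\<rho>m, \<rho>p})"

definition nonstrict_subsolution_1d ::
  "lateral \<Rightarrow> 'n::finite \<Rightarrow> real \<Rightarrow> real \<Rightarrow> real \<Rightarrow> real \<Rightarrow> real \<Rightarrow>
   ((real^'n) \<times> real \<Rightarrow> 'n state) \<Rightarrow> ((real^'n) \<times> real \<Rightarrow> real) \<Rightarrow>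
   (((real^'n) \<times> real \<Rightarrow> real) \<Rightarrow> real) \<Rightarrow> bool" where
  "nonstrict_subsolution_1d b N g L T \<rho>m \<rho>p z q \<nu> \<longleftrightarrow>
     admissible_class b N g L T z q \<nu> \<and>
     linear_system b N g L T \<rho>m \<rho>p z q \<nu> \<and>
     one_dimensional b N g L T \<rho>m \<rho>p z q \<nu> \<and>
     (\<exists>U. mixing_zone b N g L T \<rho>m \<rho>p z q U)"

section \<open>The Riemann problem and the total energy\<close>

definition a_fun :: "real \<Rightarrow> real \<Rightarrow> real \<Rightarrow> real" where
  "a_fun \<rho>m \<rho>p r = (\<rho>p - r) * (r - \<rho>m) / (\<rho>p + \<rho>m - r)"

definition m_flux :: "real \<Rightarrow> real \<Rightarrow> real \<Rightarrow> real \<Rightarrow> real \<Rightarrow> real \<Rightarrow> real" where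
  "m_flux \<rho>m \<rho>p g lam t r = g * t * (r - lam * a_fun \<rho>m \<rho>p r)"

definition E_tot ::
  "lateral \<Rightarrow> 'n::finite \<Rightarrow> real \<Rightarrow> real \<Rightarrow> ((real^'n) \<times> real \<Rightarrow> 'n state) \<Rightarrow> real \<Rightarrow> real" where
  "E_tot b N g L z t = (LINT y:Dt b N g L t \<inter> cell N|lebesgue.
     z_e (z (y, t)) - z_m (z (y, t)) $ N * g * t + z_mu (z (y, t)) * g * y $ N)"

end

theory Submission
  imports Defs
begin

text \<open>
  With \<open>P = \<rho>m \<rho>p\<close> and \<open>S = \<rho>m + \<rho>p\<close> one has \<open>a(r) = r - P / (S - r)\<close>, which is concave. Hence the
  flux \<open>gt (r - \<lambda> a(r))\<close> is convex in \<open>r\<close>, and the Riemann data jump upwards, so that the entropy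
  solution is a centred rarefaction wave. In terms of the distance of fall \<open>\<tau> = g t\<^sup>2 / 2\<close> the level \<open>r\<close>
  travels along the ray \<open>y\<^sub>n = c(r) \<tau>\<close> with \<open>c = 1 - \<lambda> a'\<close>, and \<open>\<mu>\<close> is the explicit inverse of \<open>c\<close>
  evaluated at \<open>y\<^sub>n / \<tau>\<close>, cut off at \<open>\<rho>m\<close> and \<open>\<rho>p\<close>.

  Uniqueness needs no doubling of variables, because the waves spread. Fix a level \<open>k\<close>. On the right of
  the ray of speed \<open>c(k)\<close> the entropy \<open>((k - r)\<^sup>+)\<^sup>2\<close> vanishes initially, and by convexity of the flux its
  entropy flux never exceeds \<open>c(k)\<close> times the entropy, so none of it can enter through the ray. A test
  function supported on that side therefore shows \<open>v \<ge> k\<close> there (\<open>entropy_solution_ge\<close>); on the other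
  side \<open>v \<le> k\<close> follows in the same way (\<open>entropy_solution_le\<close>). Letting \<open>k\<close> run through the rationals
  determines \<open>v\<close> almost everywhere (\<open>entropy_solution_unique\<close>).

  Existence of the entropy solution and the three nontrivial balance laws are instances of a single
  integration by parts (\<open>rectangle_ibp\<close>, \<open>fan_ibp\<close>) for a balance law \<open>\<partial>\<^sub>t A + \<partial>\<^sub>x B = R\<close> that holds off
  the two edges of the fan. The fields are continuous except at the origin, and \<open>\<partial>\<^sub>t A\<close> is of order
  \<open>|x|\<^sup>-\<^sup>1\<^sup>/\<^sup>2\<close>, hence integrable. The fundamental theorem of calculus on lines and Fubini's theorem
  then suffice. The parameter \<open>d\<close> below selects the frame of reference: \<open>d = 0\<close> is the frame of the
  Riemann problem, and \<open>d = 1\<close> is the frame that falls with the domain, in which \<open>D(t)\<close> becomes the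
  fixed strip \<open>|x| < L\<close>, where \<open>x = y\<^sub>n - \<tau>\<close>.

  In the falling frame all fields are polynomial expressions in \<open>x\<close>, \<open>t\<close>, \<open>\<mu>\<close>, \<open>a(\<mu>)\<close>, \<open>a'(\<mu>)\<close> and a
  primitive \<open>A\<close> of \<open>(a')\<^sup>2\<close>. They are found by solving the momentum balance for the pressure with the
  help of the relation \<open>x = - \<lambda> a'(\<mu>) \<tau>\<close>, which holds in the fan. Outside the fan \<open>a\<close> vanishes and the
  same formulas describe the pure phases. The hypothesis on \<open>T\<close> keeps the fan away from the top and the
  bottom of the domain, where \<open>a = 0\<close> reduces the fluxes relative to the moving boundary to \<open>0\<close>, \<open>q\<close>
  and \<open>gtq\<close>. These are exactly the boundary terms of the linear system. The energy balance leaves the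
  source \<open>\<nu> = \<lambda> (2 \<lambda> - 1) g\<^sup>2 t a(\<mu>)\<close>, which is nonpositive because \<open>\<lambda> \<le> 1/2\<close>.

  The passage from the single vertical dimension to \<open>n\<close> dimensions is Cavalieri's principle for the sheared
  coordinate \<open>x\<close>; the horizontal directions only contribute pressure terms on walls, or
  cancel by periodicity. The total energy is the integral of an exact derivative (\<open>energy_primitive\<close>),
  and its change in time comes from the jump \<open>A(\<rho>p) - A(\<rho>m) = (\<rho>p - \<rho>m)\<^sup>3 / (3 P)\<close>. All fields except \<open>\<mu>\<close> carry
  a factor \<open>t\<close> or \<open>x\<close>, which makes them continuous at the centre of the wave.
\<close>

section \<open>The centred rarefaction wave\<close>

text \<open>
  The distance of free fall. Self-similarity of the wave is with respect to \<open>y\<^sub>n / fall g t\<close>, since the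
  flux carries the factor \<open>gt\<close>, the derivative of \<open>fall g\<close>.
\<close>

definition fall :: "real \<Rightarrow> real \<Rightarrow> real" where
  "fall g t = 1/2 * g * t\<^sup>2"

lemma continuous_on_fall [continuous_intros]: "continuous_on S f \<Longrightarrow> continuous_on S (\<lambda>x. fall g (f x))"
  unfolding fall_def by (intro continuous_intros)

text \<open>
  The parameters of the Riemann problem. Inside the locale \<open>af\<close> is the function \<open>a\<close> in the form in which
  its concavity is visible, \<open>daf\<close> its derivative, \<open>speed\<close> the characteristic speed with respect to
  \<open>fall g t\<close>, \<open>prof\<close> its inverse, and \<open>slope\<close> the derivative of the wave \<open>mu d\<close> in space. The argument
  \<open>d\<close> is the speed of the frame of reference, again with respect to \<open>fall g t\<close>.
\<close>

locale fan =
  fixes g lam \<rho>m \<rho>p :: real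
  assumes g_pos: "0 < g" and rho_pos: "0 < \<rho>m" and rho_less: "\<rho>m < \<rho>p"
    and lam_pos: "0 < lam" and lam_half: "lam \<le> 1/2"
begin

definition af :: "real \<Rightarrow> real" where "af r = r - \<rho>m * \<rho>p / (\<rho>m + \<rho>p - r)"
definition daf :: "real \<Rightarrow> real" where "daf r = 1 - \<rho>m * \<rho>p / (\<rho>m + \<rho>p - r)\<^sup>2"
definition speed :: "real \<Rightarrow> real" where "speed r = 1 - lam * daf r"
definition prof :: "real \<Rightarrow> real" where
  "prof c = \<rho>m + \<rho>p - sqrt (lam * \<rho>m * \<rho>p / (c - 1 + lam))"
definition mu :: "real \<Rightarrow> real \<Rightarrow> real \<Rightarrow> real" where
  "mu d x t = (if t = 0 then rho0 \<rho>m \<rho>p x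
     else prof (max (speed \<rho>m) (min (speed \<rho>p) (x / fall g t + d))))"
definition slope :: "real \<Rightarrow> real \<Rightarrow> real \<Rightarrow> real" where
  "slope d x t = (if speed \<rho>m < x / fall g t + d \<and> x / fall g t + d < speed \<rho>p
     then (\<rho>m + \<rho>p - mu d x t) ^ 3 / (2 * lam * \<rho>m * \<rho>p * fall g t) else 0)"

lemma fall_pos: "t \<noteq> 0 \<Longrightarrow> fall g t > 0"
  using g_pos by (simp add: fall_def)

lemma fall_nonneg: "fall g t \<ge> 0"
  using g_pos by (simp add: fall_def)

lemma rhop_pos: "0 < \<rho>p"
  using rho_pos rho_less by linarith

lemma gap_pos: "r \<le> \<rho>p \<Longrightarrow> 0 < \<rho>m + \<rho>p - r"
  using rho_pos by linarith

lemma a_fun_af: "r \<le> \<rho>p \<Longrightarrow> a_fun \<rho>m \<rho>p r = af r"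
  using gap_pos[of r] by (simp add: a_fun_def af_def field_simps)

lemma af_rhom [simp]: "af \<rho>m = 0" and af_rhop [simp]: "af \<rho>p = 0"
  using rho_pos rhop_pos by (simp_all add: af_def)

lemma speed_eq: "speed r = 1 - lam + lam * (\<rho>m * \<rho>p) / (\<rho>m + \<rho>p - r)\<^sup>2"
  by (simp add: speed_def daf_def algebra_simps)

lemma speed_rhom: "speed \<rho>m = 1 - lam + lam * \<rho>m / \<rho>p"
  using rhop_pos by (simp add: speed_eq power2_eq_square)

lemma speed_rhop: "speed \<rho>p = 1 - lam + lam * \<rho>p / \<rho>m"
  using rho_pos by (simp add: speed_eq power2_eq_square)

lemma speed_gt: "r \<le> \<rho>p \<Longrightarrow> speed r > 1 - lam"
  using gap_pos[of r] rho_pos rhop_pos lam_pos by (simp add: speed_eq)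

lemma speed_pos: "r \<le> \<rho>p \<Longrightarrow> speed r > 0"
  using speed_gt[of r] lam_half by linarith

lemma speed_less: assumes "r < k" "k \<le> \<rho>p" shows "speed r < speed k"
proof -
  have "(\<rho>m + \<rho>p - k)\<^sup>2 < (\<rho>m + \<rho>p - r)\<^sup>2"
    using assms gap_pos[of k] by (intro power_strict_mono) auto
  moreover have "0 < lam * (\<rho>m * \<rho>p)" using rho_pos rhop_pos lam_pos by simp
  moreover have "0 < (\<rho>m + \<rho>p - k)\<^sup>2" using gap_pos[of k] assms by simp
  ultimately have "lam * (\<rho>m * \<rho>p) / (\<rho>m + \<rho>p - r)\<^sup>2 < lam * (\<rho>m * \<rho>p) / (\<rho>m + \<rho>p - k)\<^sup>2"
    by (intro divide_strict_left_mono mult_pos_pos[of "_\<^sup>2"]) linarith+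
  then show ?thesis
    unfolding speed_eq by simp
qed

lemma speed_le: "r \<le> k \<Longrightarrow> k \<le> \<rho>p \<Longrightarrow> speed r \<le> speed k"
  using speed_less[of r k] by (cases "r = k") auto

lemma prof_speed: assumes "r \<le> \<rho>p" shows "prof (speed r) = r"
proof -
  have "lam * \<rho>m * \<rho>p / (speed r - 1 + lam) = (\<rho>m + \<rho>p - r)\<^sup>2"
    using rho_pos rhop_pos lam_pos gap_pos[OF assms] by (simp add: speed_eq field_simps)
  then show ?thesis using gap_pos[OF assms] by (simp add: prof_def)
qed

lemma prof_mono: assumes "1 - lam < c" "c \<le> c'" shows "prof c \<le> prof c'"
proof -
  have "lam * \<rho>m * \<rho>p / (c' - 1 + lam) \<le> lam * \<rho>m * \<rho>p / (c - 1 + lam)"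
    using assms lam_pos rho_pos rhop_pos by (intro divide_left_mono) (auto intro!: mult_pos_pos)
  then show ?thesis by (simp add: prof_def)
qed

lemma speed_prof: assumes "1 - lam < c" shows "speed (prof c) = c"
proof -
  have "0 < lam * \<rho>m * \<rho>p / (c - 1 + lam)"
    using assms lam_pos rho_pos rhop_pos by (intro divide_pos_pos mult_pos_pos) auto
  then have "(sqrt (lam * \<rho>m * \<rho>p / (c - 1 + lam)))\<^sup>2 = lam * \<rho>m * \<rho>p / (c - 1 + lam)"
    by (intro real_sqrt_pow2) linarith
  then show ?thesis using assms lam_pos rho_pos rhop_pos
    by (simp add: speed_eq prof_def)
qed

lemma DERIV_prof: assumes "1 - lam < c"
  shows "(prof has_real_derivative (\<rho>m + \<rho>p - prof c) ^ 3 / (2 * lam * \<rho>m * \<rho>p)) (at c)"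
proof -
  define s where "s = sqrt (lam * \<rho>m * \<rho>p / (c - 1 + lam))"
  have pos: "lam * \<rho>m * \<rho>p / (c - 1 + lam) > 0" "lam * \<rho>m * \<rho>p > 0"
    using assms lam_pos rho_pos rhop_pos by (auto intro!: divide_pos_pos mult_pos_pos)
  then have s: "s > 0" and s2: "s\<^sup>2 = lam * \<rho>m * \<rho>p / (c - 1 + lam)" by (simp_all add: s_def)
  have "((\<lambda>c. lam * \<rho>m * \<rho>p / (c - 1 + lam)) has_real_derivative - (lam * \<rho>m * \<rho>p) / (c - 1 + lam)\<^sup>2) (at c)"
    using assms by (auto intro!: derivative_eq_intros simp: power2_eq_square)
  from DERIV_chain2[OF DERIV_real_sqrt[OF pos(1)] this]
  have "((\<lambda>c. sqrt (lam * \<rho>m * \<rho>p / (c - 1 + lam))) has_real_derivative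
      inverse s / 2 * (- (lam * \<rho>m * \<rho>p) / (c - 1 + lam)\<^sup>2)) (at c)"
    unfolding s_def .
  from DERIV_diff[OF DERIV_const[of "\<rho>m + \<rho>p"] this] have "(prof has_real_derivative
      - (inverse s / 2 * (- (lam * \<rho>m * \<rho>p) / (c - 1 + lam)\<^sup>2))) (at c)"
    unfolding prof_def by simp
  also have "- (inverse s / 2 * (- (lam * \<rho>m * \<rho>p) / (c - 1 + lam)\<^sup>2)) = inverse s / 2 * (s\<^sup>2)\<^sup>2 / (lam * \<rho>m * \<rho>p)"
    using pos assms unfolding s2 by (simp add: power2_eq_square)
  also have "\<dots> = s ^ 3 / (2 * lam * \<rho>m * \<rho>p)"
    using s pos by (simp add: field_simps power2_eq_square power3_eq_cube)
  also have "s = \<rho>m + \<rho>p - prof c" by (simp add: prof_def s_def)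
  finally show ?thesis .
qed

lemma clamp_gt: "1 - lam < max (speed \<rho>m) c"
  using speed_gt[of \<rho>m] rho_less by simp

lemma clamp_between:
  "speed \<rho>m \<le> max (speed \<rho>m) (min (speed \<rho>p) c)" "max (speed \<rho>m) (min (speed \<rho>p) c) \<le> speed \<rho>p"
  using speed_le[of \<rho>m \<rho>p] rho_less by auto

lemma mu_mem: "mu d x t \<in> {\<rho>m..\<rho>p}"
proof (cases "t = 0")
  case True
  then show ?thesis using rho_less by (simp add: mu_def rho0_def)
next
  case False
  let ?c = "max (speed \<rho>m) (min (speed \<rho>p) (x / fall g t + d))"
  have "prof (speed \<rho>m) \<le> prof ?c" "prof ?c \<le> prof (speed \<rho>p)"
    using clamp_between clamp_gt speed_gt[of \<rho>m] rho_less by (intro prof_mono; simp)+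
  then show ?thesis using False rho_less by (simp add: mu_def prof_speed)
qed

lemma mu_le: "mu d x t \<le> \<rho>p" and mu_ge: "\<rho>m \<le> mu d x t"
  using mu_mem[of d x t] by auto

lemma mu_0: "mu d x 0 = rho0 \<rho>m \<rho>p x"
  by (simp add: mu_def)

lemma mu_low: "t \<noteq> 0 \<Longrightarrow> x / fall g t + d \<le> speed \<rho>m \<Longrightarrow> mu d x t = \<rho>m"
  using rho_less speed_less[of \<rho>m \<rho>p] prof_speed[of \<rho>m] by (simp add: mu_def min_def max_def)

lemma mu_high: "t \<noteq> 0 \<Longrightarrow> speed \<rho>p \<le> x / fall g t + d \<Longrightarrow> mu d x t = \<rho>p"
  using rho_less speed_le[of \<rho>m \<rho>p] by (simp add: mu_def min_def max_def prof_speed)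

lemma mu_shift: "mu d x t = mu 0 (x + d * fall g t) t"
  using fall_pos[of t] by (cases "t = 0") (auto simp: mu_def add_divide_distrib, simp add: fall_def)

lemma speed_mu:
  assumes "t \<noteq> 0" "speed \<rho>m \<le> x / fall g t + d" "x / fall g t + d \<le> speed \<rho>p"
  shows "speed (mu d x t) = x / fall g t + d"
  using assms speed_gt[of \<rho>m] rho_less by (simp add: mu_def speed_prof)

lemma mu_fan:
  assumes "t \<noteq> 0" "speed \<rho>m \<le> x / fall g t + d" "x / fall g t + d \<le> speed \<rho>p"
  shows "x = (speed (mu d x t) - d) * fall g t"
  using speed_mu[OF assms] fall_pos[OF assms(1)] by simp

lemma mu_ge_if_speed:
  assumes "t \<noteq> 0" "k \<in> {\<rho>m..\<rho>p}" "speed k \<le> x / fall g t + d"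
  shows "k \<le> mu d x t"
proof -
  let ?c = "max (speed \<rho>m) (min (speed \<rho>p) (x / fall g t + d))"
  have "speed k \<le> ?c" using assms speed_le[of k \<rho>p] by auto
  then have "prof (speed k) \<le> prof ?c" using assms speed_gt[of k] by (intro prof_mono) auto
  then show ?thesis using assms by (simp add: prof_speed mu_def)
qed

lemma mu_le_if_speed:
  assumes "t \<noteq> 0" "k \<in> {\<rho>m..\<rho>p}" "x / fall g t + d \<le> speed k"
  shows "mu d x t \<le> k"
proof -
  let ?c = "max (speed \<rho>m) (min (speed \<rho>p) (x / fall g t + d))"
  have "?c \<le> speed k" using assms speed_le[of \<rho>m k] by auto
  then have "prof ?c \<le> prof (speed k)" using assms clamp_gt by (intro prof_mono) auto
  then show ?thesis using assms by (simp add: prof_speed mu_def)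
qed

lemma mu_high_near0:
  assumes "(speed \<rho>p + \<bar>d\<bar>) * fall g t < x" shows "mu d x t = \<rho>p"
proof (cases "t = 0")
  case True
  then show ?thesis using assms by (simp add: mu_def rho0_def fall_def)
next
  case False
  then have "speed \<rho>p + \<bar>d\<bar> < x / fall g t" using assms fall_pos by (simp add: field_simps)
  then show ?thesis using False by (intro mu_high) auto
qed

lemma mu_low_near0:
  assumes "x < - \<bar>d\<bar> * fall g t" shows "mu d x t = \<rho>m"
proof (cases "t = 0")
  case True
  then show ?thesis using assms by (simp add: mu_def rho0_def fall_def)
next
  case False
  then have "x / fall g t < - \<bar>d\<bar>" using assms fall_pos by (simp add: field_simps)
  then show ?thesis using False speed_pos[of \<rho>m] rho_less by (intro mu_low) auto
qed

lemma continuous_on_prof: "continuous_on {1 - lam<..} prof"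
  using DERIV_prof by (meson DERIV_isCont continuous_at_imp_continuous_on greaterThan_iff)

text \<open>
  Near points \<open>(x, 0)\<close> with \<open>x \<noteq> 0\<close> the wave is still constant, since its edges have bounded speed. So the
  punctured plane is covered by three open sets on each of which continuity is clear.
\<close>

lemma continuous_mu: "continuous_on (UNIV - {(0,0)}) (\<lambda>(x, t). mu d x t)"
proof -
  define U1 where "U1 = {p :: real \<times> real. snd p \<noteq> 0}"
  define U2 where "U2 = {p. (speed \<rho>p + \<bar>d\<bar>) * fall g (snd p) < fst p}"
  define U3 where "U3 = {p. fst p < - \<bar>d\<bar> * fall g (snd p)}"
  have o: "open U1" "open U2" "open U3"
    unfolding U1_def U2_def U3_def
    by (intro open_Collect_neq open_Collect_less continuous_intros)+
  have "continuous_on U1 (\<lambda>p. prof (max (speed \<rho>m) (min (speed \<rho>p) (fst p / fall g (snd p) + d))))"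
  proof (rule continuous_on_compose2[OF continuous_on_prof])
    show "continuous_on U1 (\<lambda>p. max (speed \<rho>m) (min (speed \<rho>p) (fst p / fall g (snd p) + d)))"
      by (intro continuous_intros) (use fall_pos in \<open>force simp: U1_def\<close>)
  qed (use clamp_gt in auto)
  then have c1: "continuous_on U1 (\<lambda>(x, t). mu d x t)"
    by (rule continuous_on_eq) (auto simp: U1_def mu_def)
  have c2: "continuous_on U2 (\<lambda>(x, t). mu d x t)"
    by (rule continuous_on_eq[where f="\<lambda>_. \<rho>p"]) (auto simp: U2_def mu_high_near0)
  have c3: "continuous_on U3 (\<lambda>(x, t). mu d x t)"
    by (rule continuous_on_eq[where f="\<lambda>_. \<rho>m"]) (auto simp: U3_def mu_low_near0)
  have "continuous_on (U1 \<union> (U2 \<union> U3)) (\<lambda>(x, t). mu d x t)"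
    by (intro continuous_on_open_Un c1 c2 c3 o open_Un)
  then show ?thesis
    by (rule continuous_on_subset) (auto simp: U1_def U2_def U3_def fall_def)
qed

lemma DERIV_mu_x:
  assumes t: "t \<noteq> 0" and k: "x / fall g t + d \<noteq> speed \<rho>m" "x / fall g t + d \<noteq> speed \<rho>p"
  shows "((\<lambda>x. mu d x t) has_real_derivative slope d x t) (at x)"
proof -
  have f: "fall g t \<noteq> 0" using fall_pos[OF t] by simp
  have cont: "isCont (\<lambda>x. x / fall g t + d) x" by (intro continuous_intros f)
  consider "x / fall g t + d < speed \<rho>m" | "speed \<rho>p < x / fall g t + d"
    | "speed \<rho>m < x / fall g t + d" "x / fall g t + d < speed \<rho>p" using k by linarith
  then show ?thesis
  proof cases
    case 1
    then have "\<forall>\<^sub>F y in nhds x. y / fall g t + d < speed \<rho>m"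
      using order_tendstoD(2)[OF cont[unfolded isCont_def]] by (simp add: eventually_nhds_conv_at)
    then have ev: "\<forall>\<^sub>F y in nhds x. mu d y t = \<rho>m"
      by eventually_elim (use t mu_low in simp)
    show ?thesis
      by (subst DERIV_cong_ev[OF refl ev refl]) (use 1 in \<open>simp add: slope_def\<close>)
  next
    case 2
    then have "\<forall>\<^sub>F y in nhds x. speed \<rho>p < y / fall g t + d"
      using order_tendstoD(1)[OF cont[unfolded isCont_def]] by (simp add: eventually_nhds_conv_at)
    then have ev: "\<forall>\<^sub>F y in nhds x. mu d y t = \<rho>p"
      by eventually_elim (use t mu_high in simp)
    show ?thesis
      by (subst DERIV_cong_ev[OF refl ev refl]) (use 2 in \<open>simp add: slope_def\<close>)
  next
    case 3
    have "\<forall>\<^sub>F y in nhds x. y / fall g t + d < speed \<rho>p" "\<forall>\<^sub>F y in nhds x. speed \<rho>m < y / fall g t + d"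
      using 3 order_tendstoD[OF cont[unfolded isCont_def]] by (simp_all add: eventually_nhds_conv_at)
    then have ev: "\<forall>\<^sub>F y in nhds x. mu d y t = prof (y / fall g t + d)"
      by eventually_elim (use t in \<open>simp add: mu_def\<close>)
    have gt: "1 - lam < x / fall g t + d" using 3 speed_gt[of \<rho>m] rho_less by simp
    have e: "prof (x / fall g t + d) = mu d x t" using 3 t by (simp add: mu_def)
    have "((\<lambda>x. prof (x / fall g t + d)) has_real_derivative
       (\<rho>m + \<rho>p - mu d x t) ^ 3 / (2 * lam * \<rho>m * \<rho>p) * (1 / fall g t)) (at x)"
      by (rule DERIV_chain2[where f=prof and g="\<lambda>x. x / fall g t + d", OF DERIV_prof[OF gt, unfolded e]]) (auto intro!: derivative_eq_intros f)
    then show ?thesis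
      by (subst DERIV_cong_ev[OF refl ev refl]) (use 3 in \<open>simp add: slope_def\<close>)
  qed
qed

lemma DERIV_mu_t:
  assumes t: "t > 0" and k: "x / fall g t + d \<noteq> speed \<rho>m" "x / fall g t + d \<noteq> speed \<rho>p"
  shows "((\<lambda>t. mu d x t) has_real_derivative - (2 * x / t) * slope d x t) (at t)"
proof -
  have f: "fall g t \<noteq> 0" using fall_pos[of t] t by simp
  have D: "((\<lambda>t. x / fall g t + d) has_real_derivative - (2 * x / t) / fall g t) (at t)"
    using t g_pos unfolding fall_def
    by (auto intro!: derivative_eq_intros simp: field_simps power2_eq_square)
  have cont: "isCont (\<lambda>t. x / fall g t + d) t" using D by (rule DERIV_isCont)
  have nz: "\<forall>\<^sub>F y in nhds t. y \<noteq> 0" using t by (intro t1_space_nhds) auto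
  consider "x / fall g t + d < speed \<rho>m" | "speed \<rho>p < x / fall g t + d"
    | "speed \<rho>m < x / fall g t + d" "x / fall g t + d < speed \<rho>p" using k by linarith
  then show ?thesis
  proof cases
    case 1
    then have "\<forall>\<^sub>F y in nhds t. x / fall g y + d < speed \<rho>m"
      using order_tendstoD(2)[OF cont[unfolded isCont_def]] by (simp add: eventually_nhds_conv_at)
    then have ev: "\<forall>\<^sub>F y in nhds t. mu d x y = \<rho>m"
      using nz by eventually_elim (use mu_low in simp)
    show ?thesis
      by (subst DERIV_cong_ev[OF refl ev refl]) (use 1 in \<open>simp add: slope_def\<close>)
  next
    case 2
    then have "\<forall>\<^sub>F y in nhds t. speed \<rho>p < x / fall g y + d"
      using order_tendstoD(1)[OF cont[unfolded isCont_def]] by (simp add: eventually_nhds_conv_at)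
    then have ev: "\<forall>\<^sub>F y in nhds t. mu d x y = \<rho>p"
      using nz by eventually_elim (use mu_high in simp)
    show ?thesis
      by (subst DERIV_cong_ev[OF refl ev refl]) (use 2 in \<open>simp add: slope_def\<close>)
  next
    case 3
    have "\<forall>\<^sub>F y in nhds t. x / fall g y + d < speed \<rho>p" "\<forall>\<^sub>F y in nhds t. speed \<rho>m < x / fall g y + d"
      using 3 order_tendstoD[OF cont[unfolded isCont_def]] by (simp_all add: eventually_nhds_conv_at)
    then have ev: "\<forall>\<^sub>F y in nhds t. mu d x y = prof (x / fall g y + d)"
      using nz by eventually_elim (simp add: mu_def)
    have gt: "1 - lam < x / fall g t + d" using 3 speed_gt[of \<rho>m] rho_less by simp
    have e: "prof (x / fall g t + d) = mu d x t" using 3 t by (simp add: mu_def)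
    have "((\<lambda>t. prof (x / fall g t + d)) has_real_derivative
       (\<rho>m + \<rho>p - mu d x t) ^ 3 / (2 * lam * \<rho>m * \<rho>p) * (- (2 * x / t) / fall g t)) (at t)"
      by (rule DERIV_chain2[where f=prof, OF DERIV_prof[OF gt, unfolded e] D])
    then show ?thesis
      by (subst DERIV_cong_ev[OF refl ev refl]) (use 3 in \<open>simp add: slope_def field_simps\<close>)
  qed
qed

lemma slope_nonneg: "0 \<le> slope d x t"
  using gap_pos[OF mu_le[of d x t]] fall_nonneg[of t] lam_pos rho_pos rhop_pos
  by (simp add: slope_def)

lemma x_slope: "t \<noteq> 0 \<Longrightarrow> x * slope d x t = (speed (mu d x t) - d) * fall g t * slope d x t"
  using mu_fan[of t x d] by (cases "slope d x t = 0") (auto simp: slope_def split: if_splits)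

text \<open>
  The time derivative of the wave blows up at the centre, but only integrably: in the fan \<open>|x|\<close> is at most
  a multiple of \<open>t\<^sup>2\<close> and \<open>slope\<close> is of order \<open>t\<^sup>-\<^sup>2\<close>, so the product is of order \<open>1 / t\<close>, and \<open>1 / t\<close> is at
  most a multiple of \<open>|x|\<^sup>-\<^sup>1\<^sup>/\<^sup>2\<close>.
\<close>

lemma mu_t_bound:
  obtains C where "\<And>x t. 0 < t \<Longrightarrow> x \<noteq> 0 \<Longrightarrow> \<bar>- (2 * x / t) * slope d x t\<bar> \<le> C * \<bar>x\<bar> powr (-1/2)"
proof -
  define K where "K = speed \<rho>p + \<bar>d\<bar>"
  define W where "W = \<rho>p ^ 3 / (2 * lam * \<rho>m * \<rho>p)"
  have K: "K > 0" using speed_pos[of \<rho>p] by (simp add: K_def)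
  have W: "W > 0" using lam_pos rho_pos rhop_pos by (simp add: W_def)
  have "\<bar>- (2 * x / t) * slope d x t\<bar> \<le> (2 * K * W * sqrt (K * g / 2)) * \<bar>x\<bar> powr (-1/2)"
    if t: "0 < t" and x: "x \<noteq> 0" for x t
  proof (cases "slope d x t = 0")
    case True
    then show ?thesis using K W g_pos by simp
  next
    case False
    have f: "fall g t > 0" using fall_pos t by simp
    from False have fan: "speed \<rho>m < x / fall g t + d" "x / fall g t + d < speed \<rho>p"
      by (auto simp: slope_def split: if_splits)
    then have "\<bar>x / fall g t\<bar> \<le> K" using speed_pos[of \<rho>m] rho_less by (simp add: K_def)
    then have xk: "\<bar>x\<bar> \<le> K * fall g t" using f by (simp add: field_simps)
    have "(\<rho>m + \<rho>p - mu d x t) ^ 3 \<le> \<rho>p ^ 3"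
      using mu_ge[of d x t] gap_pos[OF mu_le[of d x t]] by (intro power_mono) auto
    then have sl: "slope d x t \<le> W / fall g t"
      using fan f lam_pos rho_pos rhop_pos by (simp add: slope_def W_def field_simps)
    have "\<bar>- (2 * x / t) * slope d x t\<bar> = 2 / t * \<bar>x\<bar> * slope d x t"
      using t slope_nonneg[of d x t] by (simp add: abs_mult)
    also have "\<dots> \<le> 2 / t * (K * fall g t) * (W / fall g t)"
      using xk sl t K f slope_nonneg[of d x t] by (intro mult_mono) auto
    also have "\<dots> = 2 * K * W / t" using f by simp
    finally have 1: "\<bar>- (2 * x / t) * slope d x t\<bar> \<le> 2 * K * W / t" .
    have "sqrt \<bar>x\<bar> \<le> sqrt (K * g / 2 * t\<^sup>2)" using xk by (simp add: fall_def)
    also have "\<dots> = sqrt (K * g / 2) * t" unfolding real_sqrt_mult using t by simp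
    finally have "1 / t \<le> sqrt (K * g / 2) / sqrt \<bar>x\<bar>" using t x by (simp add: field_simps)
    also have "\<dots> = sqrt (K * g / 2) * \<bar>x\<bar> powr (-1/2)"
      using x by (simp add: powr_minus powr_half_sqrt field_simps)
    finally have "2 * K * W * (1 / t) \<le> 2 * K * W * (sqrt (K * g / 2) * \<bar>x\<bar> powr (-1/2))"
      using K W by (intro mult_left_mono) auto
    then show ?thesis using 1 by (simp add: mult.assoc)
  qed
  then show ?thesis using that by blast
qed

end

section \<open>Integration by parts on a rectangle\<close>

lemma powr_half_integrable: "0 < l \<Longrightarrow> set_integrable lborel {-l..l::real} (\<lambda>x. \<bar>x\<bar> powr (-1/2))"
proof -
  assume l: "0 < l"
  have 1: "set_integrable lborel {0..l} (\<lambda>x. \<bar>x\<bar> powr (-1/2))"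
  proof -
    have "(\<lambda>x::real. x powr (-1/2)) integrable_on {0..l}"
      using has_integral_powr_from_0[of "-1/2" l] l by (auto simp: integrable_on_def)
    then have "(\<lambda>x::real. \<bar>x\<bar> powr (-1/2)) integrable_on {0..l}"
      by (rule integrable_eq) simp
    then have "(\<lambda>x::real. \<bar>x\<bar> powr (-1/2)) absolutely_integrable_on {0..l}"
      by (rule nonnegative_absolutely_integrable_1) simp
    then show ?thesis
      unfolding set_integrable_def by (subst (asm) integrable_completion) simp_all
  qed
  have "integrable lborel (\<lambda>x. indicator {0..l} (0 + (-1) * x) *\<^sub>R \<bar>0 + (-1) * x\<bar> powr (-1/2))"
    using 1 unfolding set_integrable_def by (intro lborel_integrable_real_affine) auto
  then have 2: "set_integrable lborel {-l..0} (\<lambda>x. \<bar>x\<bar> powr (-1/2))"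
    unfolding set_integrable_def
    by (rule back_subst[where P="integrable lborel"]) (auto simp: indicator_def fun_eq_iff)
  have "{-l..0} \<union> {0..l} = {-l..l}" using l by auto
  with set_integrable_Un[OF 2 1] show ?thesis by simp
qed

text \<open>
  Finitely many exceptional points are allowed, as a line in space or time crosses the edges of the fan.
\<close>

lemma set_lebesgue_FTC:
  fixes F :: "real \<Rightarrow> real"
  assumes "finite S" "a \<le> b" "set_integrable lborel {a..b} f"
    "\<And>x. x \<in> {a<..<b} - S \<Longrightarrow> (F has_real_derivative f x) (at x)" "continuous_on {a..b} F"
  shows "(LINT x:{a..b}|lborel. f x) = F b - F a"
proof -
  have "(f has_integral (F b - F a)) {a..b}"
    using assms
    by (intro fundamental_theorem_of_calculus_interior_strong)
       (auto simp: has_real_derivative_iff_has_vector_derivative)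
  then show ?thesis
    using set_borel_integral_eq_integral(2)[OF assms(3)] by (simp add: integral_unique)
qed

lemma indicator_prod_eq: "indicator (A \<times> B) (x, y) = (indicator A x * indicator B y :: real)"
  by (simp add: indicator_def)

lemma set_integral_rectangle_fst:
  fixes f :: "real \<times> real \<Rightarrow> real"
  assumes "set_integrable lborel (A \<times> B) f"
  shows "(LINT p:A \<times> B|lborel. f p) = (LINT x:A|lborel. (LINT y:B|lborel. f (x, y)))"
    and "AE x in lborel. x \<in> A \<longrightarrow> set_integrable lborel B (\<lambda>y. f (x, y))"
    and "set_integrable lborel A (\<lambda>x. (LINT y:B|lborel. f (x, y)))"
proof -
  have i: "integrable (lborel \<Otimes>\<^sub>M lborel) (\<lambda>p. indicator (A \<times> B) p *\<^sub>R f p)"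
    using assms by (simp add: set_integrable_def lborel_prod)
  have "(LINT p:A \<times> B|lborel. f p) = (\<integral>x. (\<integral>y. indicator (A \<times> B) (x, y) *\<^sub>R f (x, y) \<partial>lborel) \<partial>lborel)"
    unfolding set_lebesgue_integral_def using lborel_pair.integral_fst'[OF i] by (simp add: lborel_prod)
  then show "(LINT p:A \<times> B|lborel. f p) = (LINT x:A|lborel. (LINT y:B|lborel. f (x, y)))"
    by (simp add: set_lebesgue_integral_def indicator_prod_eq mult.assoc)
  show "AE x in lborel. x \<in> A \<longrightarrow> set_integrable lborel B (\<lambda>y. f (x, y))"
    using lborel_pair.AE_integrable_fst'[OF i]
    by eventually_elim (auto simp: set_integrable_def indicator_prod_eq)
  show "set_integrable lborel A (\<lambda>x. (LINT y:B|lborel. f (x, y)))"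
    using lborel_pair.integrable_fst'[OF i]
    by (simp add: set_integrable_def set_lebesgue_integral_def indicator_prod_eq mult.assoc)
qed

lemma set_integral_rectangle_snd:
  fixes f :: "real \<times> real \<Rightarrow> real"
  assumes "set_integrable lborel (A \<times> B) f"
  shows "(LINT p:A \<times> B|lborel. f p) = (LINT y:B|lborel. (LINT x:A|lborel. f (x, y)))"
    and "AE y in lborel. y \<in> B \<longrightarrow> set_integrable lborel A (\<lambda>x. f (x, y))"
    and "set_integrable lborel B (\<lambda>y. (LINT x:A|lborel. f (x, y)))"
proof -
  have e: "(\<integral>x. indicator (A \<times> B) (x, y) *\<^sub>R f (x, y) \<partial>lborel) = indicator B y *\<^sub>R (LINT x:A|lborel. f (x, y))" for y
    by (cases "y \<in> B") (simp_all add: set_lebesgue_integral_def indicator_prod_eq)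
  have i: "integrable (lborel \<Otimes>\<^sub>M lborel) (case_prod (\<lambda>x y. indicator (A \<times> B) (x, y) *\<^sub>R f (x, y)))"
    using assms by (simp add: set_integrable_def lborel_prod case_prod_unfold)
  have "(LINT p:A \<times> B|lborel. f p) = (\<integral>y. (\<integral>x. indicator (A \<times> B) (x, y) *\<^sub>R f (x, y) \<partial>lborel) \<partial>lborel)"
    unfolding set_lebesgue_integral_def using lborel_pair.integral_snd[OF i]
    by (simp add: lborel_prod case_prod_unfold)
  then show "(LINT p:A \<times> B|lborel. f p) = (LINT y:B|lborel. (LINT x:A|lborel. f (x, y)))"
    unfolding e by (simp add: set_lebesgue_integral_def[of lborel B])
  show "AE y in lborel. y \<in> B \<longrightarrow> set_integrable lborel A (\<lambda>x. f (x, y))"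
    using lborel_pair.AE_integrable_snd[OF i]
    by eventually_elim (auto simp: set_integrable_def indicator_prod_eq)
  show "set_integrable lborel B (\<lambda>y. (LINT x:A|lborel. f (x, y)))"
    using lborel_pair.integrable_snd[OF i]
    unfolding e by (simp add: set_integrable_def)

qed

lemma set_lebesgue_integral_cong_AE2:
  fixes f h :: "real \<Rightarrow> real"
  assumes "set_integrable lborel A f" "h \<in> borel_measurable borel" "A \<in> sets borel"
    "AE x in lborel. x \<in> A \<longrightarrow> f x = h x"
  shows "(LINT x:A|lborel. f x) = (LINT x:A|lborel. h x)"
  unfolding set_lebesgue_integral_def
proof (rule integral_cong_AE)
  show "(\<lambda>x. indicator A x *\<^sub>R f x) \<in> borel_measurable lborel"
    using assms(1) by (simp add: set_integrable_def)
  show "(\<lambda>x. indicator A x *\<^sub>R h x) \<in> borel_measurable lborel"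
    using assms(2,3) by simp
  show "AE x in lborel. indicator A x *\<^sub>R f x = indicator A x *\<^sub>R h x"
    using assms(4) by eventually_elim (auto simp: indicator_def)
qed

lemma integrable_tensor:
  fixes u v :: "real \<Rightarrow> real"
  assumes u: "integrable lborel u" and v: "integrable lborel v"
  shows "integrable lborel (\<lambda>p. u (fst p) * v (snd p))"
proof -
  have [measurable]: "u \<in> borel_measurable borel" "v \<in> borel_measurable borel"
    using u v by (simp_all add: integrable_iff_bounded)
  have "integrable (lborel \<Otimes>\<^sub>M lborel) (\<lambda>p. u (fst p) * v (snd p))"
  proof (rule lborel_pair.Fubini_integrable)
    show "integrable lborel (\<lambda>x. \<integral>y. norm (u (fst (x, y)) * v (snd (x, y))) \<partial>lborel)"
      using u by (simp add: abs_mult)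
    show "AE x in lborel. integrable lborel (\<lambda>y. u (fst (x, y)) * v (snd (x, y)))"
      using v by simp
  qed measurable
  then show ?thesis by (simp add: lborel_prod)
qed

lemma borel_measurable_continuous_except_point:
  fixes f :: "'a::euclidean_space \<Rightarrow> 'b::euclidean_space"
  assumes "continuous_on (UNIV - {c}) f" shows "f \<in> borel_measurable borel"
  using borel_measurable_continuous_countable_exceptions[of "{c}" f] assms
  by (simp add: Compl_eq_Diff_UNIV)

lemma set_integrable_bounded:
  fixes f :: "'a::euclidean_space \<Rightarrow> real"
  assumes "f \<in> borel_measurable borel" "bounded S" "S \<in> sets borel" "\<And>p. p \<in> S \<Longrightarrow> \<bar>f p\<bar> \<le> C"
  shows "set_integrable lborel S f"
  unfolding set_integrable_def
proof (rule integrableI_bounded_set[where A=S and B=C])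
  show "emeasure lborel S < \<infinity>" using emeasure_bounded_finite[OF assms(2)] by simp
qed (use assms in \<open>auto\<close>)

text \<open>
  The balance law \<open>\<partial>\<^sub>t A + \<partial>\<^sub>x B = R\<close> in weak form. It may fail on a set \<open>X\<close> that meets the relevant lines in
  finitely many points, and \<open>D = \<partial>\<^sub>t A\<close> may have an integrable singularity at \<open>x = 0\<close>. The term \<open>D \<psi>\<close> is added to
  \<open>A \<partial>\<^sub>t \<psi>\<close> and subtracted from \<open>B \<partial>\<^sub>x \<psi> + R \<psi>\<close>. Then the first sum is an exact derivative along almost every line
  in time, and the second one along almost every line in space.
\<close>

lemma rectangle_ibp:
  fixes A B R D \<psi> \<psi>x \<psi>t :: "real \<times> real \<Rightarrow> real"
  assumes l: "0 < l" and T: "0 < T"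
    and cont: "continuous_on (UNIV - {(0,0)}) A" "continuous_on (UNIV - {(0,0)}) B"
      "continuous_on (UNIV - {(0,0)}) R"
    and meas: "D \<in> borel_measurable borel"
    and bdd: "\<And>p. p \<in> {-l..l} \<times> {0..T} \<Longrightarrow> \<bar>A p\<bar> \<le> C" "\<And>p. p \<in> {-l..l} \<times> {0..T} \<Longrightarrow> \<bar>B p\<bar> \<le> C"
      "\<And>p. p \<in> {-l..l} \<times> {0..T} \<Longrightarrow> \<bar>R p\<bar> \<le> C"
      "\<And>x t. x \<in> {-l..l} \<Longrightarrow> x \<noteq> 0 \<Longrightarrow> t \<in> {0<..T} \<Longrightarrow> \<bar>D (x, t)\<bar> \<le> C * (1 + \<bar>x\<bar> powr (-1/2))"
    and fin: "\<And>x. x \<noteq> 0 \<Longrightarrow> finite {t. 0 < t \<and> (x, t) \<in> X}" "\<And>t. 0 < t \<Longrightarrow> finite {x. (x, t) \<in> X}"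
    and dt: "\<And>x t. x \<noteq> 0 \<Longrightarrow> 0 < t \<Longrightarrow> t < T \<Longrightarrow> (x, t) \<notin> X \<Longrightarrow> ((\<lambda>t. A (x, t)) has_real_derivative D (x, t)) (at t)"
    and dx: "\<And>x t. x \<in> {-l<..<l} \<Longrightarrow> 0 < t \<Longrightarrow> t < T \<Longrightarrow> (x, t) \<notin> X \<Longrightarrow>
       ((\<lambda>x. B (x, t)) has_real_derivative R (x, t) - D (x, t)) (at x)"
    and \<psi>: "continuous_on UNIV \<psi>" "continuous_on UNIV \<psi>x" "continuous_on UNIV \<psi>t"
      "\<And>x t. ((\<lambda>x. \<psi> (x, t)) has_real_derivative \<psi>x (x, t)) (at x)"
      "\<And>x t. ((\<lambda>t. \<psi> (x, t)) has_real_derivative \<psi>t (x, t)) (at t)"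
    and \<psi>T: "\<And>x. x \<in> {-l<..<l} \<Longrightarrow> \<psi> (x, T) = 0"
  shows "(LINT p:{-l..l} \<times> {0..T}|lborel. A p * \<psi>t p + B p * \<psi>x p + R p * \<psi> p) =
    (LINT t:{0..T}|lborel. B (l, t) * \<psi> (l, t) - B (-l, t) * \<psi> (-l, t))
    - (LINT x:{-l..l}|lborel. A (x, 0) * \<psi> (x, 0))" (is "?I = ?B - ?A")
proof -
  let ?Q = "{-l..l} \<times> {0..T}"
  have mA: "A \<in> borel_measurable borel" and mB: "B \<in> borel_measurable borel" and mR: "R \<in> borel_measurable borel"
    using cont by (simp_all add: borel_measurable_continuous_except_point)
  have m\<psi>: "\<psi> \<in> borel_measurable borel" "\<psi>x \<in> borel_measurable borel" "\<psi>t \<in> borel_measurable borel"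
    using \<psi>(1-3) by (simp_all add: borel_measurable_continuous_onI)
  have cQ: "compact ?Q" by (intro compact_Times compact_Icc)
  have "\<exists>K. \<forall>p\<in>?Q. \<bar>\<psi> p\<bar> \<le> K \<and> \<bar>\<psi>x p\<bar> \<le> K \<and> \<bar>\<psi>t p\<bar> \<le> K"
  proof -
    have "bounded ((\<lambda>p. (\<psi> p, \<psi>x p, \<psi>t p)) ` ?Q)"
      by (intro compact_imp_bounded compact_continuous_image continuous_intros cQ)
         (use \<psi>(1-3) continuous_on_subset in blast)+
    then obtain K where K: "\<And>p. p \<in> ?Q \<Longrightarrow> norm (\<psi> p, \<psi>x p, \<psi>t p) \<le> K" unfolding bounded_iff by auto
    show ?thesis
    proof (intro exI[of _ K] ballI)
      fix p assume "p \<in> ?Q"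
      have "norm (\<psi> p) \<le> norm (\<psi> p, \<psi>x p, \<psi>t p)" "norm (\<psi>x p, \<psi>t p) \<le> norm (\<psi> p, \<psi>x p, \<psi>t p)"
        "norm (\<psi>x p) \<le> norm (\<psi>x p, \<psi>t p)" "norm (\<psi>t p) \<le> norm (\<psi>x p, \<psi>t p)"
        using norm_fst_le[of "\<psi> p" "(\<psi>x p, \<psi>t p)"] norm_snd_le[of "(\<psi>x p, \<psi>t p)" "\<psi> p"]
          norm_fst_le[of "\<psi>x p" "\<psi>t p"] norm_snd_le[of "\<psi>t p" "\<psi>x p"] by simp_all
      with K[OF \<open>p \<in> ?Q\<close>] show "\<bar>\<psi> p\<bar> \<le> K \<and> \<bar>\<psi>x p\<bar> \<le> K \<and> \<bar>\<psi>t p\<bar> \<le> K" by (simp del: norm_Pair)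
    qed
  qed
  then obtain K where K: "\<And>p. p \<in> ?Q \<Longrightarrow> \<bar>\<psi> p\<bar> \<le> K" "\<And>p. p \<in> ?Q \<Longrightarrow> \<bar>\<psi>x p\<bar> \<le> K" "\<And>p. p \<in> ?Q \<Longrightarrow> \<bar>\<psi>t p\<bar> \<le> K"
    by blast
  have C0: "0 \<le> C" by (rule order_trans[OF abs_ge_zero bdd(1)[of "(0,0)"]]) (use l T in auto)
  have K0: "0 \<le> K" by (rule order_trans[OF abs_ge_zero K(1)[of "(0,0)"]]) (use l T in auto)
  have bQ: "bounded ?Q" using cQ by (rule compact_imp_bounded)
  have sQ: "?Q \<in> sets borel" using cQ by (simp add: borel_compact)
  have mult_le: "\<bar>a * b\<bar> \<le> C * K" if "\<bar>a\<bar> \<le> C" "\<bar>b\<bar> \<le> K" for a b :: real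
    unfolding abs_mult using that C0 by (intro mult_mono) auto
  have int_mult: "set_integrable lborel ?Q (\<lambda>p. F p * G p)"
    if "F \<in> borel_measurable borel" "G \<in> borel_measurable borel"
      "\<And>p. p \<in> ?Q \<Longrightarrow> \<bar>F p\<bar> \<le> C" "\<And>p. p \<in> ?Q \<Longrightarrow> \<bar>G p\<bar> \<le> K" for F G
    by (rule set_integrable_bounded[OF borel_measurable_times[OF that(1,2)] bQ sQ mult_le[OF that(3,4)]])
  have iA: "set_integrable lborel ?Q (\<lambda>p. A p * \<psi>t p)"
    by (rule int_mult[OF mA m\<psi>(3) bdd(1) K(3)])
  have iB: "set_integrable lborel ?Q (\<lambda>p. B p * \<psi>x p)"
    by (rule int_mult[OF mB m\<psi>(2) bdd(2) K(2)])
  have iR: "set_integrable lborel ?Q (\<lambda>p. R p * \<psi> p)"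
    by (rule int_mult[OF mR m\<psi>(1) bdd(3) K(1)])
  have iw: "set_integrable lborel ?Q (\<lambda>p. C * (1 + \<bar>fst p\<bar> powr (-1/2)) * K)"
  proof -
    have 1: "integrable lborel (\<lambda>x. indicator {-l..l} x *\<^sub>R (C * (1 + \<bar>x\<bar> powr (-1/2)) * K))"
    proof -
      have "set_integrable lborel {-l..l} (\<lambda>x. 1 + \<bar>x\<bar> powr (-1/2))"
        by (rule set_integral_add(1)[OF _ powr_half_integrable[OF l]]) (simp add: set_integrable_def integrable_indicator_iff emeasure_lborel_Icc_eq)
      from integrable_mult_right[OF this[unfolded set_integrable_def], of "C * K"]
      show ?thesis by (simp add: algebra_simps)
    qed
    have 2: "integrable lborel (\<lambda>t. indicator {0..T} t *\<^sub>R (1::real))"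
      by (simp add: integrable_indicator_iff emeasure_lborel_Icc_eq)
    show ?thesis
      unfolding set_integrable_def
      by (rule back_subst[of "integrable lborel", OF integrable_tensor[OF 1 2]]) (auto simp: indicator_def fun_eq_iff)
  qed
  have aex: "AE p in lborel. fst p \<noteq> (0::real) \<and> snd p \<noteq> (0::real)"
  proof -
    have s: "(- {0::real}) \<times> (- {0::real}) \<in> sets (lborel \<Otimes>\<^sub>M lborel)"
      by (intro pair_measureI) auto
    have e: "{p \<in> space (lborel \<Otimes>\<^sub>M lborel). fst p \<noteq> (0::real) \<and> snd p \<noteq> (0::real)} = (- {0}) \<times> (- {0})"
      by (auto simp: space_pair_measure)
    have t: "AE t in lborel. t \<noteq> (0::real)" by (rule AE_lborel_singleton)
    have "AE x in lborel. AE t in lborel. fst (x, t) \<noteq> (0::real) \<and> snd (x, t) \<noteq> (0::real)"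
      using t
    proof eventually_elim
      case (elim x)
      show ?case using t by eventually_elim (use elim in simp)
    qed
    from lborel_pair.AE_pair_measure[OF s[folded e] this]
    show ?thesis unfolding lborel_prod .
  qed
  have iD: "set_integrable lborel ?Q (\<lambda>p. D p * \<psi> p)"
    unfolding set_integrable_def
  proof (rule Bochner_Integration.integrable_bound[OF iw[unfolded set_integrable_def]])
    show "(\<lambda>p. indicator ?Q p *\<^sub>R (D p * \<psi> p)) \<in> borel_measurable lborel"
      using meas m\<psi> sQ by auto
    show "AE p in lborel. norm (indicator ?Q p *\<^sub>R (D p * \<psi> p))
        \<le> norm (indicator ?Q p *\<^sub>R (C * (1 + \<bar>fst p\<bar> powr (-1/2)) * K))"
      using aex
    proof eventually_elim
      case (elim p)
      obtain x t where p: "p = (x, t)" by (cases p)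
      show ?case
      proof (cases "p \<in> ?Q")
        case True
        then have D: "\<bar>D p\<bar> \<le> C * (1 + \<bar>fst p\<bar> powr (-1/2))"
          using bdd(4)[of x t] elim by (simp add: p)
        have "0 \<le> C * (1 + \<bar>fst p\<bar> powr (-1/2))" using C0 by (intro mult_nonneg_nonneg add_nonneg_nonneg) auto
        with D K(1)[OF True] have "\<bar>D p\<bar> * \<bar>\<psi> p\<bar> \<le> C * (1 + \<bar>fst p\<bar> powr (-1/2)) * K"
          by (intro mult_mono) auto
        also have "\<dots> \<le> \<bar>C * (1 + \<bar>fst p\<bar> powr (-1/2)) * K\<bar>" by simp
        finally show ?thesis using True by (simp add: abs_mult)
      qed simp
    qed
  qed
  have contAt: "continuous_on {0..T} (\<lambda>t. F (x, t))" if "continuous_on (UNIV - {(0,0)}) F" "x \<noteq> 0" for F :: "real \<times> real \<Rightarrow> real" and x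
    by (rule continuous_on_compose2[OF that(1)]) (use that(2) in \<open>auto intro!: continuous_intros\<close>)
  have contBx: "continuous_on {-l..l} (\<lambda>x. F (x, t))" if "continuous_on (UNIV - {(0,0)}) F" "t \<noteq> 0" for F :: "real \<times> real \<Rightarrow> real" and t
    by (rule continuous_on_compose2[OF that(1)]) (use that(2) in \<open>auto intro!: continuous_intros\<close>)
  have cont\<psi>t: "continuous_on S (\<lambda>t. \<psi> (x, t))" for S x
    by (rule continuous_on_compose2[OF \<psi>(1)]) (auto intro!: continuous_intros)
  have cont\<psi>x: "continuous_on S (\<lambda>x. \<psi> (x, t))" for S t
    by (rule continuous_on_compose2[OF \<psi>(1)]) (auto intro!: continuous_intros)
  have sec1: "(\<lambda>x. F (x, c)) \<in> borel_measurable borel"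
    if "F \<in> borel_measurable borel" for F :: "real \<times> real \<Rightarrow> real" and c
    by (rule measurable_compose[OF borel_measurable_continuous_onI that]) (intro continuous_intros)
  have sec2: "(\<lambda>t. F (c, t)) \<in> borel_measurable borel"
    if "F \<in> borel_measurable borel" for F :: "real \<times> real \<Rightarrow> real" and c
    by (rule measurable_compose[OF borel_measurable_continuous_onI that]) (intro continuous_intros)
  have i1: "set_integrable lborel ?Q (\<lambda>p. A p * \<psi>t p + D p * \<psi> p)"
    using iA iD by (rule set_integral_add(1))
  have i2: "set_integrable lborel ?Q (\<lambda>p. B p * \<psi>x p + (R p * \<psi> p - D p * \<psi> p))"
    by (rule set_integral_add(1)[OF iB set_integral_diff(1)[OF iR iD]])
  have "(LINT p:?Q|lborel. A p * \<psi>t p + D p * \<psi> p) =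
    (LINT x:{-l..l}|lborel. (LINT t:{0..T}|lborel. A (x,t) * \<psi>t (x,t) + D (x,t) * \<psi> (x,t)))"
    using set_integral_rectangle_fst(1)[OF i1] by simp
  also have "\<dots> = (LINT x:{-l..l}|lborel. - (A (x, 0) * \<psi> (x, 0)))"
  proof (rule set_lebesgue_integral_cong_AE2[OF set_integral_rectangle_fst(3)[OF i1]])
    show "(\<lambda>x. - (A (x, 0) * \<psi> (x, 0))) \<in> borel_measurable borel"
      by (intro borel_measurable_uminus borel_measurable_times sec1 mA m\<psi>)
    show "AE x in lborel. x \<in> {-l..l} \<longrightarrow> (LINT t:{0..T}|lborel. A (x,t) * \<psi>t (x,t) + D (x,t) * \<psi> (x,t)) = - (A (x, 0) * \<psi> (x, 0))"
      using set_integral_rectangle_fst(2)[OF i1] AE_lborel_singleton[of "0::real"] AE_lborel_singleton[of l] AE_lborel_singleton[of "-l"]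
    proof eventually_elim
      case (elim x)
      show ?case
      proof
        assume x: "x \<in> {-l..l}"
        have "(LINT t:{0..T}|lborel. A (x,t) * \<psi>t (x,t) + D (x,t) * \<psi> (x,t)) = A (x, T) * \<psi> (x, T) - A (x, 0) * \<psi> (x, 0)"
        proof (rule set_lebesgue_FTC[where F="\<lambda>t. A (x, t) * \<psi> (x, t)" and S="{t. 0 < t \<and> (x, t) \<in> X}"])
          show "continuous_on {0..T} (\<lambda>t. A (x, t) * \<psi> (x, t))"
            by (intro continuous_on_mult contAt[OF cont(1)] cont\<psi>t) (use elim in auto)
          show "((\<lambda>t. A (x, t) * \<psi> (x, t)) has_real_derivative A (x, t) * \<psi>t (x, t) + D (x, t) * \<psi> (x, t)) (at t)"
            if "t \<in> {0<..<T} - {t. 0 < t \<and> (x, t) \<in> X}" for t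
          proof -
            have "((\<lambda>t. A (x, t)) has_real_derivative D (x, t)) (at t)"
              by (rule dt) (use that elim in auto)
            from DERIV_mult[OF this \<psi>(5)] show ?thesis by (rule DERIV_cong) (simp add: algebra_simps)
          qed
          show "finite {t. 0 < t \<and> (x, t) \<in> X}" by (rule fin(1)) (use elim in auto)
          show "set_integrable lborel {0..T} (\<lambda>t. A (x,t) * \<psi>t (x,t) + D (x,t) * \<psi> (x,t))"
            using elim x by blast
        qed (use T in simp)
        then show "(LINT t:{0..T}|lborel. A (x,t) * \<psi>t (x,t) + D (x,t) * \<psi> (x,t)) = - (A (x, 0) * \<psi> (x, 0))"
          using \<psi>T[of x] x elim by simp
      qed
    qed
  qed simp
  finally have 1: "(LINT p:?Q|lborel. A p * \<psi>t p + D p * \<psi> p) = - ?A"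
    by (simp add: set_lebesgue_integral_def)
  have "(LINT p:?Q|lborel. B p * \<psi>x p + (R p * \<psi> p - D p * \<psi> p)) =
    (LINT t:{0..T}|lborel. (LINT x:{-l..l}|lborel. B (x,t) * \<psi>x (x,t) + (R (x,t) * \<psi> (x,t) - D (x,t) * \<psi> (x,t))))"
    using set_integral_rectangle_snd(1)[OF i2] by simp
  also have "\<dots> = ?B"
  proof (rule set_lebesgue_integral_cong_AE2[OF set_integral_rectangle_snd(3)[OF i2]])
    show "(\<lambda>t. B (l, t) * \<psi> (l, t) - B (- l, t) * \<psi> (- l, t)) \<in> borel_measurable borel"
      by (intro borel_measurable_diff borel_measurable_times sec2 mB m\<psi>)
    show "AE t in lborel. t \<in> {0..T} \<longrightarrow> (LINT x:{-l..l}|lborel. B (x,t) * \<psi>x (x,t) + (R (x,t) * \<psi> (x,t) - D (x,t) * \<psi> (x,t)))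
       = B (l, t) * \<psi> (l, t) - B (-l, t) * \<psi> (-l, t)"
      using set_integral_rectangle_snd(2)[OF i2] AE_lborel_singleton[of "0::real"] AE_lborel_singleton[of T]
    proof eventually_elim
      case (elim t)
      show ?case
      proof
        assume t: "t \<in> {0..T}"
        show "(LINT x:{-l..l}|lborel. B (x,t) * \<psi>x (x,t) + (R (x,t) * \<psi> (x,t) - D (x,t) * \<psi> (x,t)))
           = B (l, t) * \<psi> (l, t) - B (-l, t) * \<psi> (-l, t)"
        proof (rule set_lebesgue_FTC[where F="\<lambda>x. B (x, t) * \<psi> (x, t)" and S="{x. (x, t) \<in> X}"])
          show "continuous_on {-l..l} (\<lambda>x. B (x, t) * \<psi> (x, t))"
            by (intro continuous_on_mult contBx[OF cont(2)] cont\<psi>x) (use elim in auto)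
          show "((\<lambda>x. B (x, t) * \<psi> (x, t)) has_real_derivative B (x, t) * \<psi>x (x, t) + (R (x, t) * \<psi> (x, t) - D (x, t) * \<psi> (x, t))) (at x)"
            if "x \<in> {-l<..<l} - {x. (x, t) \<in> X}" for x
          proof -
            have "((\<lambda>x. B (x, t)) has_real_derivative R (x, t) - D (x, t)) (at x)"
              by (rule dx) (use that elim t in auto)
            from DERIV_mult[OF this \<psi>(4)] show ?thesis by (rule DERIV_cong) (simp add: algebra_simps)
          qed
          show "finite {x. (x, t) \<in> X}" by (rule fin(2)) (use elim t in auto)
          show "set_integrable lborel {- l..l} (\<lambda>x. B (x,t) * \<psi>x (x,t) + (R (x,t) * \<psi> (x,t) - D (x,t) * \<psi> (x,t)))"
            using elim t by blast
        qed (use l in simp)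
      qed
    qed
  qed simp
  finally have 2: "(LINT p:?Q|lborel. B p * \<psi>x p + (R p * \<psi> p - D p * \<psi> p)) = ?B" .
  have "?I = (LINT p:?Q|lborel. (A p * \<psi>t p + D p * \<psi> p) + (B p * \<psi>x p + (R p * \<psi> p - D p * \<psi> p)))"
    by (rule arg_cong[where f="set_lebesgue_integral lborel ?Q"]) (simp add: fun_eq_iff)
  also have "\<dots> = - ?A + ?B" unfolding 1[symmetric] 2[symmetric] using i1 i2 by (rule set_integral_add(2))
  finally show ?thesis by simp
qed

section \<open>Integration by parts across the fan\<close>

lemma continuous_compact_bound:
  fixes f :: "'a::topological_space \<Rightarrow> real"
  assumes "continuous_on K f" "compact K"
  obtains C where "0 \<le> C" "\<And>p. p \<in> K \<Longrightarrow> \<bar>f p\<bar> \<le> C"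
proof -
  have "bounded (f ` K)" using assms by (intro compact_imp_bounded compact_continuous_image)
  then obtain C where C: "\<forall>y\<in>f ` K. norm y \<le> C" unfolding bounded_iff by auto
  show ?thesis
  proof (rule that[of "\<bar>C\<bar>"])
    fix p assume "p \<in> K"
    then have "norm (f p) \<le> C" using C by blast
    then show "\<bar>f p\<bar> \<le> \<bar>C\<bar>" by simp
  qed simp
qed

context fan
begin

abbreviation states :: "(real \<times> real \<times> real) set" where
  "states \<equiv> UNIV \<times> UNIV \<times> {\<rho>m..\<rho>p}"

text \<open>
  The fields of interest are functions of position, time and density, continuous on \<open>states\<close>, which are then
  evaluated along the wave. In this way all fields share the continuity and the bounds proved once for general \<open>\<alpha>\<close>.
\<close>

definition at_mu :: "real \<Rightarrow> (real \<times> real \<times> real \<Rightarrow> 'b) \<Rightarrow> real \<times> real \<Rightarrow> 'b" where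
  "at_mu d \<alpha> = (\<lambda>(x, t). \<alpha> (x, t, mu d x t))"

definition mu_t :: "real \<Rightarrow> real \<Rightarrow> real \<Rightarrow> real" where
  "mu_t d x t = - (2 * x / t) * slope d x t"

lemma continuous_at_mu:
  assumes "continuous_on states \<alpha>"
  shows "continuous_on (UNIV - {(0,0)}) (at_mu d \<alpha>)"
proof -
  have "continuous_on (UNIV - {(0,0)}) (\<lambda>p. \<alpha> (fst p, snd p, (\<lambda>(x, t). mu d x t) p))"
    by (rule continuous_on_compose2[OF assms])
       (auto intro!: continuous_on_Pair continuous_on_fst continuous_on_snd continuous_on_id continuous_mu
         simp: mu_ge mu_le)
  then show ?thesis by (simp add: at_mu_def case_prod_unfold)
qed

lemma measurable_mu: "(\<lambda>p. mu d (fst p) (snd p)) \<in> borel_measurable borel"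
  using borel_measurable_continuous_except_point[OF continuous_mu] by (simp add: case_prod_unfold)

lemma measurable_mu_t: "(\<lambda>p. mu_t d (fst p) (snd p)) \<in> borel_measurable borel"
proof -
  have [measurable]: "(\<lambda>p. mu d (fst p) (snd p)) \<in> borel_measurable (borel \<Otimes>\<^sub>M borel)"
    using measurable_mu[of d] by (simp add: borel_prod)
  show ?thesis unfolding mu_t_def slope_def fall_def borel_prod[symmetric] by measurable
qed

text \<open>
  A vertical line \<open>x \<noteq> 0\<close> meets the edge of a fan at most once, so that the edges are harmless for the
  fundamental theorem of calculus in time.
\<close>

lemma finite_ray: "x \<noteq> 0 \<Longrightarrow> finite {t. 0 < t \<and> x = k * fall g t}"
proof -
  assume x: "x \<noteq> 0"
  have "{t. 0 < t \<and> x = k * fall g t} \<subseteq> {sqrt (2 * x / (k * g))}"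
  proof
    fix t :: real assume "t \<in> {t. 0 < t \<and> x = k * fall g t}"
    then have t: "0 < t" "x = k * fall g t" by auto
    then have "k \<noteq> 0" using x by auto
    then have "2 * x / (k * g) = t\<^sup>2" using g_pos t by (simp add: fall_def field_simps)
    then show "t \<in> {sqrt (2 * x / (k * g))}" using t by simp
  qed
  then show ?thesis by (rule finite_subset) simp
qed

text \<open>
  The time derivative of \<open>\<alpha>\<close> along the wave is given in the form \<open>\<alpha>1 + \<alpha>2 \<partial>\<^sub>t \<mu>\<close> with continuous \<open>\<alpha>1\<close> and \<open>\<alpha>2\<close>.
  This isolates its only singular factor, which \<open>mu_t_bound\<close> controls.
\<close>

lemma fan_ibp:
  fixes \<alpha> \<beta> \<alpha>1 \<alpha>2 R :: "real \<times> real \<times> real \<Rightarrow> real" and \<psi> \<psi>x \<psi>t :: "real \<times> real \<Rightarrow> real"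
  assumes l: "0 < l" and T: "0 < T"
    and cont: "continuous_on states \<alpha>" "continuous_on states \<beta>"
      "continuous_on states R"
      "continuous_on states \<alpha>1" "continuous_on states \<alpha>2"
    and dt: "\<And>x t. 0 < t \<Longrightarrow> t < T \<Longrightarrow> x / fall g t + d \<noteq> speed \<rho>m \<Longrightarrow> x / fall g t + d \<noteq> speed \<rho>p \<Longrightarrow>
      ((\<lambda>t. at_mu d \<alpha> (x, t)) has_real_derivative at_mu d \<alpha>1 (x, t) + at_mu d \<alpha>2 (x, t) * mu_t d x t) (at t)"
    and dx: "\<And>x t. 0 < t \<Longrightarrow> t < T \<Longrightarrow> x / fall g t + d \<noteq> speed \<rho>m \<Longrightarrow> x / fall g t + d \<noteq> speed \<rho>p \<Longrightarrow>
      ((\<lambda>x. at_mu d \<beta> (x, t)) has_real_derivative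
        at_mu d R (x, t) - (at_mu d \<alpha>1 (x, t) + at_mu d \<alpha>2 (x, t) * mu_t d x t)) (at x)"
    and \<psi>: "continuous_on UNIV \<psi>" "continuous_on UNIV \<psi>x" "continuous_on UNIV \<psi>t"
      "\<And>x t. ((\<lambda>x. \<psi> (x, t)) has_real_derivative \<psi>x (x, t)) (at x)"
      "\<And>x t. ((\<lambda>t. \<psi> (x, t)) has_real_derivative \<psi>t (x, t)) (at t)"
    and \<psi>T: "\<And>x. x \<in> {-l<..<l} \<Longrightarrow> \<psi> (x, T) = 0"
  shows "(LINT p:{-l..l} \<times> {0..T}|lborel. at_mu d \<alpha> p * \<psi>t p + at_mu d \<beta> p * \<psi>x p + at_mu d R p * \<psi> p) =
    (LINT t:{0..T}|lborel. at_mu d \<beta> (l, t) * \<psi> (l, t) - at_mu d \<beta> (-l, t) * \<psi> (-l, t))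
    - (LINT x:{-l..l}|lborel. at_mu d \<alpha> (x, 0) * \<psi> (x, 0))"
proof -
  define K where "K = {-l..l} \<times> {0..T} \<times> {\<rho>m..\<rho>p}"
  have cK: "compact K" unfolding K_def by (intro compact_Times compact_Icc)
  have bnd: "\<exists>C\<ge>0. \<forall>p\<in>K. \<bar>F p\<bar> \<le> C" if "continuous_on states F" for F :: "real \<times> real \<times> real \<Rightarrow> real"
    using continuous_compact_bound[OF continuous_on_subset[OF that] cK] by (metis K_def Sigma_mono order_refl subset_UNIV)
  obtain C1 where C1: "C1 \<ge> 0" "\<And>p. p \<in> K \<Longrightarrow> \<bar>\<alpha> p\<bar> \<le> C1" using bnd[OF cont(1)] by blast
  obtain C2 where C2: "C2 \<ge> 0" "\<And>p. p \<in> K \<Longrightarrow> \<bar>\<beta> p\<bar> \<le> C2" using bnd[OF cont(2)] by blast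
  obtain C3 where C3: "C3 \<ge> 0" "\<And>p. p \<in> K \<Longrightarrow> \<bar>R p\<bar> \<le> C3" using bnd[OF cont(3)] by blast
  obtain C4 where C4: "C4 \<ge> 0" "\<And>p. p \<in> K \<Longrightarrow> \<bar>\<alpha>1 p\<bar> \<le> C4" using bnd[OF cont(4)] by blast
  obtain C5 where C5: "C5 \<ge> 0" "\<And>p. p \<in> K \<Longrightarrow> \<bar>\<alpha>2 p\<bar> \<le> C5" using bnd[OF cont(5)] by blast
  obtain C6 where C6: "\<And>x t. 0 < t \<Longrightarrow> x \<noteq> 0 \<Longrightarrow> \<bar>- (2 * x / t) * slope d x t\<bar> \<le> C6 * \<bar>x\<bar> powr (-1/2)"
    using mu_t_bound[of d] by metis
  define C where "C = C1 + C2 + C3 + C4 + C5 * \<bar>C6\<bar>"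
  have inK: "(x, t, mu d x t) \<in> K" if "x \<in> {-l..l}" "t \<in> {0..T}" for x t
    using that mu_mem[of d x t] by (simp add: K_def)
  define D where "D = (\<lambda>(x, t). at_mu d \<alpha>1 (x, t) + at_mu d \<alpha>2 (x, t) * mu_t d x t)"
  (* The edges of the fan, where the wave has kinks. *)
  define X where "X = {(x, t). x = (speed \<rho>m - d) * fall g t \<or> x = (speed \<rho>p - d) * fall g t}"
  have nX: "x / fall g t + d \<noteq> speed \<rho>m" "x / fall g t + d \<noteq> speed \<rho>p" if "0 < t" "(x, t) \<notin> X" for x t
    using that fall_pos[of t] by (auto simp: X_def field_simps)
  show ?thesis
  proof (rule rectangle_ibp[where C=C and D=D and X=X, OF l T continuous_at_mu[OF cont(1)]
        continuous_at_mu[OF cont(2)] continuous_at_mu[OF cont(3)] _ _ _ _ _ _ _ _ _ \<psi> \<psi>T])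
    have "D = (\<lambda>p. at_mu d \<alpha>1 p + at_mu d \<alpha>2 p * mu_t d (fst p) (snd p))"
      by (auto simp: D_def)
    moreover have "at_mu d \<alpha>1 \<in> borel_measurable borel" "at_mu d \<alpha>2 \<in> borel_measurable borel"
      by (rule borel_measurable_continuous_except_point[OF continuous_at_mu], rule cont)+
    ultimately show "D \<in> borel_measurable borel" using measurable_mu_t[of d]
      by (simp add: borel_measurable_add borel_measurable_times)
    have n: "0 \<le> C5 * \<bar>C6\<bar>" using C5(1) by simp
    fix p assume p: "p \<in> {-l..l} \<times> {0..T}"
    then have k: "(fst p, snd p, mu d (fst p) (snd p)) \<in> K" by (intro inK) auto
    show "\<bar>at_mu d \<alpha> p\<bar> \<le> C" "\<bar>at_mu d \<beta> p\<bar> \<le> C" "\<bar>at_mu d R p\<bar> \<le> C"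
      using C1(1) C2(1) C3(1) C4(1) n C1(2)[OF k] C2(2)[OF k] C3(2)[OF k]
      unfolding at_mu_def C_def case_prod_unfold by linarith+
  next
    fix x t assume a: "x \<in> {-l..l}" "x \<noteq> 0" "t \<in> {0<..T}"
    then have k: "(x, t, mu d x t) \<in> K" by (intro inK) auto
    have "\<bar>D (x, t)\<bar> \<le> \<bar>at_mu d \<alpha>1 (x, t)\<bar> + \<bar>at_mu d \<alpha>2 (x, t)\<bar> * \<bar>mu_t d x t\<bar>"
      unfolding D_def by (simp add: abs_mult[symmetric])
    also have "\<dots> \<le> C4 + C5 * (\<bar>C6\<bar> * \<bar>x\<bar> powr (-1/2))"
    proof (intro add_mono mult_mono)
      have "\<bar>mu_t d x t\<bar> \<le> C6 * \<bar>x\<bar> powr (-1/2)" using C6[of t x] a by (simp add: mu_t_def)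
      also have "\<dots> \<le> \<bar>C6\<bar> * \<bar>x\<bar> powr (-1/2)" by (intro mult_right_mono) auto
      finally show "\<bar>mu_t d x t\<bar> \<le> \<bar>C6\<bar> * \<bar>x\<bar> powr (-1/2)" .
    qed (use C4 C5 k in \<open>auto simp: at_mu_def\<close>)
    also have "\<dots> \<le> C * 1 + C * \<bar>x\<bar> powr (-1/2)"
      unfolding mult.assoc[symmetric] mult_1_right
      by (intro add_mono mult_right_mono) (use C1(1) C2(1) C3(1) C4(1) C5(1) in \<open>auto simp: C_def\<close>)
    finally show "\<bar>D (x, t)\<bar> \<le> C * (1 + \<bar>x\<bar> powr (-1/2))" by (simp add: distrib_left)
  next
    fix x :: real assume x: "x \<noteq> 0"
    have "{t. 0 < t \<and> (x, t) \<in> X} = {t. 0 < t \<and> x = (speed \<rho>m - d) * fall g t} \<union> {t. 0 < t \<and> x = (speed \<rho>p - d) * fall g t}"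
      by (auto simp: X_def)
    then show "finite {t. 0 < t \<and> (x, t) \<in> X}" using finite_ray[OF x] by simp
  next
    fix t :: real
    have "{x. (x, t) \<in> X} = {(speed \<rho>m - d) * fall g t, (speed \<rho>p - d) * fall g t}" by (auto simp: X_def)
    then show "finite {x. (x, t) \<in> X}" by simp
  next
    fix x t assume a: "0 < t" "t < T" "(x, t) \<notin> X"
    show "((\<lambda>t. at_mu d \<alpha> (x, t)) has_real_derivative D (x, t)) (at t)"
      using dt[OF a(1,2) nX[OF a(1,3)]] by (simp add: D_def)
    show "((\<lambda>x. at_mu d \<beta> (x, t)) has_real_derivative at_mu d R (x, t) - D (x, t)) (at x)"
      using dx[OF a(1,2) nX[OF a(1,3)]] by (simp add: D_def)
  qed
qed

end

section \<open>Smooth cutoff functions\<close>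

lemma Ck_Suc_imp: "Ck (Suc k) f \<Longrightarrow> Ck k f"
proof (induction k arbitrary: f)
  case 0
  then show ?case by (simp add: differentiable_imp_continuous_on)
next
  case (Suc k)
  then have "f differentiable_on UNIV" "\<forall>v. Ck k (\<lambda>x. frechet_derivative f (at x) v)" by auto
  then show ?case by simp
qed

lemma Ck_differentiable: "Ck (Suc k) f \<Longrightarrow> (f has_derivative frechet_derivative f (at x)) (at x)"
  using frechet_derivative_works by (auto simp: differentiable_on_def)

lemma Ck_SucI:
  assumes "\<And>x. (f has_derivative f' x) (at x)" "\<And>v. Ck k (\<lambda>x. f' x v)"
  shows "Ck (Suc k) f"
proof -
  have "frechet_derivative f (at x) = f' x" for x
    using assms(1) by (metis frechet_derivative_at)
  then show ?thesis using assms by (auto simp: differentiable_on_def differentiable_def)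
qed

lemma Ck_const: "Ck k (\<lambda>x. c)"
proof (induction k arbitrary: c)
  case (Suc k)
  show ?case by (rule Ck_SucI[where f'="\<lambda>_ _. 0"]) (use Suc in auto)
qed simp

lemma Ck_linear: assumes "bounded_linear f" shows "Ck k f"
proof (cases k)
  case 0
  then show ?thesis using assms by (simp add: linear_continuous_on)
next
  case (Suc k')
  show ?thesis unfolding Suc
    by (rule Ck_SucI[where f'="\<lambda>_. f"]) (use assms in \<open>auto intro: bounded_linear_imp_has_derivative Ck_const\<close>)
qed

lemma Ck_add: "Ck k f \<Longrightarrow> Ck k h \<Longrightarrow> Ck k (\<lambda>x. f x + h x)"
proof (induction k arbitrary: f h)
  case (Suc k)
  show ?case
    by (rule Ck_SucI[where f'="\<lambda>x v. frechet_derivative f (at x) v + frechet_derivative h (at x) v"])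
       (use Suc in \<open>auto intro!: has_derivative_add Ck_differentiable\<close>)
qed (simp add: continuous_on_add)

lemma Ck_mult:
  fixes f h :: "'a::real_normed_vector \<Rightarrow> real"
  shows "Ck k f \<Longrightarrow> Ck k h \<Longrightarrow> Ck k (\<lambda>x. f x * h x)"
proof (induction k arbitrary: f h)
  case (Suc k)
  show ?case
  proof (rule Ck_SucI)
    show "((\<lambda>x. f x * h x) has_derivative
        (\<lambda>v. f x * frechet_derivative h (at x) v + frechet_derivative f (at x) v * h x)) (at x)" for x
      by (rule has_derivative_mult[OF Ck_differentiable[OF Suc.prems(1)] Ck_differentiable[OF Suc.prems(2)]])
    show "Ck k (\<lambda>x. f x * frechet_derivative h (at x) v + frechet_derivative f (at x) v * h x)" for v
      using Suc.prems Ck_Suc_imp by (intro Ck_add Suc.IH) auto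
  qed
qed (simp add: continuous_on_mult)

text \<open>
  The functions \<open>P(1/x) exp(-1/x)\<close>, continued by \<open>0\<close>, form a class that is closed under differentiation. One
  induction therefore shows that all of them are smooth. The polynomial \<open>1\<close> gives the cutoff function, and
  \<open>x\<^sup>2\<close> its derivative.
\<close>

definition flat :: "real poly \<Rightarrow> real \<Rightarrow> real" where
  "flat P x = (if x \<le> 0 then 0 else poly P (inverse x) * exp (- inverse x))"

lemma poly_times_exp_tendsto_0: "((\<lambda>x::real. poly P x * exp (- x)) \<longlongrightarrow> 0) at_top"
proof -
  have "((\<lambda>x::real. \<Sum>i\<le>degree P. coeff P i * (x ^ i / exp x)) \<longlongrightarrow> (\<Sum>i\<le>degree P. coeff P i * 0)) at_top"
    by (intro tendsto_sum tendsto_mult tendsto_const tendsto_power_div_exp_0)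
  then show ?thesis by (simp add: poly_altdef exp_minus field_simps sum_divide_distrib)
qed

lemma flat_tendsto_0: "((\<lambda>x. poly P (inverse x) * exp (- inverse x)) \<longlongrightarrow> (0::real)) (at_right 0)"
  using filterlim_compose[OF poly_times_exp_tendsto_0 filterlim_inverse_at_top_right] by simp

lemma DERIV_flat: "(flat P has_real_derivative flat ([:0, 0, 1:] * (P - pderiv P)) x) (at x)"
proof -
  consider "x < 0" | "x = 0" | "x > 0" by linarith
  then show ?thesis
  proof cases
    case 1
    have ev: "\<forall>\<^sub>F y in nhds x. flat P y = 0"
      using eventually_nhds_in_open[of "{..<0}" x] 1 by (auto simp: flat_def elim!: eventually_mono)
    show ?thesis by (subst DERIV_cong_ev[OF refl ev refl]) (use 1 in \<open>simp add: flat_def\<close>)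
  next
    case 2
    have r: "((\<lambda>h. flat P h / h) \<longlongrightarrow> 0) (at_right 0)"
    proof (rule Lim_transform_eventually[OF flat_tendsto_0[of "[:0, 1:] * P"]])
      show "\<forall>\<^sub>F h in at_right 0. poly ([:0, 1:] * P) (inverse h) * exp (- inverse h) = flat P h / h"
        by (auto simp: eventually_at_filter flat_def divide_inverse)
    qed
    have l: "((\<lambda>h. flat P h / h) \<longlongrightarrow> 0) (at_left 0)"
      by (rule Lim_transform_eventually[of "\<lambda>_. 0"]) (auto simp: eventually_at_filter flat_def)
    have "((\<lambda>h. flat P h / h) \<longlongrightarrow> 0) (at 0)"
      using l r by (simp add: filterlim_split_at)
    then show ?thesis unfolding 2 by (simp add: DERIV_def flat_def)
  next
    case 3
    have ev: "\<forall>\<^sub>F y in nhds x. flat P y = poly P (inverse y) * exp (- inverse y)"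
      using eventually_nhds_in_open[of "{0<..}" x] 3 by (auto simp: flat_def elim!: eventually_mono)
    have "((\<lambda>y. poly P (inverse y) * exp (- inverse y)) has_real_derivative
      (poly (pderiv P) (inverse x) * (- (inverse x * inverse x))) * exp (- inverse x)
      + poly P (inverse x) * (exp (- inverse x) * (inverse x * inverse x))) (at x)"
      using 3 by (auto intro!: derivative_eq_intros DERIV_chain2[OF poly_DERIV] simp: power2_eq_square)
    then show ?thesis
      by (subst DERIV_cong_ev[OF refl ev refl]) (use 3 in \<open>simp add: flat_def algebra_simps\<close>)
  qed
qed

lemma Ck_flat_comp:
  fixes h :: "'a::real_normed_vector \<Rightarrow> real"
  assumes "\<And>k. Ck k h" shows "Ck k (\<lambda>x. flat P (h x))"
proof (induction k arbitrary: P)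
  case 0
  have "continuous_on UNIV (flat P)" by (meson DERIV_flat DERIV_isCont continuous_at_imp_continuous_on)
  then show ?case using assms[of 0] by (auto intro: continuous_on_compose2)
next
  case (Suc k)
  let ?P' = "[:0, 0, 1:] * (P - pderiv P)"
  show ?case
  proof (rule Ck_SucI)
    show "((\<lambda>x. flat P (h x)) has_derivative (\<lambda>v. flat ?P' (h x) * frechet_derivative h (at x) v)) (at x)" for x
      using has_derivative_compose[OF Ck_differentiable[OF assms, of x] DERIV_flat[of P "h x", unfolded has_field_derivative_def]]
      by simp
    show "Ck k (\<lambda>x. flat ?P' (h x) * frechet_derivative h (at x) v)" for v
      using assms[of "Suc k"] by (intro Ck_mult Suc.IH) auto
  qed
qed

lemma flat_1_pos: "x > 0 \<Longrightarrow> flat 1 x > 0" and flat_1_nonneg: "flat 1 x \<ge> 0"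
  and flat_eq_0: "x \<le> 0 \<Longrightarrow> flat P x = 0"
  and flat_1'_pos: "x > 0 \<Longrightarrow> flat [:0, 0, 1:] x > 0" and flat_1'_nonneg: "flat [:0, 0, 1:] x \<ge> 0"
  by (auto simp: flat_def)

lemma DERIV_flat_1: "(flat 1 has_real_derivative flat [:0, 0, 1:] x) (at x)"
  using DERIV_flat[of 1 x] by simp

section \<open>Uniqueness of the entropy solution\<close>

lemma has_derivative_line:
  fixes f :: "'a::real_normed_vector \<Rightarrow> real"
  assumes "(f has_derivative D) (at (p s))" "(p has_vector_derivative v) (at s)"
  shows "((\<lambda>s. f (p s)) has_real_derivative D v) (at s)"
  using vector_derivative_diff_chain_within[OF assms(2) has_derivative_at_withinI[OF assms(1)]]
  by (simp add: has_real_derivative_iff_has_vector_derivative o_def)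

lemma frechet_derivative_fst:
  fixes \<phi> :: "real \<times> real \<Rightarrow> real"
  assumes "\<phi> differentiable (at (x, t))" "((\<lambda>x. \<phi> (x, t)) has_real_derivative d) (at x)"
  shows "frechet_derivative \<phi> (at (x, t)) (1, 0) = d"
proof -
  have "((\<lambda>s. (s, t)) has_vector_derivative (1, 0)) (at x)"
    by (auto intro!: derivative_eq_intros simp: has_vector_derivative_def)
  from has_derivative_line[where p="\<lambda>s. (s, t)", OF _ this] assms(1)[unfolded frechet_derivative_works]
  have "((\<lambda>x. \<phi> (x, t)) has_real_derivative frechet_derivative \<phi> (at (x, t)) (1, 0)) (at x)" by blast
  then show ?thesis using assms(2) DERIV_unique by blast
qed

lemma frechet_derivative_snd:
  fixes \<phi> :: "real \<times> real \<Rightarrow> real"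
  assumes "\<phi> differentiable (at (x, t))" "((\<lambda>t. \<phi> (x, t)) has_real_derivative d) (at t)"
  shows "frechet_derivative \<phi> (at (x, t)) (0, 1) = d"
proof -
  have "((\<lambda>s. (x, s)) has_vector_derivative (0, 1)) (at t)"
    by (auto intro!: derivative_eq_intros simp: has_vector_derivative_def)
  from has_derivative_line[where p="\<lambda>s. (x, s)", OF _ this] assms(1)[unfolded frechet_derivative_works]
  have "((\<lambda>t. \<phi> (x, t)) has_real_derivative frechet_derivative \<phi> (at (x, t)) (0, 1)) (at t)" by blast
  then show ?thesis using assms(2) DERIV_unique by blast
qed

text \<open>
  The derivatives of entropies and fluxes are one-sided at the ends of the interval of states; this version of
  the monotonicity criterion accepts them.
\<close>

lemma mono_within:
  fixes f :: "real \<Rightarrow> real"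
  assumes "a \<le> b" "{a..b} \<subseteq> J" "\<And>x. x \<in> J \<Longrightarrow> (f has_real_derivative f' x) (at x within J)"
    "\<And>x. x \<in> {a..b} \<Longrightarrow> 0 \<le> f' x"
  shows "f a \<le> f b"
proof (cases "a = b")
  case False
  have d: "(f has_real_derivative f' x) (at x within {a..b})" if "x \<in> {a..b}" for x
    using assms(2,3) that by (meson has_field_derivative_subset subsetD)
  show ?thesis
  proof (rule DERIV_nonneg_imp_increasing_open[of a b f])
    show "a \<le> b" by fact
    show "\<exists>y. (f has_real_derivative y) (at x) \<and> 0 \<le> y" if "a < x" "x < b" for x
      using d[of x] assms(4)[of x] that by (auto simp: at_within_Icc_at)
    show "continuous_on {a..b} f" using d by (meson DERIV_continuous continuous_on_eq_continuous_within)
  qed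
qed simp

lemma DERIV_pos_part_sq: "((\<lambda>x::real. (max 0 x)\<^sup>2) has_real_derivative 2 * max 0 x) (at x)"
proof -
  consider "x < 0" | "x = 0" | "x > 0" by linarith
  then show ?thesis
  proof cases
    case 1
    have ev: "\<forall>\<^sub>F y in nhds x. (max 0 y)\<^sup>2 = 0"
      using eventually_nhds_in_open[of "{..<0}" x] 1 by (auto elim!: eventually_mono)
    show ?thesis by (subst DERIV_cong_ev[OF refl ev refl]) (use 1 in simp)
  next
    case 2
    have "((\<lambda>h::real. (max 0 h)\<^sup>2 / h) \<longlongrightarrow> 0) (at 0)"
    proof (rule Lim_null_comparison[where g="\<lambda>h. \<bar>h\<bar>"])
      have "norm ((max 0 h)\<^sup>2 / h) \<le> \<bar>h\<bar>" for h :: real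
        by (cases "h > 0") (auto simp: max_def power2_eq_square)
      then show "\<forall>\<^sub>F h in at 0. norm ((max 0 h)\<^sup>2 / h) \<le> \<bar>h::real\<bar>" by simp
      show "((\<lambda>h::real. \<bar>h\<bar>) \<longlongrightarrow> 0) (at 0)" using tendsto_rabs[OF tendsto_ident_at[of "0::real" UNIV]] by simp
    qed
    then show ?thesis unfolding 2 by (simp add: DERIV_def)
  next
    case 3
    have ev: "\<forall>\<^sub>F y in nhds x. (max 0 y)\<^sup>2 = y\<^sup>2"
      using eventually_nhds_in_open[of "{0<..}" x] 3 by (auto elim!: eventually_mono)
    show ?thesis by (subst DERIV_cong_ev[OF refl ev refl]) (use 3 in \<open>auto intro!: derivative_eq_intros\<close>)
  qed
qed

context fan
begin

lemma DERIV_m_flux: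
  assumes "r \<in> {\<rho>m..\<rho>p}"
  shows "(m_flux \<rho>m \<rho>p g lam t has_real_derivative g * t * speed r) (at r within {\<rho>m..\<rho>p})"
proof -
  have nz: "\<rho>m + \<rho>p - r \<noteq> 0" using gap_pos[of r] assms by auto
  have "((\<lambda>r. g * t * (r - lam * af r)) has_real_derivative g * t * speed r) (at r within {\<rho>m..\<rho>p})"
    unfolding af_def speed_def daf_def using nz
    by (auto intro!: derivative_eq_intros simp: power2_eq_square)
  then show ?thesis
    by (rule has_field_derivative_transform_within[of _ _ _ _ 1]) (use assms in \<open>auto simp: m_flux_def a_fun_af\<close>)
qed

lemma continuous_on_speed: "continuous_on {\<rho>m..\<rho>p} speed"
  unfolding speed_def daf_def by (intro continuous_intros) (use gap_pos in force)

text \<open>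
  No entropy crosses the front \<open>x = c \<tau>\<close>. Here \<open>s = 1\<close> means the region on the right of the front and \<open>s = -1\<close>
  the region on its left. In that region the entropy vanishes initially. Its flux through the front is
  outgoing by \<open>flux_c\<close>. The region is made bounded by a second front of speed \<open>M\<close>, at distance \<open>Rb\<close>
  initially, through which entropy can only leave as well (\<open>flux_M\<close>), and by the time \<open>T1\<close>. The product of three
  smooth cutoffs, one for each part of the boundary, is a test function for which each of the three terms in
  the entropy inequality has the wrong sign. So all of them vanish.
\<close>

lemma entropy_front:
  fixes v :: "real \<times> real \<Rightarrow> real"
  assumes v: "entropy_solution (m_flux \<rho>m \<rho>p g lam) {\<rho>m..\<rho>p} T (rho0 \<rho>m \<rho>p) v"
    and pair: "entropy_pair (m_flux \<rho>m \<rho>p g lam) {\<rho>m..\<rho>p} T \<eta> (\<lambda>t r. g * t * Q r)"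
    and cont: "continuous_on UNIV \<eta>" "continuous_on UNIV Q"
    and nonneg: "\<And>r. r \<in> {\<rho>m..\<rho>p} \<Longrightarrow> 0 \<le> \<eta> r"
    and s: "s = 1 \<or> s = -1"
    and flux_c: "\<And>r. r \<in> {\<rho>m..\<rho>p} \<Longrightarrow> s * (Q r - c * \<eta> r) \<le> 0"
    and flux_M: "\<And>r. r \<in> {\<rho>m..\<rho>p} \<Longrightarrow> 0 \<le> s * (Q r - M * \<eta> r)"
    and init: "\<And>x. 0 < s * x \<Longrightarrow> \<eta> (rho0 \<rho>m \<rho>p x) = 0"
    and T1: "0 < T1" "T1 < T" and Rb: "0 < Rb"
  shows "AE p in lebesgue_on (UNIV \<times> {0<..<T}). 0 < s * (fst p - c * fall g (snd p)) \<longrightarrow>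
     s * (fst p - M * fall g (snd p)) < Rb \<longrightarrow> snd p < T1 \<longrightarrow> \<eta> (v p) = 0"
proof -
  let ?S = "UNIV \<times> {0<..<T} :: (real \<times> real) set"
  have mS: "?S \<in> sets lebesgue" by (simp add: borel_open open_Times)
  (* Each of the three functions is positive on one side of a part of the boundary of the region. *)
  define h1 where "h1 = (\<lambda>p. s * (fst p - c * fall g (snd p)))"
  define h2 where "h2 = (\<lambda>p. Rb - s * (fst p - M * fall g (snd p)))"
  define h3 where "h3 = (\<lambda>p :: real \<times> real. T1 - snd p)"
  define \<phi> where "\<phi> = (\<lambda>p. flat 1 (h1 p) * flat 1 (h2 p) * flat 1 (h3 p))"
  have fst_Ck: "Ck k (fst :: real \<times> real \<Rightarrow> real)" and snd_Ck: "Ck k (snd :: real \<times> real \<Rightarrow> real)" for k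
    by (intro Ck_linear bounded_linear_fst bounded_linear_snd)+
  have tau: "Ck k (\<lambda>p :: real \<times> real. 1/2 * g * (snd p * snd p))" for k
    by (intro Ck_mult Ck_const snd_Ck)
  have lin: "Ck k (\<lambda>p :: real \<times> real. a + b * fst p + d * (1/2 * g * (snd p * snd p)) + e * snd p)" for k a b d e
    by (intro Ck_add Ck_mult[of k "\<lambda>_. b"] Ck_mult[of k "\<lambda>_. d"] Ck_mult[of k "\<lambda>_. e"] Ck_const fst_Ck snd_Ck tau)
  have h: "Ck k h1" "Ck k h2" "Ck k h3" for k
  proof -
    have e1: "h1 = (\<lambda>p. 0 + s * fst p + (- s * c) * (1/2 * g * (snd p * snd p)) + 0 * snd p)"
      by (auto simp: h1_def fall_def algebra_simps power2_eq_square)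
    show "Ck k h1" by (subst e1) (rule lin)
    have e2: "h2 = (\<lambda>p. Rb + (- s) * fst p + (s * M) * (1/2 * g * (snd p * snd p)) + 0 * snd p)"
      by (auto simp: h2_def fall_def algebra_simps power2_eq_square)
    show "Ck k h2" by (subst e2) (rule lin)
    have e3: "h3 = (\<lambda>p. T1 + 0 * fst p + 0 * (1/2 * g * (snd p * snd p)) + (-1) * snd p)"
      by (auto simp: h3_def)
    show "Ck k h3" by (subst e3) (rule lin)
  qed
  have "Ck k \<phi>" for k unfolding \<phi>_def by (intro Ck_mult Ck_flat_comp h)
  then have smooth: "smooth \<phi>" by (simp add: smooth_def)
  have diff: "\<phi> differentiable (at p)" for p
    using Ck_differentiable[of 0 \<phi>] \<open>\<And>k. Ck k \<phi>\<close> unfolding differentiable_def by blast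
  define \<phi>x where "\<phi>x = (\<lambda>p. s * flat [:0,0,1:] (h1 p) * flat 1 (h2 p) * flat 1 (h3 p)
      - s * flat 1 (h1 p) * flat [:0,0,1:] (h2 p) * flat 1 (h3 p))"
  define \<phi>t where "\<phi>t = (\<lambda>p. - s * c * g * snd p * flat [:0,0,1:] (h1 p) * flat 1 (h2 p) * flat 1 (h3 p)
      + s * M * g * snd p * flat 1 (h1 p) * flat [:0,0,1:] (h2 p) * flat 1 (h3 p)
      - flat 1 (h1 p) * flat 1 (h2 p) * flat [:0,0,1:] (h3 p))"
  note chain = DERIV_chain2[where f="flat 1", OF DERIV_flat_1]
  have fx: "frechet_derivative \<phi> (at (x, t)) (1, 0) = \<phi>x (x, t)" for x t
  proof (rule frechet_derivative_fst[OF diff])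
    show "((\<lambda>x. \<phi> (x, t)) has_real_derivative \<phi>x (x, t)) (at x)"
      unfolding \<phi>_def \<phi>x_def h1_def h2_def h3_def
      by (auto intro!: derivative_eq_intros chain simp: algebra_simps)
  qed
  have ft: "frechet_derivative \<phi> (at (x, t)) (0, 1) = \<phi>t (x, t)" for x t
  proof (rule frechet_derivative_snd[OF diff])
    show "((\<lambda>t. \<phi> (x, t)) has_real_derivative \<phi>t (x, t)) (at t)"
      unfolding \<phi>_def \<phi>t_def h1_def h2_def h3_def fall_def
      by (auto intro!: derivative_eq_intros chain simp: algebra_simps)
  qed
  define Bd where "Bd = Rb + (\<bar>c\<bar> + \<bar>M\<bar>) * fall g T1"
  define K where "K = {-Bd..Bd} \<times> {0..T1}"
  have cK: "compact K" unfolding K_def by (intro compact_Times compact_Icc)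
  have outside: "h1 p \<le> 0 \<or> h2 p \<le> 0 \<or> h3 p \<le> 0" if "snd p \<ge> 0" "p \<notin> K" for p
  proof (rule ccontr)
    assume n: "\<not> (h1 p \<le> 0 \<or> h2 p \<le> 0 \<or> h3 p \<le> 0)"
    then have t: "snd p < T1" by (simp add: h3_def)
    have f: "0 \<le> fall g (snd p)" "fall g (snd p) \<le> fall g T1"
      using that(1) t g_pos by (auto simp: fall_def intro!: power_mono)
    have "\<bar>c * fall g (snd p)\<bar> \<le> \<bar>c\<bar> * fall g T1" "\<bar>M * fall g (snd p)\<bar> \<le> \<bar>M\<bar> * fall g T1"
      using f by (auto simp: abs_mult intro!: mult_left_mono)
    moreover have "0 \<le> \<bar>c\<bar> * fall g T1" "0 \<le> \<bar>M\<bar> * fall g T1" using f by auto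
    ultimately have "\<bar>fst p\<bar> \<le> Bd"
      using n s Rb unfolding h1_def h2_def Bd_def distrib_right by auto
    then show False using that t by (cases p) (auto simp: K_def)
  qed
  have zero: "\<phi> p = 0" "\<phi>x p = 0" "\<phi>t p = 0" if "snd p \<ge> 0" "p \<notin> K" for p
    using outside[OF that] by (auto simp: \<phi>_def \<phi>x_def \<phi>t_def flat_eq_0)
  define G where "G = (\<lambda>p. \<eta> (v p) * \<phi>t p + g * snd p * Q (v p) * \<phi>x p)"
  have vm: "v \<in> borel_measurable (lebesgue_on ?S)" and vJ: "AE p in lebesgue_on ?S. v p \<in> {\<rho>m..\<rho>p}"
    using v by (auto simp: entropy_solution_def)
  have entropy: "0 \<le> (LINT p:?S|lebesgue. \<eta> (v p) * frechet_derivative \<phi> (at p) (0, 1) +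
            g * snd p * Q (v p) * frechet_derivative \<phi> (at p) (1, 0)) +
        (LINT x|lebesgue. \<eta> (rho0 \<rho>m \<rho>p x) * \<phi> (x, 0))"
  proof -
    have "K \<subseteq> UNIV \<times> {0..<T}" using T1 by (auto simp: K_def)
    moreover have "\<forall>p \<in> UNIV \<times> {0..<T} - K. \<phi> p = 0" using zero by auto
    moreover have "\<forall>p \<in> UNIV \<times> {0..<T}. \<phi> p \<ge> 0" by (auto simp: \<phi>_def flat_1_nonneg)
    ultimately show ?thesis using v pair smooth cK unfolding entropy_solution_def by blast
  qed
  have init0: "\<eta> (rho0 \<rho>m \<rho>p x) * \<phi> (x, 0) = 0" for x
    using init[of x] by (cases "0 < s * x") (auto simp: \<phi>_def h1_def fall_def flat_eq_0)
  have "(\<lambda>p. \<eta> (v p) * frechet_derivative \<phi> (at p) (0, 1) +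
            g * snd p * Q (v p) * frechet_derivative \<phi> (at p) (1, 0)) = G"
    by (auto simp: G_def fx ft)
  then have G0: "0 \<le> (LINT p|lebesgue_on ?S. G p)"
    using entropy init0 mS by (simp add: integral_restrict_space set_lebesgue_integral_def)
  (* The contributions of the two fronts and of the final time. None of them is positive. *)
  have G_eq: "G p = g * snd p * flat [:0,0,1:] (h1 p) * flat 1 (h2 p) * flat 1 (h3 p) * (s * (Q (v p) - c * \<eta> (v p)))
      - g * snd p * flat 1 (h1 p) * flat [:0,0,1:] (h2 p) * flat 1 (h3 p) * (s * (Q (v p) - M * \<eta> (v p)))
      - \<eta> (v p) * (flat 1 (h1 p) * flat 1 (h2 p) * flat [:0,0,1:] (h3 p))" for p
    unfolding G_def \<phi>x_def \<phi>t_def by (simp add: algebra_simps)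
  have G_le: "G p \<le> - (\<eta> (v p) * (flat 1 (h1 p) * flat 1 (h2 p) * flat [:0,0,1:] (h3 p)))"
    if "p \<in> ?S" "v p \<in> {\<rho>m..\<rho>p}" for p
  proof -
    have "0 \<le> g * snd p" using that g_pos by auto
    then have "g * snd p * flat [:0,0,1:] (h1 p) * flat 1 (h2 p) * flat 1 (h3 p) * (s * (Q (v p) - c * \<eta> (v p))) \<le> 0"
      "0 \<le> g * snd p * flat 1 (h1 p) * flat [:0,0,1:] (h2 p) * flat 1 (h3 p) * (s * (Q (v p) - M * \<eta> (v p)))"
      using flux_c[OF that(2)] flux_M[OF that(2)]
      by (auto intro!: mult_nonneg_nonpos mult_nonneg_nonneg flat_1_nonneg flat_1'_nonneg simp del: mult_le_0_iff)
    then show ?thesis unfolding G_eq by linarith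
  qed
  have cflat: "continuous_on UNIV (flat P)" for P
    by (meson DERIV_flat DERIV_isCont continuous_at_imp_continuous_on)
  have ch: "continuous_on UNIV h1" "continuous_on UNIV h2" "continuous_on UNIV h3"
    using h[of 0] by auto
  have cfh: "continuous_on UNIV (\<lambda>p. flat P (h p))" if "continuous_on UNIV h" for P and h :: "real \<times> real \<Rightarrow> real"
    using continuous_on_compose2[OF cflat that] by simp
  have c\<phi>: "continuous_on UNIV \<phi>x" "continuous_on UNIV \<phi>t"
    unfolding \<phi>x_def \<phi>t_def by (intro continuous_intros cfh ch)+
  have meas_of: "f \<in> borel_measurable (lebesgue_on ?S)" if "continuous_on UNIV f" for f :: "real \<times> real \<Rightarrow> real"
    using continuous_imp_measurable_on_sets_lebesgue[OF continuous_on_subset[OF that subset_UNIV] mS] .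
  have Gm: "G \<in> borel_measurable (lebesgue_on ?S)"
  proof -
    have [measurable]: "(\<lambda>p. \<eta> (v p)) \<in> borel_measurable (lebesgue_on ?S)" "(\<lambda>p. Q (v p)) \<in> borel_measurable (lebesgue_on ?S)"
      using cont vm by (auto intro: borel_measurable_continuous_on)
    have [measurable]: "\<phi>x \<in> borel_measurable (lebesgue_on ?S)" "\<phi>t \<in> borel_measurable (lebesgue_on ?S)"
      "(\<lambda>p. snd p) \<in> borel_measurable (lebesgue_on ?S)"
      by (intro meas_of c\<phi> continuous_intros)+
    show ?thesis unfolding G_def by (intro borel_measurable_add borel_measurable_times borel_measurable_const; fact)
  qed
  have Gi: "integrable (lebesgue_on ?S) G"
  proof -
    have cc: "compact ({\<rho>m..\<rho>p} \<times> K)" using cK by (intro compact_Times) auto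
    have cn: "continuous_on ({\<rho>m..\<rho>p} \<times> K) (\<lambda>(r, p). \<eta> r * \<phi>t p + g * snd p * Q r * \<phi>x p)"
    proof -
      have 1: "continuous_on A (\<lambda>q. F (fst q))" if "continuous_on UNIV F" for A and F :: "real \<Rightarrow> real"
        by (rule continuous_on_compose2[OF that continuous_on_fst[OF continuous_on_id]]) simp
      have 2: "continuous_on A (\<lambda>q. F (snd q))" if "continuous_on UNIV F" for A and F :: "real \<times> real \<Rightarrow> real"
        by (rule continuous_on_compose2[OF that continuous_on_snd[OF continuous_on_id]]) simp
      show ?thesis unfolding case_prod_unfold
        by (intro continuous_on_add continuous_on_mult continuous_on_const continuous_on_snd continuous_on_id 1 2 cont c\<phi>)
    qed
    obtain C where C: "\<And>q. q \<in> {\<rho>m..\<rho>p} \<times> K \<Longrightarrow> \<bar>(\<lambda>(r, p). \<eta> r * \<phi>t p + g * snd p * Q r * \<phi>x p) q\<bar> \<le> C"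
      using continuous_compact_bound[OF cn cc] by blast
    show ?thesis
    proof (rule integrableI_bounded_set[where A="K \<inter> ?S" and B=C])
      have "K \<in> sets lebesgue" using cK by (simp add: borel_compact)
      then show "K \<inter> ?S \<in> sets (lebesgue_on ?S)" using mS by (simp add: sets_restrict_space_iff)
      have "emeasure (lebesgue_on ?S) (K \<inter> ?S) \<le> emeasure lborel K"
        using mS \<open>K \<in> sets lebesgue\<close> cK
        by (subst emeasure_restrict_space) (auto intro!: emeasure_mono order_trans[OF emeasure_mono[of "K \<inter> ?S" K lebesgue]] simp: borel_compact)
      also have "\<dots> < \<infinity>" using emeasure_compact_finite[OF cK] .
      finally show "emeasure (lebesgue_on ?S) (K \<inter> ?S) < \<infinity>" .
      show "AE p in lebesgue_on ?S. p \<in> K \<inter> ?S \<longrightarrow> norm (G p) \<le> C"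
        using vJ by eventually_elim (use C in \<open>force simp: G_def\<close>)
      show "AE p in lebesgue_on ?S. p \<notin> K \<inter> ?S \<longrightarrow> G p = 0"
        using AE_space by eventually_elim (auto simp: G_def zero space_restrict_space)
    qed (rule Gm)
  qed
  have Gneg: "AE p in lebesgue_on ?S. 0 \<le> - G p"
    using vJ AE_space
  proof eventually_elim
    case (elim p)
    then have "0 \<le> \<eta> (v p) * (flat 1 (h1 p) * flat 1 (h2 p) * flat [:0,0,1:] (h3 p))"
      using nonneg by (intro mult_nonneg_nonneg flat_1_nonneg flat_1'_nonneg) auto
    then show ?case using G_le[of p] elim by (auto simp: space_restrict_space)
  qed
  have "(LINT p|lebesgue_on ?S. - G p) = 0"
    using G0 integral_nonneg_AE[OF Gneg] by simp
  then have "AE p in lebesgue_on ?S. - G p = 0"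
    using integral_nonneg_eq_0_iff_AE[OF _ Gneg] Gi by simp
  then show ?thesis using vJ AE_space
  proof eventually_elim
    case (elim p)
    show ?case
    proof (intro impI)
      assume a: "0 < s * (fst p - c * fall g (snd p))" "s * (fst p - M * fall g (snd p)) < Rb" "snd p < T1"
      have pS: "p \<in> ?S" using elim by (simp add: space_restrict_space)
      have pos: "0 < flat 1 (h1 p) * flat 1 (h2 p) * flat [:0,0,1:] (h3 p)"
        using a by (intro mult_pos_pos flat_1_pos flat_1'_pos) (auto simp: h1_def h2_def h3_def)
      have "\<eta> (v p) * (flat 1 (h1 p) * flat 1 (h2 p) * flat [:0,0,1:] (h3 p)) \<le> 0"
        using G_le[OF pS] elim by auto
      then have "\<eta> (v p) \<le> 0" using mult_pos_pos[OF _ pos, of "\<eta> (v p)"] by linarith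
      then show "\<eta> (v p) = 0" using nonneg elim by force
    qed
  qed
qed

end

text \<open>
  Two functions that agree at \<open>k\<close> are compared by the sign of the derivative of their difference on the two
  sides of \<open>k\<close>.
\<close>

lemma nonneg_from_derivative_sign:
  fixes f :: "real \<Rightarrow> real"
  assumes d: "\<And>r. r \<in> {a..b} \<Longrightarrow> (f has_real_derivative f' r) (at r within {a..b})"
    and k: "k \<in> {a..b}" "f k = 0" and r: "r \<in> {a..b}"
    and sgn: "\<And>r. r \<in> {a..b} \<Longrightarrow> k \<le> r \<Longrightarrow> 0 \<le> f' r" "\<And>r. r \<in> {a..b} \<Longrightarrow> r \<le> k \<Longrightarrow> f' r \<le> 0"
  shows "0 \<le> f r"
proof (cases "k \<le> r")
  case True
  have "f k \<le> f r" by (rule mono_within[where f'=f' and J="{a..b}"]) (use True d k r sgn in auto)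
  then show ?thesis using k by simp
next
  case False
  have "- f r \<le> - f k"
    by (rule mono_within[where f'="\<lambda>x. - f' x" and J="{a..b}"]) (use False d k r sgn in \<open>auto intro!: DERIV_minus\<close>)
  then show ?thesis using k by simp
qed

context fan
begin

lemma entropy_flux_exists:
  assumes \<eta>': "continuous_on {\<rho>m..\<rho>p} \<eta>'" and k: "k \<in> {\<rho>m..\<rho>p}"
  obtains Q where "continuous_on UNIV Q" "Q k = 0"
    "\<And>r. r \<in> {\<rho>m..\<rho>p} \<Longrightarrow> (Q has_real_derivative \<eta>' r * speed r) (at r within {\<rho>m..\<rho>p})"
proof -
  define Q0 where "Q0 r = integral {\<rho>m..r} (\<lambda>s. \<eta>' s * speed s) - integral {\<rho>m..k} (\<lambda>s. \<eta>' s * speed s)" for r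
  define Q where "Q r = Q0 (max \<rho>m (min \<rho>p r))" for r
  have d0: "(Q0 has_real_derivative \<eta>' r * speed r) (at r within {\<rho>m..\<rho>p})" if "r \<in> {\<rho>m..\<rho>p}" for r
    unfolding Q0_def
    using integral_has_real_derivative[OF continuous_on_mult[OF \<eta>' continuous_on_speed] that]
    by (auto intro!: derivative_eq_intros)
  have "(Q has_real_derivative \<eta>' r * speed r) (at r within {\<rho>m..\<rho>p})" if "r \<in> {\<rho>m..\<rho>p}" for r
    by (rule has_field_derivative_transform_within[OF d0[OF that], of 1]) (use that in \<open>auto simp: Q_def\<close>)
  moreover have "continuous_on UNIV Q"
  proof -
    have "continuous_on {\<rho>m..\<rho>p} Q0"
      using d0 by (meson DERIV_continuous continuous_on_eq_continuous_within)
    then show ?thesis unfolding Q_def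
      by (rule continuous_on_compose2) (use rho_less in \<open>auto intro!: continuous_intros\<close>)
  qed
  moreover have "Q k = 0" using k by (simp add: Q_def Q0_def)
  ultimately show ?thesis using that by blast
qed

lemma entropy_pairI:
  assumes "convex_on {\<rho>m..\<rho>p} \<eta>" "continuous_on {\<rho>m..\<rho>p} \<eta>'" "continuous_on UNIV Q"
    "\<And>r. r \<in> {\<rho>m..\<rho>p} \<Longrightarrow> (\<eta> has_real_derivative \<eta>' r) (at r within {\<rho>m..\<rho>p})"
    "\<And>r. r \<in> {\<rho>m..\<rho>p} \<Longrightarrow> (Q has_real_derivative \<eta>' r * speed r) (at r within {\<rho>m..\<rho>p})"
  shows "entropy_pair (m_flux \<rho>m \<rho>p g lam) {\<rho>m..\<rho>p} T \<eta> (\<lambda>t r. g * t * Q r)"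
  unfolding entropy_pair_def
proof (intro conjI exI[of _ \<eta>'] ballI)
  have "continuous_on ({0..T} \<times> {\<rho>m..\<rho>p}) (\<lambda>p. Q (snd p))"
    by (rule continuous_on_compose2[OF assms(3) continuous_on_snd[OF continuous_on_id]]) simp
  then show "continuous_on ({0..T} \<times> {\<rho>m..\<rho>p}) (\<lambda>(t, r). g * t * Q r)"
    unfolding case_prod_unfold by (intro continuous_intros)
  fix t r assume r: "r \<in> {\<rho>m..\<rho>p}"
  show "\<exists>F'. (m_flux \<rho>m \<rho>p g lam t has_real_derivative F') (at r within {\<rho>m..\<rho>p}) \<and>
           ((\<lambda>r. g * t * Q r) has_real_derivative \<eta>' r * F') (at r within {\<rho>m..\<rho>p})"
  proof (intro exI conjI)
    show "(m_flux \<rho>m \<rho>p g lam t has_real_derivative g * t * speed r) (at r within {\<rho>m..\<rho>p})"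
      by (rule DERIV_m_flux[OF r])
    show "((\<lambda>r. g * t * Q r) has_real_derivative \<eta>' r * (g * t * speed r)) (at r within {\<rho>m..\<rho>p})"
      using DERIV_cmult[OF assms(5)[OF r], of "g * t"] by (simp add: algebra_simps)
  qed
qed (use assms in auto)

text \<open>
  On states \<open>r \<le> k\<close> the characteristic speed lies between \<open>0\<close> and \<open>speed k\<close>, and the entropy \<open>((k - r)\<^sup>+)\<^sup>2\<close> lives
  only there. Integrating its derivative against the speed gives \<open>0 \<le> Q \<le> speed k * \<eta>\<close>, that is, the hypotheses
  of \<open>entropy_front\<close> with outer speed \<open>0\<close>.
\<close>

lemma entropy_solution_ge:
  assumes v: "entropy_solution (m_flux \<rho>m \<rho>p g lam) {\<rho>m..\<rho>p} T (rho0 \<rho>m \<rho>p) v"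
    and k: "k \<in> {\<rho>m<..<\<rho>p}" and T1: "0 < T1" "T1 < T" and Rb: "0 < Rb"
  shows "AE p in lebesgue_on (UNIV \<times> {0<..<T}). speed k * fall g (snd p) < fst p \<longrightarrow> fst p < Rb \<longrightarrow>
    snd p < T1 \<longrightarrow> k \<le> v p"
proof -
  define \<eta> where "\<eta> r = (max 0 (k - r))\<^sup>2" for r
  define \<eta>' where "\<eta>' r = - 2 * max 0 (k - r)" for r
  have c': "continuous_on {\<rho>m..\<rho>p} \<eta>'" unfolding \<eta>'_def by (intro continuous_intros)
  have kJ: "k \<in> {\<rho>m..\<rho>p}" using k by auto
  obtain Q where Q: "continuous_on UNIV Q" "Q k = 0"
    "\<And>r. r \<in> {\<rho>m..\<rho>p} \<Longrightarrow> (Q has_real_derivative \<eta>' r * speed r) (at r within {\<rho>m..\<rho>p})"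
    using entropy_flux_exists[OF c' kJ] by blast
  have d: "(\<eta> has_real_derivative \<eta>' r) (at r within S)" for r S
  proof -
    have "((\<lambda>r. (max 0 (k - r))\<^sup>2) has_real_derivative 2 * max 0 (k - r) * (-1)) (at r within S)"
      by (rule DERIV_chain2[where f="\<lambda>x. (max 0 x)\<^sup>2", OF DERIV_pos_part_sq]) (auto intro!: derivative_eq_intros)
    then show ?thesis by (simp add: \<eta>_def[abs_def] \<eta>'_def)
  qed
  have conv: "convex_on {\<rho>m..\<rho>p} \<eta>"
  proof (rule convex_on_realI[where f'=\<eta>'])
    show "\<eta>' x \<le> \<eta>' y" if "x \<le> y" for x y using that by (auto simp: \<eta>'_def)
  qed (use d in auto)
  have flux: "1 * (Q r - speed k * \<eta> r) \<le> 0" "0 \<le> 1 * (Q r - 0 * \<eta> r)" if r: "r \<in> {\<rho>m..\<rho>p}" for r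
  proof -
    have "0 \<le> speed k * \<eta> r - Q r"
    proof (rule nonneg_from_derivative_sign[where f'="\<lambda>r. speed k * \<eta>' r - \<eta>' r * speed r", OF _ kJ _ r])
      show "((\<lambda>r. speed k * \<eta> r - Q r) has_real_derivative speed k * \<eta>' r - \<eta>' r * speed r) (at r within {\<rho>m..\<rho>p})"
        if "r \<in> {\<rho>m..\<rho>p}" for r by (intro DERIV_diff DERIV_cmult d Q that)
      show "speed k * \<eta>' r - \<eta>' r * speed r \<le> 0" if "r \<in> {\<rho>m..\<rho>p}" "r \<le> k" for r
      proof -
        have "- \<eta>' r * speed r \<le> - \<eta>' r * speed k"
          by (rule mult_left_mono) (use speed_le[of r k] k that in \<open>auto simp: \<eta>'_def\<close>)
        then show ?thesis by (simp add: mult.commute)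
      qed
    qed (auto simp: \<eta>_def \<eta>'_def Q)
    then show "1 * (Q r - speed k * \<eta> r) \<le> 0" by simp
    have "0 \<le> Q r"
    proof (rule nonneg_from_derivative_sign[OF Q(3) kJ Q(2) r])
      show "\<eta>' r * speed r \<le> 0" if "r \<in> {\<rho>m..\<rho>p}" for r
        using speed_pos[of r] that by (auto simp: \<eta>'_def mult_nonneg_nonneg)
    qed (auto simp: \<eta>'_def)
    then show "0 \<le> 1 * (Q r - 0 * \<eta> r)" by simp
  qed
  have "AE p in lebesgue_on (UNIV \<times> {0<..<T}). 0 < 1 * (fst p - speed k * fall g (snd p)) \<longrightarrow>
     1 * (fst p - 0 * fall g (snd p)) < Rb \<longrightarrow> snd p < T1 \<longrightarrow> \<eta> (v p) = 0"
  proof (rule entropy_front[OF v entropy_pairI[OF conv c' Q(1) d Q(3)] _ Q(1) _ _ flux _ T1 Rb])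
    show "continuous_on UNIV \<eta>" unfolding \<eta>_def by (intro continuous_intros)
    show "\<eta> (rho0 \<rho>m \<rho>p x) = 0" if "0 < 1 * x" for x using that k by (simp add: rho0_def \<eta>_def)
  qed (auto simp: \<eta>_def)
  then show ?thesis by eventually_elim (auto simp: \<eta>_def max_def split: if_splits)
qed

text \<open>
  The counterpart for the entropy \<open>((r - k)\<^sup>+)\<^sup>2\<close> and the left side of the ray. Now \<open>speed k * \<eta> \<le> Q \<le> speed \<rho>p * \<eta>\<close>,
  so the outer front has to move with the maximal speed.
\<close>

lemma entropy_solution_le:
  assumes v: "entropy_solution (m_flux \<rho>m \<rho>p g lam) {\<rho>m..\<rho>p} T (rho0 \<rho>m \<rho>p) v"
    and k: "k \<in> {\<rho>m<..<\<rho>p}" and T1: "0 < T1" "T1 < T" and Rb: "0 < Rb"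
  shows "AE p in lebesgue_on (UNIV \<times> {0<..<T}). fst p < speed k * fall g (snd p) \<longrightarrow>
    speed \<rho>p * fall g (snd p) - Rb < fst p \<longrightarrow> snd p < T1 \<longrightarrow> v p \<le> k"
proof -
  define \<eta> where "\<eta> r = (max 0 (r - k))\<^sup>2" for r
  define \<eta>' where "\<eta>' r = 2 * max 0 (r - k)" for r
  have c': "continuous_on {\<rho>m..\<rho>p} \<eta>'" unfolding \<eta>'_def by (intro continuous_intros)
  have kJ: "k \<in> {\<rho>m..\<rho>p}" using k by auto
  obtain Q where Q: "continuous_on UNIV Q" "Q k = 0"
    "\<And>r. r \<in> {\<rho>m..\<rho>p} \<Longrightarrow> (Q has_real_derivative \<eta>' r * speed r) (at r within {\<rho>m..\<rho>p})"
    using entropy_flux_exists[OF c' kJ] by blast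
  have d: "(\<eta> has_real_derivative \<eta>' r) (at r within S)" for r S
  proof -
    have "((\<lambda>r. (max 0 (r - k))\<^sup>2) has_real_derivative 2 * max 0 (r - k) * 1) (at r within S)"
      by (rule DERIV_chain2[where f="\<lambda>x. (max 0 x)\<^sup>2", OF DERIV_pos_part_sq]) (auto intro!: derivative_eq_intros)
    then show ?thesis by (simp add: \<eta>_def[abs_def] \<eta>'_def)
  qed
  have conv: "convex_on {\<rho>m..\<rho>p} \<eta>"
  proof (rule convex_on_realI[where f'=\<eta>'])
    show "\<eta>' x \<le> \<eta>' y" if "x \<le> y" for x y using that by (auto simp: \<eta>'_def)
  qed (use d in auto)
  have flux: "-1 * (Q r - speed k * \<eta> r) \<le> 0" "0 \<le> -1 * (Q r - speed \<rho>p * \<eta> r)" if r: "r \<in> {\<rho>m..\<rho>p}" for r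
  proof -
    have "0 \<le> Q r - speed k * \<eta> r"
    proof (rule nonneg_from_derivative_sign[where f'="\<lambda>r. \<eta>' r * speed r - speed k * \<eta>' r", OF _ kJ _ r])
      show "((\<lambda>r. Q r - speed k * \<eta> r) has_real_derivative \<eta>' r * speed r - speed k * \<eta>' r) (at r within {\<rho>m..\<rho>p})"
        if "r \<in> {\<rho>m..\<rho>p}" for r by (intro DERIV_diff DERIV_cmult d Q that)
      show "0 \<le> \<eta>' r * speed r - speed k * \<eta>' r" if "r \<in> {\<rho>m..\<rho>p}" "k \<le> r" for r
        using mult_left_mono[OF speed_le[of k r], of "\<eta>' r"] that by (simp add: \<eta>'_def mult.commute)
    qed (auto simp: \<eta>_def \<eta>'_def Q)
    then show "-1 * (Q r - speed k * \<eta> r) \<le> 0" by simp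
    have "0 \<le> speed \<rho>p * \<eta> r - Q r"
    proof (rule nonneg_from_derivative_sign[where f'="\<lambda>r. speed \<rho>p * \<eta>' r - \<eta>' r * speed r", OF _ kJ _ r])
      show "((\<lambda>r. speed \<rho>p * \<eta> r - Q r) has_real_derivative speed \<rho>p * \<eta>' r - \<eta>' r * speed r) (at r within {\<rho>m..\<rho>p})"
        if "r \<in> {\<rho>m..\<rho>p}" for r by (intro DERIV_diff DERIV_cmult d Q that)
      show "0 \<le> speed \<rho>p * \<eta>' r - \<eta>' r * speed r" if "r \<in> {\<rho>m..\<rho>p}" "k \<le> r" for r
        using mult_left_mono[OF speed_le[of r \<rho>p], of "\<eta>' r"] that by (simp add: \<eta>'_def mult.commute)
    qed (auto simp: \<eta>_def \<eta>'_def Q)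
    then show "0 \<le> -1 * (Q r - speed \<rho>p * \<eta> r)" by simp
  qed
  have "AE p in lebesgue_on (UNIV \<times> {0<..<T}). 0 < -1 * (fst p - speed k * fall g (snd p)) \<longrightarrow>
     -1 * (fst p - speed \<rho>p * fall g (snd p)) < Rb \<longrightarrow> snd p < T1 \<longrightarrow> \<eta> (v p) = 0"
  proof (rule entropy_front[OF v entropy_pairI[OF conv c' Q(1) d Q(3)] _ Q(1) _ _ flux _ T1 Rb])
    show "continuous_on UNIV \<eta>" unfolding \<eta>_def by (intro continuous_intros)
    show "\<eta> (rho0 \<rho>m \<rho>p x) = 0" if "0 < -1 * x" for x using that k by (simp add: rho0_def \<eta>_def)
  qed (auto simp: \<eta>_def)
  then show ?thesis by eventually_elim (auto simp: \<eta>_def max_def split: if_splits)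
qed

text \<open>
  At almost every point the bounds hold simultaneously for all rational levels and for a countable exhaustion
  of the half space by the regions of \<open>entropy_front\<close>. A rational strictly between \<open>v\<close> and the wave would
  violate one of them.
\<close>

theorem entropy_solution_unique:
  assumes v: "entropy_solution (m_flux \<rho>m \<rho>p g lam) {\<rho>m..\<rho>p} T (rho0 \<rho>m \<rho>p) v" and T: "0 < T"
  shows "AE p in lebesgue_on (UNIV \<times> {0<..<T}). v p = mu 0 (fst p) (snd p)"
proof -
  define X where "X = \<rat> \<inter> {\<rho>m<..<\<rho>p}"
  (* Times increasing to T, which exhaust the time interval. *)
  define T1 where "T1 n = T * (1 - 1 / (real n + 2))" for n
  have X: "countable X" unfolding X_def using countable_rat by auto
  have T1: "0 < T1 n" "T1 n < T" for n
  proof -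
    have "0 < 1 - 1 / (real n + 2)" "0 < 1 / (real n + 2)" by simp_all
    then have "0 < T * (1 - 1 / (real n + 2))" "0 < T * (1 / (real n + 2))" using T by (simp_all only: mult_pos_pos)
    then show "0 < T1 n" "T1 n < T" by (simp_all add: T1_def right_diff_distrib)
  qed
  have "AE p in lebesgue_on (UNIV \<times> {0<..<T}). \<forall>k\<in>X. \<forall>n m. (speed k * fall g (snd p) < fst p \<longrightarrow> fst p < real (Suc m) \<longrightarrow> snd p < T1 n \<longrightarrow> k \<le> v p)
      \<and> (fst p < speed k * fall g (snd p) \<longrightarrow> speed \<rho>p * fall g (snd p) - real (Suc m) < fst p \<longrightarrow> snd p < T1 n \<longrightarrow> v p \<le> k)"
    unfolding AE_ball_countable[OF X] AE_all_countable AE_conj_iff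
    by (intro ballI allI conjI entropy_solution_ge[OF v] entropy_solution_le[OF v] T1) (auto simp: X_def)
  moreover have "AE p in lebesgue_on (UNIV \<times> {0<..<T}). v p \<in> {\<rho>m..\<rho>p}"
    using v by (simp add: entropy_solution_def)
  ultimately show ?thesis using AE_space
  proof eventually_elim
    case (elim p)
    then have t: "0 < snd p" "snd p < T" by (auto simp: space_restrict_space)
    obtain n where n: "snd p < T1 n"
    proof -
      have "0 < 1 - snd p / T" using t by simp
      then obtain n where n: "inverse (real (Suc n)) < 1 - snd p / T" using reals_Archimedean by blast
      have "1 / (real n + 2) \<le> inverse (real (Suc n))" by (simp add: field_simps)
      with n have "snd p / T < 1 - 1 / (real n + 2)" by linarith
      then have "snd p < T1 n" using T by (simp add: T1_def pos_divide_less_eq mult.commute)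
      then show ?thesis by (rule that)
    qed
    obtain m where m: "\<bar>fst p\<bar> + speed \<rho>p * fall g (snd p) < real (Suc m)"
      using reals_Archimedean2 by (metis less_trans lessI of_nat_less_iff)
    have sp: "0 \<le> speed \<rho>p * fall g (snd p)" using speed_pos[of \<rho>p] fall_nonneg by simp
    have ge: "k \<le> v p" if "k \<in> X" "speed k * fall g (snd p) < fst p" for k
      using elim(1) that n m sp by (meson abs_ge_self add_increasing2 le_less_trans order_refl)
    have le: "v p \<le> k" if "k \<in> X" "fst p < speed k * fall g (snd p)" for k
    proof -
      have "speed \<rho>p * fall g (snd p) - real (Suc m) < fst p" using m by linarith
      then show ?thesis using elim(1) that n by blast
    qed
    have f: "0 < fall g (snd p)" using fall_pos t by simp
    have "\<not> v p < mu 0 (fst p) (snd p)"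
    proof
      assume "v p < mu 0 (fst p) (snd p)"
      then obtain k where k: "k \<in> \<rat>" "v p < k" "k < mu 0 (fst p) (snd p)" using Rats_dense_in_real by blast
      have kX: "k \<in> X" using k elim(2) mu_le[of 0 "fst p" "snd p"] by (auto simp: X_def)
      then have "\<not> fst p / fall g (snd p) + 0 \<le> speed k"
        using mu_le_if_speed[of "snd p" k "fst p" 0] t k by (auto simp: X_def)
      then have "speed k * fall g (snd p) < fst p" using f by (simp add: field_simps)
      then show False using ge[OF kX] k by linarith
    qed
    moreover have "\<not> mu 0 (fst p) (snd p) < v p"
    proof
      assume "mu 0 (fst p) (snd p) < v p"
      then obtain k where k: "k \<in> \<rat>" "mu 0 (fst p) (snd p) < k" "k < v p" using Rats_dense_in_real by blast
      have kX: "k \<in> X" using k elim(2) mu_ge[of 0 "fst p" "snd p"] by (auto simp: X_def)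
      then have "\<not> speed k \<le> fst p / fall g (snd p) + 0"
        using mu_ge_if_speed[of "snd p" k "fst p" 0] t k by (auto simp: X_def)
      then have "fst p < speed k * fall g (snd p)" using f by (simp add: field_simps)
      then show False using le[OF kX] k by linarith
    qed
    ultimately show ?case by linarith
  qed
qed

section \<open>The rarefaction wave is an entropy solution\<close>

text \<open>
  The conservation law in nonconservative form, in the frame of speed \<open>d\<close>.
\<close>

lemma mu_t_eq: "0 < t \<Longrightarrow> mu_t d x t = - (speed (mu d x t) - d) * g * t * slope d x t"
  using x_slope[of t x d] unfolding mu_t_def fall_def by (simp add: field_simps power2_eq_square)

lemma zero_at_T:
  fixes \<phi> :: "real \<times> real \<Rightarrow> real"
  assumes "0 < T" "continuous_on UNIV \<phi>" "compact K" "K \<subseteq> UNIV \<times> {0..<T}"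
    "\<And>p. p \<in> UNIV \<times> {0..<T} - K \<Longrightarrow> \<phi> p = 0"
  shows "\<phi> (x, T) = 0"
proof -
  have lim: "((\<lambda>t. \<phi> (x, t)) \<longlongrightarrow> \<phi> (x, T)) (at_left T)"
  proof -
    have "isCont (\<lambda>t. \<phi> (x, t)) T"
      by (rule continuous_on_interior[where S=UNIV], rule continuous_on_compose2[OF assms(2)])
         (auto intro!: continuous_intros)
    then show ?thesis by (simp add: isCont_def filterlim_at_split)
  qed
  have "compact (snd ` K)" using assms(3) by (intro compact_continuous_image continuous_intros)
  then have "open (- (snd ` K))" by (simp add: compact_imp_closed open_Compl)
  moreover have "T \<in> - (snd ` K)" using assms(4) by auto
  ultimately have "\<forall>\<^sub>F t in at_left T. t \<in> - (snd ` K)"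
    by (rule topological_tendstoD[OF tendsto_ident_at])
  moreover have "\<forall>\<^sub>F t in at_left T. t \<in> {0<..<T}" using assms(1) by (rule eventually_at_left_real)
  ultimately have "\<forall>\<^sub>F t in at_left T. \<phi> (x, t) = 0"
  proof eventually_elim
    case (elim t)
    then have "(x, t) \<notin> K" by force
    then show ?case using assms(5)[of "(x, t)"] elim by auto
  qed
  then have "((\<lambda>t. \<phi> (x, t)) \<longlongrightarrow> 0) (at_left T)" by (rule tendsto_eventually)
  then show ?thesis using lim tendsto_unique trivial_limit_at_left_real by blast
qed

end

context fan
begin

lemma borel_imp_lebesgue_on: "f \<in> borel_measurable borel \<Longrightarrow> f \<in> borel_measurable (lebesgue_on S)"
  for f :: "'a::euclidean_space \<Rightarrow> 'b::euclidean_space"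
  by (intro measurable_restrict_space1 measurable_completion) simp

lemma DERIV_mu_comp:
  assumes "(f has_real_derivative f') (at (h x) within {\<rho>m..\<rho>p})" "(h has_real_derivative h') (at x)"
    "\<And>y. h y \<in> {\<rho>m..\<rho>p}"
  shows "((\<lambda>x. f (h x)) has_real_derivative f' * h') (at x)"
proof -
  have "range h \<subseteq> {\<rho>m..\<rho>p}" using assms(3) by blast
  from DERIV_image_chain[OF has_field_derivative_subset[OF assms(1) this] assms(2)] show ?thesis
    by (simp add: o_def)
qed

lemma entropy_pair_flux_derivative:
  assumes pair: "(m_flux \<rho>m \<rho>p g lam t has_real_derivative F') (at r within {\<rho>m..\<rho>p})" and r: "r \<in> {\<rho>m..\<rho>p}"
  shows "F' = g * t * speed r"
  by (rule vector_derivative_unique_within_closed_interval[of \<rho>m \<rho>p r "m_flux \<rho>m \<rho>p g lam t"])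
     (use pair DERIV_m_flux[OF r] rho_less r in \<open>simp_all add: has_real_derivative_iff_has_vector_derivative cbox_interval\<close>)

text \<open>
  A rarefaction wave is continuous for positive times, so every entropy is conserved, and the entropy inequality
  holds with equality. It is \<open>fan_ibp\<close> in the rest frame, on a rectangle that contains the support of the test
  function.
\<close>

theorem entropy_solution_mu:
  assumes T: "0 < T"
  shows "entropy_solution (m_flux \<rho>m \<rho>p g lam) {\<rho>m..\<rho>p} T (rho0 \<rho>m \<rho>p) (\<lambda>(x, t). mu 0 x t)"
  unfolding entropy_solution_def
proof (intro conjI allI impI)
  show "(\<lambda>(x, t). mu 0 x t) \<in> borel_measurable (lebesgue_on (UNIV \<times> {0<..<T}))"
    using measurable_mu[of 0] by (intro borel_imp_lebesgue_on) (simp add: case_prod_unfold)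
  show "AE p in lebesgue_on (UNIV \<times> {0<..<T}). (case p of (x, t) \<Rightarrow> mu 0 x t) \<in> {\<rho>m..\<rho>p}"
    by (auto simp: mu_ge mu_le)
  fix \<eta> :: "real \<Rightarrow> real" and \<psi> :: "real \<Rightarrow> real \<Rightarrow> real" and \<phi> :: "real \<times> real \<Rightarrow> real" and K :: "(real \<times> real) set"
  assume pair: "entropy_pair (m_flux \<rho>m \<rho>p g lam) {\<rho>m..\<rho>p} T \<eta> \<psi>" and smooth: "smooth \<phi>"
    and K: "compact K" "K \<subseteq> UNIV \<times> {0..<T}" and zero: "\<forall>p \<in> UNIV \<times> {0..<T} - K. \<phi> p = 0"
  let ?S = "UNIV \<times> {0<..<T} :: (real \<times> real) set"
  obtain \<eta>' where \<eta>': "continuous_on {\<rho>m..\<rho>p} \<eta>'"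
      "\<And>r. r \<in> {\<rho>m..\<rho>p} \<Longrightarrow> (\<eta> has_real_derivative \<eta>' r) (at r within {\<rho>m..\<rho>p})"
      "\<And>t r. t \<in> {0..T} \<Longrightarrow> r \<in> {\<rho>m..\<rho>p} \<Longrightarrow> (\<psi> t has_real_derivative \<eta>' r * (g * t * speed r)) (at r within {\<rho>m..\<rho>p})"
    and c\<psi>: "continuous_on ({0..T} \<times> {\<rho>m..\<rho>p}) (\<lambda>(t, r). \<psi> t r)"
    using pair entropy_pair_flux_derivative unfolding entropy_pair_def by metis
  have Ck1: "Ck (Suc 0) \<phi>" using smooth by (simp only: smooth_def)
  define \<phi>x where "\<phi>x p = frechet_derivative \<phi> (at p) (1, 0)" for p
  define \<phi>t where "\<phi>t p = frechet_derivative \<phi> (at p) (0, 1)" for p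
  have c: "continuous_on UNIV \<phi>" "continuous_on UNIV \<phi>x" "continuous_on UNIV \<phi>t"
    using Ck_Suc_imp[OF Ck1] Ck1 by (simp_all add: \<phi>x_def[abs_def] \<phi>t_def[abs_def])
  have D: "(\<phi> has_derivative frechet_derivative \<phi> (at p)) (at p)" for p
    using Ck_differentiable[OF Ck1] .
  have Dx: "((\<lambda>x. \<phi> (x, t)) has_real_derivative \<phi>x (x, t)) (at x)" for x t
    unfolding \<phi>x_def
    by (rule has_derivative_line[where p="\<lambda>s. (s, t)", OF D])
       (auto intro!: derivative_eq_intros simp: has_vector_derivative_def)
  have Dt: "((\<lambda>t. \<phi> (x, t)) has_real_derivative \<phi>t (x, t)) (at t)" for x t
    unfolding \<phi>t_def
    by (rule has_derivative_line[where p="\<lambda>s. (x, s)", OF D])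
       (auto intro!: derivative_eq_intros simp: has_vector_derivative_def)
  have "bounded (fst ` K)" using K(1) by (intro compact_imp_bounded compact_continuous_image continuous_intros)
  then obtain b where b: "\<And>p. p \<in> K \<Longrightarrow> \<bar>fst p\<bar> \<le> b" unfolding bounded_iff by auto
  define l where "l = \<bar>b\<bar> + 1"
  have l: "0 < l" and lK: "\<And>x t. l \<le> \<bar>x\<bar> \<Longrightarrow> (x, t) \<notin> K" using b unfolding l_def by fastforce+
  have \<phi>T: "\<phi> (x, T) = 0" for x
    by (rule zero_at_T[OF T c(1) K]) (use zero in auto)
  have \<phi>l: "\<phi> (x, t) = 0" if "l \<le> \<bar>x\<bar>" "t \<in> {0..T}" for x t
    using \<phi>T zero lK[OF that(1)] that by (cases "t = T") auto
  have \<phi>'l: "\<phi>x (x, t) = 0" "\<phi>t (x, t) = 0" if "(x, t) \<notin> K" "t \<in> {0<..<T}" for x t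
  proof -
    have "open (?S - K)" using K(1) by (intro open_Diff open_Times compact_imp_closed) auto
    then have "(\<phi> has_derivative (\<lambda>_. 0)) (at (x, t))"
      by (rule has_derivative_transform_within_open[OF has_derivative_const[of 0]]) (use that zero in auto)
    then have "frechet_derivative \<phi> (at (x, t)) = (\<lambda>_. 0)" by (metis frechet_derivative_at)
    then show "\<phi>x (x, t) = 0" "\<phi>t (x, t) = 0" by (simp_all add: \<phi>x_def \<phi>t_def)
  qed
  define \<alpha> where "\<alpha> = (\<lambda>(x::real, t::real, r). \<eta> r)"
  (* The time is clamped because psi is continuous only for times in [0, T]. *)
  define \<beta> where "\<beta> = (\<lambda>(x::real, t, r). \<psi> (max 0 (min T t)) r)"
  define \<alpha>2 where "\<alpha>2 = (\<lambda>(x::real, t::real, r). \<eta>' r)"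
  define Z where "Z = (\<lambda>_ :: real \<times> real \<times> real. 0 :: real)"
  have c\<eta>: "continuous_on {\<rho>m..\<rho>p} \<eta>"
    using \<eta>'(2) by (meson DERIV_continuous continuous_on_eq_continuous_within)
  have cJ: "continuous_on states (\<lambda>(x::real, t::real, r). f r)" if "continuous_on {\<rho>m..\<rho>p} f" for f :: "real \<Rightarrow> real"
    unfolding case_prod_unfold by (rule continuous_on_compose2[OF that]) (auto intro!: continuous_intros)
  have c\<beta>: "continuous_on states \<beta>"
  proof -
    have "continuous_on states
       (\<lambda>q :: real \<times> real \<times> real. (\<lambda>(t, r). \<psi> t r) (max 0 (min T (fst (snd q))), snd (snd q)))"
      by (rule continuous_on_compose2[OF c\<psi>]) (use T in \<open>auto intro!: continuous_intros\<close>)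
    then show ?thesis by (simp add: \<beta>_def case_prod_unfold)
  qed
  have ibp: "(LINT p:{-l..l} \<times> {0..T}|lborel. at_mu 0 \<alpha> p * \<phi>t p + at_mu 0 \<beta> p * \<phi>x p + at_mu 0 Z p * \<phi> p) =
    (LINT t:{0..T}|lborel. at_mu 0 \<beta> (l, t) * \<phi> (l, t) - at_mu 0 \<beta> (-l, t) * \<phi> (-l, t))
    - (LINT x:{-l..l}|lborel. at_mu 0 \<alpha> (x, 0) * \<phi> (x, 0))"
  proof (rule fan_ibp[where ?\<alpha>1.0=Z and ?\<alpha>2.0=\<alpha>2, OF l T _ c\<beta> _ _ _ _ _ c Dx Dt \<phi>T])
    show "continuous_on states \<alpha>" "continuous_on states \<alpha>2"
      unfolding \<alpha>_def \<alpha>2_def by (intro cJ c\<eta> \<eta>')+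
    fix x t assume t: "0 < t" "t < T" and k: "x / fall g t + 0 \<noteq> speed \<rho>m" "x / fall g t + 0 \<noteq> speed \<rho>p"
    have "((\<lambda>t. \<eta> (mu 0 x t)) has_real_derivative \<eta>' (mu 0 x t) * mu_t 0 x t) (at t)"
      unfolding mu_t_def by (rule DERIV_mu_comp[OF \<eta>'(2)[OF mu_mem] DERIV_mu_t[OF t(1) k] mu_mem])
    then show "((\<lambda>t. at_mu 0 \<alpha> (x, t)) has_real_derivative at_mu 0 Z (x, t) + at_mu 0 \<alpha>2 (x, t) * mu_t 0 x t) (at t)"
      by (simp add: at_mu_def \<alpha>_def \<alpha>2_def Z_def)
    have tT: "t \<in> {0..T}" using t by simp
    have "((\<lambda>x. \<psi> t (mu 0 x t)) has_real_derivative \<eta>' (mu 0 x t) * (g * t * speed (mu 0 x t)) * slope 0 x t) (at x)"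
      by (rule DERIV_mu_comp[OF \<eta>'(3)[OF tT mu_mem] DERIV_mu_x[OF _ k] mu_mem]) (use t in simp)
    then show "((\<lambda>x. at_mu 0 \<beta> (x, t)) has_real_derivative
        at_mu 0 Z (x, t) - (at_mu 0 Z (x, t) + at_mu 0 \<alpha>2 (x, t) * mu_t 0 x t)) (at x)"
      using t by (simp add: at_mu_def \<beta>_def \<alpha>2_def Z_def mu_t_eq mult_ac)
  qed (auto simp: Z_def)
  have 1: "(LINT p:?S|lebesgue. \<eta> (case p of (x, t) \<Rightarrow> mu 0 x t) * frechet_derivative \<phi> (at p) (0, 1) +
            \<psi> (snd p) (case p of (x, t) \<Rightarrow> mu 0 x t) * frechet_derivative \<phi> (at p) (1, 0)) =
      (LINT p:{-l..l} \<times> {0..T}|lborel. at_mu 0 \<alpha> p * \<phi>t p + at_mu 0 \<beta> p * \<phi>x p + at_mu 0 Z p * \<phi> p)"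
  proof -
    let ?H = "\<lambda>p. at_mu 0 \<alpha> p * \<phi>t p + at_mu 0 \<beta> p * \<phi>x p"
    have m: "?H \<in> borel_measurable borel"
      using c by (intro borel_measurable_add borel_measurable_times borel_measurable_continuous_onI
        borel_measurable_continuous_except_point[OF continuous_at_mu] c\<beta>) (auto simp: \<alpha>_def intro!: cJ c\<eta>)
    have e: "indicator ?S p *\<^sub>R (\<eta> (case p of (x, t) \<Rightarrow> mu 0 x t) * frechet_derivative \<phi> (at p) (0, 1) +
            \<psi> (snd p) (case p of (x, t) \<Rightarrow> mu 0 x t) * frechet_derivative \<phi> (at p) (1, 0)) = indicator ?S p *\<^sub>R ?H p" for p
      by (cases p) (auto simp: at_mu_def \<alpha>_def \<beta>_def \<phi>x_def \<phi>t_def indicator_def)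
    have "(LINT p:?S|lebesgue. \<eta> (case p of (x, t) \<Rightarrow> mu 0 x t) * frechet_derivative \<phi> (at p) (0, 1) +
            \<psi> (snd p) (case p of (x, t) \<Rightarrow> mu 0 x t) * frechet_derivative \<phi> (at p) (1, 0)) = (\<integral>p. indicator ?S p *\<^sub>R ?H p \<partial>lebesgue)"
      unfolding set_lebesgue_integral_def e ..
    also have "\<dots> = (\<integral>p. indicator ?S p *\<^sub>R ?H p \<partial>lborel)"
      by (rule integral_completion) (use m in \<open>auto intro!: borel_measurable_times borel_measurable_indicator simp: borel_open open_Times\<close>)
    also have "\<dots> = (\<integral>p. indicator ({-l..l} \<times> {0..T}) p *\<^sub>R ?H p \<partial>lborel)"
    proof (rule integral_cong_AE)
      have neg: "{p :: real \<times> real. p \<bullet> (0, 1) = 0} \<union> {p. p \<bullet> (0, 1) = T} \<in> null_sets lborel"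
      proof -
        have "negligible ({p :: real \<times> real. p \<bullet> (0, 1) = 0} \<union> {p. p \<bullet> (0, 1) = T})"
          by (intro negligible_Un negligible_standard_hyperplane) (auto simp: Basis_prod_def)
        moreover have "{p :: real \<times> real. p \<bullet> (0, 1) = 0} \<union> {p. p \<bullet> (0, 1) = T} \<in> sets borel"
          by (intro sets.Un borel_closed closed_Collect_eq continuous_intros)
        ultimately show ?thesis by (simp add: negligible_iff_null_sets null_sets_completion_iff)
      qed
      show "AE p in lborel. indicator ?S p *\<^sub>R ?H p = indicator ({-l..l} \<times> {0..T}) p *\<^sub>R ?H p"
        using AE_not_in[OF neg]
      proof eventually_elim
        case (elim p)
        obtain x t where p: "p = (x, t)" by (cases p)
        show ?case
        proof (cases "t \<in> {0<..<T} \<and> x \<notin> {-l..l}")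
          case True
          then have "(x, t) \<notin> K" by (intro lK) auto
          then show ?thesis using True \<phi>'l[of x t] by (simp add: p indicator_def)
        next
          case False
          then show ?thesis using elim by (auto simp: p indicator_def)
        qed
      qed
    qed (use m in \<open>auto intro!: borel_measurable_times borel_measurable_indicator simp: borel_open open_Times borel_closed closed_Times\<close>)
    finally show ?thesis by (simp add: set_lebesgue_integral_def Z_def at_mu_def)
  qed
  have 2: "(LINT x|lebesgue. \<eta> (rho0 \<rho>m \<rho>p x) * \<phi> (x, 0)) = (LINT x:{-l..l}|lborel. at_mu 0 \<alpha> (x, 0) * \<phi> (x, 0))"
  proof -
    have "(LINT x|lebesgue. \<eta> (rho0 \<rho>m \<rho>p x) * \<phi> (x, 0)) = (LINT x|lborel. \<eta> (rho0 \<rho>m \<rho>p x) * \<phi> (x, 0))"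
    proof (rule integral_completion)
      have "continuous_on UNIV (\<lambda>x. \<phi> (x, 0))"
        by (rule continuous_on_compose2[OF c(1)]) (auto intro!: continuous_intros)
      then have [measurable]: "(\<lambda>x. \<phi> (x, 0)) \<in> borel_measurable borel" by (rule borel_measurable_continuous_onI)
      have "(\<lambda>x. \<eta> (rho0 \<rho>m \<rho>p x)) = (\<lambda>x. if 0 < x then \<eta> \<rho>p else \<eta> \<rho>m)" by (auto simp: rho0_def)
      then have [measurable]: "(\<lambda>x. \<eta> (rho0 \<rho>m \<rho>p x)) \<in> borel_measurable borel" by simp
      show "(\<lambda>x. \<eta> (rho0 \<rho>m \<rho>p x) * \<phi> (x, 0)) \<in> borel_measurable lborel" by measurable
    qed
    moreover have "(\<lambda>x. \<eta> (rho0 \<rho>m \<rho>p x) * \<phi> (x, 0)) = (\<lambda>x. indicator {-l..l} x *\<^sub>R (at_mu 0 \<alpha> (x, 0) * \<phi> (x, 0)))"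
    proof
      fix x show "\<eta> (rho0 \<rho>m \<rho>p x) * \<phi> (x, 0) = indicator {-l..l} x *\<^sub>R (at_mu 0 \<alpha> (x, 0) * \<phi> (x, 0))"
      proof (cases "x \<in> {-l..l}")
        case False
        then have "l \<le> \<bar>x\<bar>" by auto
        then show ?thesis using \<phi>l[of x 0] T False by simp
      qed (simp add: at_mu_def \<alpha>_def mu_0)
    qed
    ultimately show ?thesis unfolding set_lebesgue_integral_def by metis
  qed
  have 3: "(LINT t:{0..T}|lborel. at_mu 0 \<beta> (l, t) * \<phi> (l, t) - at_mu 0 \<beta> (-l, t) * \<phi> (-l, t)) = 0"
  proof -
    have z: "indicator {0..T} t *\<^sub>R (at_mu 0 \<beta> (l, t) * \<phi> (l, t) - at_mu 0 \<beta> (-l, t) * \<phi> (-l, t)) = 0" for t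
      using \<phi>l[of l t] \<phi>l[of "-l" t] by (simp add: indicator_def)
    show ?thesis unfolding set_lebesgue_integral_def z by simp
  qed
  show "0 \<le> (LINT p:?S|lebesgue. \<eta> (case p of (x, t) \<Rightarrow> mu 0 x t) * frechet_derivative \<phi> (at p) (0, 1) +
            \<psi> (snd p) (case p of (x, t) \<Rightarrow> mu 0 x t) * frechet_derivative \<phi> (at p) (1, 0)) +
        (LINT x|lebesgue. \<eta> (rho0 \<rho>m \<rho>p x) * \<phi> (x, 0))"
    using ibp unfolding 1 2 3 by simp
qed

end

section \<open>Slicing Lebesgue measure\<close>

lemma face_point_nth [simp]: "face_point i c \<omega> $ j = (if j = i then c else \<omega> j)"
  by (simp add: face_point_def)

text \<open>
  Lebesgue measure on the hyperplanes transversal to the \<open>i\<close>-th direction, in the form used for the faces of the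
  domain.
\<close>

abbreviation trans_measure :: "'n::finite \<Rightarrow> ('n \<Rightarrow> real) measure" where
  "trans_measure i \<equiv> Pi\<^sub>M (UNIV - {i}) (\<lambda>_. lborel)"

lemma product_sigma_finite_lborel: "product_sigma_finite (\<lambda>_. lborel :: real measure)"
  by (simp add: product_sigma_finite_def sigma_finite_lborel)

lemma sigma_finite_trans: "sigma_finite_measure (trans_measure i)"
  by (rule product_sigma_finite.sigma_finite[OF product_sigma_finite_lborel]) simp

lemma Basis_vec_real: "(Basis :: (real^'n) set) = range (\<lambda>i. axis i 1)"
  by (auto simp: Basis_vec_def)

lemma prod_Basis_vec: "(\<Prod>b\<in>(Basis :: (real^'n) set). f b) = (\<Prod>j\<in>UNIV. f (axis j 1))"
  unfolding Basis_vec_real by (subst prod.reindex) (auto simp: inj_on_def axis_eq_axis)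

lemma prod_Basis_pair:
  fixes f :: "'a::euclidean_space \<times> 'b::euclidean_space \<Rightarrow> real"
  shows "(\<Prod>b\<in>Basis. f b) = (\<Prod>b\<in>Basis. f (b, 0)) * (\<Prod>b\<in>Basis. f (0, b))"
proof -
  have i: "inj_on (\<lambda>u. (u, 0 :: 'b)) (Basis :: 'a set)" "inj_on (\<lambda>v. (0 :: 'a, v)) (Basis :: 'b set)"
    by (simp_all add: inj_on_def)
  have d: "(\<lambda>u. (u, 0)) ` (Basis :: 'a set) \<inter> (\<lambda>v. (0, v)) ` (Basis :: 'b set) = {}"
    by auto
  show ?thesis
    unfolding Basis_prod_def prod.union_disjoint[OF finite_imageI[OF finite_Basis] finite_imageI[OF finite_Basis] d]
      prod.reindex[OF i(1)] prod.reindex[OF i(2)] by (simp add: o_def)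
qed

lemma measurable_trans_component: "j \<noteq> i \<Longrightarrow> (\<lambda>\<omega>. \<omega> j) \<in> borel_measurable (trans_measure i)"
  using measurable_component_singleton[of j "UNIV - {i}" "\<lambda>_. lborel"] by simp

lemma measurable_face_point:
  fixes i :: "'n::finite"
  assumes "f \<in> M \<rightarrow>\<^sub>M trans_measure i" "c \<in> borel_measurable M"
  shows "(\<lambda>x. face_point i (c x) (f x)) \<in> borel_measurable M"
proof (subst borel_measurable_euclidean_space, unfold Basis_vec_real, rule ballI, erule rangeE)
  fix b :: "real^'n" and j assume b: "b = axis j 1"
  have e: "face_point i (c x) (f x) \<bullet> b = (if j = i then c x else f x j)" for x
    by (simp add: b inner_axis)
  show "(\<lambda>x. face_point i (c x) (f x) \<bullet> b) \<in> borel_measurable M"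
  proof (cases "j = i")
    case True
    then show ?thesis unfolding e using assms(2) by simp
  next
    case False
    from measurable_compose[OF assms(1) measurable_trans_component[OF False]]
    show ?thesis unfolding e using False by simp
  qed
qed

lemma emeasure_trans_box:
  assumes "\<And>j. l j \<le> u j"
  shows "emeasure (trans_measure i) (Pi\<^sub>E (UNIV - {i}) (\<lambda>j. {l j<..<u j})) = ennreal (\<Prod>j\<in>UNIV - {i}. u j - l j)"
  using assms by (subst product_sigma_finite.emeasure_PiM[OF product_sigma_finite_lborel]) (auto simp: prod_ennreal)

lemma trans_box_sets: "Pi\<^sub>E (UNIV - {i}) (\<lambda>j. {l j<..<u j}) \<in> sets (trans_measure i)"
  by (intro sets_PiM_I_finite) auto

lemma prod_split: "(\<Prod>j\<in>UNIV. f j) = (f i :: real) * (\<Prod>j\<in>UNIV - {i}. f j)" for i :: "'n::finite"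
  by (rule prod.remove) auto

lemma face_point_box_iff:
  "face_point i s \<omega> \<in> box l u \<longleftrightarrow> s \<in> {l $ i<..<u $ i} \<and> (\<forall>j\<in>UNIV - {i}. \<omega> j \<in> {l $ j<..<u $ j})"
proof
  assume a: "face_point i s \<omega> \<in> box l u"
  have "l $ j < (if j = i then s else \<omega> j) \<and> (if j = i then s else \<omega> j) < u $ j" for j
    using a by (simp add: mem_box_cart)
  then show "s \<in> {l $ i<..<u $ i} \<and> (\<forall>j\<in>UNIV - {i}. \<omega> j \<in> {l $ j<..<u $ j})"
    by (metis DiffE greaterThanLessThan_iff insertI1)
qed (simp add: mem_box_cart)

lemma mem_box_pair: "(y, t) \<in> box l u \<longleftrightarrow> y \<in> box (fst l) (fst u) \<and> t \<in> box (snd l) (snd u)"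
  by (simp add: mem_box Basis_prod_def inner_prod_def ball_Un)

lemma trans_box_iff:
  "\<omega> \<in> Pi\<^sub>E (UNIV - {i}) (\<lambda>j. {l j<..<u j}) \<longleftrightarrow> \<omega> \<in> space (trans_measure i) \<and> (\<forall>j\<in>UNIV - {i}. \<omega> j \<in> {l j<..<u j})"
  by (simp add: space_PiM PiE_iff conj_commute del: greaterThanLessThan_iff)

text \<open>
  Lebesgue measure on \<open>\<real>\<^sup>n\<close> is a product of \<open>trans_measure i\<close> and Lebesgue measure in direction \<open>i\<close>, because both have
  the same values on boxes. The lemmas \<open>lborel_face_time\<close> and \<open>lborel_face_plane\<close> are the same statement with
  a time coordinate, once with time among the parameters of a line, once with planes instead of lines.
\<close>

lemma lborel_vec_face:
  "distr (trans_measure i \<Otimes>\<^sub>M lborel) borel (\<lambda>(\<omega>, s). face_point i s \<omega>) = (lborel :: (real^'n) measure)"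
proof (rule lborel_eqI[symmetric])
  let ?f = "\<lambda>(\<omega>, s). face_point i s \<omega>"
  fix l u :: "real^'n" assume le: "\<And>b. b \<in> Basis \<Longrightarrow> l \<bullet> b \<le> u \<bullet> b"
  have le': "l $ j \<le> u $ j" for j using le[of "axis j 1"] by (simp add: Basis_vec_real inner_axis)
  have f: "?f \<in> (trans_measure i \<Otimes>\<^sub>M lborel) \<rightarrow>\<^sub>M borel"
    unfolding case_prod_unfold by (intro measurable_face_point) measurable
  have "?f -` box l u \<inter> space (trans_measure i \<Otimes>\<^sub>M lborel) = Pi\<^sub>E (UNIV - {i}) (\<lambda>j. {l $ j<..<u $ j}) \<times> {l $ i<..<u $ i}"
  proof (rule set_eqI)
    fix p show "p \<in> ?f -` box l u \<inter> space (trans_measure i \<Otimes>\<^sub>M lborel) \<longleftrightarrow> p \<in> Pi\<^sub>E (UNIV - {i}) (\<lambda>j. {l $ j<..<u $ j}) \<times> {l $ i<..<u $ i}"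
      by (cases p, simp only: vimage_eq Int_iff mem_Sigma_iff split_conv space_pair_measure trans_box_iff
          mem_box_pair box_real face_point_box_iff space_lborel space_borel UNIV_I) blast
  qed
  then have "emeasure (distr (trans_measure i \<Otimes>\<^sub>M lborel) borel ?f) (box l u)
      = emeasure (trans_measure i \<Otimes>\<^sub>M lborel) (Pi\<^sub>E (UNIV - {i}) (\<lambda>j. {l $ j<..<u $ j}) \<times> {l $ i<..<u $ i})"
    using f by (simp add: emeasure_distr)
  also have "\<dots> = ennreal (\<Prod>j\<in>UNIV - {i}. u $ j - l $ j) * ennreal (u $ i - l $ i)"
    using le' by (simp add: lborel.emeasure_pair_measure_Times trans_box_sets emeasure_trans_box)
  also have "\<dots> = (\<Prod>b\<in>Basis. (u - l) \<bullet> b)"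
    using le' unfolding prod_Basis_vec
    by (subst prod_split[of _ i]) (simp add: inner_axis ennreal_mult[symmetric] prod_nonneg mult.commute)
  finally show "emeasure (distr (trans_measure i \<Otimes>\<^sub>M lborel) borel ?f) (box l u) = (\<Prod>b\<in>Basis. (u - l) \<bullet> b)" .
qed simp

lemma prod_Basis_vec_real:
  fixes l u :: "(real^'n) \<times> real"
  shows "(\<Prod>b\<in>Basis. (u - l) \<bullet> b) = (fst u $ i - fst l $ i) * (\<Prod>j\<in>UNIV - {i}. fst u $ j - fst l $ j) * (snd u - snd l)"
  unfolding prod_Basis_pair prod_Basis_vec by (subst prod_split[of _ i]) (simp add: inner_axis inner_prod_def)

lemma box_pair_le:
  fixes l u :: "(real^'n) \<times> real"
  assumes "\<And>b. b \<in> Basis \<Longrightarrow> l \<bullet> b \<le> u \<bullet> b"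
  shows "fst l $ j \<le> fst u $ j" "snd l \<le> snd u"
proof -
  have "(axis j 1, 0) \<in> (Basis :: ((real^'n) \<times> real) set)" "(0, 1) \<in> (Basis :: ((real^'n) \<times> real) set)"
    by (auto simp: Basis_prod_def Basis_vec_real)
  from this[THEN assms] show "fst l $ j \<le> fst u $ j" "snd l \<le> snd u"
    by (simp_all add: inner_prod_def inner_axis)
qed

lemma lborel_face_time:
  "distr ((trans_measure i \<Otimes>\<^sub>M lborel) \<Otimes>\<^sub>M lborel) borel (\<lambda>((\<omega>, t), s). (face_point i s \<omega>, t))
    = (lborel :: ((real^'n) \<times> real) measure)"
proof (rule lborel_eqI[symmetric])
  let ?M = "(trans_measure i \<Otimes>\<^sub>M lborel) \<Otimes>\<^sub>M lborel"
  let ?f = "\<lambda>((\<omega>, t), s). (face_point i s \<omega>, t)"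
  fix l u :: "(real^'n) \<times> real" assume le: "\<And>b. b \<in> Basis \<Longrightarrow> l \<bullet> b \<le> u \<bullet> b"
  let ?E = "Pi\<^sub>E (UNIV - {i}) (\<lambda>j. {fst l $ j<..<fst u $ j})"
  have f: "?f \<in> ?M \<rightarrow>\<^sub>M borel"
    unfolding case_prod_unfold by (intro borel_measurable_Pair measurable_face_point) measurable
  have e: "?f -` box l u \<inter> space ?M = (?E \<times> {snd l<..<snd u}) \<times> {fst l $ i<..<fst u $ i}"
  proof (rule set_eqI)
    fix p :: "(('n \<Rightarrow> real) \<times> real) \<times> real"
    obtain \<omega> :: "'n \<Rightarrow> real" and s t :: real where p: "p = ((\<omega>, t), s)" by (metis surj_pair)
    show "p \<in> ?f -` box l u \<inter> space ?M \<longleftrightarrow> p \<in> (?E \<times> {snd l<..<snd u}) \<times> {fst l $ i<..<fst u $ i}"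
      by (simp only: p vimage_eq Int_iff mem_Sigma_iff split_conv space_pair_measure trans_box_iff
          mem_box_pair box_real face_point_box_iff space_lborel space_borel UNIV_I) blast
  qed
  then have "emeasure (distr ?M borel ?f) (box l u) = emeasure ?M ((?E \<times> {snd l<..<snd u}) \<times> {fst l $ i<..<fst u $ i})"
    by (simp only: emeasure_distr[OF f borel_open[OF open_box]] e)
  also have "\<dots> = ennreal (\<Prod>j\<in>UNIV - {i}. fst u $ j - fst l $ j) * ennreal (snd u - snd l) * ennreal (fst u $ i - fst l $ i)"
    using box_pair_le[OF le]
    by (simp add: lborel.emeasure_pair_measure_Times trans_box_sets emeasure_trans_box pair_measureI)
  also have "\<dots> = (\<Prod>b\<in>Basis. (u - l) \<bullet> b)"
    using box_pair_le[OF le] unfolding prod_Basis_vec_real[of _ _ i]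
    by (simp add: ennreal_mult[symmetric] prod_nonneg mult_ac)
  finally show "emeasure (distr ?M borel ?f) (box l u) = (\<Prod>b\<in>Basis. (u - l) \<bullet> b)" .
qed simp

lemma lborel_face_plane:
  "distr (trans_measure i \<Otimes>\<^sub>M lborel) borel (\<lambda>(\<omega>, s, t). (face_point i s \<omega>, t))
    = (lborel :: ((real^'n) \<times> real) measure)"
proof (rule lborel_eqI[symmetric])
  let ?M = "trans_measure i \<Otimes>\<^sub>M (lborel :: (real \<times> real) measure)"
  let ?f = "\<lambda>(\<omega>, s, t). (face_point i s \<omega>, t)"
  fix l u :: "(real^'n) \<times> real" assume le: "\<And>b. b \<in> Basis \<Longrightarrow> l \<bullet> b \<le> u \<bullet> b"
  let ?E = "Pi\<^sub>E (UNIV - {i}) (\<lambda>j. {fst l $ j<..<fst u $ j})"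
  have [measurable]: "fst \<in> (lborel :: (real \<times> real) measure) \<rightarrow>\<^sub>M borel" "snd \<in> (lborel :: (real \<times> real) measure) \<rightarrow>\<^sub>M borel"
    by (simp_all add: borel_measurable_continuous_onI continuous_intros)
  have f: "?f \<in> ?M \<rightarrow>\<^sub>M borel"
    unfolding case_prod_unfold by (intro borel_measurable_Pair measurable_face_point) measurable
  have e: "?f -` box l u \<inter> space ?M = ?E \<times> ({fst l $ i<..<fst u $ i} \<times> {snd l<..<snd u})"
  proof (rule set_eqI)
    fix p :: "('n \<Rightarrow> real) \<times> real \<times> real"
    obtain \<omega> :: "'n \<Rightarrow> real" and s t :: real where p: "p = (\<omega>, s, t)" by (metis surj_pair)
    show "p \<in> ?f -` box l u \<inter> space ?M \<longleftrightarrow> p \<in> ?E \<times> ({fst l $ i<..<fst u $ i} \<times> {snd l<..<snd u})"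
      by (simp only: p vimage_eq Int_iff mem_Sigma_iff split_conv space_pair_measure trans_box_iff
          mem_box_pair box_real face_point_box_iff space_lborel space_borel UNIV_I) blast
  qed
  then have "emeasure (distr ?M borel ?f) (box l u) = emeasure ?M (?E \<times> ({fst l $ i<..<fst u $ i} \<times> {snd l<..<snd u}))"
    by (simp only: emeasure_distr[OF f borel_open[OF open_box]] e)
  also have "\<dots> = ennreal (\<Prod>j\<in>UNIV - {i}. fst u $ j - fst l $ j) * emeasure lborel ({fst l $ i<..<fst u $ i} \<times> {snd l<..<snd u})"
    using box_pair_le[OF le]
    by (subst lborel.emeasure_pair_measure_Times)
       (auto simp: trans_box_sets emeasure_trans_box borel_open open_Times)
  also have "emeasure lborel ({fst l $ i<..<fst u $ i} \<times> {snd l<..<snd u}) = ennreal (fst u $ i - fst l $ i) * ennreal (snd u - snd l)"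
    using box_pair_le[OF le]
    by (simp add: lborel_prod[symmetric] lborel.emeasure_pair_measure_Times)
  also have "ennreal (\<Prod>j\<in>UNIV - {i}. fst u $ j - fst l $ j) * (ennreal (fst u $ i - fst l $ i) * ennreal (snd u - snd l)) = (\<Prod>b\<in>Basis. (u - l) \<bullet> b)"
    using box_pair_le[OF le] unfolding prod_Basis_vec_real[of _ _ i]
    by (simp add: ennreal_mult[symmetric] prod_nonneg mult_ac)
  finally show "emeasure (distr ?M borel ?f) (box l u) = (\<Prod>b\<in>Basis. (u - l) \<bullet> b)" .
qed simp

text \<open>
  The change to the falling frame preserves the area, since it is a translation for each time.
\<close>

lemma lborel_shear:
  assumes "continuous_on UNIV h"
  shows "distr lborel borel (\<lambda>(x, t). (x + h t, t)) = (lborel :: (real \<times> real) measure)"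
proof (rule lborel_eqI[symmetric])
  let ?f = "\<lambda>(x, t). (x + h t :: real, t :: real)"
  have cf: "continuous_on UNIV ?f"
    unfolding case_prod_unfold by (intro continuous_intros continuous_on_compose2[OF assms]) auto
  then have f: "?f \<in> borel \<rightarrow>\<^sub>M borel" by (rule borel_measurable_continuous_onI)
  fix l u :: "real \<times> real" assume le: "\<And>b. b \<in> Basis \<Longrightarrow> l \<bullet> b \<le> u \<bullet> b"
  obtain l1 l2 u1 u2 where lu: "l = (l1, l2)" "u = (u1, u2)" by (cases l, cases u)
  have le': "l1 \<le> u1" "l2 \<le> u2" using le[of "(1, 0)"] le[of "(0, 1)"] by (auto simp: lu Basis_prod_def)
  have op: "open (?f -` box l u)" by (intro open_vimage cf) auto
  have "emeasure (distr lborel borel ?f) (box l u) = emeasure (lborel \<Otimes>\<^sub>M lborel) (?f -` box l u)"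
    using f by (simp add: emeasure_distr lborel_prod)
  also have "\<dots> = (\<integral>\<^sup>+t. emeasure lborel ((\<lambda>x. (x, t)) -` (?f -` box l u)) \<partial>lborel)"
    by (rule lborel_pair.emeasure_pair_measure_alt2) (use borel_open[OF op] in \<open>simp only: lborel_prod sets_lborel\<close>)
  also have "\<dots> = (\<integral>\<^sup>+t. ennreal (u1 - l1) * indicator {l2<..<u2} t \<partial>lborel)"
  proof (rule nn_integral_cong)
    fix t
    have "(\<lambda>x. (x, t)) -` (?f -` box l u) = (if t \<in> {l2<..<u2} then {l1 - h t<..<u1 - h t} else {})"
      by (auto simp: lu mem_box Basis_prod_def)
    then show "emeasure lborel ((\<lambda>x. (x, t)) -` (?f -` box l u)) = ennreal (u1 - l1) * indicator {l2<..<u2} t"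
      using le' by (simp add: indicator_def)
  qed
  also have "\<dots> = ennreal (u1 - l1) * ennreal (u2 - l2)" using le' by (simp add: nn_integral_cmult)
  also have "\<dots> = (\<Prod>b\<in>Basis. (u - l) \<bullet> b)"
    using le' by (simp add: prod_Basis_pair lu ennreal_mult)
  finally show "emeasure (distr lborel borel ?f) (box l u) = (\<Prod>b\<in>Basis. (u - l) \<bullet> b)" .
qed simp

section \<open>Cavalieri's principle on the moving domain\<close>

lemma face_point_alt: "face_point i s \<omega> = face_point i 0 \<omega> + s *\<^sub>R axis i 1"
  by (simp add: vec_eq_iff axis_def)

lemma pair_sigma_finite_trans: "pair_sigma_finite (trans_measure i) (lborel :: 'a::euclidean_space measure)"
  by (rule pair_sigma_finite.intro[OF sigma_finite_trans sigma_finite_lborel])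

lemma measurable_fst_lborel [measurable]: "fst \<in> (lborel :: (real \<times> real) measure) \<rightarrow>\<^sub>M borel"
  and measurable_snd_lborel [measurable]: "snd \<in> (lborel :: (real \<times> real) measure) \<rightarrow>\<^sub>M borel"
  by (simp_all add: borel_measurable_continuous_onI continuous_intros)

lemma lborel_sheared:
  assumes h: "continuous_on UNIV h"
  shows "distr (trans_measure i \<Otimes>\<^sub>M lborel) borel (\<lambda>(\<omega>, q). (face_point i (fst q + h (snd q)) \<omega>, snd q))
    = (lborel :: ((real^'n) \<times> real) measure)"
proof -
  let ?sh = "\<lambda>(x, t). (x + h t :: real, t :: real)"
  have "continuous_on UNIV ?sh"
    unfolding case_prod_unfold by (intro continuous_intros continuous_on_compose2[OF h]) auto
  then have sh: "?sh \<in> borel \<rightarrow>\<^sub>M borel" by (rule borel_measurable_continuous_onI)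
  have sl: "?sh \<in> lborel \<rightarrow>\<^sub>M lborel" using sh by simp
  have dl: "distr lborel lborel ?sh = lborel"
    using lborel_shear[OF h] by (metis (no_types, lifting) distr_cong sets_lborel)
  have sf: "sigma_finite_measure (distr lborel lborel ?sh)" unfolding dl by (rule sigma_finite_lborel)
  have "trans_measure i \<Otimes>\<^sub>M lborel = distr (trans_measure i) (trans_measure i) (\<lambda>x. x) \<Otimes>\<^sub>M distr lborel lborel ?sh"
    unfolding dl by (simp add: distr_id)
  also have "\<dots> = distr (trans_measure i \<Otimes>\<^sub>M lborel) (trans_measure i \<Otimes>\<^sub>M lborel) (\<lambda>(x, y). (x, ?sh y))"
    by (rule pair_measure_distr[OF _ sl sf]) simp
  finally have e: "distr (trans_measure i \<Otimes>\<^sub>M lborel) (trans_measure i \<Otimes>\<^sub>M lborel) (\<lambda>(x, y). (x, ?sh y)) = trans_measure i \<Otimes>\<^sub>M lborel" ..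
  let ?f = "\<lambda>(\<omega>, s, t). (face_point i s \<omega>, t :: real)"
  have f: "?f \<in> (trans_measure i \<Otimes>\<^sub>M (lborel :: (real \<times> real) measure)) \<rightarrow>\<^sub>M borel"
    unfolding case_prod_unfold by (intro borel_measurable_Pair measurable_face_point) measurable
  have m: "(\<lambda>(x, y). (x, ?sh y)) \<in> (trans_measure i \<Otimes>\<^sub>M lborel) \<rightarrow>\<^sub>M (trans_measure i \<Otimes>\<^sub>M lborel)"
    using sl by (simp add: measurable_split_conv measurable_Pair)
  have c: "?f \<circ> (\<lambda>(x, y). (x, ?sh y)) = (\<lambda>(\<omega>, q). (face_point i (fst q + h (snd q)) \<omega>, snd q))"
    by (auto simp: fun_eq_iff)
  have "distr (distr (trans_measure i \<Otimes>\<^sub>M lborel) (trans_measure i \<Otimes>\<^sub>M lborel) (\<lambda>(x, y). (x, ?sh y))) borel ?f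
      = distr (trans_measure i \<Otimes>\<^sub>M lborel) borel (\<lambda>(\<omega>, q). (face_point i (fst q + h (snd q)) \<omega>, snd q))"
    using distr_distr[OF f m] unfolding c .
  then show ?thesis unfolding e lborel_face_plane ..
qed

text \<open>
  Integration over the moving domain becomes integration over the transversal coordinates and over a plane with
  coordinates \<open>x = y\<^sub>i - h(t)\<close> and \<open>t\<close>. For the vertical direction, the section of the domain by this plane is a rectangle
  when \<open>h\<close> is the distance of fall.
\<close>

lemma cavalieri_sheared:
  fixes F :: "(real^'n) \<times> real \<Rightarrow> real" and i :: 'n
  assumes h: "continuous_on UNIV h" and F: "integrable lborel F"
  defines "G \<equiv> \<lambda>\<omega> q. F (face_point i (fst q + h (snd q)) \<omega>, snd q)"
  shows "integral\<^sup>L lborel F = (\<integral>\<omega>. \<integral>q. G \<omega> q \<partial>lborel \<partial>trans_measure i)"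
    and "integral\<^sup>L lborel F = (\<integral>q. \<integral>\<omega>. G \<omega> q \<partial>trans_measure i \<partial>lborel)"
    and "integrable (trans_measure i) (\<lambda>\<omega>. \<integral>q. G \<omega> q \<partial>lborel)"
    and "AE \<omega> in trans_measure i. integrable lborel (G \<omega>)"
    and "integrable lborel (\<lambda>q. \<integral>\<omega>. G \<omega> q \<partial>trans_measure i)"
proof -
  interpret pair_sigma_finite "trans_measure i" "lborel :: (real \<times> real) measure" by (rule pair_sigma_finite_trans)
  let ?M = "trans_measure i \<Otimes>\<^sub>M (lborel :: (real \<times> real) measure)"
  let ?f = "\<lambda>(\<omega>, q). (face_point i (fst q + h (snd q)) \<omega>, snd q)"
  have [measurable]: "h \<in> borel_measurable borel" using h by (rule borel_measurable_continuous_onI)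
  have f: "?f \<in> ?M \<rightarrow>\<^sub>M borel"
    unfolding case_prod_unfold by (intro borel_measurable_Pair measurable_face_point) measurable
  have Fm: "F \<in> borel_measurable borel" using F by simp
  have c: "(\<lambda>x. F (?f x)) = (\<lambda>(\<omega>, q). G \<omega> q)" by (auto simp: G_def)
  have i: "integrable ?M (\<lambda>(\<omega>, q). G \<omega> q)"
    using integrable_distr_eq[OF f Fm] F unfolding lborel_sheared[OF h] c by simp
  have e: "integral\<^sup>L lborel F = integral\<^sup>L ?M (\<lambda>(\<omega>, q). G \<omega> q)"
    using integral_distr[OF f Fm] unfolding lborel_sheared[OF h] c .
  show "integral\<^sup>L lborel F = (\<integral>\<omega>. \<integral>q. G \<omega> q \<partial>lborel \<partial>trans_measure i)" unfolding e by (rule integral_fst[OF i, symmetric])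
  show "integral\<^sup>L lborel F = (\<integral>q. \<integral>\<omega>. G \<omega> q \<partial>trans_measure i \<partial>lborel)" unfolding e by (rule integral_snd[OF i, symmetric])
  show "integrable (trans_measure i) (\<lambda>\<omega>. \<integral>q. G \<omega> q \<partial>lborel)" by (rule integrable_fst[OF i])
  show "AE \<omega> in trans_measure i. integrable lborel (G \<omega>)" using AE_integrable_fst[OF i] .
  show "integrable lborel (\<lambda>q. \<integral>\<omega>. G \<omega> q \<partial>trans_measure i)" by (rule integrable_snd[OF i])
qed

lemma cavalieri_time:
  fixes F :: "(real^'n) \<times> real \<Rightarrow> real"
  assumes F: "integrable lborel F"
  shows "integral\<^sup>L lborel F = (\<integral>z. \<integral>s. F (face_point i s (fst z), snd z) \<partial>lborel \<partial>(trans_measure i \<Otimes>\<^sub>M lborel))"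
    and "integrable (trans_measure i \<Otimes>\<^sub>M lborel) (\<lambda>z. \<integral>s. F (face_point i s (fst z), snd z) \<partial>lborel)"
    and "AE z in trans_measure i \<Otimes>\<^sub>M lborel. integrable lborel (\<lambda>s. F (face_point i s (fst z), snd z))"
proof -
  interpret A: pair_sigma_finite "trans_measure i" "lborel :: real measure" by (rule pair_sigma_finite_trans)
  interpret pair_sigma_finite "trans_measure i \<Otimes>\<^sub>M (lborel :: real measure)" "lborel :: real measure"
    by (intro pair_sigma_finite.intro sigma_finite_lborel) unfold_locales
  let ?M = "(trans_measure i \<Otimes>\<^sub>M lborel) \<Otimes>\<^sub>M (lborel :: real measure)"
  let ?f = "\<lambda>((\<omega>, t), s). (face_point i s \<omega>, t :: real)"
  have f: "?f \<in> ?M \<rightarrow>\<^sub>M borel"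
    unfolding case_prod_unfold by (intro borel_measurable_Pair measurable_face_point) measurable
  have Fm: "F \<in> borel_measurable borel" using F by simp
  have c: "(\<lambda>x. F (?f x)) = (\<lambda>(z, s). F (face_point i s (fst z), snd z))" by auto
  have i: "integrable ?M (\<lambda>(z, s). F (face_point i s (fst z), snd z))"
    using integrable_distr_eq[OF f Fm] F unfolding lborel_face_time c by simp
  have e: "integral\<^sup>L lborel F = integral\<^sup>L ?M (\<lambda>(z, s). F (face_point i s (fst z), snd z))"
    using integral_distr[OF f Fm] unfolding lborel_face_time c .
  show "integral\<^sup>L lborel F = (\<integral>z. \<integral>s. F (face_point i s (fst z), snd z) \<partial>lborel \<partial>(trans_measure i \<Otimes>\<^sub>M lborel))"
    unfolding e by (rule integral_fst[OF i, symmetric])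
  show "integrable (trans_measure i \<Otimes>\<^sub>M lborel) (\<lambda>z. \<integral>s. F (face_point i s (fst z), snd z) \<partial>lborel)"
    by (rule integrable_fst[OF i])
  show "AE z in trans_measure i \<Otimes>\<^sub>M lborel. integrable lborel (\<lambda>s. F (face_point i s (fst z), snd z))"
    using AE_integrable_fst[OF i] .
qed

lemma cavalieri_vec:
  fixes F :: "real^'n \<Rightarrow> real"
  assumes F: "integrable lborel F"
  shows "integral\<^sup>L lborel F = (\<integral>\<omega>. \<integral>s. F (face_point i s \<omega>) \<partial>lborel \<partial>trans_measure i)"
    and "integrable (trans_measure i) (\<lambda>\<omega>. \<integral>s. F (face_point i s \<omega>) \<partial>lborel)"
proof -
  interpret pair_sigma_finite "trans_measure i" "lborel :: real measure" by (rule pair_sigma_finite_trans)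
  let ?M = "trans_measure i \<Otimes>\<^sub>M (lborel :: real measure)"
  let ?f = "\<lambda>(\<omega>, s). face_point i s \<omega>"
  have f: "?f \<in> ?M \<rightarrow>\<^sub>M borel"
    unfolding case_prod_unfold by (intro measurable_face_point) measurable
  have Fm: "F \<in> borel_measurable borel" using F by simp
  have c: "(\<lambda>x. F (?f x)) = (\<lambda>(\<omega>, s). F (face_point i s \<omega>))" by auto
  have i: "integrable ?M (\<lambda>(\<omega>, s). F (face_point i s \<omega>))"
    using integrable_distr_eq[OF f Fm] F unfolding lborel_vec_face c by simp
  have e: "integral\<^sup>L lborel F = integral\<^sup>L ?M (\<lambda>(\<omega>, s). F (face_point i s \<omega>))"
    using integral_distr[OF f Fm] unfolding lborel_vec_face c .
  show "integral\<^sup>L lborel F = (\<integral>\<omega>. \<integral>s. F (face_point i s \<omega>) \<partial>lborel \<partial>trans_measure i)"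
    unfolding e by (rule integral_fst[OF i, symmetric])
  show "integrable (trans_measure i) (\<lambda>\<omega>. \<integral>s. F (face_point i s \<omega>) \<partial>lborel)"
    by (rule integrable_fst[OF i])
qed

lemma AE_not_hyperplane: "b \<in> Basis \<Longrightarrow> AE p in lborel. p \<bullet> b \<noteq> (c::real)" for b :: "'a::euclidean_space"
proof -
  assume b: "b \<in> Basis"
  have "{p. p \<bullet> b = c} \<in> sets borel" by (intro borel_closed closed_Collect_eq continuous_intros)
  then have "{p. p \<bullet> b = c} \<in> null_sets lborel"
    using negligible_standard_hyperplane[OF b, of c] by (simp add: negligible_iff_null_sets null_sets_completion_iff)
  from AE_not_in[OF this] show ?thesis by simp
qed

definition cube :: "'n \<Rightarrow> ('n \<Rightarrow> real) set" where
  "cube i = {\<omega>. \<forall>j. j \<noteq> i \<longrightarrow> 0 < \<omega> j \<and> \<omega> j < 1}"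

text \<open>
  For both choices of the lateral factor the domain \<open>DD\<close>, restricted to a cell, agrees with this open set up to a
  null set of lateral hyperplanes. Its section at a time \<open>t\<close> is a \<open>slab\<close> with centre \<open>fall g t\<close>.
\<close>

definition cylinder :: "'n::finite \<Rightarrow> real \<Rightarrow> real \<Rightarrow> real \<Rightarrow> ((real^'n) \<times> real) set" where
  "cylinder N g L T = {(y, t). 0 < t \<and> t < T \<and> \<bar>y $ N - fall g t\<bar> < L \<and> (\<forall>j. j \<noteq> N \<longrightarrow> 0 < y $ j \<and> y $ j < 1)}"

definition slab :: "'n::finite \<Rightarrow> real \<Rightarrow> real \<Rightarrow> (real^'n) set" where
  "slab N c L = {y. \<bar>y $ N - c\<bar> < L \<and> (\<forall>j. j \<noteq> N \<longrightarrow> 0 < y $ j \<and> y $ j < 1)}"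

text \<open>
  A compact box that contains the domain together with all its faces. It serves to bound continuous functions
  there.
\<close>

definition bbox :: "'n::finite \<Rightarrow> real \<Rightarrow> real \<Rightarrow> real \<Rightarrow> ((real^'n) \<times> real) set" where
  "bbox N g L T = {(y, t). 0 \<le> t \<and> t \<le> T \<and> - L \<le> y $ N \<and> y $ N \<le> L + fall g T \<and> (\<forall>j. j \<noteq> N \<longrightarrow> 0 \<le> y $ j \<and> y $ j \<le> 1)}"

lemma mem_Dt:
  fixes N :: "'n::finite"
  shows "y \<in> Dt b N g L t \<longleftrightarrow>
   \<bar>y $ N - fall g t\<bar> < L \<and> (b = Walls \<longrightarrow> (\<forall>j. j \<noteq> N \<longrightarrow> 0 < y $ j \<and> y $ j < 1))"
proof -
  let ?c = "fall g t *\<^sub>R axis N 1 :: real^'n"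
  have "y \<in> Dt b N g L t \<longleftrightarrow> y - ?c \<in> Omega b N L"
      proof
    assume "y - ?c \<in> Omega b N L"
    then have "y - ?c + ?c \<in> Dt b N g L t" unfolding Dt_def fall_def by (rule imageI)
    then show "y \<in> Dt b N g L t" by simp
  qed (auto simp: Dt_def fall_def)
  also have "\<dots> \<longleftrightarrow> \<bar>y $ N - fall g t\<bar> < L \<and> (b = Walls \<longrightarrow> (\<forall>j. j \<noteq> N \<longrightarrow> 0 < y $ j \<and> y $ j < 1))"
    by (auto simp: Omega_def axis_def)
  finally show ?thesis .
qed

lemma AE_lateral: "AE y in lborel. \<forall>j. (y :: real^'n) $ j \<noteq> 0 \<and> y $ j \<noteq> 1"
proof -
  have "AE y in lborel. (y :: real^'n) $ j \<noteq> c" for j c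
    using AE_not_hyperplane[of "axis j 1 :: real^'n" c] by (simp add: Basis_vec_real inner_axis)
  then show ?thesis by (simp add: AE_all_countable)
qed

lemma AE_lateral_time: "AE p in lborel. \<forall>j. fst (p :: (real^'n) \<times> real) $ j \<noteq> 0 \<and> fst p $ j \<noteq> 1"
proof -
  have "AE p in lborel. fst (p :: (real^'n) \<times> real) $ j \<noteq> c" for j c
    using AE_not_hyperplane[of "(axis j 1, 0) :: (real^'n) \<times> real" c]
    by (simp add: Basis_prod_def Basis_vec_real inner_prod_def inner_axis)
  then show ?thesis by (simp add: AE_all_countable)
qed

lemma open_lateral: "open {p :: (real^'n) \<times> real. \<forall>j. j \<noteq> N \<longrightarrow> 0 < fst p $ j \<and> fst p $ j < 1}"
proof -
  have "{p :: (real^'n) \<times> real. \<forall>j. j \<noteq> N \<longrightarrow> 0 < fst p $ j \<and> fst p $ j < 1}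
      = (\<Inter>j\<in>UNIV - {N}. {p. 0 < fst p $ j \<and> fst p $ j < 1})" by auto
  also have "open \<dots>"
    by (intro open_INT ballI open_Collect_conj open_Collect_less continuous_intros) simp
  finally show ?thesis .
qed

lemma closed_lateral: "closed {p :: (real^'n) \<times> real. \<forall>j. j \<noteq> N \<longrightarrow> 0 \<le> fst p $ j \<and> fst p $ j \<le> 1}"
  by (intro closed_Collect_all closed_Collect_imp closed_Collect_conj closed_Collect_le continuous_intros open_Collect_const)

lemma open_tube: "open {p :: (real^'n) \<times> real. 0 < snd p \<and> snd p < T \<and> \<bar>fst p $ N - fall g (snd p)\<bar> < L}"
  by (intro open_Collect_conj open_Collect_less continuous_intros)

lemma cylinder_alt: "cylinder N g L T = {p. 0 < snd p \<and> snd p < T \<and> \<bar>fst p $ N - fall g (snd p)\<bar> < L}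
    \<inter> {p. \<forall>j. j \<noteq> N \<longrightarrow> 0 < fst p $ j \<and> fst p $ j < 1}"
  by (auto simp: cylinder_def)

lemma open_cylinder: "open (cylinder N g L T)"
  unfolding cylinder_alt by (intro open_Int open_tube open_lateral)

lemma DD_alt: "DD b N g L T = {p. 0 < snd p \<and> snd p < T \<and> \<bar>fst p $ N - fall g (snd p)\<bar> < L}
    \<inter> {p. b = Walls \<longrightarrow> (\<forall>j. j \<noteq> N \<longrightarrow> 0 < fst p $ j \<and> fst p $ j < 1)}"
  by (auto simp: DD_def mem_Dt)

lemma open_DD: "open (DD b N g L T)"
  unfolding DD_alt using open_tube open_lateral by (cases b) (auto intro!: open_Int)

lemma DDint_eq:
  fixes F :: "(real^'n) \<times> real \<Rightarrow> real"
  assumes F: "F \<in> borel_measurable borel"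
  shows "DDint b N g L T F = (LINT p:cylinder N g L T|lborel. F p)"
proof -
  let ?S = "DD b N g L T \<inter> (cell N \<times> UNIV)"
  have "cell N \<times> UNIV = {p :: (real^'n) \<times> real. \<forall>j. j \<noteq> N \<longrightarrow> 0 \<le> fst p $ j \<and> fst p $ j \<le> 1}"
    by (auto simp: cell_def)
  then have S: "?S \<in> sets borel" using closed_lateral[of N] open_DD[of b N g L T] by (simp add: borel_open borel_closed)
  have "DDint b N g L T F = (\<integral>p. indicator ?S p *\<^sub>R F p \<partial>lborel)"
    unfolding DDint_def set_lebesgue_integral_def
    by (rule integral_completion) (use F S in \<open>auto intro!: borel_measurable_times borel_measurable_indicator\<close>)
  also have "\<dots> = (\<integral>p. indicator (cylinder N g L T) p *\<^sub>R F p \<partial>lborel)"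
  proof (rule integral_cong_AE)
    show "AE p in lborel. indicator ?S p *\<^sub>R F p = indicator (cylinder N g L T) p *\<^sub>R F p"
      using AE_lateral_time
    proof eventually_elim
      case (elim p)
      obtain y t where p: "p = (y, t)" by (cases p)
      have "p \<in> ?S \<longleftrightarrow> p \<in> cylinder N g L T"
        using elim unfolding p DD_alt cylinder_alt by (auto simp: cell_def less_le)
      then show ?case by (simp add: indicator_def)
    qed
  qed (use F S open_cylinder[of N g L T] in \<open>auto intro!: borel_measurable_times borel_measurable_indicator simp: borel_open\<close>)
  finally show ?thesis by (simp add: set_lebesgue_integral_def)
qed

section \<open>The faces of the moving domain\<close>

lemma fall_mono: "0 \<le> g \<Longrightarrow> 0 \<le> s \<Longrightarrow> s \<le> t \<Longrightarrow> fall g s \<le> fall g t"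
  unfolding fall_def by (intro mult_left_mono power_mono) auto

lemma fall_ge_0: "0 \<le> g \<Longrightarrow> 0 \<le> fall g t"
  by (simp add: fall_def)

lemma compact_bbox: "compact (bbox N g L T :: ((real^'n) \<times> real) set)"
proof -
  have "bbox N g L T = cbox (\<chi> j. if j = N then - L else 0) (\<chi> j. if j = N then L + fall g T else 1) \<times> cbox 0 T"
    by (auto simp: bbox_def mem_box_cart split: if_splits)
  then show ?thesis by (simp add: compact_Times)
qed

lemma cylinder_bbox:
  assumes "0 \<le> g" shows "cylinder N g L T \<subseteq> bbox N g L T"
proof
  fix p assume p: "p \<in> cylinder N g L T"
  obtain y t where yt: "p = (y, t)" by (cases p)
  from p have c: "0 < t" "t < T" "\<bar>y $ N - fall g t\<bar> < L" "\<And>j. j \<noteq> N \<Longrightarrow> 0 < y $ j \<and> y $ j < 1"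
    by (simp_all add: yt cylinder_def)
  have "0 \<le> fall g t" "fall g t \<le> fall g T"
    using fall_ge_0[OF assms] fall_mono[OF assms, of t T] c by simp_all
  then have "- L \<le> y $ N" "y $ N \<le> L + fall g T" using c(3) by linarith+
  then show "p \<in> bbox N g L T" using c(1,2) c(4)[THEN conjunct1, THEN less_imp_le] c(4)[THEN conjunct2, THEN less_imp_le]
    by (simp add: yt bbox_def)
qed

lemma cylinder_integrable:
  fixes F :: "(real^'n) \<times> real \<Rightarrow> real"
  assumes "0 \<le> g" "F \<in> borel_measurable borel" "\<And>p. p \<in> bbox N g L T \<Longrightarrow> \<bar>F p\<bar> \<le> C"
  shows "set_integrable lborel (cylinder N g L T) F"
proof (rule set_integrable_bounded)
  show "bounded (cylinder N g L T)"
    by (rule bounded_subset[OF compact_imp_bounded[OF compact_bbox] cylinder_bbox[OF assms(1)]])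
  show "cylinder N g L T \<in> sets borel" using open_cylinder by (rule borel_open)
  show "\<bar>F p\<bar> \<le> C" if "p \<in> cylinder N g L T" for p
    by (rule assms(3)[OF subsetD[OF cylinder_bbox[OF assms(1)] that]])
  show "F \<in> borel_measurable borel" by (rule assms(2))
qed

text \<open>
  The set of parameters over which \<open>face_measure\<close> is an image measure.
\<close>

definition face_region :: "'n::finite \<Rightarrow> real \<Rightarrow> real \<Rightarrow> real \<Rightarrow> 'n \<Rightarrow> (('n \<Rightarrow> real) \<times> real) set" where
  "face_region N g L T i = {(\<omega>, t). t \<in> {0<..<T} \<and> (\<forall>j. j \<noteq> i \<longrightarrow>
           (if j = N then \<bar>\<omega> j - 1/2 * g * t\<^sup>2\<bar> < L else 0 < \<omega> j \<and> \<omega> j < 1))}"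

lemma face_region_sets:
  fixes N i :: "'n::finite"
  shows "face_region N g L T i \<inter> space (trans_measure i \<Otimes>\<^sub>M lborel) \<in> sets (trans_measure i \<Otimes>\<^sub>M lborel)"
proof -
  let ?M = "trans_measure i \<Otimes>\<^sub>M (lborel :: real measure)"
  define A where "A j = {z \<in> space ?M. j \<noteq> i \<longrightarrow> (if j = N then \<bar>fst z j - 1/2 * g * (snd z)\<^sup>2\<bar> < L else 0 < fst z j \<and> fst z j < 1)}" for j
  have A: "A j \<in> sets ?M" for j
  proof (cases "j = i")
    case True
    then have "A j = space ?M" by (auto simp: A_def)
    then show ?thesis by (simp only: sets.top)
  next
    case False
    have [measurable]: "(\<lambda>z. fst z j) \<in> borel_measurable ?M"
      using measurable_compose[OF measurable_fst measurable_trans_component[OF False]] .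
    have [measurable]: "snd \<in> borel_measurable ?M" by measurable
    show ?thesis unfolding A_def by measurable
  qed
  have B: "{z \<in> space ?M. 0 < snd z \<and> snd z < T} \<in> sets ?M" by measurable
  have "face_region N g L T i \<inter> space ?M = {z \<in> space ?M. 0 < snd z \<and> snd z < T} \<inter> (\<Inter>j\<in>UNIV. A j)"
    unfolding face_region_def A_def by (rule set_eqI) (simp only: case_prod_unfold, fastforce)
  also have "\<dots> \<in> sets ?M" using A B by (intro sets.Int sets.finite_INT) auto
  finally show ?thesis .
qed

lemma face_region_finite:
  fixes N i :: "'n::finite"
  assumes g: "0 \<le> g" and L: "0 \<le> L" and T: "0 \<le> T"
  shows "emeasure (trans_measure i \<Otimes>\<^sub>M lborel) (face_region N g L T i \<inter> space (trans_measure i \<Otimes>\<^sub>M lborel)) < \<infinity>"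
proof -
  let ?M = "trans_measure i \<Otimes>\<^sub>M (lborel :: real measure)"
  define lo where "lo = (\<lambda>j. if j = N then - L else 0)"
  define hi where "hi = (\<lambda>j. if j = N then L + fall g T else 1)"
  let ?E = "Pi\<^sub>E (UNIV - {i}) (\<lambda>j. {lo j<..<hi j})"
  have le: "lo j \<le> hi j" for j using fall_ge_0[OF g, of T] L by (simp add: lo_def hi_def)
  have "face_region N g L T i \<inter> space ?M \<subseteq> ?E \<times> {0<..<T}"
  proof
    fix z assume z: "z \<in> face_region N g L T i \<inter> space ?M"
    obtain \<omega> t where zz: "z = (\<omega>, t)" by (cases z)
    have t: "0 < t" "t < T" and r: "\<And>j. j \<noteq> i \<Longrightarrow> (if j = N then \<bar>\<omega> j - fall g t\<bar> < L else 0 < \<omega> j \<and> \<omega> j < 1)"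
      using z unfolding zz face_region_def fall_def Int_iff mem_Collect_eq split_conv greaterThanLessThan_iff by blast+
    have f: "0 \<le> fall g t" "fall g t \<le> fall g T"
      using fall_ge_0[OF g] fall_mono[OF g, of t T] t by simp_all
    have "lo j < \<omega> j \<and> \<omega> j < hi j" if "j \<noteq> i" for j
      using r[OF that] f by (auto simp: lo_def hi_def split: if_splits)
    moreover have "\<omega> \<in> space (trans_measure i)" using z by (simp add: zz space_pair_measure)
    ultimately show "z \<in> ?E \<times> {0<..<T}" using t by (simp only: zz mem_Sigma_iff trans_box_iff) auto
  qed
  then have "emeasure ?M (face_region N g L T i \<inter> space ?M) \<le> emeasure ?M (?E \<times> {0<..<T})"
    by (rule emeasure_mono) (intro pair_measureI trans_box_sets, simp)
  also have "\<dots> = ennreal (\<Prod>j\<in>UNIV - {i}. hi j - lo j) * ennreal (T - 0)"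
    using T by (subst lborel.emeasure_pair_measure_Times) (simp_all add: trans_box_sets emeasure_trans_box le)
  also have "\<dots> < \<infinity>" by (simp add: ennreal_mult_less_top)
  finally show ?thesis .
qed

lemma face_point_bbox:
  fixes N i :: "'n::finite"
  assumes g: "0 \<le> g" and L: "0 \<le> L" and z: "(\<omega>, t) \<in> face_region N g L T i"
  shows "(face_point i (face_pos N g L (i, up) t) \<omega>, t) \<in> bbox N g L T"
proof -
  have t: "0 < t" "t < T" and r: "\<And>j. j \<noteq> i \<Longrightarrow> (if j = N then \<bar>\<omega> j - fall g t\<bar> < L else 0 < \<omega> j \<and> \<omega> j < 1)"
    using z unfolding face_region_def fall_def mem_Collect_eq split_conv greaterThanLessThan_iff by blast+
  have f: "0 \<le> fall g t" "fall g t \<le> fall g T"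
    using fall_ge_0[OF g] fall_mono[OF g, of t T] t by simp_all
  have N: "- L \<le> face_point i (face_pos N g L (i, up) t) \<omega> $ N \<and> face_point i (face_pos N g L (i, up) t) \<omega> $ N \<le> L + fall g T"
  proof (cases "N = i")
    case True
    then show ?thesis using f L by (simp add: face_pos_def fall_def)
  next
    case False
    then show ?thesis using r[of N] f by auto
  qed
  have "0 \<le> face_point i (face_pos N g L (i, up) t) \<omega> $ j \<and> face_point i (face_pos N g L (i, up) t) \<omega> $ j \<le> 1" if "j \<noteq> N" for j
    using r[of j] that by (cases "j = i") (auto simp: face_pos_def)
  then show ?thesis using t N by (simp add: bbox_def)
qed

lemma measurable_face_map:
  "(\<lambda>(\<omega>, t). (face_point i (face_pos N g L (i, up) t) \<omega>, t)) \<in> (trans_measure i \<Otimes>\<^sub>M lborel) \<rightarrow>\<^sub>M borel"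
proof -
  have [measurable]: "face_pos N g L (i, up) \<in> borel_measurable borel"
    unfolding face_pos_def by (cases "i = N") simp_all
  show ?thesis
    unfolding case_prod_unfold by (intro borel_measurable_Pair measurable_face_point) measurable
qed

lemma face_integral:
  fixes G :: "(real^'n) \<times> real \<Rightarrow> real" and i N :: 'n and up :: bool and g L T :: real
  assumes G: "G \<in> borel_measurable borel"
  defines "H \<equiv> \<lambda>z. indicator (face_region N g L T i) z *\<^sub>R G (face_point i (face_pos N g L (i, up) (snd z)) (fst z), snd z)"
  shows "(LINT p|face_measure N g L T (i, up). G p) = integral\<^sup>L (trans_measure i \<Otimes>\<^sub>M lborel) H"
    and "integrable (face_measure N g L T (i, up)) G \<longleftrightarrow> integrable (trans_measure i \<Otimes>\<^sub>M lborel) H"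
proof -
  let ?M = "trans_measure i \<Otimes>\<^sub>M (lborel :: real measure)"
  let ?f = "\<lambda>(\<omega>, t). (face_point i (face_pos N g L (i, up) t) \<omega>, t)"
  let ?R = "restrict_space ?M (face_region N g L T i)"
  have fm: "face_measure N g L T (i, up) = completion (distr ?R borel ?f)"
    by (simp only: face_measure_def face_region_def fst_conv)
  have f: "?f \<in> ?R \<rightarrow>\<^sub>M borel" by (intro measurable_restrict_space1 measurable_face_map)
  have e: "(\<lambda>x. indicator (face_region N g L T i) x *\<^sub>R G (?f x)) = H" by (auto simp: H_def)
  have Gd: "G \<in> borel_measurable (distr ?R borel ?f)" using G by simp
  have "(LINT p|face_measure N g L T (i, up). G p) = integral\<^sup>L (distr ?R borel ?f) G"
    unfolding fm by (rule integral_completion[OF Gd])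
  also have "\<dots> = integral\<^sup>L ?R (\<lambda>x. G (?f x))" by (rule integral_distr[OF f G])
  also have "\<dots> = integral\<^sup>L ?M H" unfolding e[symmetric] by (rule integral_restrict_space[OF face_region_sets])
  finally show "(LINT p|face_measure N g L T (i, up). G p) = integral\<^sup>L ?M H" .
  have "integrable (face_measure N g L T (i, up)) G \<longleftrightarrow> integrable (distr ?R borel ?f) G"
    unfolding fm by (rule integrable_completion[OF Gd])
  also have "\<dots> \<longleftrightarrow> integrable ?R (\<lambda>x. G (?f x))" by (rule integrable_distr_eq[OF f G])
  also have "\<dots> \<longleftrightarrow> integrable ?M H" unfolding e[symmetric] by (rule integrable_restrict_space[OF face_region_sets])
  finally show "integrable (face_measure N g L T (i, up)) G \<longleftrightarrow> integrable ?M H" .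
qed

lemma face_integrable:
  fixes G :: "(real^'n) \<times> real \<Rightarrow> real" and i N :: 'n
  assumes G: "G \<in> borel_measurable borel" and bd: "\<And>p. p \<in> bbox N g L T \<Longrightarrow> \<bar>G p\<bar> \<le> C"
    and gLT: "0 \<le> g" "0 \<le> L" "0 \<le> T"
  shows "integrable (trans_measure i \<Otimes>\<^sub>M lborel)
      (\<lambda>z. indicator (face_region N g L T i) z *\<^sub>R G (face_point i (face_pos N g L (i, up) (snd z)) (fst z), snd z))"
    and "integrable (face_measure N g L T (i, up)) G"
proof -
  let ?M = "trans_measure i \<Otimes>\<^sub>M (lborel :: real measure)"
  let ?R = "face_region N g L T i"
  let ?H = "\<lambda>z. indicator ?R z *\<^sub>R G (face_point i (face_pos N g L (i, up) (snd z)) (fst z), snd z)"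
  show *: "integrable ?M ?H"
  proof (rule integrableI_bounded_set[where A="?R \<inter> space ?M" and B=C])
    have "(\<lambda>z. G (face_point i (face_pos N g L (i, up) (snd z)) (fst z), snd z)) \<in> borel_measurable ?M"
      using measurable_compose[OF measurable_face_map G, of i N g L up] by (simp add: case_prod_unfold)
    then have m: "(\<lambda>z. indicator (?R \<inter> space ?M) z *\<^sub>R G (face_point i (face_pos N g L (i, up) (snd z)) (fst z), snd z)) \<in> borel_measurable ?M"
      by (intro borel_measurable_scaleR borel_measurable_indicator face_region_sets)
    show "?H \<in> borel_measurable ?M"
      by (rule measurable_cong[THEN iffD1, OF _ m]) (simp add: indicator_def)
    show "AE z in ?M. z \<in> ?R \<inter> space ?M \<longrightarrow> norm (?H z) \<le> C"
    proof (intro AE_I2 impI)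
      fix z assume "z \<in> ?R \<inter> space ?M"
      then have z: "(fst z, snd z) \<in> ?R" by simp
      show "norm (?H z) \<le> C" using bd[OF face_point_bbox[OF gLT(1,2) z, of up]] z by simp
    qed
    show "AE z in ?M. z \<notin> ?R \<inter> space ?M \<longrightarrow> ?H z = 0"
      using AE_space by eventually_elim simp
  qed (use face_region_sets face_region_finite[OF gLT] in auto)
  then show "integrable (face_measure N g L T (i, up)) G" unfolding face_integral(2)[OF G] .
qed

lemma boundary_flux_eq:
  fixes N :: "'n::finite"
  shows "boundary_flux b N g L T F = (\<Sum>i | i = N \<or> b = Walls.
    (LINT p|face_measure N g L T (i, True). F p $ i) - (LINT p|face_measure N g L T (i, False). F p $ i))"
proof -
  have f: "faces b N = {i. i = N \<or> b = Walls} \<times> UNIV" by (auto simp: faces_def)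
  have "boundary_flux b N g L T F = (\<Sum>i | i = N \<or> b = Walls. \<Sum>up\<in>UNIV.
      LINT p|face_measure N g L T (i, up). F p \<bullet> face_normal (i, up))"
    unfolding boundary_flux_def f by (simp add: sum.cartesian_product)
  also have "\<dots> = (\<Sum>i | i = N \<or> b = Walls.
    (LINT p|face_measure N g L T (i, True). F p $ i) - (LINT p|face_measure N g L T (i, False). F p $ i))"
    by (intro sum.cong refl) (simp add: UNIV_bool face_normal_def inner_axis)
  finally show ?thesis .
qed

section \<open>Integration by parts in the horizontal directions\<close>

text \<open>
  The weak equations contain first derivatives only. Stating the integrations by parts for a function with a
  given continuous derivative covers scalar test functions and the components of vector-valued ones alike.
\<close>

definition C1_derivative :: "('a::real_normed_vector \<Rightarrow> real) \<Rightarrow> ('a \<Rightarrow> 'a \<Rightarrow> real) \<Rightarrow> bool" where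
  "C1_derivative \<Psi> D \<longleftrightarrow> (\<forall>p. (\<Psi> has_derivative D p) (at p)) \<and> (\<forall>v. continuous_on UNIV (\<lambda>p. D p v))"

lemma C1_derivativeD:
  assumes "C1_derivative \<Psi> D"
  shows "(\<Psi> has_derivative D p) (at p)" "continuous_on UNIV (\<lambda>p. D p v)" "continuous_on UNIV \<Psi>"
  using assms has_derivative_continuous_on[of UNIV \<Psi> D] by (auto simp: C1_derivative_def)

lemma set_integral_open_Icc:
  fixes f :: "real \<Rightarrow> real"
  assumes "f \<in> borel_measurable borel"
  shows "(LINT x:{a<..<b}|lborel. f x) = (LINT x:{a..b}|lborel. f x)"
  unfolding set_lebesgue_integral_def
proof (rule integral_cong_AE)
  show "AE x in lborel. indicator {a<..<b} x *\<^sub>R f x = indicator {a..b} x *\<^sub>R f x"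
    using AE_lborel_singleton[of a] AE_lborel_singleton[of b]
    by eventually_elim (auto simp: indicator_def)
qed (use assms in \<open>auto intro!: borel_measurable_times borel_measurable_indicator\<close>)

lemma set_integral_open_rectangle:
  fixes f :: "real \<times> real \<Rightarrow> real"
  assumes "f \<in> borel_measurable borel"
  shows "(LINT x:{a<..<b} \<times> {c<..<d}|lborel. f x) = (LINT x:{a..b} \<times> {c..d}|lborel. f x)"
  unfolding set_lebesgue_integral_def
proof (rule integral_cong_AE)
  have B: "(1, 0) \<in> (Basis :: (real \<times> real) set)" "(0, 1) \<in> (Basis :: (real \<times> real) set)"
    by (auto simp: Basis_prod_def)
  show "AE x in lborel. indicator ({a<..<b} \<times> {c<..<d}) x *\<^sub>R f x = indicator ({a..b} \<times> {c..d}) x *\<^sub>R f x"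
    using AE_not_hyperplane[OF B(1), of a] AE_not_hyperplane[OF B(1), of b]
      AE_not_hyperplane[OF B(2), of c] AE_not_hyperplane[OF B(2), of d]
  proof eventually_elim
    case (elim x)
    then have "x \<in> {a<..<b} \<times> {c<..<d} \<longleftrightarrow> x \<in> {a..b} \<times> {c..d}"
      by (cases x) (auto simp: less_le)
    then show ?case by (simp add: indicator_def)
  qed
  have "{a<..<b} \<times> {c<..<d} \<in> sets borel" "{a..b} \<times> {c..d} \<in> sets borel"
    by (simp_all add: borel_open open_Times borel_closed closed_Times)
  then show "(\<lambda>x. indicator ({a<..<b} \<times> {c<..<d}) x *\<^sub>R f x) \<in> borel_measurable lborel"
    "(\<lambda>x. indicator ({a..b} \<times> {c..d}) x *\<^sub>R f x) \<in> borel_measurable lborel"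
    using assms by (simp_all add: borel_measurable_indicator)
qed

lemma face_line_eq: "(\<lambda>s. (face_point i s \<omega>, t)) = (\<lambda>s. (face_point i 0 \<omega>, t) + s *\<^sub>R (axis i 1, 0 :: real))"
proof
  show "(face_point i s \<omega>, t) = (face_point i 0 \<omega>, t) + s *\<^sub>R (axis i 1, 0 :: real)" for s
    by (subst face_point_alt) simp
qed

lemma face_line_derivative:
  "((\<lambda>s. (face_point i s \<omega>, t :: real)) has_vector_derivative (axis i 1, 0)) (at s)"
  by (subst face_line_eq) (auto intro!: derivative_eq_intros simp: has_vector_derivative_def)

lemma continuous_face_line: "continuous_on S (\<lambda>s. (face_point i s \<omega>, t :: real))"
  by (subst face_line_eq) (intro continuous_intros)

lemma bbox_bound:
  fixes f :: "(real^'n) \<times> real \<Rightarrow> real"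
  assumes "continuous_on UNIV f"
  obtains C where "0 \<le> C" "\<And>p. p \<in> bbox N g L T \<Longrightarrow> \<bar>f p\<bar> \<le> C"
  using continuous_compact_bound[OF continuous_on_subset[OF assms subset_UNIV] compact_bbox[of N g L T]] by blast

text \<open>
  A field that does not depend on \<open>y\<^sub>j\<close> is a constant on each segment in direction \<open>j\<close>, so that only the values of
  the test function at the two ends of the segment remain.
\<close>

lemma lateral_ibp:
  fixes H \<Psi> :: "(real^'n) \<times> real \<Rightarrow> real" and j N :: 'n
  assumes C1: "C1_derivative \<Psi> D" and j: "j \<noteq> N" and gLT: "0 \<le> g" "0 \<le> L" "0 \<le> T"
    and H: "H \<in> borel_measurable borel" "\<And>p. p \<in> bbox N g L T \<Longrightarrow> \<bar>H p\<bar> \<le> C"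
    and H_indep: "\<And>s \<omega> t. H (face_point j s \<omega>, t) = H (face_point j 0 \<omega>, t)"
  shows "set_integrable lborel (cylinder N g L T) (\<lambda>p. H p * D p (axis j 1, 0))"
    and "(LINT p:cylinder N g L T|lborel. H p * D p (axis j 1, 0)) =
      (LINT p|face_measure N g L T (j, True). H p * \<Psi> p) - (LINT p|face_measure N g L T (j, False). H p * \<Psi> p)"
proof -
  let ?M = "trans_measure j \<Otimes>\<^sub>M (lborel :: real measure)"
  let ?v = "(axis j 1, 0) :: (real^'n) \<times> real"
  obtain K1 where K1: "0 \<le> K1" "\<And>p. p \<in> bbox N g L T \<Longrightarrow> \<bar>\<Psi> p\<bar> \<le> K1"
    using bbox_bound[OF C1_derivativeD(3)[OF C1]] by blast
  obtain K2 where K2: "0 \<le> K2" "\<And>p. p \<in> bbox N g L T \<Longrightarrow> \<bar>D p ?v\<bar> \<le> K2"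
    using bbox_bound[OF C1_derivativeD(2)[OF C1]] by blast
  have m\<Psi>: "\<Psi> \<in> borel_measurable borel" "(\<lambda>p. D p ?v) \<in> borel_measurable borel"
    using C1_derivativeD(2,3)[OF C1] by (simp_all add: borel_measurable_continuous_onI)
  show i: "set_integrable lborel (cylinder N g L T) (\<lambda>p. H p * D p ?v)"
  proof (rule cylinder_integrable[OF gLT(1) borel_measurable_times[OF H(1) m\<Psi>(2)]])
    fix p assume p: "p \<in> bbox N g L T"
    show "\<bar>H p * D p ?v\<bar> \<le> C * K2"
      unfolding abs_mult by (intro mult_mono H(2) K2(2) p order_trans[OF abs_ge_zero H(2)[OF p]]) simp
  qed
  have f: "integrable ?M (\<lambda>z. indicator (face_region N g L T j) z *\<^sub>R
       ((\<lambda>p. H p * \<Psi> p) (face_point j (face_pos N g L (j, up) (snd z)) (fst z), snd z)))" for up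
  proof (rule face_integrable(1)[OF borel_measurable_times[OF H(1) m\<Psi>(1)] _ gLT])
    fix p assume p: "p \<in> bbox N g L T"
    show "\<bar>H p * \<Psi> p\<bar> \<le> C * K1"
      unfolding abs_mult by (intro mult_mono H(2) K1(2) p order_trans[OF abs_ge_zero H(2)[OF p]]) simp
  qed
  have inner: "(\<integral>s. indicator (cylinder N g L T) (face_point j s (fst z), snd z) *\<^sub>R
        (H (face_point j s (fst z), snd z) * D (face_point j s (fst z), snd z) ?v) \<partial>lborel) =
      indicator (face_region N g L T j) z *\<^sub>R
       ((\<lambda>p. H p * \<Psi> p) (face_point j (face_pos N g L (j, True) (snd z)) (fst z), snd z)) -
      indicator (face_region N g L T j) z *\<^sub>R
       ((\<lambda>p. H p * \<Psi> p) (face_point j (face_pos N g L (j, False) (snd z)) (fst z), snd z))" for z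
  proof -
    obtain \<omega> t where z: "z = (\<omega>, t)" by (cases z)
    have ind: "indicator (cylinder N g L T) (face_point j s \<omega>, t) = indicator (face_region N g L T j) z * (indicator {0<..<1} s :: real)" for s
    proof -
      have "(face_point j s \<omega>, t) \<in> cylinder N g L T \<longleftrightarrow> z \<in> face_region N g L T j \<and> s \<in> {0<..<1}"
        using j unfolding z cylinder_def face_region_def fall_def by (auto split: if_splits)
      then show ?thesis by (simp add: indicator_def)
    qed
    have c: "continuous_on S (\<lambda>s. D (face_point j s \<omega>, t) ?v)" for S
      by (rule continuous_on_compose2[OF C1_derivativeD(2)[OF C1] continuous_face_line]) simp
    have d: "((\<lambda>s. \<Psi> (face_point j s \<omega>, t)) has_real_derivative D (face_point j s \<omega>, t) ?v) (at s)" for s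
      by (rule has_derivative_line[OF C1_derivativeD(1)[OF C1] face_line_derivative])
    have "(LINT s:{0<..<1}|lborel. D (face_point j s \<omega>, t) ?v) = (LINT s:{0..1}|lborel. D (face_point j s \<omega>, t) ?v)"
      by (rule set_integral_open_Icc[OF borel_measurable_continuous_onI[OF c]])
    also have "\<dots> = \<Psi> (face_point j 1 \<omega>, t) - \<Psi> (face_point j 0 \<omega>, t)"
    proof (rule set_lebesgue_FTC[where S="{}"])
      show "continuous_on {0..1} (\<lambda>s. \<Psi> (face_point j s \<omega>, t))"
        by (rule continuous_on_compose2[OF C1_derivativeD(3)[OF C1] continuous_face_line]) simp
      show "set_integrable lborel {0..1} (\<lambda>s. D (face_point j s \<omega>, t) ?v)"
        by (rule borel_integrable_atLeastAtMost'[OF c])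
      show "((\<lambda>s. \<Psi> (face_point j s \<omega>, t)) has_real_derivative D (face_point j s \<omega>, t) ?v) (at s)" for s by (rule d)
    qed simp_all
    finally have I: "(\<integral>s. indicator {0<..<1} s * D (face_point j s \<omega>, t) ?v \<partial>lborel) = \<Psi> (face_point j 1 \<omega>, t) - \<Psi> (face_point j 0 \<omega>, t)"
      by (simp add: set_lebesgue_integral_def)
    have "(\<integral>s. indicator (cylinder N g L T) (face_point j s \<omega>, t) *\<^sub>R
        (H (face_point j s \<omega>, t) * D (face_point j s \<omega>, t) ?v) \<partial>lborel) =
      (\<integral>s. (indicator (face_region N g L T j) z * H (face_point j 0 \<omega>, t)) * (indicator {0<..<1} s * D (face_point j s \<omega>, t) ?v) \<partial>lborel)"
    proof (intro Bochner_Integration.integral_cong refl)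
      fix s
      show "indicator (cylinder N g L T) (face_point j s \<omega>, t) *\<^sub>R (H (face_point j s \<omega>, t) * D (face_point j s \<omega>, t) ?v)
        = (indicator (face_region N g L T j) z * H (face_point j 0 \<omega>, t)) * (indicator {0<..<1} s * D (face_point j s \<omega>, t) ?v)"
        unfolding ind H_indep[of s \<omega> t] by simp
    qed
    also have "\<dots> = indicator (face_region N g L T j) z * H (face_point j 0 \<omega>, t) * (\<Psi> (face_point j 1 \<omega>, t) - \<Psi> (face_point j 0 \<omega>, t))"
      unfolding integral_mult_right_zero I ..
    finally show ?thesis using j H_indep[of 1 \<omega> t] by (simp add: z face_pos_def right_diff_distrib mult.assoc)
  qed
  have "(LINT p:cylinder N g L T|lborel. H p * D p ?v) = (\<integral>z. \<integral>s. indicator (cylinder N g L T) (face_point j s (fst z), snd z) *\<^sub>R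
        (H (face_point j s (fst z), snd z) * D (face_point j s (fst z), snd z) ?v) \<partial>lborel \<partial>?M)"
    unfolding set_lebesgue_integral_def by (rule cavalieri_time(1)[OF i[unfolded set_integrable_def]])
  also have "\<dots> = (LINT p|face_measure N g L T (j, True). H p * \<Psi> p) - (LINT p|face_measure N g L T (j, False). H p * \<Psi> p)"
    unfolding inner face_integral(1)[OF borel_measurable_times[OF H(1) m\<Psi>(1)]]
    by (rule Bochner_Integration.integral_diff[OF f f])
  finally show "(LINT p:cylinder N g L T|lborel. H p * D p ?v) =
      (LINT p|face_measure N g L T (j, True). H p * \<Psi> p) - (LINT p|face_measure N g L T (j, False). H p * \<Psi> p)" .
qed

text \<open>
  On the torus the opposite sides of a cell are the same set. This is why the boundary terms of \<open>lateral_ibp\<close>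
  appear in the weak equations for walls only.
\<close>

lemma periodic_face_cancel:
  fixes H \<Psi> :: "(real^'n) \<times> real \<Rightarrow> real" and j N :: 'n
  assumes lift: "lateral_lift Periodic N \<Psi>" and j: "j \<noteq> N"
    and m: "(\<lambda>p. H p * \<Psi> p) \<in> borel_measurable borel"
    and H_indep: "\<And>s \<omega> t. H (face_point j s \<omega>, t) = H (face_point j 0 \<omega>, t)"
  shows "(LINT p|face_measure N g L T (j, True). H p * \<Psi> p) = (LINT p|face_measure N g L T (j, False). H p * \<Psi> p)"
proof -
  have "\<Psi> (face_point j 1 \<omega>, t) = \<Psi> (face_point j 0 \<omega>, t)" for \<omega> t
    using lift j by (simp add: lateral_lift_def face_point_alt[of j 1])
  then show ?thesis
    unfolding face_integral(1)[OF m] using j H_indep[of 1] by (simp add: face_pos_def)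
qed

section \<open>Integration by parts in the vertical direction\<close>

lemma cylinder_sheared_iff:
  "(face_point N (fst q + fall g (snd q)) \<omega>, snd q) \<in> cylinder N g L T \<longleftrightarrow> \<omega> \<in> cube N \<and> q \<in> {-L<..<L} \<times> {0<..<T}"
  by (cases q) (auto simp: cylinder_def cube_def abs_less_iff)

lemma cylinder_sheared_indicator:
  "indicator (cylinder N g L T) (face_point N (fst q + fall g (snd q)) \<omega>, snd q)
     = indicator (cube N) \<omega> * (indicator ({-L<..<L} \<times> {0<..<T}) q :: real)"
  using cylinder_sheared_iff[of N q g \<omega> L T] by (simp add: indicator_def)

lemma vertical_face_integral:
  fixes G :: "(real^'n) \<times> real \<Rightarrow> real" and N :: 'n
  assumes G: "G \<in> borel_measurable borel" and bd: "\<forall>p\<in>bbox N g L T. \<bar>G p\<bar> \<le> C"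
    and gLT: "0 \<le> g" "0 \<le> L" "0 \<le> T"
  shows "(LINT p|face_measure N g L T (N, up). G p) =
      (\<integral>\<omega>. indicator (cube N) \<omega> * (LINT t:{0<..<T}|lborel. G (face_point N ((if up then L else - L) + fall g t) \<omega>, t)) \<partial>trans_measure N)"
    and "integrable (trans_measure N) (\<lambda>\<omega>. indicator (cube N) \<omega> *
      (LINT t:{0<..<T}|lborel. G (face_point N ((if up then L else - L) + fall g t) \<omega>, t)))"
proof -
  interpret pair_sigma_finite "trans_measure N" "lborel :: real measure" by (rule pair_sigma_finite_trans)
  let ?H = "\<lambda>z. indicator (face_region N g L T N) z *\<^sub>R G (face_point N (face_pos N g L (N, up) (snd z)) (fst z), snd z)"
  have r: "indicator (face_region N g L T N) (\<omega>, t) = indicator (cube N) \<omega> * (indicator {0<..<T} t :: real)" for \<omega> t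
  proof -
    have "(\<omega>, t) \<in> face_region N g L T N \<longleftrightarrow> \<omega> \<in> cube N \<and> t \<in> {0<..<T}"
      unfolding face_region_def cube_def mem_Collect_eq split_conv by meson
    then show ?thesis by (simp add: indicator_def)
  qed
  have i: "integrable (trans_measure N \<Otimes>\<^sub>M lborel) (\<lambda>(\<omega>, t). ?H (\<omega>, t))"
    unfolding case_prod_unfold prod.collapse fst_conv snd_conv by (rule face_integrable(1)[OF G _ gLT]) (rule bspec[OF bd])
  have inner: "(\<integral>t. ?H (\<omega>, t) \<partial>lborel) = indicator (cube N) \<omega> * (LINT t:{0<..<T}|lborel. G (face_point N ((if up then L else - L) + fall g t) \<omega>, t))" for \<omega>
    unfolding r by (simp add: set_lebesgue_integral_def face_pos_def fall_def mult.assoc)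
  have "(LINT p|face_measure N g L T (N, up). G p) = (\<integral>z. ?H z \<partial>(trans_measure N \<Otimes>\<^sub>M lborel))"
    by (rule face_integral(1)[OF G])
  also have "\<dots> = (\<integral>\<omega>. \<integral>t. ?H (\<omega>, t) \<partial>lborel \<partial>trans_measure N)"
    unfolding integral_fst[OF i] case_prod_unfold prod.collapse ..
  finally show "(LINT p|face_measure N g L T (N, up). G p) =
      (\<integral>\<omega>. indicator (cube N) \<omega> * (LINT t:{0<..<T}|lborel. G (face_point N ((if up then L else - L) + fall g t) \<omega>, t)) \<partial>trans_measure N)"
    unfolding inner .
  show "integrable (trans_measure N) (\<lambda>\<omega>. indicator (cube N) \<omega> *
      (LINT t:{0<..<T}|lborel. G (face_point N ((if up then L else - L) + fall g t) \<omega>, t)))"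
    using integrable_fst[OF i] unfolding inner .
qed

lemma open_slab: "open (slab N c L :: (real^'n) set)"
proof -
  have "slab N c L = {y :: real^'n. \<bar>y $ N - c\<bar> < L} \<inter> (\<Inter>j\<in>UNIV - {N}. {y. 0 < y $ j \<and> y $ j < 1})"
    by (auto simp: slab_def)
  also have "open \<dots>"
    by (intro open_Int open_INT ballI open_Collect_conj open_Collect_less continuous_intros) simp
  finally show ?thesis .
qed

lemma bounded_slab: "bounded (slab N c L :: (real^'n) set)"
proof -
  have "slab N c L \<subseteq> cbox (\<chi> j. if j = N then c - L else 0) (\<chi> j. if j = N then c + L else 1)"
    by (auto simp: slab_def mem_box_cart abs_less_iff less_imp_le)
  then show ?thesis using bounded_cbox bounded_subset by blast
qed

lemma slab_integral:
  fixes F :: "real^'n \<Rightarrow> real" and N :: 'n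
  assumes F: "F \<in> borel_measurable borel" "\<forall>y\<in>slab N c L. \<bar>F y\<bar> \<le> C"
  shows "(LINT y:slab N c L|lborel. F y) =
      (\<integral>\<omega>. indicator (cube N) \<omega> * (LINT s:{c - L<..<c + L}|lborel. F (face_point N s \<omega>)) \<partial>trans_measure N)"
    and "integrable (trans_measure N) (\<lambda>\<omega>. indicator (cube N) \<omega> * (LINT s:{c - L<..<c + L}|lborel. F (face_point N s \<omega>)))"
proof -
  have i: "integrable lborel (\<lambda>y. indicator (slab N c L) y *\<^sub>R F y)"
    unfolding set_integrable_def[symmetric]
    by (rule set_integrable_bounded[OF F(1) bounded_slab borel_open[OF open_slab]]) (rule bspec[OF F(2)])
  have r: "indicator (slab N c L) (face_point N s \<omega>) = indicator (cube N) \<omega> * (indicator {c - L<..<c + L} s :: real)" for s \<omega>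
  proof -
    have "face_point N s \<omega> \<in> slab N c L \<longleftrightarrow> \<omega> \<in> cube N \<and> s \<in> {c - L<..<c + L}"
      by (auto simp: slab_def cube_def abs_less_iff)
    then show ?thesis by (simp add: indicator_def)
  qed
  have inner: "(\<integral>s. indicator (slab N c L) (face_point N s \<omega>) *\<^sub>R F (face_point N s \<omega>) \<partial>lborel)
      = indicator (cube N) \<omega> * (LINT s:{c - L<..<c + L}|lborel. F (face_point N s \<omega>))" for \<omega>
    unfolding r by (simp add: set_lebesgue_integral_def mult.assoc)
  show "(LINT y:slab N c L|lborel. F y) =
      (\<integral>\<omega>. indicator (cube N) \<omega> * (LINT s:{c - L<..<c + L}|lborel. F (face_point N s \<omega>)) \<partial>trans_measure N)"
    unfolding set_lebesgue_integral_def[of lborel "slab N c L"] cavalieri_vec(1)[OF i, of N] inner ..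
  show "integrable (trans_measure N) (\<lambda>\<omega>. indicator (cube N) \<omega> * (LINT s:{c - L<..<c + L}|lborel. F (face_point N s \<omega>)))"
    using cavalieri_vec(2)[OF i, of N] unfolding inner .
qed

lemma sheared_line_eq:
  "(\<lambda>x. (face_point N (x + c) \<omega>, t)) = (\<lambda>x. (face_point N c \<omega>, t) + x *\<^sub>R (axis N 1, 0 :: real))"
proof
  fix x
  show "(face_point N (x + c) \<omega>, t) = (face_point N c \<omega>, t) + x *\<^sub>R (axis N 1, 0 :: real)"
    by (simp add: vec_eq_iff axis_def)
qed

lemma falling_line_eq:
  "(\<lambda>t. (face_point N (x + fall g t) \<omega>, t)) = (\<lambda>t. (face_point N x \<omega> + fall g t *\<^sub>R axis N 1, t))"
proof
  fix t
  show "(face_point N (x + fall g t) \<omega>, t) = (face_point N x \<omega> + fall g t *\<^sub>R axis N 1, t)"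
    by (simp add: vec_eq_iff axis_def)
qed

lemma falling_line_derivative:
  "((\<lambda>t. (face_point N (x + fall g t) \<omega>, t)) has_vector_derivative ((g * t) *\<^sub>R axis N 1, 1)) (at t)"
proof -
  have "(fall g has_real_derivative g * t) (at t)"
    unfolding fall_def by (auto intro!: derivative_eq_intros)
  then have "((\<lambda>t. (face_point N x \<omega> + fall g t *\<^sub>R axis N 1, t)) has_vector_derivative (0 + (fall g t *\<^sub>R 0 + (g * t) *\<^sub>R axis N 1), 1)) (at t)"
    by (intro has_vector_derivative_Pair has_vector_derivative_add has_vector_derivative_const
        has_vector_derivative_scaleR has_vector_derivative_id)
  then show ?thesis by (subst falling_line_eq) simp
qed

lemma continuous_sheared_plane:
  "continuous_on S (\<lambda>q :: real \<times> real. (face_point N (fst q + fall g (snd q)) \<omega>, snd q))"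
proof -
  have e: "(\<lambda>q :: real \<times> real. (face_point N (fst q + fall g (snd q)) \<omega>, snd q))
     = (\<lambda>q. (face_point N 0 \<omega> + (fst q + fall g (snd q)) *\<^sub>R axis N 1, snd q))"
    by (simp add: fun_eq_iff vec_eq_iff axis_def)
  show ?thesis unfolding e by (intro continuous_intros)
qed

context fan
begin

text \<open>
  A field given in the falling frame, at a point of space and time in the rest frame.
\<close>

definition moving :: "'n::finite \<Rightarrow> (real \<times> real \<times> real \<Rightarrow> 'b) \<Rightarrow> (real^'n) \<times> real \<Rightarrow> 'b" where
  "moving N \<alpha> p = at_mu 1 \<alpha> (fst p $ N - fall g (snd p), snd p)"

lemma moving_face_point [simp]: "moving N \<alpha> (face_point N (x + fall g t) \<omega>, t) = at_mu 1 \<alpha> (x, t)"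
  by (simp add: moving_def)

lemma moving_measurable:
  fixes \<alpha> :: "real \<times> real \<times> real \<Rightarrow> real"
  assumes "continuous_on states \<alpha>"
  shows "moving N \<alpha> \<in> borel_measurable borel"
proof -
  have "at_mu 1 \<alpha> \<in> borel_measurable borel"
    by (rule borel_measurable_continuous_except_point[OF continuous_at_mu[OF assms]])
  moreover have "(\<lambda>p :: (real^'a) \<times> real. (fst p $ N - fall g (snd p), snd p)) \<in> borel \<rightarrow>\<^sub>M borel"
    by (intro borel_measurable_continuous_onI continuous_intros)
  ultimately have "(\<lambda>p. at_mu 1 \<alpha> (fst p $ N - fall g (snd p), snd p)) \<in> borel_measurable borel"
    by (rule measurable_compose[rotated])
  then show ?thesis by (simp add: moving_def[abs_def])
qed

lemma moving_bound:
  fixes \<alpha> :: "real \<times> real \<times> real \<Rightarrow> real"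
  assumes "continuous_on states \<alpha>"
  obtains C where "0 \<le> C" "\<And>p. p \<in> bbox N g L T \<Longrightarrow> \<bar>moving N \<alpha> p\<bar> \<le> C"
proof -
  let ?K = "{-L - fall g T..L + fall g T} \<times> {0..T} \<times> {\<rho>m..\<rho>p}"
  have "compact ?K" by (intro compact_Times compact_Icc)
  moreover have "continuous_on ?K \<alpha>" by (rule continuous_on_subset[OF assms]) auto
  ultimately obtain C where C: "0 \<le> C" "\<And>p. p \<in> ?K \<Longrightarrow> \<bar>\<alpha> p\<bar> \<le> C"
    using continuous_compact_bound by metis
  show ?thesis
  proof (rule that[OF C(1)])
    fix p :: "(real^'a) \<times> real" assume "p \<in> bbox N g L T"
    then have p: "0 \<le> snd p" "snd p \<le> T" "- L \<le> fst p $ N" "fst p $ N \<le> L + fall g T" by (auto simp: bbox_def)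
    have "0 \<le> fall g (snd p)" "fall g (snd p) \<le> fall g T"
      using fall_nonneg fall_mono[of g "snd p" T] g_pos p by simp_all
    then have "(fst p $ N - fall g (snd p), snd p, mu 1 (fst p $ N - fall g (snd p)) (snd p)) \<in> ?K"
      using p mu_ge mu_le by (simp only: mem_Sigma_iff atLeastAtMost_iff) simp
    from C(2)[OF this] show "\<bar>moving N \<alpha> p\<bar> \<le> C" by (simp add: moving_def at_mu_def)
  qed
qed

text \<open>
  For each horizontal position this is \<open>fan_ibp\<close> in the falling frame. The derivative in time along a falling
  point is \<open>\<partial>\<^sub>t + gt \<partial>\<^sub>n\<close>, and so a flux \<open>\<beta>\<close> relative to the falling frame corresponds to the flux \<open>\<beta> + gt \<alpha>\<close> in the
  rest frame. The flux \<open>\<beta>\<close> is also the one that appears on the moving top and bottom.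
\<close>

lemma vertical_ibp:
  fixes \<alpha> \<beta> \<alpha>1 \<alpha>2 R :: "real \<times> real \<times> real \<Rightarrow> real" and \<Psi> :: "(real^'n) \<times> real \<Rightarrow> real" and N :: 'n
  assumes L: "0 < L" and T: "0 < T"
    and cont: "continuous_on states \<alpha>" "continuous_on states \<beta>"
      "continuous_on states R"
      "continuous_on states \<alpha>1" "continuous_on states \<alpha>2"
    and dt: "\<And>x t. 0 < t \<Longrightarrow> t < T \<Longrightarrow> x / fall g t + 1 \<noteq> speed \<rho>m \<Longrightarrow> x / fall g t + 1 \<noteq> speed \<rho>p \<Longrightarrow>
      ((\<lambda>t. at_mu 1 \<alpha> (x, t)) has_real_derivative at_mu 1 \<alpha>1 (x, t) + at_mu 1 \<alpha>2 (x, t) * mu_t 1 x t) (at t)"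
    and dx: "\<And>x t. 0 < t \<Longrightarrow> t < T \<Longrightarrow> x / fall g t + 1 \<noteq> speed \<rho>m \<Longrightarrow> x / fall g t + 1 \<noteq> speed \<rho>p \<Longrightarrow>
      ((\<lambda>x. at_mu 1 \<beta> (x, t)) has_real_derivative
        at_mu 1 R (x, t) - (at_mu 1 \<alpha>1 (x, t) + at_mu 1 \<alpha>2 (x, t) * mu_t 1 x t)) (at x)"
    and C1: "C1_derivative \<Psi> D"
    and \<Psi>T: "\<And>y. \<bar>y $ N - fall g T\<bar> < L \<Longrightarrow> (\<And>j. j \<noteq> N \<Longrightarrow> 0 < y $ j \<and> y $ j < 1) \<Longrightarrow> \<Psi> (y, T) = 0"
  defines "F \<equiv> \<lambda>p. moving N \<alpha> p * D p (0, 1) + (moving N \<beta> p + g * snd p * moving N \<alpha> p) * D p (axis N 1, 0)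
      + moving N R p * \<Psi> p"
  shows "set_integrable lborel (cylinder N g L T) F"
    and "(LINT p:cylinder N g L T|lborel. F p) =
      (LINT p|face_measure N g L T (N, True). moving N \<beta> p * \<Psi> p) - (LINT p|face_measure N g L T (N, False). moving N \<beta> p * \<Psi> p)
      - (LINT y:slab N 0 L|lborel. \<alpha> (y $ N, 0, rho0 \<rho>m \<rho>p (y $ N)) * \<Psi> (y, 0))"
proof -
  let ?et = "(0, 1) :: (real^'n) \<times> real" and ?en = "(axis N 1, 0) :: (real^'n) \<times> real"
  have g0: "0 \<le> g" "0 \<le> L" "0 \<le> T" using g_pos L T by auto
  have c\<Psi>: "continuous_on UNIV \<Psi>" "continuous_on UNIV (\<lambda>p. D p ?et)" "continuous_on UNIV (\<lambda>p. D p ?en)"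
    using C1_derivativeD[OF C1] by auto
  have m: "moving N \<alpha> \<in> borel_measurable borel" "moving N \<beta> \<in> borel_measurable borel" "moving N R \<in> borel_measurable borel"
    "\<Psi> \<in> borel_measurable borel" "(\<lambda>p. D p ?et) \<in> borel_measurable borel" "(\<lambda>p. D p ?en) \<in> borel_measurable borel"
    "(\<lambda>p :: (real^'n) \<times> real. g * snd p) \<in> borel_measurable borel"
    by (intro moving_measurable cont borel_measurable_continuous_onI c\<Psi> continuous_intros)+
  have bd: "\<exists>C\<ge>0. \<forall>p\<in>bbox N g L T. \<bar>f p\<bar> \<le> C" if "continuous_on UNIV f" for f :: "(real^'n) \<times> real \<Rightarrow> real"
    using bbox_bound[OF that, of N g L T] by metis
  have bm: "\<exists>C\<ge>0. \<forall>p\<in>bbox N g L T. \<bar>moving N f p\<bar> \<le> C" if "continuous_on states f" for f :: "real \<times> real \<times> real \<Rightarrow> real"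
    using moving_bound[OF that, where N=N and L=L and T=T] by metis
  have mult_bd: "\<exists>C\<ge>0. \<forall>p\<in>bbox N g L T. \<bar>f p * h p\<bar> \<le> C"
    if f: "\<exists>C\<ge>0. \<forall>p\<in>bbox N g L T. \<bar>f p\<bar> \<le> C" and h: "\<exists>C\<ge>0. \<forall>p\<in>bbox N g L T. \<bar>h p\<bar> \<le> C" for f h :: "(real^'n) \<times> real \<Rightarrow> real"
  proof -
    obtain A B where "0 \<le> A" "0 \<le> B" "\<And>p. p\<in>bbox N g L T \<Longrightarrow> \<bar>f p\<bar> \<le> A" "\<And>p. p\<in>bbox N g L T \<Longrightarrow> \<bar>h p\<bar> \<le> B"
      using f h by blast
    then show ?thesis by (intro exI[of _ "A * B"]) (auto simp: abs_mult intro!: mult_mono)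
  qed
  have add_bd: "\<exists>C\<ge>0. \<forall>p\<in>bbox N g L T. \<bar>f p + h p\<bar> \<le> C"
    if f: "\<exists>C\<ge>0. \<forall>p\<in>bbox N g L T. \<bar>f p\<bar> \<le> C" and h: "\<exists>C\<ge>0. \<forall>p\<in>bbox N g L T. \<bar>h p\<bar> \<le> C" for f h :: "(real^'n) \<times> real \<Rightarrow> real"
  proof -
    obtain A B where "0 \<le> A" "0 \<le> B" "\<And>p. p\<in>bbox N g L T \<Longrightarrow> \<bar>f p\<bar> \<le> A" "\<And>p. p\<in>bbox N g L T \<Longrightarrow> \<bar>h p\<bar> \<le> B"
      using f h by blast
    then show ?thesis by (intro exI[of _ "A + B"]) (auto intro!: order_trans[OF abs_triangle_ineq] add_mono)
  qed
  have mF: "F \<in> borel_measurable borel"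
    unfolding F_def by (intro borel_measurable_add borel_measurable_times m)
  have "\<exists>C\<ge>0. \<forall>p\<in>bbox N g L T. \<bar>F p\<bar> \<le> C"
    unfolding F_def by (intro add_bd mult_bd bm bd cont c\<Psi> continuous_intros)
  then obtain CF where CF: "\<forall>p \<in> bbox N g L T. \<bar>F p\<bar> \<le> CF" by blast
  show iF: "set_integrable lborel (cylinder N g L T) F"
    by (rule cylinder_integrable[OF g0(1) mF]) (rule bspec[OF CF])
  have m\<beta>: "(\<lambda>p. moving N \<beta> p * \<Psi> p) \<in> borel_measurable borel" by (intro borel_measurable_times m)
  obtain C\<beta> where C\<beta>: "\<forall>p\<in>bbox N g L T. \<bar>moving N \<beta> p * \<Psi> p\<bar> \<le> C\<beta>"
    using mult_bd[OF bm[OF cont(2)] bd[OF c\<Psi>(1)]] by blast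
  define U where "U up \<omega> = (LINT t:{0<..<T}|lborel. at_mu 1 \<beta> (if up then L else - L, t) * \<Psi> (face_point N ((if up then L else - L) + fall g t) \<omega>, t))" for up \<omega>
  have face: "(LINT p|face_measure N g L T (N, up). moving N \<beta> p * \<Psi> p) = (\<integral>\<omega>. indicator (cube N) \<omega> * U up \<omega> \<partial>trans_measure N)"
    "integrable (trans_measure N) (\<lambda>\<omega>. indicator (cube N) \<omega> * U up \<omega>)" for up
    using vertical_face_integral[OF m\<beta> C\<beta> g0, of up] unfolding moving_face_point U_def by blast+
  define \<alpha>0 where "\<alpha>0 x = \<alpha> (x, 0, rho0 \<rho>m \<rho>p x)" for x
  have \<alpha>0_eq: "\<alpha>0 x = at_mu 1 \<alpha> (x, 0)" for x by (simp add: \<alpha>0_def at_mu_def mu_0)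
  define V where "V \<omega> = (LINT x:{-L<..<L}|lborel. \<alpha>0 x * \<Psi> (face_point N x \<omega>, 0))" for \<omega>
  have m0: "(\<lambda>y :: real^'n. \<alpha>0 (y $ N) * \<Psi> (y, 0)) \<in> borel_measurable borel"
  proof (rule borel_measurable_times)
    have "(\<lambda>y :: real^'n. moving N \<alpha> (y, 0)) \<in> borel_measurable borel"
      by (rule measurable_compose[OF borel_measurable_continuous_onI m(1)]) (intro continuous_intros)
    then show "(\<lambda>y :: real^'n. \<alpha>0 (y $ N)) \<in> borel_measurable borel" by (simp add: \<alpha>0_eq moving_def fall_def)
    show "(\<lambda>y. \<Psi> (y, 0)) \<in> borel_measurable borel"
      by (rule measurable_compose[OF borel_measurable_continuous_onI m(4)]) (intro continuous_intros)
  qed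
  obtain C0 where C0: "\<And>p. p \<in> bbox N g L T \<Longrightarrow> \<bar>moving N \<alpha> p * \<Psi> p\<bar> \<le> C0"
    using mult_bd[OF bm[OF cont(1)] bd[OF c\<Psi>(1)]] by blast
  have b0: "\<forall>y\<in>slab N 0 L. \<bar>\<alpha>0 (y $ N) * \<Psi> (y, 0)\<bar> \<le> C0"
  proof
    fix y :: "real^'n" assume y: "y \<in> slab N 0 L"
    have "(y, 0) \<in> bbox N g L T" using y T fall_nonneg[of T]
      by (auto simp: slab_def bbox_def abs_less_iff less_imp_le)
    from C0[OF this] show "\<bar>\<alpha>0 (y $ N) * \<Psi> (y, 0)\<bar> \<le> C0" by (simp add: \<alpha>0_eq moving_def fall_def)
  qed
  have slab: "(LINT y:slab N 0 L|lborel. \<alpha>0 (y $ N) * \<Psi> (y, 0)) = (\<integral>\<omega>. indicator (cube N) \<omega> * V \<omega> \<partial>trans_measure N)"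
    "integrable (trans_measure N) (\<lambda>\<omega>. indicator (cube N) \<omega> * V \<omega>)"
    using slab_integral[OF m0 b0] unfolding V_def by simp_all
  have inner: "(\<integral>q. indicator (cylinder N g L T) (face_point N (fst q + fall g (snd q)) \<omega>, snd q) *\<^sub>R F (face_point N (fst q + fall g (snd q)) \<omega>, snd q) \<partial>lborel)
      = indicator (cube N) \<omega> * U True \<omega> - indicator (cube N) \<omega> * U False \<omega> - indicator (cube N) \<omega> * V \<omega>" for \<omega>
  proof (cases "\<omega> \<in> cube N")
    case False
    then show ?thesis unfolding cylinder_sheared_indicator by simp
  next
    case True
    let ?P = "\<lambda>q :: real \<times> real. (face_point N (fst q + fall g (snd q)) \<omega>, snd q)"
    define \<psi> where "\<psi> q = \<Psi> (?P q)" for q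
    define \<psi>x where "\<psi>x q = D (?P q) ?en" for q
    (* The derivative along a falling point. *)
    define \<psi>t where "\<psi>t q = D (?P q) ?et + g * snd q * D (?P q) ?en" for q
    have cc: "continuous_on UNIV (\<lambda>q. f (?P q))" if "continuous_on UNIV f" for f :: "(real^'n) \<times> real \<Rightarrow> real"
      by (rule continuous_on_compose2[OF that continuous_sheared_plane]) simp
    have c: "continuous_on UNIV \<psi>" "continuous_on UNIV \<psi>x" "continuous_on UNIV \<psi>t"
      unfolding \<psi>_def \<psi>x_def \<psi>t_def by (intro cc c\<Psi> continuous_intros)+
    have ibp: "(LINT p:{-L..L} \<times> {0..T}|lborel. at_mu 1 \<alpha> p * \<psi>t p + at_mu 1 \<beta> p * \<psi>x p + at_mu 1 R p * \<psi> p) =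
      (LINT t:{0..T}|lborel. at_mu 1 \<beta> (L, t) * \<psi> (L, t) - at_mu 1 \<beta> (-L, t) * \<psi> (-L, t))
      - (LINT x:{-L..L}|lborel. at_mu 1 \<alpha> (x, 0) * \<psi> (x, 0))"
    proof (rule fan_ibp[OF L T cont dt dx c])
      fix x t
      have "((\<lambda>x. (face_point N (x + fall g t) \<omega>, t)) has_vector_derivative ?en) (at x)"
        unfolding sheared_line_eq by (auto intro!: derivative_eq_intros simp: has_vector_derivative_def)
      from has_derivative_line[OF C1_derivativeD(1)[OF C1] this]
      show "((\<lambda>x. \<psi> (x, t)) has_real_derivative \<psi>x (x, t)) (at x)" by (simp add: \<psi>_def \<psi>x_def)
      interpret Dp: bounded_linear "D (?P (x, t))"
        by (rule has_derivative_bounded_linear[OF C1_derivativeD(1)[OF C1]])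
      have "((g * t) *\<^sub>R axis N 1, 1) = ?et + (g * t) *\<^sub>R ?en" by simp
      then have "D (?P (x, t)) ((g * t) *\<^sub>R axis N 1, 1) = \<psi>t (x, t)"
        by (simp only: Dp.add Dp.scaleR \<psi>t_def) simp
      then show "((\<lambda>t. \<psi> (x, t)) has_real_derivative \<psi>t (x, t)) (at t)"
        using has_derivative_line[OF C1_derivativeD(1)[OF C1] falling_line_derivative[of N x g \<omega> t]]
        by (simp add: \<psi>_def)
    next
      fix x assume "x \<in> {-L<..<L}"
      then show "\<psi> (x, T) = 0" unfolding \<psi>_def
        using True by (simp, intro \<Psi>T) (auto simp: cube_def)
    qed
    have FP: "F (?P q) = at_mu 1 \<alpha> q * \<psi>t q + at_mu 1 \<beta> q * \<psi>x q + at_mu 1 R q * \<psi> q" for q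
      unfolding F_def moving_face_point \<psi>_def \<psi>x_def \<psi>t_def by (simp add: algebra_simps)
    have mq: "(\<lambda>q. F (?P q)) \<in> borel_measurable borel"
      by (rule measurable_compose[OF borel_measurable_continuous_onI[OF continuous_sheared_plane] mF])
    have "(\<integral>q. indicator (cylinder N g L T) (?P q) *\<^sub>R F (?P q) \<partial>lborel) = (LINT q:{-L<..<L} \<times> {0<..<T}|lborel. F (?P q))"
      unfolding cylinder_sheared_indicator set_lebesgue_integral_def using True by simp
    also have "\<dots> = (LINT q:{-L..L} \<times> {0..T}|lborel. F (?P q))" by (rule set_integral_open_rectangle[OF mq])
    also have "\<dots> = (LINT t:{0..T}|lborel. at_mu 1 \<beta> (L, t) * \<psi> (L, t) - at_mu 1 \<beta> (-L, t) * \<psi> (-L, t))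
      - (LINT x:{-L..L}|lborel. at_mu 1 \<alpha> (x, 0) * \<psi> (x, 0))" unfolding FP by (rule ibp)
    also have "(LINT x:{-L..L}|lborel. at_mu 1 \<alpha> (x, 0) * \<psi> (x, 0)) = V \<omega>"
    proof -
      have "(\<lambda>x. at_mu 1 \<alpha> (x, 0) * \<psi> (x, 0)) \<in> borel_measurable borel"
      proof (rule borel_measurable_times)
        show "(\<lambda>x. at_mu 1 \<alpha> (x, 0)) \<in> borel_measurable borel"
          by (rule measurable_compose[OF borel_measurable_continuous_onI
                borel_measurable_continuous_except_point[OF continuous_at_mu[OF cont(1)]]]) (intro continuous_intros)
        show "(\<lambda>x. \<psi> (x, 0)) \<in> borel_measurable borel"
          by (rule measurable_compose[OF borel_measurable_continuous_onI borel_measurable_continuous_onI[OF c(1)]]) (intro continuous_intros)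
      qed
      from set_integral_open_Icc[OF this, of "-L" L] show ?thesis
        by (simp add: V_def \<alpha>0_eq \<psi>_def fall_def)
    qed
    also have "(LINT t:{0..T}|lborel. at_mu 1 \<beta> (L, t) * \<psi> (L, t) - at_mu 1 \<beta> (-L, t) * \<psi> (-L, t)) = U True \<omega> - U False \<omega>"
    proof -
      have ct: "continuous_on UNIV (\<lambda>t. at_mu 1 \<beta> (l, t) * \<psi> (l, t))" if "l \<noteq> 0" for l
      proof (intro continuous_on_mult)
        show "continuous_on UNIV (\<lambda>t. at_mu 1 \<beta> (l, t))"
          by (rule continuous_on_compose2[OF continuous_at_mu[OF cont(2)]]) (use that in \<open>auto intro!: continuous_intros\<close>)
        show "continuous_on UNIV (\<lambda>t. \<psi> (l, t))"
          by (rule continuous_on_compose2[OF c(1)]) (auto intro!: continuous_intros)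
      qed
      have it: "set_integrable lborel {0..T} (\<lambda>t. at_mu 1 \<beta> (l, t) * \<psi> (l, t))"
        "(LINT t:{0..T}|lborel. at_mu 1 \<beta> (l, t) * \<psi> (l, t)) = (LINT t:{0<..<T}|lborel. at_mu 1 \<beta> (l, t) * \<psi> (l, t))"
        if "l \<noteq> 0" for l
        using borel_integrable_atLeastAtMost'[OF continuous_on_subset[OF ct[OF that] subset_UNIV]]
          set_integral_open_Icc[OF borel_measurable_continuous_onI[OF ct[OF that]]] by simp_all
      have "L \<noteq> 0" "- L \<noteq> 0" using L by auto
      from set_integral_diff(2)[OF it(1)[OF this(1)] it(1)[OF this(2)]] it(2)[OF this(1)] it(2)[OF this(2)]
      show ?thesis by (simp add: U_def \<psi>_def)
    qed
    finally show ?thesis using True by simp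
  qed
  have "(LINT p:cylinder N g L T|lborel. F p) = (\<integral>\<omega>. indicator (cube N) \<omega> * U True \<omega> - indicator (cube N) \<omega> * U False \<omega> - indicator (cube N) \<omega> * V \<omega> \<partial>trans_measure N)"
    unfolding inner[symmetric] set_lebesgue_integral_def
    by (rule cavalieri_sheared(1)[OF _ iF[unfolded set_integrable_def]]) (intro continuous_intros)
  also have "\<dots> = (LINT p|face_measure N g L T (N, True). moving N \<beta> p * \<Psi> p) - (LINT p|face_measure N g L T (N, False). moving N \<beta> p * \<Psi> p)
      - (LINT y:slab N 0 L|lborel. \<alpha>0 (y $ N) * \<Psi> (y, 0))"
    unfolding face(1) slab(1) using face(2) slab(2) by simp
  finally show "(LINT p:cylinder N g L T|lborel. F p) =
      (LINT p|face_measure N g L T (N, True). moving N \<beta> p * \<Psi> p) - (LINT p|face_measure N g L T (N, False). moving N \<beta> p * \<Psi> p)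
      - (LINT y:slab N 0 L|lborel. \<alpha> (y $ N, 0, rho0 \<rho>m \<rho>p (y $ N)) * \<Psi> (y, 0))"
    unfolding \<alpha>0_def .
qed

end

section \<open>The fields of the subsolution\<close>

context fan
begin

text \<open>
  A primitive of \<open>(a')\<^sup>2\<close>. In the fan the momentum balance prescribes for \<open>\<partial>\<^sub>x q\<close> a combination of \<open>\<mu>\<close>, \<open>a(\<mu>)\<close>,
  \<open>a'(\<mu>) \<partial>\<^sub>x \<mu>\<close> and \<open>(a'(\<mu>))\<^sup>2 \<partial>\<^sub>x \<mu>\<close>, and integrating the last term leads to this function.
\<close>

definition daf2 :: "real \<Rightarrow> real" where
  "daf2 r = r - 2 * (\<rho>m * \<rho>p) / (\<rho>m + \<rho>p - r) + (\<rho>m * \<rho>p)\<^sup>2 / (3 * (\<rho>m + \<rho>p - r) ^ 3)"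

definition ddaf :: "real \<Rightarrow> real" where "ddaf r = - 2 * (\<rho>m * \<rho>p) / (\<rho>m + \<rho>p - r) ^ 3"

text \<open>
  The fields in the falling frame, as functions of \<open>x = y\<^sub>n - \<tau>\<close>, \<open>t\<close> and \<open>r = \<mu>\<close>. Here \<open>f_f\<close> is the coefficient \<open>f\<close> of
  \<open>\<sigma>\<close>, simplified by \<open>m = gt (r - \<lambda> a(r))\<close>. The pressure \<open>q_f\<close> is the solution of the momentum balance, which is
  unique up to a function of time, and \<open>h_f\<close> is the energy flux prescribed in the mixing zone, in the form that
  remains meaningful where \<open>a = 0\<close>.
\<close>

definition mass_f :: "real \<times> real \<times> real \<Rightarrow> real" where "mass_f = (\<lambda>(x, t, r). r)"
definition m_f :: "real \<times> real \<times> real \<Rightarrow> real" where "m_f = (\<lambda>(x, t, r). g * t * (r - lam * af r))"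
definition f_f :: "real \<times> real \<times> real \<Rightarrow> real" where
  "f_f = (\<lambda>(x, t, r). g\<^sup>2 * t\<^sup>2 * (r - (2 * lam - lam\<^sup>2) * af r))"
definition q_f :: "real \<times> real \<times> real \<Rightarrow> real" where
  "q_f = (\<lambda>(x, t, r). g\<^sup>2 * t\<^sup>2 * (3/2 * lam\<^sup>2 * daf2 r - (lam\<^sup>2 + lam/2) * af r) - g * x * (r - lam * af r))"
definition e_f :: "real \<times> real \<times> real \<Rightarrow> real" where "e_f = (\<lambda>v. f_f v / 2)"
definition h_f :: "real \<times> real \<times> real \<Rightarrow> real" where
  "h_f = (\<lambda>(x, t, r). (e_f (x, t, r) + q_f (x, t, r)) * (g * t)
     - g ^ 3 * t ^ 3 / 2 * lam * af r * (1 - 2 * lam + lam\<^sup>2 * daf r))"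
definition nu_f :: "real \<times> real \<times> real \<Rightarrow> real" where
  "nu_f = (\<lambda>(x, t, r). lam * (2 * lam - 1) * g\<^sup>2 * t * af r)"

lemma DERIV_inverse_gap:
  assumes "r \<le> \<rho>p"
  shows "((\<lambda>r. inverse (\<rho>m + \<rho>p - r)) has_real_derivative (inverse (\<rho>m + \<rho>p - r))\<^sup>2) (at r)"
  using gap_pos[OF assms] by (auto intro!: derivative_eq_intros simp: power2_eq_square)

lemma DERIV_af:
  assumes "r \<le> \<rho>p" shows "(af has_real_derivative daf r) (at r)"
proof -
  define v where "v = inverse (\<rho>m + \<rho>p - r)"
  have "((\<lambda>r. r - \<rho>m * \<rho>p * inverse (\<rho>m + \<rho>p - r)) has_real_derivative 1 - \<rho>m * \<rho>p * v\<^sup>2) (at r)"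
    unfolding v_def by (intro DERIV_diff DERIV_ident DERIV_cmult DERIV_inverse_gap assms)
  moreover have "daf r = 1 - \<rho>m * \<rho>p * v\<^sup>2"
    by (simp add: daf_def v_def divide_inverse power_inverse)
  ultimately show ?thesis by (simp add: af_def[abs_def] divide_inverse)
qed

lemma DERIV_daf:
  assumes "r \<le> \<rho>p" shows "(daf has_real_derivative ddaf r) (at r)"
proof -
  define v where "v = inverse (\<rho>m + \<rho>p - r)"
  have "((\<lambda>r. 1 - \<rho>m * \<rho>p * (inverse (\<rho>m + \<rho>p - r))\<^sup>2) has_real_derivative
      0 - \<rho>m * \<rho>p * (of_nat 2 * (v\<^sup>2 * v ^ (2 - Suc 0)))) (at r)"
    unfolding v_def by (intro DERIV_diff DERIV_const DERIV_cmult DERIV_power DERIV_inverse_gap assms)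
  moreover have "0 - \<rho>m * \<rho>p * (of_nat 2 * (v\<^sup>2 * v ^ (2 - Suc 0))) = ddaf r"
    by (simp add: ddaf_def v_def divide_inverse power_inverse power2_eq_square power3_eq_cube)
  moreover have "daf = (\<lambda>r. 1 - \<rho>m * \<rho>p * (inverse (\<rho>m + \<rho>p - r))\<^sup>2)"
    by (simp add: fun_eq_iff daf_def divide_inverse power_inverse)
  ultimately show ?thesis by simp
qed

lemma DERIV_daf2: assumes "r \<le> \<rho>p" shows "(daf2 has_real_derivative (daf r)\<^sup>2) (at r)"
proof -
  define P where "P = \<rho>m * \<rho>p"
  define v where "v = inverse (\<rho>m + \<rho>p - r)"
  have "((\<lambda>r. r - 2 * P * inverse (\<rho>m + \<rho>p - r) + P\<^sup>2 / 3 * inverse (\<rho>m + \<rho>p - r) ^ 3) has_real_derivative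
      1 - 2 * P * v\<^sup>2 + P\<^sup>2 / 3 * (of_nat 3 * (v\<^sup>2 * v ^ (3 - Suc 0)))) (at r)"
    unfolding v_def
    by (intro DERIV_add DERIV_diff DERIV_ident DERIV_const DERIV_cmult DERIV_power DERIV_inverse_gap assms)
  moreover have "1 - 2 * P * v\<^sup>2 + P\<^sup>2 / 3 * (of_nat 3 * (v\<^sup>2 * v ^ (3 - Suc 0))) = (1 - P * v\<^sup>2)\<^sup>2"
    by (simp add: power2_eq_square algebra_simps)
  moreover have "daf2 = (\<lambda>r. r - 2 * P * inverse (\<rho>m + \<rho>p - r) + P\<^sup>2 / 3 * inverse (\<rho>m + \<rho>p - r) ^ 3)"
    unfolding fun_eq_iff daf2_def P_def divide_inverse inverse_mult_distrib power_inverse by (simp only: mult_ac simp_thms)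
  moreover have "daf r = 1 - P * v\<^sup>2"
    by (simp add: daf_def P_def v_def divide_inverse power_inverse)
  ultimately show ?thesis by simp
qed

lemma continuous_on_J:
  "continuous_on {\<rho>m..\<rho>p} af" "continuous_on {\<rho>m..\<rho>p} daf" "continuous_on {\<rho>m..\<rho>p} daf2"
  using DERIV_af DERIV_daf DERIV_daf2
  by (auto intro!: continuous_at_imp_continuous_on DERIV_isCont)

lemma continuous_on_state:
  assumes "continuous_on {\<rho>m..\<rho>p} f"
  shows "continuous_on states (\<lambda>v :: real \<times> real \<times> real. f (snd (snd v)))"
  by (rule continuous_on_compose2[OF assms]) (auto intro!: continuous_intros)

lemmas continuous_state = continuous_on_state[OF continuous_on_J(1)] continuous_on_state[OF continuous_on_J(2)]
  continuous_on_state[OF continuous_on_J(3)]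

lemma continuous_fields:
  "continuous_on states mass_f" "continuous_on states m_f"
  "continuous_on states f_f" "continuous_on states q_f"
  "continuous_on states e_f" "continuous_on states h_f"
  "continuous_on states nu_f"
  unfolding mass_f_def m_f_def f_f_def q_f_def e_f_def h_f_def nu_f_def case_prod_unfold
  by (intro continuous_intros continuous_state; simp)+

text \<open>
  Either the wave is locally constant and \<open>a\<close> vanishes, or \<open>x = - \<lambda> a'(\<mu>) \<tau>\<close>. Differentiating the latter relation
  in \<open>x\<close> gives \<open>\<partial>\<^sub>x a'(\<mu>) = - 1 / (\<lambda> \<tau>)\<close>. These two relations are all that the balance laws need to know about the
  wave.
\<close>

lemma slope_cases:
  assumes "0 < t" "x / fall g t + 1 \<noteq> speed \<rho>m" "x / fall g t + 1 \<noteq> speed \<rho>p"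
  obtains "slope 1 x t = 0" "af (mu 1 x t) = 0"
  | "x = - lam * daf (mu 1 x t) * (1/2 * g * t\<^sup>2)" "lam * g * t\<^sup>2 * (ddaf (mu 1 x t) * slope 1 x t) = - 2"
proof -
  consider "x / fall g t + 1 < speed \<rho>m" | "speed \<rho>p < x / fall g t + 1"
    | "speed \<rho>m < x / fall g t + 1" "x / fall g t + 1 < speed \<rho>p" using assms by linarith
  then show ?thesis
  proof cases
    case 1
    then show ?thesis using mu_low[of t x 1] assms by (intro that(1)) (simp_all add: slope_def)
  next
    case 2
    then show ?thesis using mu_high[of t x 1] assms by (intro that(1)) (simp_all add: slope_def)
  next
    case 3
    have x: "x = - lam * daf (mu 1 x t) * (1/2 * g * t\<^sup>2)"
      using mu_fan[of t x 1] 3 assms by (simp add: speed_def fall_def)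
    have s: "\<rho>m + \<rho>p - mu 1 x t > 0" by (rule gap_pos[OF mu_le])
    have "ddaf (mu 1 x t) * slope 1 x t = - 1 / (lam * fall g t)"
      using 3 s fall_pos[of t] assms(1) lam_pos rho_pos rhop_pos by (simp add: slope_def ddaf_def field_simps)
    then have "lam * g * t\<^sup>2 * (ddaf (mu 1 x t) * slope 1 x t) = - 2"
      using assms(1) lam_pos g_pos by (simp add: fall_def field_simps)
    with x show ?thesis by (rule that(2))
  qed
qed

lemma mu_t_1: "0 < t \<Longrightarrow> mu_t 1 x t = lam * daf (mu 1 x t) * g * t * slope 1 x t"
  by (simp add: mu_t_eq speed_def)

lemma DERIV_af_mu_t:
  assumes "0 < t" "x / fall g t + 1 \<noteq> speed \<rho>m" "x / fall g t + 1 \<noteq> speed \<rho>p"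
  shows "((\<lambda>t. mu 1 x t) has_real_derivative mu_t 1 x t) (at t)"
    "((\<lambda>t. af (mu 1 x t)) has_real_derivative daf (mu 1 x t) * mu_t 1 x t) (at t)"
proof -
  show d: "((\<lambda>t. mu 1 x t) has_real_derivative mu_t 1 x t) (at t)"
    unfolding mu_t_def by (rule DERIV_mu_t[OF assms])
  show "((\<lambda>t. af (mu 1 x t)) has_real_derivative daf (mu 1 x t) * mu_t 1 x t) (at t)"
    by (rule DERIV_chain2[where f=af, OF DERIV_af[OF mu_le] d])
qed

lemma DERIV_fields_x:
  assumes "0 < t" "x / fall g t + 1 \<noteq> speed \<rho>m" "x / fall g t + 1 \<noteq> speed \<rho>p"
  shows "((\<lambda>x. mu 1 x t) has_real_derivative slope 1 x t) (at x)"
    "((\<lambda>x. af (mu 1 x t)) has_real_derivative daf (mu 1 x t) * slope 1 x t) (at x)"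
    "((\<lambda>x. daf (mu 1 x t)) has_real_derivative ddaf (mu 1 x t) * slope 1 x t) (at x)"
    "((\<lambda>x. daf2 (mu 1 x t)) has_real_derivative (daf (mu 1 x t))\<^sup>2 * slope 1 x t) (at x)"
proof -
  show d: "((\<lambda>x. mu 1 x t) has_real_derivative slope 1 x t) (at x)"
    by (rule DERIV_mu_x[OF _ assms(2,3)]) (use assms in simp)
  show "((\<lambda>x. af (mu 1 x t)) has_real_derivative daf (mu 1 x t) * slope 1 x t) (at x)"
    by (rule DERIV_chain2[where f=af, OF DERIV_af[OF mu_le] d])
  show "((\<lambda>x. daf (mu 1 x t)) has_real_derivative ddaf (mu 1 x t) * slope 1 x t) (at x)"
    by (rule DERIV_chain2[where f=daf, OF DERIV_daf[OF mu_le] d])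
  show "((\<lambda>x. daf2 (mu 1 x t)) has_real_derivative (daf (mu 1 x t))\<^sup>2 * slope 1 x t) (at x)"
    by (rule DERIV_chain2[where f=daf2, OF DERIV_daf2[OF mu_le] d])
qed

text \<open>
  The fluxes relative to the falling frame are the fluxes in the rest frame minus \<open>gt\<close> times the density. The
  fields with suffix \<open>1\<close> and \<open>2\<close> are the explicit part of a time derivative and its coefficient of \<open>\<partial>\<^sub>t \<mu>\<close>, as
  required by \<open>fan_ibp\<close>.
\<close>

definition mass_flux :: "real \<times> real \<times> real \<Rightarrow> real" where "mass_flux = (\<lambda>(x, t, r). - lam * g * t * af r)"
definition m_t1 :: "real \<times> real \<times> real \<Rightarrow> real" where "m_t1 = (\<lambda>(x, t, r). g * (r - lam * af r))"
definition m_t2 :: "real \<times> real \<times> real \<Rightarrow> real" where "m_t2 = (\<lambda>(x, t, r). g * t * (1 - lam * daf r))"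
definition m_moving_flux :: "real \<times> real \<times> real \<Rightarrow> real" where
  "m_moving_flux = (\<lambda>(x, t, r). f_f (x, t, r) + q_f (x, t, r) - g * t * m_f (x, t, r))"
definition e_t1 :: "real \<times> real \<times> real \<Rightarrow> real" where "e_t1 = (\<lambda>(x, t, r). g\<^sup>2 * t * (r - (2 * lam - lam\<^sup>2) * af r))"
definition e_t2 :: "real \<times> real \<times> real \<Rightarrow> real" where "e_t2 = (\<lambda>(x, t, r). g\<^sup>2 * t\<^sup>2 / 2 * (1 - (2 * lam - lam\<^sup>2) * daf r))"
definition e_moving_flux :: "real \<times> real \<times> real \<Rightarrow> real" where
  "e_moving_flux = (\<lambda>(x, t, r). h_f (x, t, r) - g * t * e_f (x, t, r))"
definition zero_f :: "real \<times> real \<times> real \<Rightarrow> real" where "zero_f = (\<lambda>_. 0)"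
definition one_f :: "real \<times> real \<times> real \<Rightarrow> real" where "one_f = (\<lambda>_. 1)"

lemma continuous_fluxes:
  "continuous_on states mass_flux" "continuous_on states m_moving_flux"
  "continuous_on states e_moving_flux" "continuous_on states m_t1"
  "continuous_on states m_t2" "continuous_on states e_t1"
  "continuous_on states e_t2" "continuous_on states zero_f"
  "continuous_on states one_f"
  unfolding mass_flux_def m_moving_flux_def e_moving_flux_def m_t1_def m_t2_def e_t1_def e_t2_def zero_f_def one_f_def
    m_f_def f_f_def q_f_def e_f_def h_f_def case_prod_unfold
  by (intro continuous_intros continuous_state; simp)+

lemma mass_dt:
  assumes "0 < t" "x / fall g t + 1 \<noteq> speed \<rho>m" "x / fall g t + 1 \<noteq> speed \<rho>p"
  shows "((\<lambda>t. at_mu 1 mass_f (x, t)) has_real_derivative at_mu 1 zero_f (x, t) + at_mu 1 one_f (x, t) * mu_t 1 x t) (at t)"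
  using DERIV_af_mu_t(1)[OF assms] by (simp add: at_mu_def mass_f_def zero_f_def one_f_def)

lemma mass_dx:
  assumes "0 < t" "x / fall g t + 1 \<noteq> speed \<rho>m" "x / fall g t + 1 \<noteq> speed \<rho>p"
  shows "((\<lambda>x. at_mu 1 mass_flux (x, t)) has_real_derivative
    at_mu 1 zero_f (x, t) - (at_mu 1 zero_f (x, t) + at_mu 1 one_f (x, t) * mu_t 1 x t)) (at x)"
proof -
  have "((\<lambda>x. - lam * g * t * af (mu 1 x t)) has_real_derivative - lam * g * t * (daf (mu 1 x t) * slope 1 x t)) (at x)"
    by (rule DERIV_cmult[OF DERIV_fields_x(2)[OF assms]])
  then show ?thesis using assms(1)
    by (simp add: at_mu_def mass_flux_def zero_f_def one_f_def mu_t_1 mult_ac)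
qed

lemma m_dt:
  assumes "0 < t" "x / fall g t + 1 \<noteq> speed \<rho>m" "x / fall g t + 1 \<noteq> speed \<rho>p"
  shows "((\<lambda>t. at_mu 1 m_f (x, t)) has_real_derivative at_mu 1 m_t1 (x, t) + at_mu 1 m_t2 (x, t) * mu_t 1 x t) (at t)"
proof -
  note d = DERIV_af_mu_t[OF assms]
  have "((\<lambda>t. g * t * (mu 1 x t - lam * af (mu 1 x t))) has_real_derivative
     g * (mu 1 x t - lam * af (mu 1 x t)) + g * t * (1 - lam * daf (mu 1 x t)) * mu_t 1 x t) (at t)"
    by (rule derivative_eq_intros d refl)+ (simp add: algebra_simps)
  then show ?thesis by (simp add: at_mu_def m_f_def m_t1_def m_t2_def)
qed

text \<open>
  The momentum balance. The coefficients of \<open>slope\<close> match by the relation \<open>x = - \<lambda> a'(\<mu>) \<tau>\<close>; this is how \<open>q_f\<close> was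
  obtained.
\<close>

lemma m_dx:
  assumes "0 < t" "x / fall g t + 1 \<noteq> speed \<rho>m" "x / fall g t + 1 \<noteq> speed \<rho>p"
  shows "((\<lambda>x. at_mu 1 m_moving_flux (x, t)) has_real_derivative
    at_mu 1 zero_f (x, t) - (at_mu 1 m_t1 (x, t) + at_mu 1 m_t2 (x, t) * mu_t 1 x t)) (at x)"
proof -
  define r where "r = mu 1 x t"
  define sl where "sl = slope 1 x t"
  define d where "d = daf r"
  note D = DERIV_fields_x[OF assms, folded r_def sl_def, folded d_def]
  have e: "m_moving_flux (x, t, r) = g\<^sup>2 * t\<^sup>2 * (3/2 * lam\<^sup>2 * daf2 r - 3/2 * lam * af r) - g * x * (r - lam * af r)" for x t r
    by (simp add: m_moving_flux_def f_f_def q_f_def m_f_def power2_eq_square algebra_simps)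
  have D1: "((\<lambda>x. g\<^sup>2 * t\<^sup>2 * (3/2 * lam\<^sup>2 * daf2 (mu 1 x t) - 3/2 * lam * af (mu 1 x t)) - g * x * (mu 1 x t - lam * af (mu 1 x t)))
    has_real_derivative g\<^sup>2 * t\<^sup>2 * (3/2 * lam\<^sup>2 * (d\<^sup>2 * sl) - 3/2 * lam * (d * sl)) - (g * (r - lam * af r) + g * x * (sl - lam * (d * sl)))) (at x)"
    by (rule derivative_eq_intros D refl)+ (simp add: r_def algebra_simps)
  have E1: "g\<^sup>2 * t\<^sup>2 * (3/2 * lam\<^sup>2 * (d\<^sup>2 * sl) - 3/2 * lam * (d * sl)) - (g * (r - lam * af r) + g * x * (sl - lam * (d * sl)))
    = 0 - (g * (r - lam * af r) + g * t * (1 - lam * d) * (lam * d * g * t * sl))"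
  proof (cases rule: slope_cases[OF assms])
    case 1
    then show ?thesis by (simp add: sl_def)
  next
    case 2
    then have x: "x = - lam * d * (1/2 * g * t\<^sup>2)" by (simp add: d_def r_def)
    show ?thesis unfolding x by (simp add: power2_eq_square field_simps)
  qed
  from DERIV_cong[OF D1 E1] show ?thesis
    using assms(1) by (simp add: at_mu_def e zero_f_def m_t1_def m_t2_def mu_t_1 r_def d_def sl_def)
qed

lemma e_dt:
  assumes "0 < t" "x / fall g t + 1 \<noteq> speed \<rho>m" "x / fall g t + 1 \<noteq> speed \<rho>p"
  shows "((\<lambda>t. at_mu 1 e_f (x, t)) has_real_derivative at_mu 1 e_t1 (x, t) + at_mu 1 e_t2 (x, t) * mu_t 1 x t) (at t)"
proof -
  note d = DERIV_af_mu_t[OF assms]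
  define k where "k = 2 * lam - lam\<^sup>2"
  have D1: "((\<lambda>t. g\<^sup>2 / 2 * (t\<^sup>2 * (mu 1 x t - k * af (mu 1 x t)))) has_real_derivative
     g\<^sup>2 / 2 * (of_nat 2 * (1 * t ^ (2 - Suc 0)) * (mu 1 x t - k * af (mu 1 x t))
       + (mu_t 1 x t - k * (daf (mu 1 x t) * mu_t 1 x t)) * t\<^sup>2)) (at t)"
    by (intro DERIV_cmult DERIV_mult DERIV_diff DERIV_power DERIV_ident d)
  have E1: "g\<^sup>2 / 2 * (of_nat 2 * (1 * t ^ (2 - Suc 0)) * u + (M - k * (B * M)) * t\<^sup>2)
     = g\<^sup>2 * t * u + g\<^sup>2 * t\<^sup>2 / 2 * (1 - k * B) * M" for u M B
    by (simp add: field_simps)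
  have F: "(\<lambda>t. at_mu 1 e_f (x, t)) = (\<lambda>t. g\<^sup>2 / 2 * (t\<^sup>2 * (mu 1 x t - k * af (mu 1 x t))))"
    by (simp add: at_mu_def e_f_def f_f_def k_def fun_eq_iff)
  show ?thesis
    unfolding F unfolding at_mu_def e_t1_def e_t2_def split_conv k_def[symmetric] by (rule DERIV_cong[OF D1 E1])
qed

text \<open>
  The energy balance, which determines the dissipation. The terms with \<open>slope\<close> cancel in the fan, and
  multiples of \<open>a\<close> are left over; one of them comes from differentiating \<open>a'\<close> in the energy flux, by the second
  relation of \<open>slope_cases\<close>.
\<close>

lemma e_dx:
  assumes "0 < t" "x / fall g t + 1 \<noteq> speed \<rho>m" "x / fall g t + 1 \<noteq> speed \<rho>p"
  shows "((\<lambda>x. at_mu 1 e_moving_flux (x, t)) has_real_derivative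
    at_mu 1 nu_f (x, t) - (at_mu 1 e_t1 (x, t) + at_mu 1 e_t2 (x, t) * mu_t 1 x t)) (at x)"
proof -
  define r where "r = mu 1 x t"
  define sl where "sl = slope 1 x t"
  define d where "d = daf r"
  define dd where "dd = ddaf r"
  define a where "a = af r"
  note D = DERIV_fields_x[OF assms, folded r_def sl_def, folded d_def dd_def]
  have e: "e_moving_flux (x, t, r) = g * t * (g\<^sup>2 * t\<^sup>2 * (3/2 * lam\<^sup>2 * daf2 r - (lam\<^sup>2 + lam/2) * af r) - g * x * (r - lam * af r))
     - g ^ 3 * t ^ 3 / 2 * lam * (af r * (1 - 2 * lam + lam\<^sup>2 * daf r))" for x t r
    by (simp add: e_moving_flux_def h_f_def q_f_def field_simps)
  let ?L = "g * t * (g\<^sup>2 * t\<^sup>2 * (3/2 * lam\<^sup>2 * (d\<^sup>2 * sl) - (lam\<^sup>2 + lam/2) * (d * sl)) - (g * (r - lam * a) + g * x * (sl - lam * (d * sl))))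
     - g ^ 3 * t ^ 3 / 2 * lam * (d * sl * (1 - 2 * lam + lam\<^sup>2 * d) + a * (lam\<^sup>2 * (dd * sl)))"
  have D1: "((\<lambda>x. g * t * (g\<^sup>2 * t\<^sup>2 * (3/2 * lam\<^sup>2 * daf2 (mu 1 x t) - (lam\<^sup>2 + lam/2) * af (mu 1 x t)) - g * x * (mu 1 x t - lam * af (mu 1 x t)))
     - g ^ 3 * t ^ 3 / 2 * lam * (af (mu 1 x t) * (1 - 2 * lam + lam\<^sup>2 * daf (mu 1 x t)))) has_real_derivative ?L) (at x)"
    by (rule derivative_eq_intros D refl)+ (simp add: r_def d_def a_def algebra_simps)
  have E1: "?L = lam * (2 * lam - 1) * g\<^sup>2 * t * a
     - (g\<^sup>2 * t * (r - (2 * lam - lam\<^sup>2) * a) + g\<^sup>2 * t\<^sup>2 / 2 * (1 - (2 * lam - lam\<^sup>2) * d) * (lam * d * g * t * sl))"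
  proof (cases rule: slope_cases[OF assms])
    case 1
    then have "sl = 0" "a = 0" by (simp_all add: sl_def a_def r_def)
    then show ?thesis by (simp add: power2_eq_square)
  next
    case 2
    then have x: "x = - lam * d * (1/2 * g * t\<^sup>2)" and E: "lam * g * t\<^sup>2 * (dd * sl) = - 2"
      by (simp_all add: d_def r_def dd_def sl_def)
    have "g ^ 3 * t ^ 3 / 2 * lam * (a * (lam\<^sup>2 * (dd * sl))) = g\<^sup>2 * t / 2 * lam\<^sup>2 * a * (lam * g * t\<^sup>2 * (dd * sl))"
      by (simp add: power2_eq_square power3_eq_cube)
    then have E': "g ^ 3 * t ^ 3 / 2 * lam * (a * (lam\<^sup>2 * (dd * sl))) = - (g\<^sup>2 * t * lam\<^sup>2 * a)" unfolding E by simp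
    show ?thesis unfolding distrib_left[of "g ^ 3 * t ^ 3 / 2 * lam"] E' x
      by (simp add: power2_eq_square power3_eq_cube field_simps)
  qed
  from DERIV_cong[OF D1 E1] show ?thesis
    using assms(1) by (simp add: at_mu_def e nu_f_def e_t1_def e_t2_def mu_t_1 r_def d_def sl_def a_def)
qed

text \<open>
  With \<open>s = \<rho>m + \<rho>p - r\<close> the denominator of \<open>f\<close> is \<open>s a\<close>, and \<open>\<rho>m \<rho>p = s (r - a)\<close>. Substituting the latter into the
  numerator makes it divisible by \<open>s a\<close>, which removes the singularity of \<open>f\<close> at the edges of the fan.
\<close>

lemma f_fun_eq:
  assumes "r \<in> {\<rho>m..\<rho>p}"
  shows "f_fun \<rho>m \<rho>p g t r (g * t * (r - lam * af r)) = f_f (x, t, r)"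
proof (cases "\<rho>m < r \<and> r < \<rho>p")
  case False
  then have "r = \<rho>m \<or> r = \<rho>p" using assms by auto
  then have "af r = 0" by auto
  then show ?thesis using False by (auto simp: f_fun_def f_f_def)
next
  case True
  define s where "s = \<rho>m + \<rho>p - r"
  define a where "a = af r"
  have s: "s > 0" using gap_pos[of r] True by (simp add: s_def)
  have as: "(\<rho>p - r) * (r - \<rho>m) = s * a"
    using a_fun_af[of r] True s by (simp add: a_fun_def s_def[symmetric] a_def field_simps)
  have sa: "s * a > 0" using True unfolding as[symmetric] by simp
  have P: "\<rho>m * \<rho>p = s * (r - a)" using s by (simp add: a_def af_def s_def[symmetric] field_simps)
  have "r * \<rho>m * \<rho>p * g\<^sup>2 * t\<^sup>2 - 2 * \<rho>m * \<rho>p * (g * t * (r - lam * a)) * g * t + (\<rho>p + \<rho>m - r) * (g * t * (r - lam * a))\<^sup>2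
     = g\<^sup>2 * t\<^sup>2 * ((\<rho>m * \<rho>p) * r - 2 * (\<rho>m * \<rho>p) * (r - lam * a) + s * (r - lam * a)\<^sup>2)"
    by (simp add: s_def power2_eq_square algebra_simps)
  also have "\<dots> = (s * a) * (g\<^sup>2 * t\<^sup>2 * (r - (2 * lam - lam\<^sup>2) * a))"
    unfolding P by (simp add: power2_eq_square algebra_simps)
  finally have "r * \<rho>m * \<rho>p * g\<^sup>2 * t\<^sup>2 - 2 * \<rho>m * \<rho>p * (g * t * (r - lam * a)) * g * t + (\<rho>p + \<rho>m - r) * (g * t * (r - lam * a))\<^sup>2
     = (s * a) * (g\<^sup>2 * t\<^sup>2 * (r - (2 * lam - lam\<^sup>2) * a))" .
  moreover have "a \<noteq> 0" "s \<noteq> 0" using sa by auto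
  ultimately show ?thesis using True by (simp add: f_fun_def as a_def[symmetric] f_f_def)
qed

end

section \<open>Test functions and densities\<close>

lemma smooth_has_derivative: "smooth \<phi> \<Longrightarrow> (\<phi> has_derivative frechet_derivative \<phi> (at p)) (at p)"
  and smooth_continuous_derivative: "smooth \<phi> \<Longrightarrow> continuous_on UNIV (\<lambda>p. frechet_derivative \<phi> (at p) v)"
  and smooth_continuous: "smooth \<phi> \<Longrightarrow> continuous_on UNIV \<phi>"
proof -
  assume "smooth \<phi>"
  then have c: "Ck (Suc 0) \<phi>" "Ck 0 \<phi>" by (simp_all only: smooth_def)
  show "(\<phi> has_derivative frechet_derivative \<phi> (at p)) (at p)" using Ck_differentiable[OF c(1)] .
  show "continuous_on UNIV (\<lambda>p. frechet_derivative \<phi> (at p) v)" using c(1) by simp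
  show "continuous_on UNIV \<phi>" using c(2) by simp
qed

lemma smooth_C1_derivative: "smooth \<phi> \<Longrightarrow> C1_derivative \<phi> (\<lambda>p. frechet_derivative \<phi> (at p))"
  using smooth_has_derivative smooth_continuous_derivative unfolding C1_derivative_def by blast

lemma smooth_component_C1_derivative:
  fixes \<Phi> :: "'a::real_normed_vector \<Rightarrow> real^'n"
  assumes "smooth \<Phi>"
  shows "C1_derivative (\<lambda>p. \<Phi> p $ i) (\<lambda>p v. frechet_derivative \<Phi> (at p) v $ i)"
  unfolding C1_derivative_def
proof (intro conjI allI)
  show "((\<lambda>p. \<Phi> p $ i) has_derivative (\<lambda>v. frechet_derivative \<Phi> (at p) v $ i)) (at p)" for p
    by (rule bounded_linear.has_derivative[OF bounded_linear_vec_nth smooth_has_derivative[OF assms]])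
  show "continuous_on UNIV (\<lambda>p. frechet_derivative \<Phi> (at p) v $ i)" for v
    by (intro continuous_intros smooth_continuous_derivative assms)
qed

lemma cylinder_DDstar: "cylinder N g L T \<subseteq> DDstar b N g L T \<inter> (cell N \<times> UNIV)"
proof
  fix p assume p: "p \<in> cylinder N g L T"
  obtain y t where yt: "p = (y, t)" by (cases p)
  have "y \<in> Dt b N g L t" using p by (auto simp: yt cylinder_def mem_Dt)
  then have "y \<in> closure (Dt b N g L t)" using closure_subset by blast
  then show "p \<in> DDstar b N g L T \<inter> (cell N \<times> UNIV)"
    using p by (auto simp: yt DDstar_def cell_def cylinder_def less_imp_le)
qed

lemma test_fun_smooth: "test_fun b N g L T \<phi> \<Longrightarrow> smooth \<phi>"
  and test_fun_lift: "test_fun b N g L T \<phi> \<Longrightarrow> lateral_lift b N \<phi>"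
  by (auto simp: test_fun_def test_in_def)

text \<open>
  Test functions vanish near the final time on the domain only. The point at time \<open>T\<close> is therefore approached along
  a curve that falls with the domain and so stays inside it.
\<close>

lemma test_fun_zero_at_T:
  fixes \<phi> :: "(real^'n) \<times> real \<Rightarrow> 'b::real_normed_vector"
  assumes \<phi>: "test_fun b N g L T \<phi>" and T: "0 < T"
    and y: "\<bar>y $ N - fall g T\<bar> < L" "\<And>j. j \<noteq> N \<Longrightarrow> 0 < y $ j \<and> y $ j < 1"
  shows "\<phi> (y, T) = 0"
proof -
  obtain K where K: "compact K" "K \<subseteq> DDstar b N g L T" "test_in b N g L T K \<phi>"
    using \<phi> unfolding test_fun_def by blast
  define P where "P t = (y + (fall g t - fall g T) *\<^sub>R axis N 1, t)" for t
  have "continuous_on UNIV (\<lambda>t. \<phi> (P t))"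
    by (rule continuous_on_compose2[OF smooth_continuous[OF test_fun_smooth[OF \<phi>]]])
       (auto simp: P_def intro!: continuous_intros)
  then have "isCont (\<lambda>t. \<phi> (P t)) T" by (simp add: continuous_on_eq_continuous_at)
  then have lim: "((\<lambda>t. \<phi> (P t)) \<longlongrightarrow> \<phi> (P T)) (at_left T)"
    by (simp add: isCont_def filterlim_at_split)
  have "compact (snd ` K)" using K(1) by (intro compact_continuous_image continuous_intros)
  then have "open (- (snd ` K))" by (simp add: compact_imp_closed open_Compl)
  moreover have "T \<in> - (snd ` K)" using K(2) by (auto simp: DDstar_def)
  ultimately have "\<forall>\<^sub>F t in at_left T. t \<in> - (snd ` K)" by (rule topological_tendstoD[OF tendsto_ident_at])
  moreover have "\<forall>\<^sub>F t in at_left T. t \<in> {0<..<T}" using T by (rule eventually_at_left_real)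
  ultimately have "\<forall>\<^sub>F t in at_left T. \<phi> (P t) = 0"
  proof eventually_elim
    case (elim t)
    have "P t \<in> cylinder N g L T"
      using elim y by (auto simp: P_def cylinder_def axis_def)
    moreover have "P t \<notin> K" using elim(1) by (force simp: P_def)
    ultimately show ?case using K(3) cylinder_DDstar[of N g L T b] unfolding test_in_def by blast
  qed
  then have "((\<lambda>t. \<phi> (P t)) \<longlongrightarrow> 0) (at_left T)" by (rule tendsto_eventually)
  then have "\<phi> (P T) = 0" using lim tendsto_unique trivial_limit_at_left_real by blast
  then show ?thesis by (simp add: P_def)
qed

lemma slab_integral_eq:
  fixes G :: "real^'n \<Rightarrow> real"
  assumes G: "G \<in> borel_measurable borel"
    and S: "\<And>y. y \<in> S \<longleftrightarrow> \<bar>y $ N - c\<bar> < L \<and> (b = Walls \<longrightarrow> (\<forall>j. j \<noteq> N \<longrightarrow> 0 < y $ j \<and> y $ j < 1))"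
  shows "(LINT y:S \<inter> cell N|lebesgue. G y) = (LINT y:slab N c L|lborel. G y)"
proof -
  have o1: "open {y :: real^'n. \<bar>y $ N - c\<bar> < L}" by (intro open_Collect_less continuous_intros)
  have "{y :: real^'n. \<forall>j. j \<noteq> N \<longrightarrow> 0 < y $ j \<and> y $ j < 1} = (\<Inter>j\<in>UNIV - {N}. {y. 0 < y $ j \<and> y $ j < 1})" by auto
  also have "open \<dots>" by (intro open_INT ballI open_Collect_conj open_Collect_less continuous_intros) simp
  finally have o2: "open {y :: real^'n. \<forall>j. j \<noteq> N \<longrightarrow> 0 < y $ j \<and> y $ j < 1}" .
  have "S = {y. \<bar>y $ N - c\<bar> < L} \<inter> {y. b = Walls \<longrightarrow> (\<forall>j. j \<noteq> N \<longrightarrow> 0 < y $ j \<and> y $ j < 1)}"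
    using S by auto
  then have "open S" using o1 o2 by (cases b) (auto intro!: open_Int)
  moreover have "closed (cell N :: (real^'n) set)"
    unfolding cell_def by (intro closed_Collect_all closed_Collect_imp closed_Collect_conj closed_Collect_le continuous_intros open_Collect_const)
  ultimately have SB: "S \<inter> cell N \<in> sets borel" by (simp add: borel_open borel_closed)
  have "(LINT y:S \<inter> cell N|lebesgue. G y) = (\<integral>y. indicator (S \<inter> cell N) y *\<^sub>R G y \<partial>lborel)"
    unfolding set_lebesgue_integral_def
    by (rule integral_completion) (use G SB in \<open>auto intro!: borel_measurable_times borel_measurable_indicator\<close>)
  also have "\<dots> = (\<integral>y. indicator (slab N c L) y *\<^sub>R G y \<partial>lborel)"
  proof (rule integral_cong_AE)
    show "AE y in lborel. indicator (S \<inter> cell N) y *\<^sub>R G y = indicator (slab N c L) y *\<^sub>R G y"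
      using AE_lateral
    proof eventually_elim
      case (elim y)
      have "y \<in> S \<inter> cell N \<longleftrightarrow> y \<in> slab N c L"
        using elim by (auto simp: S cell_def slab_def less_le)
      then show ?case by (simp add: indicator_def)
    qed
  qed (use G SB open_slab[of N c L] in \<open>auto intro!: borel_measurable_times borel_measurable_indicator simp: borel_open\<close>)
  finally show ?thesis by (simp add: set_lebesgue_integral_def)
qed

lemma Omega_integral:
  fixes G :: "real^'n \<Rightarrow> real"
  assumes G: "G \<in> borel_measurable borel"
  shows "(LINT y:Omega b N L \<inter> cell N|lebesgue. G y) = (LINT y:slab N 0 L|lborel. G y)"
  by (rule slab_integral_eq[OF G]) (auto simp: Omega_def abs_less_iff)

lemma Dt_integral:
  fixes G :: "real^'n \<Rightarrow> real"
  assumes G: "G \<in> borel_measurable borel"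
  shows "(LINT y:Dt b N g L t \<inter> cell N|lebesgue. G y) = (LINT y:slab N (fall g t) L|lborel. G y)"
  by (rule slab_integral_eq[OF G]) (simp add: mem_Dt)

lemma cube_integral: "(\<integral>\<omega>. indicator (cube N) \<omega> \<partial>trans_measure N) = (1::real)"
proof -
  have e: "cube N \<inter> space (trans_measure N) = Pi\<^sub>E (UNIV - {N}) (\<lambda>j. {0<..<1})"
    by (rule set_eqI) (simp only: Int_iff trans_box_iff, auto simp: cube_def)
  have "measure (trans_measure N) (Pi\<^sub>E (UNIV - {N}) (\<lambda>j. {0<..<1::real})) = 1"
    using emeasure_trans_box[of "\<lambda>_. 0" "\<lambda>_. 1" N] by (simp add: measure_def)
  then show ?thesis by (simp add: e)
qed

lemma slab_integral_vertical:
  fixes h :: "real \<Rightarrow> real"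
  assumes h: "h \<in> borel_measurable borel" "\<And>s. \<bar>s - c\<bar> < L \<Longrightarrow> \<bar>h s\<bar> \<le> C"
  shows "(LINT y:slab N c L|lborel. h (y $ N)) = (LINT s:{c - L..c + L}|lborel. h s)"
proof -
  have m: "(\<lambda>y :: real^'a. h (y $ N)) \<in> borel_measurable borel"
    by (rule measurable_compose[OF borel_measurable_continuous_onI h(1)]) (intro continuous_intros)
  have b: "\<forall>y\<in>slab N c L. \<bar>h (y $ N)\<bar> \<le> C" using h(2) by (auto simp: slab_def)
  have "(LINT y:slab N c L|lborel. h (y $ N)) = (\<integral>\<omega>. indicator (cube N) \<omega> * (LINT s:{c - L<..<c + L}|lborel. h s) \<partial>trans_measure N)"
    using slab_integral(1)[OF m b] by simp
  also have "\<dots> = (LINT s:{c - L<..<c + L}|lborel. h s)" unfolding integral_mult_left_zero cube_integral by simp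
  also have "\<dots> = (LINT s:{c - L..c + L}|lborel. h s)" by (rule set_integral_open_Icc[OF h(1)])
  finally show ?thesis .
qed

text \<open>
  A bounded nonpositive density is a dissipation measure; the bound in terms of seminorms holds with order \<open>0\<close>.
\<close>

lemma density_functional:
  fixes w :: "(real^'n) \<times> real \<Rightarrow> real"
  assumes w: "w \<in> borel_measurable borel" "\<And>p. p \<in> bbox N g L T \<Longrightarrow> \<bar>w p\<bar> \<le> C" and g: "0 \<le> g"
    and neg: "\<And>p. 0 \<le> snd p \<Longrightarrow> w p \<le> 0"
  shows "dissipation_measure b N g L T (\<lambda>\<phi>. DDint b N g L T (\<lambda>p. w p * \<phi> p))"
proof -
  have m: "(\<lambda>p. w p * \<phi> p) \<in> borel_measurable borel" if "smooth \<phi>" for \<phi>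
    using w(1) borel_measurable_continuous_onI[OF smooth_continuous[OF that]] by (rule borel_measurable_times)
  have i: "set_integrable lborel (cylinder N g L T) (\<lambda>p. w p * \<phi> p)" if "smooth \<phi>" for \<phi>
  proof -
    have c: "continuous_on UNIV \<phi>" by (rule smooth_continuous[OF that])
    obtain K where K: "0 \<le> K" "\<And>p. p \<in> bbox N g L T \<Longrightarrow> \<bar>\<phi> p\<bar> \<le> K"
      using bbox_bound[OF c] by blast
    show ?thesis
    proof (rule cylinder_integrable[OF g m[OF that]])
      fix p assume p: "p \<in> bbox N g L T"
      show "\<bar>w p * \<phi> p\<bar> \<le> C * K"
        unfolding abs_mult by (intro mult_mono w(2) K(2) p order_trans[OF abs_ge_zero w(2)[OF p]]) simp
    qed
  qed
  have e: "DDint b N g L T (\<lambda>p. w p * \<phi> p) = (LINT p:cylinder N g L T|lborel. w p * \<phi> p)" if "smooth \<phi>" for \<phi>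
    by (rule DDint_eq[OF m[OF that]])
  note sm = test_fun_smooth[of b N g L T]
  show ?thesis
    unfolding dissipation_measure_def
  proof (intro conjI allI impI)
    fix \<phi> \<psi> :: "(real^'n) \<times> real \<Rightarrow> real"
    assume a: "test_fun b N g L T \<phi>" "test_fun b N g L T \<psi>"
    have "(\<lambda>p. w p * (\<phi> p + \<psi> p)) \<in> borel_measurable borel"
      using m[OF sm[OF a(1)]] m[OF sm[OF a(2)]] by (simp add: distrib_left)
    from DDint_eq[OF this] show "DDint b N g L T (\<lambda>p. w p * (\<phi> p + \<psi> p)) = DDint b N g L T (\<lambda>p. w p * \<phi> p) + DDint b N g L T (\<lambda>p. w p * \<psi> p)"
      using set_integral_add(2)[OF i[OF sm[OF a(1)]] i[OF sm[OF a(2)]]] e[OF sm[OF a(1)]] e[OF sm[OF a(2)]]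
      by (simp add: distrib_left)
  next
    fix c and \<phi> :: "(real^'n) \<times> real \<Rightarrow> real"
    have "(\<lambda>p. w p * (c * \<phi> p)) = (\<lambda>p. c * (w p * \<phi> p))" by (simp add: mult_ac)
    then show "DDint b N g L T (\<lambda>p. w p * (c * \<phi> p)) = c * DDint b N g L T (\<lambda>p. w p * \<phi> p)"
      by (simp add: DDint_def)
  next
    fix K :: "((real^'n) \<times> real) set" assume K: "compact K" "K \<subseteq> DDstar b N g L T"
    have iw: "set_integrable lborel (cylinder N g L T) w" by (rule cylinder_integrable[OF g w])
    define I where "I = (LINT p:cylinder N g L T|lborel. \<bar>w p\<bar>)"
    have iabs: "set_integrable lborel (cylinder N g L T) (\<lambda>p. \<bar>w p\<bar> * B)" for B
      using set_integrable_abs[OF iw] by (rule set_integrable_mult_left[rotated]) 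
    show "\<exists>k C. \<forall>\<phi> B. test_in b N g L T K \<phi> \<longrightarrow> B \<ge> 0 \<longrightarrow> Ck_bound K B k \<phi> \<longrightarrow> \<bar>DDint b N g L T (\<lambda>p. w p * \<phi> p)\<bar> \<le> C * B"
    proof (rule exI[of _ "0::nat"], rule exI[of _ I], intro allI impI)
      fix \<phi> :: "(real^'n) \<times> real \<Rightarrow> real" and B :: real
      assume \<phi>: "test_in b N g L T K \<phi>" and B: "0 \<le> B" "Ck_bound K B 0 \<phi>"
      have s: "smooth \<phi>" using \<phi> by (simp add: test_in_def)
      have bnd: "\<bar>\<phi> p\<bar> \<le> B" if "p \<in> cylinder N g L T" for p
      proof (cases "p \<in> K")
        case False
        then have "\<phi> p = 0" using \<phi> that cylinder_DDstar[of N g L T b] unfolding test_in_def by blast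
        then show ?thesis using B by simp
      qed (use B in simp)
      have "\<bar>DDint b N g L T (\<lambda>p. w p * \<phi> p)\<bar> \<le> (\<integral>p. norm (indicator (cylinder N g L T) p *\<^sub>R (w p * \<phi> p)) \<partial>lborel)"
        unfolding e[OF s] set_lebesgue_integral_def real_norm_def[symmetric] by (rule integral_norm_bound)
      also have "\<dots> \<le> (\<integral>p. indicator (cylinder N g L T) p *\<^sub>R (\<bar>w p\<bar> * B) \<partial>lborel)"
      proof (rule integral_mono)
        show "integrable lborel (\<lambda>p. norm (indicator (cylinder N g L T) p *\<^sub>R (w p * \<phi> p)))"
          using i[OF s] by (simp only: set_integrable_def integrable_norm)
        show "integrable lborel (\<lambda>p. indicator (cylinder N g L T) p *\<^sub>R (\<bar>w p\<bar> * B))"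
          using iabs[of B] by (simp only: set_integrable_def)
        show "norm (indicator (cylinder N g L T) p *\<^sub>R (w p * \<phi> p)) \<le> indicator (cylinder N g L T) p *\<^sub>R (\<bar>w p\<bar> * B)" for p
          using bnd[of p] by (auto simp: indicator_def abs_mult intro!: mult_left_mono)
      qed
      also have "\<dots> = I * B" by (simp add: I_def set_lebesgue_integral_def mult.assoc[symmetric])
      finally show "\<bar>DDint b N g L T (\<lambda>p. w p * \<phi> p)\<bar> \<le> I * B" .
    qed
  next
    fix \<phi> :: "(real^'n) \<times> real \<Rightarrow> real"
    assume a: "test_fun b N g L T \<phi>" "\<forall>p \<in> DDstar b N g L T. \<phi> p \<ge> 0"
    have "0 \<le> (\<integral>p. - (indicator (cylinder N g L T) p *\<^sub>R (w p * \<phi> p)) \<partial>lborel)"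
    proof (rule Bochner_Integration.integral_nonneg)
      fix p
      show "0 \<le> - (indicator (cylinder N g L T) p *\<^sub>R (w p * \<phi> p))"
      proof (cases "p \<in> cylinder N g L T")
        case True
        then have "0 \<le> \<phi> p" "w p \<le> 0"
          using a(2) cylinder_DDstar[of N g L T b] neg[of p] by (auto simp: cylinder_def)
        then show ?thesis using True by (simp add: mult_nonpos_nonneg)
      qed simp
    qed
    then show "DDint b N g L T (\<lambda>p. w p * \<phi> p) \<le> 0"
      unfolding e[OF sm[OF a(1)]] set_lebesgue_integral_def by simp
  qed
qed

section \<open>Fields on the moving domain\<close>

lemma ess_boundedI:
  fixes f :: "'a::euclidean_space \<Rightarrow> 'b::euclidean_space"
  assumes "f \<in> borel_measurable borel" "\<And>p. p \<in> A \<Longrightarrow> norm (f p) \<le> C"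
  shows "ess_bounded A f"
  unfolding ess_bounded_def
proof (intro conjI exI[of _ C])
  show "f \<in> borel_measurable (lebesgue_on A)"
    by (intro measurable_restrict_space1 measurable_completion) (use assms(1) in simp)
  show "AE p in lebesgue_on A. norm (f p) \<le> C"
    by (intro AE_I2) (use assms(2) in \<open>auto simp: space_restrict_space\<close>)
qed

lemma sigma_of_scale: "sigma_of N f = f *\<^sub>R sigma_of N 1"
  by (simp add: sigma_of_def vec_eq_iff)

lemma transpose_sigma_of: "transpose (sigma_of N f) = sigma_of N f"
  by (simp add: transpose_def sigma_of_def vec_eq_iff)

lemma sum_UNIV_if: "(\<Sum>i\<in>UNIV. if i = N then a else c) = a + (real CARD('n) - 1) * c" for N :: "'n::finite"
proof -
  have "(\<Sum>i\<in>UNIV. if i = N then a else c) = a + (\<Sum>i\<in>UNIV - {N}. c)"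
    by (subst sum.remove[of _ N]) auto
  also have "(\<Sum>i\<in>UNIV - {N}. c) = (real CARD('n) - 1) * c"
    by (simp add: card_Diff_singleton of_nat_diff Suc_leI)
  finally show ?thesis .
qed

lemma trace_sigma_of:
  fixes N :: "'n::finite"
  assumes "CARD('n) = 2 \<or> CARD('n) = 3"
  shows "trace (sigma_of N f) = 0"
proof -
  have "trace (sigma_of N f) = (\<Sum>i\<in>UNIV. if i = N then (if CARD('n) = 2 then f / 2 else 2 * f / 3) else (if CARD('n) = 2 then - f / 2 else - f / 3))"
    unfolding trace_def by (intro sum.cong refl) (simp add: sigma_of_def)
  also have "\<dots> = 0" unfolding sum_UNIV_if using assms by auto
  finally show ?thesis .
qed

text \<open>
  The traceless matrix \<open>\<sigma>\<close> and the pressure part of the energy add up to a stress that acts in the vertical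
  direction only. It equals \<open>\<mu> w \<otimes> w\<close> in the pure phases.
\<close>

lemma pressure_matrix:
  fixes N :: "'n::finite"
  assumes "CARD('n) = 2 \<or> CARD('n) = 3"
  shows "sigma_of N f + mat (2 / real CARD('n) * (f / 2)) = (\<chi> i j. if i = N \<and> j = N then f else 0)"
  using assms by (auto simp: vec_eq_iff sigma_of_def mat_def)

context fan
begin

definition fan_state :: "'n::finite \<Rightarrow> (real^'n) \<times> real \<Rightarrow> 'n state" where
  "fan_state N p = (moving N mass_f p, (g * snd p) *\<^sub>R axis N 1, moving N m_f p *\<^sub>R axis N 1,
     moving N h_f p *\<^sub>R axis N 1, sigma_of N (moving N f_f p), moving N e_f p)"

lemma fan_state_simps [simp]:
  "z_mu (fan_state N p) = moving N mass_f p" "z_w (fan_state N p) = (g * snd p) *\<^sub>R axis N 1"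
  "z_m (fan_state N p) = moving N m_f p *\<^sub>R axis N 1" "z_h (fan_state N p) = moving N h_f p *\<^sub>R axis N 1"
  "z_sigma (fan_state N p) = sigma_of N (moving N f_f p)" "z_e (fan_state N p) = moving N e_f p"
  by (simp_all add: fan_state_def z_mu_def z_w_def z_m_def z_h_def z_sigma_def z_e_def)

lemma moving_mass: "moving N mass_f (y, t) = mu 0 (y $ N) t"
  using mu_shift[of 1 "y $ N - fall g t" t] by (simp add: moving_def at_mu_def mass_f_def)

lemma moving_mass_mem: "moving N mass_f p \<in> {\<rho>m..\<rho>p}"
  using mu_mem by (cases p) (simp add: moving_mass)

lemma moving_m: "moving N m_f p = g * snd p * (moving N mass_f p - lam * af (moving N mass_f p))"
  by (simp add: moving_def at_mu_def m_f_def mass_f_def)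

lemma moving_nu: "moving N nu_f p = lam * (2 * lam - 1) * g\<^sup>2 * snd p * af (moving N mass_f p)"
  by (simp add: moving_def at_mu_def nu_f_def mass_f_def)

lemma moving_f: "moving N f_f p = f_fun \<rho>m \<rho>p g (snd p) (moving N mass_f p) (moving N m_f p)"
  unfolding moving_m f_fun_eq[OF moving_mass_mem, where x="fst p $ N - fall g (snd p)"]
  by (simp add: moving_def at_mu_def mass_f_def)

lemma moving_e: "moving N e_f p = moving N f_f p / 2"
  by (simp add: moving_def at_mu_def e_f_def case_prod_unfold)

lemma moving_h: "moving N h_f p = (moving N e_f p + moving N q_f p) * (g * snd p)
     - g ^ 3 * snd p ^ 3 / 2 * lam * af (moving N mass_f p) * (1 - 2 * lam + lam\<^sup>2 * daf (moving N mass_f p))"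
  by (simp add: moving_def at_mu_def h_f_def mass_f_def)

lemma af_nonneg: "r \<in> {\<rho>m..\<rho>p} \<Longrightarrow> 0 \<le> af r"
proof -
  assume r: "r \<in> {\<rho>m..\<rho>p}"
  have "0 \<le> (\<rho>p - r) * (r - \<rho>m) / (\<rho>p + \<rho>m - r)"
    using r gap_pos[of r] by (intro divide_nonneg_pos mult_nonneg_nonneg) auto
  then show ?thesis using a_fun_af[of r] r by (simp add: a_fun_def)
qed

text \<open>
  The wave takes every density near the origin. A field that does not see the density at \<open>x = t = 0\<close> is still
  continuous there, by uniform continuity on the compact set of states near the origin.
\<close>

lemma continuous_at_mu_all:
  fixes \<alpha> :: "real \<times> real \<times> real \<Rightarrow> real"
  assumes \<alpha>: "continuous_on states \<alpha>" and c: "\<And>r. r \<in> {\<rho>m..\<rho>p} \<Longrightarrow> \<alpha> (0, 0, r) = c"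
  shows "continuous_on UNIV (at_mu d \<alpha>)"
proof -
  have "isCont (at_mu d \<alpha>) (x, t)" for x t
  proof (cases "(x, t) = (0, 0)")
    case False
    have "open (UNIV - {(0::real, 0::real)})" by (intro open_Diff) auto
    then show ?thesis
      using continuous_at_mu[OF \<alpha>, of d] False by (simp only: continuous_on_eq_continuous_at) blast
  next
    case True
    let ?K = "{-1..1::real} \<times> {-1..1::real} \<times> {\<rho>m..\<rho>p}"
    have "compact ?K" by (intro compact_Times compact_Icc)
    moreover have "continuous_on ?K \<alpha>" by (rule continuous_on_subset[OF \<alpha>]) auto
    ultimately have u: "uniformly_continuous_on ?K \<alpha>" by (rule compact_uniformly_continuous[rotated])
    have "\<exists>\<delta>>0. \<forall>p. dist p (0, 0) < \<delta> \<longrightarrow> dist (at_mu d \<alpha> p) (at_mu d \<alpha> (0, 0)) < \<epsilon>" if eps: "0 < \<epsilon>" for \<epsilon>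
    proof -
      obtain \<delta> where \<delta>: "0 < \<delta>" "\<And>v v'. v \<in> ?K \<Longrightarrow> v' \<in> ?K \<Longrightarrow> dist v' v < \<delta> \<Longrightarrow> dist (\<alpha> v') (\<alpha> v) < \<epsilon>"
        using u eps unfolding uniformly_continuous_on_def by meson
      show ?thesis
      proof (intro exI[of _ "min \<delta> 1"] conjI allI impI)
        fix p :: "real \<times> real" assume p: "dist p (0, 0) < min \<delta> 1"
        obtain y s where ys: "p = (y, s)" by (cases p)
        have n: "norm (y, s) < 1" "norm (y, s) < \<delta>" using p by (simp_all add: ys dist_norm del: norm_Pair)
        have "\<bar>y\<bar> \<le> norm (y, s)" "\<bar>s\<bar> \<le> norm (y, s)"
          using norm_fst_le[of y s] norm_snd_le[of s y] by simp_all
        then have "(y, s, mu d y s) \<in> ?K" using n(1) mu_mem[of d y s] by (auto simp del: norm_Pair)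
        moreover have "(0, 0, mu d y s) \<in> ?K" using mu_mem[of d y s] by simp
        moreover have "dist (y, s, mu d y s) (0, 0, mu d y s) < \<delta>"
          using n(2) by (simp add: dist_norm norm_Pair)
        ultimately have "dist (\<alpha> (y, s, mu d y s)) (\<alpha> (0, 0, mu d y s)) < \<epsilon>" by (intro \<delta>(2))
        then show "dist (at_mu d \<alpha> p) (at_mu d \<alpha> (0, 0)) < \<epsilon>"
          using c[OF mu_mem] by (simp add: at_mu_def ys)
      qed (use \<delta> in simp)
    qed
    then show ?thesis unfolding True continuous_at_eps_delta by blast
  qed
  then show ?thesis by (auto simp: continuous_on_eq_continuous_at)
qed

lemma continuous_moving_all:
  fixes \<alpha> :: "real \<times> real \<times> real \<Rightarrow> real"
  assumes "continuous_on states \<alpha>" "\<And>r. r \<in> {\<rho>m..\<rho>p} \<Longrightarrow> \<alpha> (0, 0, r) = 0"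
  shows "continuous_on S (moving N \<alpha>)"
proof -
  have "continuous_on S (\<lambda>p. at_mu 1 \<alpha> (fst p $ N - fall g (snd p), snd p))"
    by (rule continuous_on_compose2[OF continuous_at_mu_all[OF assms]]) (auto intro!: continuous_intros)
  then show ?thesis by (simp add: moving_def[abs_def])
qed

lemma continuous_moving_fields:
  "continuous_on S (moving N m_f)" "continuous_on S (moving N f_f)" "continuous_on S (moving N q_f)"
  "continuous_on S (moving N e_f)" "continuous_on S (moving N h_f)" "continuous_on S (moving N nu_f)"
  by (intro continuous_moving_all continuous_fields;
      simp add: m_f_def f_f_def q_f_def e_f_def h_f_def nu_f_def)+

lemma continuous_moving_mass: "continuous_on (S - {(y, t). y $ N = 0 \<and> t = 0}) (moving N mass_f)"
proof -
  have "continuous_on (S - {(y, t). y $ N = 0 \<and> t = 0}) (\<lambda>p. at_mu 1 mass_f (fst p $ N - fall g (snd p), snd p))"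
    by (rule continuous_on_compose2[OF continuous_at_mu[OF continuous_fields(1)]])
       (auto intro!: continuous_intros simp: fall_def)
  then show ?thesis by (simp add: moving_def[abs_def])
qed

lemma continuous_sigma_of: "continuous_on S f \<Longrightarrow> continuous_on S (\<lambda>p. sigma_of N (f p))"
  by (subst sigma_of_scale) (intro continuous_intros)

text \<open>
  In the falling frame the upper edge of the fan moves with speed \<open>\<lambda> (\<rho>p - \<rho>m) / \<rho>m\<close>, and the lower one with the
  smaller speed \<open>\<lambda> (\<rho>p - \<rho>m) / \<rho>p\<close>. So neither reaches the boundary of the strip up to the time \<open>T\<close>.
\<close>

lemma mu_outer:
  assumes L: "(speed \<rho>p - 1) * fall g T < L" and t: "0 \<le> t" "t \<le> T"
  shows "mu 1 L t = \<rho>p" "mu 1 (- L) t = \<rho>m"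
proof -
  have s: "1 - speed \<rho>m \<le> speed \<rho>p - 1" "0 \<le> speed \<rho>p - 1"
  proof -
    have "lam * (\<rho>p - \<rho>m) / \<rho>p \<le> lam * (\<rho>p - \<rho>m) / \<rho>m"
      using rho_pos rho_less lam_pos rhop_pos by (intro divide_left_mono) auto
    moreover have "speed \<rho>p - 1 = lam * (\<rho>p - \<rho>m) / \<rho>m" "1 - speed \<rho>m = lam * (\<rho>p - \<rho>m) / \<rho>p"
      using rho_pos rhop_pos by (simp_all add: speed_rhop speed_rhom field_simps)
    moreover have "0 \<le> lam * (\<rho>p - \<rho>m) / \<rho>m" using rho_pos rho_less lam_pos by simp
    ultimately show "1 - speed \<rho>m \<le> speed \<rho>p - 1" "0 \<le> speed \<rho>p - 1" by simp_all
  qed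
  have f: "fall g t \<le> fall g T" using fall_mono[of g t T] g_pos t by simp
  have a: "(speed \<rho>p - 1) * fall g t < L" using mult_left_mono[OF f s(2)] L by linarith
  have b: "(1 - speed \<rho>m) * fall g t < L" using mult_right_mono[OF s(1) fall_nonneg[of t]] a by linarith
  have L0: "0 < L" using mult_nonneg_nonneg[OF s(2) fall_nonneg[of T]] L by linarith
  show "mu 1 L t = \<rho>p"
  proof (cases "t = 0")
    case False
    then have "speed \<rho>p \<le> L / fall g t + 1" using a fall_pos[OF False] by (simp add: field_simps)
    then show ?thesis by (rule mu_high[OF False])
  qed (simp add: mu_0 rho0_def L0)
  show "mu 1 (- L) t = \<rho>m"
  proof (cases "t = 0")
    case False
    then have "- L / fall g t + 1 \<le> speed \<rho>m" using b fall_pos[OF False] by (simp add: field_simps)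
    then show ?thesis by (rule mu_low[OF False])
  qed (use L0 in \<open>simp add: mu_0 rho0_def\<close>)
qed

lemma vertical_face_cong:
  fixes G H :: "(real^'n) \<times> real \<Rightarrow> real" and N :: 'n
  assumes m: "G \<in> borel_measurable borel" "H \<in> borel_measurable borel"
    and e: "\<And>x \<omega> t. x = L \<or> x = - L \<Longrightarrow> 0 < t \<Longrightarrow> t < T \<Longrightarrow> G (face_point N (x + fall g t) \<omega>, t) = H (face_point N (x + fall g t) \<omega>, t)"
  shows "(LINT p|face_measure N g L T (N, up). G p) = (LINT p|face_measure N g L T (N, up). H p)"
  unfolding face_integral(1)[OF m(1)] face_integral(1)[OF m(2)]
proof (intro Bochner_Integration.integral_cong refl)
  fix z :: "('n \<Rightarrow> real) \<times> real"
  obtain \<omega> t where z: "z = (\<omega>, t)" by (cases z)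
  show "indicator (face_region N g L T N) z *\<^sub>R G (face_point N (face_pos N g L (N, up) (snd z)) (fst z), snd z)
      = indicator (face_region N g L T N) z *\<^sub>R H (face_point N (face_pos N g L (N, up) (snd z)) (fst z), snd z)"
  proof (cases "z \<in> face_region N g L T N")
    case True
    then have t: "0 < t" "t < T" by (simp_all add: z face_region_def)
    have "face_pos N g L (N, up) t = (if up then L else - L) + fall g t" by (simp add: face_pos_def fall_def)
    then show ?thesis using e[of "if up then L else - L" t \<omega>] t by (simp add: z)
  qed simp
qed

lemma moving_borel:
  "moving N mass_f \<in> borel_measurable borel" "moving N m_f \<in> borel_measurable borel"
  "moving N f_f \<in> borel_measurable borel" "moving N q_f \<in> borel_measurable borel"
  "moving N e_f \<in> borel_measurable borel" "moving N h_f \<in> borel_measurable borel"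
  "moving N nu_f \<in> borel_measurable borel"
  by (intro moving_measurable continuous_fields)+

text \<open>
  On the top and the bottom \<open>a = 0\<close>, so the mass flux relative to the falling boundary vanishes. For momentum and
  energy the same reasoning leaves \<open>q\<close> and \<open>gtq\<close> in the next two lemmas.
\<close>

lemma vertical_mass:
  fixes \<Psi> :: "(real^'n) \<times> real \<Rightarrow> real" and N :: 'n
  assumes L: "(speed \<rho>p - 1) * fall g T < L" "0 < L" and T: "0 < T" and C1: "C1_derivative \<Psi> D"
    and \<Psi>T: "\<And>y. \<bar>y $ N - fall g T\<bar> < L \<Longrightarrow> (\<And>j. j \<noteq> N \<Longrightarrow> 0 < y $ j \<and> y $ j < 1) \<Longrightarrow> \<Psi> (y, T) = 0"
  shows "(LINT p:cylinder N g L T|lborel. moving N mass_f p * D p (0, 1) + moving N m_f p * D p (axis N 1, 0))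
    = - (LINT y:slab N 0 L|lborel. rho0 \<rho>m \<rho>p (y $ N) * \<Psi> (y, 0))"
proof -
  note m\<Psi> = borel_measurable_continuous_onI[OF C1_derivativeD(3)[OF C1]]
  have m: "(\<lambda>p. moving N mass_flux p * \<Psi> p) \<in> borel_measurable borel"
    by (intro borel_measurable_times moving_measurable continuous_fluxes m\<Psi>)
  have e: "moving N mass_flux p + g * snd p * moving N mass_f p = moving N m_f p" for p
    by (simp add: moving_def at_mu_def mass_flux_def mass_f_def m_f_def algebra_simps)
  have z: "moving N zero_f p = 0" for p by (simp add: moving_def at_mu_def zero_f_def case_prod_unfold)
  have face: "(LINT p|face_measure N g L T (N, up). moving N mass_flux p * \<Psi> p) = 0" for up
  proof -
    have "(LINT p|face_measure N g L T (N, up). moving N mass_flux p * \<Psi> p) = (LINT p|face_measure N g L T (N, up). 0)"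
    proof (rule vertical_face_cong[OF m])
      fix x t and \<omega> :: "'n \<Rightarrow> real" assume "x = L \<or> x = - L" "0 < t" "t < T"
      then show "moving N mass_flux (face_point N (x + fall g t) \<omega>, t) * \<Psi> (face_point N (x + fall g t) \<omega>, t) = 0"
        using mu_outer[OF L(1), of t] by (auto simp: at_mu_def mass_flux_def)
    qed simp
    then show ?thesis by simp
  qed
  have "(LINT p:cylinder N g L T|lborel. moving N mass_f p * D p (0, 1)
      + (moving N mass_flux p + g * snd p * moving N mass_f p) * D p (axis N 1, 0) + moving N zero_f p * \<Psi> p)
    = (LINT p|face_measure N g L T (N, True). moving N mass_flux p * \<Psi> p) - (LINT p|face_measure N g L T (N, False). moving N mass_flux p * \<Psi> p)
      - (LINT y:slab N 0 L|lborel. mass_f (y $ N, 0, rho0 \<rho>m \<rho>p (y $ N)) * \<Psi> (y, 0))"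
    by (rule vertical_ibp(2)[OF L(2) T continuous_fields(1) continuous_fluxes(1) continuous_fluxes(8) continuous_fluxes(8)
        continuous_fluxes(9) _ _ C1]) (rule mass_dt mass_dx \<Psi>T; assumption)+
  moreover have "mass_f (x, t, r) = r" for x t r by (simp add: mass_f_def)
  ultimately show ?thesis unfolding e z face by simp
qed

lemma vertical_momentum:
  fixes \<Psi> :: "(real^'n) \<times> real \<Rightarrow> real" and N :: 'n
  assumes L: "(speed \<rho>p - 1) * fall g T < L" "0 < L" and T: "0 < T" and C1: "C1_derivative \<Psi> D"
    and \<Psi>T: "\<And>y. \<bar>y $ N - fall g T\<bar> < L \<Longrightarrow> (\<And>j. j \<noteq> N \<Longrightarrow> 0 < y $ j \<and> y $ j < 1) \<Longrightarrow> \<Psi> (y, T) = 0"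
  shows "set_integrable lborel (cylinder N g L T) (\<lambda>p. moving N m_f p * D p (0, 1) + (moving N f_f p + moving N q_f p) * D p (axis N 1, 0))"
    and "(LINT p:cylinder N g L T|lborel. moving N m_f p * D p (0, 1) + (moving N f_f p + moving N q_f p) * D p (axis N 1, 0))
    = (LINT p|face_measure N g L T (N, True). moving N q_f p * \<Psi> p) - (LINT p|face_measure N g L T (N, False). moving N q_f p * \<Psi> p)"
proof -
  note m\<Psi> = borel_measurable_continuous_onI[OF C1_derivativeD(3)[OF C1]]
  have m: "(\<lambda>p. moving N m_moving_flux p * \<Psi> p) \<in> borel_measurable borel" "(\<lambda>p. moving N q_f p * \<Psi> p) \<in> borel_measurable borel"
    by (intro borel_measurable_times moving_measurable continuous_fluxes continuous_fields m\<Psi>)+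
  have e: "moving N m_moving_flux p + g * snd p * moving N m_f p = moving N f_f p + moving N q_f p" for p
    by (simp add: moving_def at_mu_def m_moving_flux_def)
  have z: "moving N zero_f p = 0" for p by (simp add: moving_def at_mu_def zero_f_def case_prod_unfold)
  have face: "(LINT p|face_measure N g L T (N, up). moving N m_moving_flux p * \<Psi> p) = (LINT p|face_measure N g L T (N, up). moving N q_f p * \<Psi> p)" for up
  proof (rule vertical_face_cong[OF m])
    fix x t and \<omega> :: "'n \<Rightarrow> real" assume "x = L \<or> x = - L" "0 < t" "t < T"
    then show "moving N m_moving_flux (face_point N (x + fall g t) \<omega>, t) * \<Psi> (face_point N (x + fall g t) \<omega>, t)
        = moving N q_f (face_point N (x + fall g t) \<omega>, t) * \<Psi> (face_point N (x + fall g t) \<omega>, t)"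
      using mu_outer[OF L(1), of t] by (auto simp: at_mu_def m_moving_flux_def f_f_def m_f_def power2_eq_square)
  qed
  note ibp = vertical_ibp[OF L(2) T continuous_fields(2) continuous_fluxes(2) continuous_fluxes(8) continuous_fluxes(4)
        continuous_fluxes(5) _ _ C1]
  have v: "set_integrable lborel (cylinder N g L T) (\<lambda>p. moving N m_f p * D p (0, 1)
      + (moving N m_moving_flux p + g * snd p * moving N m_f p) * D p (axis N 1, 0) + moving N zero_f p * \<Psi> p)"
    "(LINT p:cylinder N g L T|lborel. moving N m_f p * D p (0, 1)
      + (moving N m_moving_flux p + g * snd p * moving N m_f p) * D p (axis N 1, 0) + moving N zero_f p * \<Psi> p)
    = (LINT p|face_measure N g L T (N, True). moving N m_moving_flux p * \<Psi> p) - (LINT p|face_measure N g L T (N, False). moving N m_moving_flux p * \<Psi> p)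
      - (LINT y:slab N 0 L|lborel. m_f (y $ N, 0, rho0 \<rho>m \<rho>p (y $ N)) * \<Psi> (y, 0))"
    by (rule ibp; (rule m_dt m_dx \<Psi>T; assumption))+
  show "set_integrable lborel (cylinder N g L T) (\<lambda>p. moving N m_f p * D p (0, 1) + (moving N f_f p + moving N q_f p) * D p (axis N 1, 0))"
    using v(1) unfolding e z by simp
  show "(LINT p:cylinder N g L T|lborel. moving N m_f p * D p (0, 1) + (moving N f_f p + moving N q_f p) * D p (axis N 1, 0))
    = (LINT p|face_measure N g L T (N, True). moving N q_f p * \<Psi> p) - (LINT p|face_measure N g L T (N, False). moving N q_f p * \<Psi> p)"
  proof -
    have "m_f (x, 0, r) = 0" for x r by (simp add: m_f_def)
    then show ?thesis using v(2) unfolding e z face by simp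
  qed
qed

lemma vertical_energy:
  fixes \<Psi> :: "(real^'n) \<times> real \<Rightarrow> real" and N :: 'n
  assumes L: "(speed \<rho>p - 1) * fall g T < L" "0 < L" and T: "0 < T" and C1: "C1_derivative \<Psi> D"
    and \<Psi>T: "\<And>y. \<bar>y $ N - fall g T\<bar> < L \<Longrightarrow> (\<And>j. j \<noteq> N \<Longrightarrow> 0 < y $ j \<and> y $ j < 1) \<Longrightarrow> \<Psi> (y, T) = 0"
  shows "set_integrable lborel (cylinder N g L T) (\<lambda>p. moving N e_f p * D p (0, 1) + moving N h_f p * D p (axis N 1, 0) + moving N nu_f p * \<Psi> p)"
    and "(LINT p:cylinder N g L T|lborel. moving N e_f p * D p (0, 1) + moving N h_f p * D p (axis N 1, 0) + moving N nu_f p * \<Psi> p)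
    = (LINT p|face_measure N g L T (N, True). g * snd p * moving N q_f p * \<Psi> p) - (LINT p|face_measure N g L T (N, False). g * snd p * moving N q_f p * \<Psi> p)"
proof -
  note m\<Psi> = borel_measurable_continuous_onI[OF C1_derivativeD(3)[OF C1]]
  have ms: "(\<lambda>p :: (real^'n) \<times> real. g * snd p) \<in> borel_measurable borel"
    by (intro borel_measurable_continuous_onI continuous_intros)
  have m: "(\<lambda>p. moving N e_moving_flux p * \<Psi> p) \<in> borel_measurable borel" "(\<lambda>p. g * snd p * moving N q_f p * \<Psi> p) \<in> borel_measurable borel"
    by (intro borel_measurable_times[OF borel_measurable_times[OF ms]] borel_measurable_times[OF moving_measurable]
        moving_measurable continuous_fluxes continuous_fields m\<Psi>)+
  have e: "moving N e_moving_flux p + g * snd p * moving N e_f p = moving N h_f p" for p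
    by (simp add: moving_def at_mu_def e_moving_flux_def)
  have face: "(LINT p|face_measure N g L T (N, up). moving N e_moving_flux p * \<Psi> p) = (LINT p|face_measure N g L T (N, up). g * snd p * moving N q_f p * \<Psi> p)" for up
  proof (rule vertical_face_cong[OF m])
    fix x t and \<omega> :: "'n \<Rightarrow> real" assume "x = L \<or> x = - L" "0 < t" "t < T"
    then show "moving N e_moving_flux (face_point N (x + fall g t) \<omega>, t) * \<Psi> (face_point N (x + fall g t) \<omega>, t)
        = g * snd (face_point N (x + fall g t) \<omega>, t) * moving N q_f (face_point N (x + fall g t) \<omega>, t) * \<Psi> (face_point N (x + fall g t) \<omega>, t)"
      using mu_outer[OF L(1), of t] by (auto simp: at_mu_def e_moving_flux_def h_f_def algebra_simps)
  qed
  note ibp = vertical_ibp[OF L(2) T continuous_fields(5) continuous_fluxes(3) continuous_fields(7) continuous_fluxes(6)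
        continuous_fluxes(7) _ _ C1]
  have v: "set_integrable lborel (cylinder N g L T) (\<lambda>p. moving N e_f p * D p (0, 1)
      + (moving N e_moving_flux p + g * snd p * moving N e_f p) * D p (axis N 1, 0) + moving N nu_f p * \<Psi> p)"
    "(LINT p:cylinder N g L T|lborel. moving N e_f p * D p (0, 1)
      + (moving N e_moving_flux p + g * snd p * moving N e_f p) * D p (axis N 1, 0) + moving N nu_f p * \<Psi> p)
    = (LINT p|face_measure N g L T (N, True). moving N e_moving_flux p * \<Psi> p) - (LINT p|face_measure N g L T (N, False). moving N e_moving_flux p * \<Psi> p)
      - (LINT y:slab N 0 L|lborel. e_f (y $ N, 0, rho0 \<rho>m \<rho>p (y $ N)) * \<Psi> (y, 0))"
    by (rule ibp; (rule e_dt e_dx \<Psi>T; assumption))+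
  show "set_integrable lborel (cylinder N g L T) (\<lambda>p. moving N e_f p * D p (0, 1) + moving N h_f p * D p (axis N 1, 0) + moving N nu_f p * \<Psi> p)"
    using v(1) unfolding e by simp
  show "(LINT p:cylinder N g L T|lborel. moving N e_f p * D p (0, 1) + moving N h_f p * D p (axis N 1, 0) + moving N nu_f p * \<Psi> p)
    = (LINT p|face_measure N g L T (N, True). g * snd p * moving N q_f p * \<Psi> p) - (LINT p|face_measure N g L T (N, False). g * snd p * moving N q_f p * \<Psi> p)"
  proof -
    have "e_f (x, 0, r) = 0" for x r by (simp add: e_f_def f_f_def)
    then show ?thesis using v(2) unfolding e face by simp
  qed
qed

end

section \<open>The linear system\<close>

lemma diagonal_inner:
  fixes N :: "'n::finite" and J :: "real^'n^'n"
  shows "((\<chi> i j. if i = N \<and> j = N then f else 0) + mat q) \<bullet> J = f * J $ N $ N + (\<Sum>i\<in>UNIV. q * J $ i $ i)"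
proof -
  have "((\<chi> i j. if i = N \<and> j = N then f else 0) + mat q) \<bullet> J
    = (\<Sum>i\<in>UNIV. \<Sum>j\<in>UNIV. (if i = N then if j = N then f * J $ i $ j else 0 else 0) + (if j = i then q * J $ i $ j else 0))"
    unfolding inner_vec_def by (intro sum.cong refl) (auto simp: mat_def algebra_simps)
  also have "\<dots> = (\<Sum>i\<in>UNIV. (if i = N then f * J $ i $ N else 0) + q * J $ i $ i)"
  proof (intro sum.cong refl)
    fix i
    have "(\<Sum>j\<in>UNIV. if i = N then if j = N then f * J $ i $ j else 0 else 0) = (if i = N then f * J $ i $ N else 0)"
      by (cases "i = N") simp_all
    then show "(\<Sum>j\<in>UNIV. (if i = N then if j = N then f * J $ i $ j else 0 else 0) + (if j = i then q * J $ i $ j else 0))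
      = (if i = N then f * J $ i $ N else 0) + q * J $ i $ i"
      by (simp add: sum.distrib)
  qed
  also have "\<dots> = f * J $ N $ N + (\<Sum>i\<in>UNIV. q * J $ i $ i)" by (simp add: sum.distrib)
  finally show ?thesis .
qed

lemma axis_inner_grad: "(c *\<^sub>R axis N 1) \<bullet> grad \<Psi> p = c * frechet_derivative \<Psi> (at p) (axis N 1, 0)"
  by (simp add: grad_def inner_axis' )

context fan
begin

lemma moving_indep: "j \<noteq> N \<Longrightarrow> moving N \<alpha> (face_point j s \<omega>, t) = moving N \<alpha> (face_point j 0 \<omega>, t)"
  by (simp add: moving_def)

text \<open>
  The vertical component is \<open>vertical_momentum\<close>. Each horizontal component contains the pressure only, which is
  independent of the horizontal position, so that \<open>lateral_ibp\<close> turns it into terms on the lateral faces.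
\<close>

lemma momentum_equation:
  fixes \<Phi> :: "(real^'n) \<times> real \<Rightarrow> real^'n" and N :: 'n
  assumes n: "CARD('n) = 2 \<or> CARD('n) = 3"
    and L: "(speed \<rho>p - 1) * fall g T < L" "0 < L" and T: "0 < T" and \<Phi>: "test_fun b N g L T \<Phi>"
  shows "DDint b N g L T (\<lambda>p. z_m (fan_state N p) \<bullet> dt \<Phi> p +
      (z_sigma (fan_state N p) + mat (2 / real CARD('n) * z_e (fan_state N p)) + mat (moving N q_f p)) \<bullet> jac \<Phi> p)
    - boundary_flux b N g L T (\<lambda>p. moving N q_f p *\<^sub>R \<Phi> p) = 0"
proof -
  define \<Psi> where "\<Psi> i p = \<Phi> p $ i" for i p
  define D where "D i p v = frechet_derivative \<Phi> (at p) v $ i" for i p v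
  have C1: "C1_derivative (\<Psi> i) (D i)" for i
    using smooth_component_C1_derivative[OF test_fun_smooth[OF \<Phi>]] by (simp add: \<Psi>_def[abs_def] D_def[abs_def])
  have \<Psi>T: "\<Psi> i (y, T) = 0" if "\<bar>y $ N - fall g T\<bar> < L" "\<And>j. j \<noteq> N \<Longrightarrow> 0 < y $ j \<and> y $ j < 1" for i y
    using test_fun_zero_at_T[OF \<Phi> T that] by (simp add: \<Psi>_def)
  have g0: "0 \<le> g" "0 \<le> L" "0 \<le> T" using g_pos L T by auto
  obtain C where C: "0 \<le> C" "\<And>p. p \<in> bbox N g L T \<Longrightarrow> \<bar>moving N q_f p\<bar> \<le> C"
    using moving_bound[OF continuous_fields(4), of N L T] by blast
  define q where "q = moving N q_f"
  define V where "V p = moving N m_f p * D N p (0, 1) + (moving N f_f p + moving N q_f p) * D N p (axis N 1, 0)" for p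
  define face where "face i up = (LINT p|face_measure N g L T (i, up). q p * \<Psi> i p)" for i up
  have integrand: "z_m (fan_state N p) \<bullet> dt \<Phi> p +
      (z_sigma (fan_state N p) + mat (2 / real CARD('n) * z_e (fan_state N p)) + mat (moving N q_f p)) \<bullet> jac \<Phi> p
    = V p + (\<Sum>i\<in>UNIV - {N}. q p * D i p (axis i 1, 0))" for p
  proof -
    have j: "jac \<Phi> p $ i $ i = D i p (axis i 1, 0)" for i by (simp add: jac_def D_def)
    have t: "z_m (fan_state N p) \<bullet> dt \<Phi> p = moving N m_f p * D N p (0, 1)"
      by (simp add: dt_def D_def inner_axis')
    have s: "z_sigma (fan_state N p) + mat (2 / real CARD('n) * z_e (fan_state N p)) = (\<chi> i j. if i = N \<and> j = N then moving N f_f p else 0)"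
      unfolding fan_state_simps moving_e by (rule pressure_matrix[OF n])
    have "(\<Sum>i\<in>UNIV. moving N q_f p * D i p (axis i 1, 0)) = q p * D N p (axis N 1, 0) + (\<Sum>i\<in>UNIV - {N}. q p * D i p (axis i 1, 0))"
      unfolding q_def by (rule sum.remove) auto
    then show ?thesis unfolding t s diagonal_inner j V_def by (simp add: q_def algebra_simps)
  qed
  have Vint: "set_integrable lborel (cylinder N g L T) V" "(LINT p:cylinder N g L T|lborel. V p) = face N True - face N False"
    unfolding V_def face_def q_def
    by (rule vertical_momentum[OF L T C1]; (rule \<Psi>T; assumption)?)+
  have lat: "set_integrable lborel (cylinder N g L T) (\<lambda>p. q p * D i p (axis i 1, 0))"
    "(LINT p:cylinder N g L T|lborel. q p * D i p (axis i 1, 0)) = face i True - face i False" if "i \<noteq> N" for i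
    unfolding q_def face_def
    by (rule lateral_ibp[OF C1 that g0 moving_borel(4) C(2) moving_indep[OF that]]; assumption)+
  have m1: "(\<lambda>p. q p * D i p (axis i 1, 0)) \<in> borel_measurable borel" for i
    unfolding q_def by (intro borel_measurable_times moving_borel borel_measurable_continuous_onI C1_derivativeD(2)[OF C1])
  have mV: "V \<in> borel_measurable borel"
    unfolding V_def[abs_def]
    by (intro borel_measurable_add borel_measurable_times moving_borel borel_measurable_continuous_onI C1_derivativeD(2)[OF C1])
  have iS: "set_integrable lborel (cylinder N g L T) (\<lambda>p. \<Sum>i\<in>UNIV - {N}. q p * D i p (axis i 1, 0))"
    unfolding set_integrable_def scaleR_sum_right
    by (intro Bochner_Integration.integrable_sum) (use lat(1) in \<open>simp add: set_integrable_def\<close>)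
  have S: "(LINT p:cylinder N g L T|lborel. (\<Sum>i\<in>UNIV - {N}. q p * D i p (axis i 1, 0))) = (\<Sum>i\<in>UNIV - {N}. face i True - face i False)"
  proof -
    have "(LINT p:cylinder N g L T|lborel. (\<Sum>i\<in>UNIV - {N}. q p * D i p (axis i 1, 0)))
       = (\<Sum>i\<in>UNIV - {N}. (LINT p:cylinder N g L T|lborel. q p * D i p (axis i 1, 0)))"
      unfolding set_lebesgue_integral_def scaleR_sum_right
      by (intro Bochner_Integration.integral_sum) (use lat(1) in \<open>simp add: set_integrable_def\<close>)
    also have "\<dots> = (\<Sum>i\<in>UNIV - {N}. face i True - face i False)" by (intro sum.cong refl lat(2)) simp
    finally show ?thesis .
  qed
  have "DDint b N g L T (\<lambda>p. V p + (\<Sum>i\<in>UNIV - {N}. q p * D i p (axis i 1, 0)))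
     = (LINT p:cylinder N g L T|lborel. V p + (\<Sum>i\<in>UNIV - {N}. q p * D i p (axis i 1, 0)))"
    by (intro DDint_eq borel_measurable_add mV borel_measurable_sum m1)
  also have "\<dots> = (face N True - face N False) + (\<Sum>i\<in>UNIV - {N}. face i True - face i False)"
    using set_integral_add(2)[OF Vint(1) iS] unfolding Vint(2) S .
  finally have I: "DDint b N g L T (\<lambda>p. V p + (\<Sum>i\<in>UNIV - {N}. q p * D i p (axis i 1, 0)))
     = (face N True - face N False) + (\<Sum>i\<in>UNIV - {N}. face i True - face i False)" .
  have B: "boundary_flux b N g L T (\<lambda>p. moving N q_f p *\<^sub>R \<Phi> p) = (\<Sum>i | i = N \<or> b = Walls. face i True - face i False)"
    unfolding boundary_flux_eq by (simp add: face_def q_def \<Psi>_def)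
  have "(\<Sum>i | i = N \<or> b = Walls. face i True - face i False) = (face N True - face N False) + (\<Sum>i\<in>UNIV - {N}. face i True - face i False)"
  proof (cases b)
    case Walls
    then have "{i. i = N \<or> b = Walls} = UNIV" by auto
    then show ?thesis by (simp only:) (rule sum.remove, auto)
  next
    case Periodic
    have "face i True - face i False = 0" if "i \<noteq> N" for i
    proof -
      have "lateral_lift Periodic N (\<Psi> i)"
        using test_fun_lift[OF \<Phi>] Periodic by (simp add: lateral_lift_def \<Psi>_def)
      moreover have "(\<lambda>p. moving N q_f p * \<Psi> i p) \<in> borel_measurable borel"
        by (intro borel_measurable_times moving_borel borel_measurable_continuous_onI C1_derivativeD(3)[OF C1])
      ultimately have "face i True = face i False"
        unfolding face_def q_def
        by (rule periodic_face_cancel[where H="moving N q_f", OF _ that]) (rule moving_indep[OF that])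
      then show ?thesis by simp
    qed
    then have "(\<Sum>i\<in>UNIV - {N}. face i True - face i False) = 0" by (intro sum.neutral) auto
    moreover have "{i. i = N \<or> b = Walls} = {N}" using Periodic by auto
    ultimately show ?thesis by simp
  qed
  then show ?thesis unfolding integrand I B by simp
qed

lemma energy_equation:
  fixes \<Psi> :: "(real^'n) \<times> real \<Rightarrow> real" and N :: 'n
  assumes L: "(speed \<rho>p - 1) * fall g T < L" "0 < L" and T: "0 < T" and \<Psi>: "test_fun b N g L T \<Psi>"
  shows "DDint b N g L T (\<lambda>p. z_e (fan_state N p) * dt \<Psi> p + z_h (fan_state N p) \<bullet> grad \<Psi> p)
     - boundary_flux b N g L T (\<lambda>p. (g * snd p * moving N q_f p * \<Psi> p) *\<^sub>R axis N 1)
     = - DDint b N g L T (\<lambda>p. moving N nu_f p * \<Psi> p)"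
proof -
  let ?D = "\<lambda>p. frechet_derivative \<Psi> (at p)"
  note C1 = smooth_C1_derivative[OF test_fun_smooth[OF \<Psi>]]
  note m = borel_measurable_continuous_onI[OF C1_derivativeD(3)[OF C1]] borel_measurable_continuous_onI[OF C1_derivativeD(2)[OF C1]]
  have \<Psi>T: "\<Psi> (y, T) = 0" if "\<bar>y $ N - fall g T\<bar> < L" "\<And>j. j \<noteq> N \<Longrightarrow> 0 < y $ j \<and> y $ j < 1" for y
    by (rule test_fun_zero_at_T[OF \<Psi> T that])
  let ?E = "\<lambda>p. moving N e_f p * ?D p (0, 1) + moving N h_f p * ?D p (axis N 1, 0)"
  have v: "set_integrable lborel (cylinder N g L T) (\<lambda>p. ?E p + moving N nu_f p * \<Psi> p)"
    "(LINT p:cylinder N g L T|lborel. ?E p + moving N nu_f p * \<Psi> p)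
      = (LINT p|face_measure N g L T (N, True). g * snd p * moving N q_f p * \<Psi> p) - (LINT p|face_measure N g L T (N, False). g * snd p * moving N q_f p * \<Psi> p)"
    by (rule vertical_energy[OF L T C1]; (rule \<Psi>T; assumption)?)+
  have mE: "?E \<in> borel_measurable borel" by (intro borel_measurable_add borel_measurable_times moving_borel m)
  have mn: "(\<lambda>p. moving N nu_f p * \<Psi> p) \<in> borel_measurable borel" by (intro borel_measurable_times moving_borel m)
  obtain C where C: "0 \<le> C" "\<And>p. p \<in> bbox N g L T \<Longrightarrow> \<bar>moving N nu_f p\<bar> \<le> C"
    using moving_bound[OF continuous_fields(7), of N L T] by blast
  obtain K where K: "0 \<le> K" "\<And>p. p \<in> bbox N g L T \<Longrightarrow> \<bar>\<Psi> p\<bar> \<le> K"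
    using bbox_bound[OF C1_derivativeD(3)[OF C1]] by blast
  have g0: "0 \<le> g" using g_pos by simp
  have "set_integrable lborel (cylinder N g L T) (\<lambda>p. moving N nu_f p * \<Psi> p)"
  proof (rule cylinder_integrable[OF g0 mn])
    fix p assume "p \<in> bbox N g L T"
    then show "\<bar>moving N nu_f p * \<Psi> p\<bar> \<le> C * K" unfolding abs_mult using C K by (intro mult_mono) auto
  qed
  note d = set_integral_diff(2)[OF v(1) this]
  have "(LINT p:cylinder N g L T|lborel. ?E p) = (LINT p:cylinder N g L T|lborel. ?E p + moving N nu_f p * \<Psi> p) - (LINT p:cylinder N g L T|lborel. moving N nu_f p * \<Psi> p)"
    unfolding d[symmetric] add_diff_cancel_right' ..
  then have "DDint b N g L T ?E = (LINT p|face_measure N g L T (N, True). g * snd p * moving N q_f p * \<Psi> p)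
     - (LINT p|face_measure N g L T (N, False). g * snd p * moving N q_f p * \<Psi> p) - DDint b N g L T (\<lambda>p. moving N nu_f p * \<Psi> p)"
    unfolding DDint_eq[OF mE] DDint_eq[OF mn] v(2) .
  moreover have "boundary_flux b N g L T (\<lambda>p. (g * snd p * moving N q_f p * \<Psi> p) *\<^sub>R axis N 1)
    = (LINT p|face_measure N g L T (N, True). g * snd p * moving N q_f p * \<Psi> p)
     - (LINT p|face_measure N g L T (N, False). g * snd p * moving N q_f p * \<Psi> p)"
  proof -
    have "boundary_flux b N g L T (\<lambda>p. (g * snd p * moving N q_f p * \<Psi> p) *\<^sub>R axis N 1)
      = (\<Sum>i | i = N \<or> b = Walls. if i = N then (LINT p|face_measure N g L T (N, True). g * snd p * moving N q_f p * \<Psi> p)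
     - (LINT p|face_measure N g L T (N, False). g * snd p * moving N q_f p * \<Psi> p) else 0)"
      unfolding boundary_flux_eq by (intro sum.cong refl) (auto simp: axis_def)
    then show ?thesis by simp
  qed
  moreover have "(\<lambda>p. z_e (fan_state N p) * dt \<Psi> p + z_h (fan_state N p) \<bullet> grad \<Psi> p) = ?E"
    by (simp only: fan_state_simps axis_inner_grad dt_def)
  ultimately show ?thesis by simp
qed

lemma mass_equation:
  fixes \<Psi> :: "(real^'n) \<times> real \<Rightarrow> real" and N :: 'n
  assumes L: "(speed \<rho>p - 1) * fall g T < L" "0 < L" and T: "0 < T" and \<Psi>: "test_fun b N g L T \<Psi>"
  shows "DDint b N g L T (\<lambda>p. z_mu (fan_state N p) * dt \<Psi> p + z_m (fan_state N p) \<bullet> grad \<Psi> p)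
     + (LINT y:Omega b N L \<inter> cell N|lebesgue. rho0 \<rho>m \<rho>p (y $ N) * \<Psi> (y, 0)) = 0"
proof -
  let ?D = "\<lambda>p. frechet_derivative \<Psi> (at p)"
  note C1 = smooth_C1_derivative[OF test_fun_smooth[OF \<Psi>]]
  note m = borel_measurable_continuous_onI[OF C1_derivativeD(3)[OF C1]] borel_measurable_continuous_onI[OF C1_derivativeD(2)[OF C1]]
  let ?E = "\<lambda>p. moving N mass_f p * ?D p (0, 1) + moving N m_f p * ?D p (axis N 1, 0)"
  have mE: "?E \<in> borel_measurable borel" by (intro borel_measurable_add borel_measurable_times moving_borel m)
  have m0: "(\<lambda>y :: real^'n. rho0 \<rho>m \<rho>p (y $ N) * \<Psi> (y, 0)) \<in> borel_measurable borel"
  proof (rule borel_measurable_times)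
    have "(\<lambda>y :: real^'n. moving N mass_f (y, 0)) \<in> borel_measurable borel"
      by (rule measurable_compose[OF borel_measurable_continuous_onI moving_borel(1)]) (intro continuous_intros)
    then show "(\<lambda>y :: real^'n. rho0 \<rho>m \<rho>p (y $ N)) \<in> borel_measurable borel" by (simp add: moving_mass mu_0)
    show "(\<lambda>y. \<Psi> (y, 0)) \<in> borel_measurable borel"
      by (rule measurable_compose[OF borel_measurable_continuous_onI m(1)]) (intro continuous_intros)
  qed
  have "(\<lambda>p. z_mu (fan_state N p) * dt \<Psi> p + z_m (fan_state N p) \<bullet> grad \<Psi> p) = ?E"
    by (simp only: fan_state_simps axis_inner_grad dt_def)
  moreover have "(LINT p:cylinder N g L T|lborel. ?E p) = - (LINT y:slab N 0 L|lborel. rho0 \<rho>m \<rho>p (y $ N) * \<Psi> (y, 0))"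
    by (rule vertical_mass[OF L T C1]) (rule test_fun_zero_at_T[OF \<Psi> T]; assumption)
  ultimately show ?thesis unfolding Omega_integral[OF m0] by (simp only: DDint_eq[OF mE])
qed

lemma fan_linear_system:
  fixes N :: "'n::finite"
  assumes "CARD('n) = 2 \<or> CARD('n) = 3" "(speed \<rho>p - 1) * fall g T < L" "0 < L" "0 < T"
  shows "linear_system b N g L T \<rho>m \<rho>p (fan_state N) (moving N q_f) (\<lambda>\<phi>. DDint b N g L T (\<lambda>p. moving N nu_f p * \<phi> p))"
  unfolding linear_system_def
  using momentum_equation[OF assms] mass_equation[OF assms(2-4)] energy_equation[OF assms(2-4)]
  by (auto simp: DDint_def)

lemma moving_bound_strip:
  fixes \<alpha> :: "real \<times> real \<times> real \<Rightarrow> real"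
  assumes "continuous_on states \<alpha>"
  obtains C where "0 \<le> C" "\<And>p. p \<in> DD b N g L T \<Longrightarrow> \<bar>moving N \<alpha> p\<bar> \<le> C"
proof -
  let ?K = "{-L..L} \<times> {0..T} \<times> {\<rho>m..\<rho>p}"
  have cK: "compact ?K" by (intro compact_Times compact_Icc)
  have c: "continuous_on ?K \<alpha>" by (rule continuous_on_subset[OF assms]) auto
  obtain C where C: "0 \<le> C" "\<And>p. p \<in> ?K \<Longrightarrow> \<bar>\<alpha> p\<bar> \<le> C"
    using continuous_compact_bound[OF c cK] by blast
  show ?thesis
  proof (rule that[OF C(1)])
    fix p assume "p \<in> DD b N g L T"
    then have "0 < snd p" "snd p < T" "\<bar>fst p $ N - fall g (snd p)\<bar> < L" by (simp_all add: DD_alt)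
    then have "(fst p $ N - fall g (snd p), snd p, mu 1 (fst p $ N - fall g (snd p)) (snd p)) \<in> ?K"
      using mu_ge mu_le by (simp only: mem_Sigma_iff atLeastAtMost_iff) (simp add: abs_less_iff)
    from C(2)[OF this] show "\<bar>moving N \<alpha> p\<bar> \<le> C" by (simp add: moving_def at_mu_def)
  qed
qed

lemma sigma_of_borel: "f \<in> borel_measurable M \<Longrightarrow> (\<lambda>p. sigma_of N (f p)) \<in> borel_measurable M"
  by (subst sigma_of_scale) (intro borel_measurable_scaleR borel_measurable_const)

lemma fan_state_ess_bounded: "ess_bounded (DD b N g L T) (fan_state N)"
proof -
  obtain C1 where C1: "\<And>p. p \<in> DD b N g L T \<Longrightarrow> \<bar>moving N mass_f p\<bar> \<le> C1"
    using moving_bound_strip[OF continuous_fields(1)] by blast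
  obtain C2 where C2: "\<And>p. p \<in> DD b N g L T \<Longrightarrow> \<bar>moving N m_f p\<bar> \<le> C2"
    using moving_bound_strip[OF continuous_fields(2)] by blast
  obtain C3 where C3: "\<And>p. p \<in> DD b N g L T \<Longrightarrow> \<bar>moving N h_f p\<bar> \<le> C3"
    using moving_bound_strip[OF continuous_fields(6)] by blast
  obtain C4 where C4: "\<And>p. p \<in> DD b N g L T \<Longrightarrow> \<bar>moving N f_f p\<bar> \<le> C4"
    using moving_bound_strip[OF continuous_fields(3)] by blast
  obtain C5 where C5: "\<And>p. p \<in> DD b N g L T \<Longrightarrow> \<bar>moving N e_f p\<bar> \<le> C5"
    using moving_bound_strip[OF continuous_fields(5)] by blast
  let ?S = "norm (sigma_of N 1)"
  show ?thesis
  proof (rule ess_boundedI[where C="C1 + (g * T + (C2 + (C3 + (C4 * ?S + C5))))"])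
    have "(\<lambda>p :: (real^'a) \<times> real. g * snd p) \<in> borel_measurable borel"
      by (intro borel_measurable_continuous_onI continuous_intros)
    then show "fan_state N \<in> borel_measurable borel"
      unfolding fan_state_def[abs_def]
      by (intro borel_measurable_Pair sigma_of_borel borel_measurable_scaleR borel_measurable_const moving_borel)
  next
    fix p assume p: "p \<in> DD b N g L T"
    have n: "norm (c *\<^sub>R axis N 1 :: real^'a) = \<bar>c\<bar>" for c by simp
    have s: "norm (sigma_of N (moving N f_f p)) \<le> C4 * ?S"
      by (subst sigma_of_scale) (use C4[OF p] in \<open>simp add: mult_right_mono\<close>)
    have gt: "\<bar>g * snd p\<bar> \<le> g * T" using p g_pos by (simp add: DD_alt abs_mult)
    show "norm (fan_state N p) \<le> C1 + (g * T + (C2 + (C3 + (C4 * ?S + C5))))"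
      unfolding fan_state_def
      by (intro order_trans[OF norm_Pair_le] add_mono s; (unfold n real_norm_def)?)
         (rule C1[OF p] gt C2[OF p] C3[OF p] C5[OF p])+
  qed
qed

lemma moving_lift: "lateral_lift b N (moving N \<alpha>)"
  by (simp add: lateral_lift_def moving_def axis_def)

lemma fan_state_lift: "lateral_lift b N (fan_state N)"
  using moving_lift[of b N] by (auto simp: lateral_lift_def fan_state_def)

lemma moving_nu_nonpos: "0 \<le> snd p \<Longrightarrow> moving N nu_f p \<le> 0"
proof -
  assume t: "0 \<le> snd p"
  have "0 \<le> lam * (1 - 2 * lam) * g\<^sup>2 * snd p * af (moving N mass_f p)"
    using lam_pos lam_half t af_nonneg[OF moving_mass_mem[of N p]] by (intro mult_nonneg_nonneg) simp_all
  then show ?thesis unfolding moving_nu by (simp add: algebra_simps)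
qed

lemma fan_admissible:
  fixes N :: "'n::finite"
  assumes n: "CARD('n) = 2 \<or> CARD('n) = 3" and L: "0 < L" and T: "0 < T"
  shows "admissible_class b N g L T (fan_state N) (moving N q_f) (\<lambda>\<phi>. DDint b N g L T (\<lambda>p. moving N nu_f p * \<phi> p))"
  unfolding admissible_class_def
proof (intro conjI)
  have g0: "0 \<le> g" "0 \<le> L" "0 \<le> T" using g_pos L T by auto
  show "ess_bounded (DD b N g L T) (moving N q_f)"
  proof -
    obtain C where "\<And>p. p \<in> DD b N g L T \<Longrightarrow> \<bar>moving N q_f p\<bar> \<le> C"
      using moving_bound_strip[OF continuous_fields(4)] by blast
    then show ?thesis by (intro ess_boundedI[OF moving_borel(4)]) simp
  qed
  show "\<forall>fc\<in>faces b N. integrable (face_measure N g L T fc) (moving N q_f)"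
  proof
    fix fc :: "'n \<times> bool"
    obtain i up where fc: "fc = (i, up)" by (cases fc)
    obtain C where C: "0 \<le> C" "\<And>p. p \<in> bbox N g L T \<Longrightarrow> \<bar>moving N q_f p\<bar> \<le> C"
      using moving_bound[OF continuous_fields(4), of N L T] by blast
    show "integrable (face_measure N g L T fc) (moving N q_f)"
      unfolding fc by (rule face_integrable(2)[OF moving_borel(4) C(2) g0])
  qed
  show "dissipation_measure b N g L T (\<lambda>\<phi>. DDint b N g L T (\<lambda>p. moving N nu_f p * \<phi> p))"
  proof -
    obtain C where C: "0 \<le> C" "\<And>p. p \<in> bbox N g L T \<Longrightarrow> \<bar>moving N nu_f p\<bar> \<le> C"
      using moving_bound[OF continuous_fields(7), of N L T] by blast
    show ?thesis by (rule density_functional[OF moving_borel(7) C(2) g0(1) moving_nu_nonpos])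
  qed
qed (simp_all add: fan_state_lift moving_lift fan_state_ess_bounded transpose_sigma_of trace_sigma_of[OF n])

end

section \<open>The mixing zone and the subsolution\<close>

context fan
begin

text \<open>
  Fubini's theorem: a density that depends on \<open>y\<^sub>n\<close> and \<open>t\<close> only sees a test function through its horizontal
  means.
\<close>

lemma density_slice:
  fixes \<phi> :: "(real^'n) \<times> real \<Rightarrow> real" and N :: 'n
  assumes \<alpha>: "continuous_on states \<alpha>" and \<phi>: "continuous_on UNIV \<phi>"
  shows "DDint b N g L T (\<lambda>p. moving N \<alpha> p * \<phi> p) =
    (\<integral>q. indicator ({-L<..<L} \<times> {0<..<T}) q * (at_mu 1 \<alpha> q * slice_mean N \<phi> (fst q + fall g (snd q)) (snd q)) \<partial>lborel)"
proof -
  have m: "(\<lambda>p. moving N \<alpha> p * \<phi> p) \<in> borel_measurable borel"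
    by (intro borel_measurable_times moving_measurable \<alpha> borel_measurable_continuous_onI \<phi>)
  obtain C where C: "0 \<le> C" "\<And>p. p \<in> bbox N g L T \<Longrightarrow> \<bar>moving N \<alpha> p\<bar> \<le> C"
    using moving_bound[OF \<alpha>, of N L T] by blast
  obtain K where K: "0 \<le> K" "\<And>p. p \<in> bbox N g L T \<Longrightarrow> \<bar>\<phi> p\<bar> \<le> K" using bbox_bound[OF \<phi>] by blast
  have g0: "0 \<le> g" using g_pos by simp
  have i: "set_integrable lborel (cylinder N g L T) (\<lambda>p. moving N \<alpha> p * \<phi> p)"
  proof (rule cylinder_integrable[OF g0 m])
    fix p assume "p \<in> bbox N g L T"
    then show "\<bar>moving N \<alpha> p * \<phi> p\<bar> \<le> C * K" unfolding abs_mult using C K by (intro mult_mono) auto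
  qed
  have c: "continuous_on UNIV (fall g)" by (rule continuous_on_fall[OF continuous_on_id])
  let ?P = "\<lambda>\<omega> q :: real \<times> real. (face_point N (fst q + fall g (snd q)) \<omega>, snd q)"
  have "DDint b N g L T (\<lambda>p. moving N \<alpha> p * \<phi> p) = (\<integral>q. \<integral>\<omega>. indicator (cylinder N g L T) (?P \<omega> q) *\<^sub>R (moving N \<alpha> (?P \<omega> q) * \<phi> (?P \<omega> q)) \<partial>trans_measure N \<partial>lborel)"
    unfolding DDint_eq[OF m] set_lebesgue_integral_def
    by (rule cavalieri_sheared(2)[OF c i[unfolded set_integrable_def]])
  also have "\<dots> = (\<integral>q. indicator ({-L<..<L} \<times> {0<..<T}) q * (at_mu 1 \<alpha> q * slice_mean N \<phi> (fst q + fall g (snd q)) (snd q)) \<partial>lborel)"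
  proof (intro Bochner_Integration.integral_cong refl)
    fix q :: "real \<times> real"
    have "(\<integral>\<omega>. indicator (cylinder N g L T) (?P \<omega> q) *\<^sub>R (moving N \<alpha> (?P \<omega> q) * \<phi> (?P \<omega> q)) \<partial>trans_measure N)
       = (\<integral>\<omega>. (indicator ({-L<..<L} \<times> {0<..<T}) q * at_mu 1 \<alpha> q) * (indicator (cube N) \<omega> *\<^sub>R \<phi> (?P \<omega> q)) \<partial>trans_measure N)"
      unfolding cylinder_sheared_indicator moving_face_point by (simp add: mult_ac)
    also have "\<dots> = indicator ({-L<..<L} \<times> {0<..<T}) q * at_mu 1 \<alpha> q * (\<integral>\<omega>. indicator (cube N) \<omega> *\<^sub>R \<phi> (?P \<omega> q) \<partial>trans_measure N)"
      by (rule integral_mult_right_zero)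
    also have "(\<integral>\<omega>. indicator (cube N) \<omega> *\<^sub>R \<phi> (?P \<omega> q) \<partial>trans_measure N) = slice_mean N \<phi> (fst q + fall g (snd q)) (snd q)"
      by (simp add: slice_mean_def set_lebesgue_integral_def cube_def)
    finally show "(\<integral>\<omega>. indicator (cylinder N g L T) (?P \<omega> q) *\<^sub>R (moving N \<alpha> (?P \<omega> q) * \<phi> (?P \<omega> q)) \<partial>trans_measure N)
       = indicator ({-L<..<L} \<times> {0<..<T}) q * (at_mu 1 \<alpha> q * slice_mean N \<phi> (fst q + fall g (snd q)) (snd q))"
      by (simp only: mult.assoc)
  qed
  finally show ?thesis .
qed

lemma fan_one_dimensional:
  fixes N :: "'n::finite"
  shows "one_dimensional b N g L T \<rho>m \<rho>p (fan_state N) (moving N q_f) (\<lambda>\<phi>. DDint b N g L T (\<lambda>p. moving N nu_f p * \<phi> p))"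
  unfolding one_dimensional_def
proof (intro conjI)
  have dep: "moving N \<alpha> p = (\<lambda>s t. moving N \<alpha> (s *\<^sub>R axis N 1, t)) (fst p $ N) (snd p)" for \<alpha> :: "real \<times> real \<times> real \<Rightarrow> real" and p
    by (simp add: moving_def)
  have depz: "fan_state N p = (\<lambda>s t. fan_state N (s *\<^sub>R axis N 1, t)) (fst p $ N) (snd p)" for p
    by (simp add: fan_state_def moving_def)
  show "\<exists>z1. AE p in lebesgue_on (DD b N g L T). fan_state N p = z1 (fst p $ N) (snd p)"
    by (rule exI, rule AE_I2, rule depz)
  show "\<exists>q1. (AE p in lebesgue_on (DD b N g L T). moving N q_f p = q1 (fst p $ N) (snd p)) \<and>
      (\<forall>fc\<in>faces b N. AE p in face_measure N g L T fc. moving N q_f p = q1 (fst p $ N) (snd p))"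
    by (rule exI, intro conjI ballI; rule AE_I2, rule dep)
  show "\<forall>\<phi> \<psi>. test_fun b N g L T \<phi> \<longrightarrow> test_fun b N g L T \<psi> \<longrightarrow>
      (\<forall>t\<in>{0..<T}. \<forall>s. \<bar>s - 1/2 * g * t\<^sup>2\<bar> \<le> L \<longrightarrow> slice_mean N \<phi> s t = slice_mean N \<psi> s t) \<longrightarrow>
      DDint b N g L T (\<lambda>p. moving N nu_f p * \<phi> p) = DDint b N g L T (\<lambda>p. moving N nu_f p * \<psi> p)"
  proof (intro allI impI)
    fix \<phi> \<psi> :: "(real^'n) \<times> real \<Rightarrow> real"
    assume t: "test_fun b N g L T \<phi>" "test_fun b N g L T \<psi>"
      and e: "\<forall>t\<in>{0..<T}. \<forall>s. \<bar>s - 1/2 * g * t\<^sup>2\<bar> \<le> L \<longrightarrow> slice_mean N \<phi> s t = slice_mean N \<psi> s t"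
    show "DDint b N g L T (\<lambda>p. moving N nu_f p * \<phi> p) = DDint b N g L T (\<lambda>p. moving N nu_f p * \<psi> p)"
      unfolding density_slice[OF continuous_fields(7) smooth_continuous[OF test_fun_smooth[OF t(1)]]]
        density_slice[OF continuous_fields(7) smooth_continuous[OF test_fun_smooth[OF t(2)]]]
    proof (intro Bochner_Integration.integral_cong refl)
      fix q :: "real \<times> real"
      show "indicator ({-L<..<L} \<times> {0<..<T}) q * (at_mu 1 nu_f q * slice_mean N \<phi> (fst q + fall g (snd q)) (snd q))
        = indicator ({-L<..<L} \<times> {0<..<T}) q * (at_mu 1 nu_f q * slice_mean N \<psi> (fst q + fall g (snd q)) (snd q))"
      proof (cases "q \<in> {-L<..<L} \<times> {0<..<T}")
        case True
        then have q: "snd q \<in> {0..<T}" "\<bar>fst q + fall g (snd q) - 1/2 * g * (snd q)\<^sup>2\<bar> \<le> L"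
          by (auto simp: fall_def)
        then show ?thesis using e by simp
      qed simp
    qed
  qed
  show "AE p in lebesgue_on (DD b N g L T).
      z_w (fan_state N p) = (g * snd p) *\<^sub>R axis N 1 \<and>
      (\<forall>j. j \<noteq> N \<longrightarrow> z_m (fan_state N p) $ j = 0 \<and> z_h (fan_state N p) $ j = 0) \<and>
      z_sigma (fan_state N p) = sigma_of N (f_fun \<rho>m \<rho>p g (snd p) (z_mu (fan_state N p)) (z_m (fan_state N p) $ N))"
    by (intro AE_I2) (simp add: axis_def moving_f)
qed

definition mixing :: "lateral \<Rightarrow> 'n::finite \<Rightarrow> real \<Rightarrow> real \<Rightarrow> ((real^'n) \<times> real) set" where
  "mixing b N L T = DD b N g L T \<inter> {p. speed \<rho>m * fall g (snd p) < fst p $ N \<and> fst p $ N < speed \<rho>p * fall g (snd p)}"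

text \<open>
  The functions \<open>T_plus\<close> and \<open>T_minus\<close> with the zeros of numerator and denominator cancelled. The factorisations of
  \<open>a\<close> in \<open>af_factor\<close> show that \<open>m - \<rho>\<^sub>\<mp> w\<close> contains the factor \<open>\<mu> - \<rho>\<^sub>\<mp>\<close>.
\<close>

definition T_plus_f :: "real \<times> real \<times> real \<Rightarrow> real" where
  "T_plus_f = (\<lambda>(x, t, r). \<rho>p / 2 * (g * t * (1 - lam + lam * \<rho>m / (\<rho>m + \<rho>p - r)))\<^sup>2)"
definition T_minus_f :: "real \<times> real \<times> real \<Rightarrow> real" where
  "T_minus_f = (\<lambda>(x, t, r). \<rho>m / 2 * (g * t * (1 - lam + lam * \<rho>p / (\<rho>m + \<rho>p - r)))\<^sup>2)"

lemma continuous_T: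
  "continuous_on states T_plus_f" "continuous_on states T_minus_f"
  unfolding T_plus_f_def T_minus_f_def case_prod_unfold
  by (intro continuous_intros; use gap_pos in force)+

lemma af_factor:
  assumes "r \<le> \<rho>p"
  shows "af r = (r - \<rho>m) * (1 - \<rho>m / (\<rho>m + \<rho>p - r))" "af r = (r - \<rho>p) * (1 - \<rho>p / (\<rho>m + \<rho>p - r))"
  using gap_pos[OF assms] by (simp_all add: af_def field_simps)

lemma T_fan_state:
  fixes p :: "(real^'n) \<times> real" and N :: 'n
  assumes "\<rho>m < moving N mass_f p" "moving N mass_f p < \<rho>p"
  shows "T_plus \<rho>m \<rho>p (fan_state N p) = moving N T_plus_f p" "T_minus \<rho>m \<rho>p (fan_state N p) = moving N T_minus_f p"
proof -
  define r where "r = moving N mass_f p"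
  define t where "t = snd p"
  have r: "\<rho>m < r" "r < \<rho>p" "r \<le> \<rho>p" using assms by (simp_all add: r_def)
  have T: "moving N T_plus_f p = \<rho>p / 2 * (g * t * (1 - lam + lam * \<rho>m / (\<rho>m + \<rho>p - r)))\<^sup>2"
    "moving N T_minus_f p = \<rho>m / 2 * (g * t * (1 - lam + lam * \<rho>p / (\<rho>m + \<rho>p - r)))\<^sup>2"
    by (simp_all add: moving_def at_mu_def T_plus_f_def T_minus_f_def mass_f_def r_def t_def)
  have n: "(norm (c *\<^sub>R axis N 1 - d *\<^sub>R e *\<^sub>R axis N 1 :: real^'n))\<^sup>2 = (c - d * e)\<^sup>2" for c d e
    unfolding scaleR_scaleR scaleR_left_diff_distrib[symmetric] by simp
  have 1: "moving N m_f p - \<rho>m * (g * t) = (r - \<rho>m) * (g * t * (1 - lam + lam * \<rho>m / (\<rho>m + \<rho>p - r)))"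
    unfolding moving_m r_def[symmetric] t_def[symmetric] af_factor(1)[OF r(3)] by (simp add: algebra_simps)
  have 2: "moving N m_f p - \<rho>p * (g * t) = (r - \<rho>p) * (g * t * (1 - lam + lam * \<rho>p / (\<rho>m + \<rho>p - r)))"
    unfolding moving_m r_def[symmetric] t_def[symmetric] af_factor(2)[OF r(3)] by (simp add: algebra_simps)
  show "T_plus \<rho>m \<rho>p (fan_state N p) = moving N T_plus_f p"
    unfolding T_plus_def fan_state_simps n t_def[symmetric] 1 T r_def[symmetric] power_mult_distrib[of "r - \<rho>m"]
    using r by simp
  show "T_minus \<rho>m \<rho>p (fan_state N p) = moving N T_minus_f p"
    unfolding T_minus_def fan_state_simps n t_def[symmetric] 2 T r_def[symmetric] power_mult_distrib[of "r - \<rho>p"]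
    using r by simp
qed

text \<open>
  This identifies the energy flux prescribed in the mixing zone with \<open>h_f\<close>.
\<close>

lemma T_difference:
  fixes p :: "(real^'n) \<times> real" and N :: 'n
  defines "r \<equiv> moving N mass_f p"
  shows "(moving N T_plus_f p - moving N T_minus_f p) / (\<rho>p - \<rho>m) = (g * snd p)\<^sup>2 / 2 * (1 - 2 * lam + lam\<^sup>2 * daf r)"
proof -
  define v where "v = 1 / (\<rho>m + \<rho>p - r)"
  define t where "t = snd p"
  have T: "moving N T_plus_f p = \<rho>p / 2 * (g * t * (1 - lam + lam * \<rho>m * v))\<^sup>2"
    "moving N T_minus_f p = \<rho>m / 2 * (g * t * (1 - lam + lam * \<rho>p * v))\<^sup>2"
    by (simp_all add: moving_def at_mu_def T_plus_f_def T_minus_f_def mass_f_def r_def t_def v_def)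
  have d: "daf r = 1 - \<rho>m * \<rho>p * v\<^sup>2" by (simp add: daf_def v_def power_divide)
  have "moving N T_plus_f p - moving N T_minus_f p = (\<rho>p - \<rho>m) * ((g * t)\<^sup>2 / 2 * (1 - 2 * lam + lam\<^sup>2 * daf r))"
    unfolding T d by (simp add: power2_eq_square field_simps)
  then show ?thesis using rho_less by (simp add: t_def)
qed

text \<open>
  The mixing zone is the fan.
\<close>

lemma mixing_iff:
  assumes "p \<in> DD b N g L T"
  shows "p \<in> mixing b N L T \<longleftrightarrow> \<rho>m < moving N mass_f p \<and> moving N mass_f p < \<rho>p"
proof -
  have t: "snd p \<noteq> 0" using assms by (simp add: DD_alt)
  have m: "moving N mass_f p = mu 0 (fst p $ N) (snd p)" by (cases p) (simp add: moving_mass)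
  have f: "0 < fall g (snd p)" by (rule fall_pos[OF t])
  have "p \<in> mixing b N L T \<longleftrightarrow> speed \<rho>m < fst p $ N / fall g (snd p) + 0 \<and> fst p $ N / fall g (snd p) + 0 < speed \<rho>p"
    using assms f by (simp add: mixing_def pos_less_divide_eq pos_divide_less_eq)
  also have "\<dots> \<longleftrightarrow> \<rho>m < mu 0 (fst p $ N) (snd p) \<and> mu 0 (fst p $ N) (snd p) < \<rho>p"
  proof
    assume a: "speed \<rho>m < fst p $ N / fall g (snd p) + 0 \<and> fst p $ N / fall g (snd p) + 0 < speed \<rho>p"
    then have "speed (mu 0 (fst p $ N) (snd p)) = fst p $ N / fall g (snd p) + 0" by (intro speed_mu[OF t]) auto
    then have "mu 0 (fst p $ N) (snd p) \<noteq> \<rho>m" "mu 0 (fst p $ N) (snd p) \<noteq> \<rho>p" using a by auto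
    then show "\<rho>m < mu 0 (fst p $ N) (snd p) \<and> mu 0 (fst p $ N) (snd p) < \<rho>p"
      using mu_ge[of 0 "fst p $ N" "snd p"] mu_le[of 0 "fst p $ N" "snd p"] by simp
  next
    assume a: "\<rho>m < mu 0 (fst p $ N) (snd p) \<and> mu 0 (fst p $ N) (snd p) < \<rho>p"
    show "speed \<rho>m < fst p $ N / fall g (snd p) + 0 \<and> fst p $ N / fall g (snd p) + 0 < speed \<rho>p"
      using mu_low[OF t, of "fst p $ N" 0] mu_high[OF t, of "fst p $ N" 0] a by (auto simp: not_less[symmetric])
  qed
  finally show ?thesis unfolding m .
qed

lemma open_mixing: "open (mixing b N L T)"
  unfolding mixing_def by (intro open_Int open_DD open_Collect_conj open_Collect_less continuous_intros)

lemma moving_ess_bounded_mixing: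
  fixes \<alpha> :: "real \<times> real \<times> real \<Rightarrow> real"
  assumes \<alpha>: "continuous_on states \<alpha>" and e: "\<And>p. p \<in> mixing b N L T \<Longrightarrow> f p = moving N \<alpha> p"
  shows "ess_bounded (mixing b N L T) f"
proof -
  obtain C where C: "\<And>p. p \<in> DD b N g L T \<Longrightarrow> \<bar>moving N \<alpha> p\<bar> \<le> C"
    using moving_bound_strip[OF \<alpha>] by blast
  have "ess_bounded (mixing b N L T) (moving N \<alpha>)"
    by (rule ess_boundedI[OF moving_measurable[OF \<alpha>], where C=C]) (use C in \<open>auto simp: mixing_def\<close>)
  then obtain C' where b: "moving N \<alpha> \<in> borel_measurable (lebesgue_on (mixing b N L T))"
     "AE p in lebesgue_on (mixing b N L T). norm (moving N \<alpha> p) \<le> C'" unfolding ess_bounded_def by blast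
  show ?thesis unfolding ess_bounded_def
  proof (intro conjI exI[of _ C'])
    show "f \<in> borel_measurable (lebesgue_on (mixing b N L T))"
      by (rule measurable_cong[THEN iffD2, OF _ b(1)]) (use e in \<open>auto simp: space_restrict_space\<close>)
    show "AE p in lebesgue_on (mixing b N L T). norm (f p) \<le> C'"
      using b(2) AE_space by eventually_elim (use e in \<open>auto simp: space_restrict_space\<close>)
  qed
qed

lemma fan_mixing_zone:
  fixes N :: "'n::finite"
  assumes n: "CARD('n) = 2 \<or> CARD('n) = 3"
  shows "mixing_zone b N g L T \<rho>m \<rho>p (fan_state N) (moving N q_f) (mixing b N L T)"
  unfolding mixing_zone_def
proof (intro conjI ballI)
  let ?U = "mixing b N L T"
  show "open ?U" by (rule open_mixing)
  show sub: "?U \<subseteq> DD b N g L T" by (auto simp: mixing_def)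
  show "lateral_lift b N (\<lambda>p. p \<in> ?U)"
    by (auto simp: lateral_lift_def mixing_def DD_alt axis_def)
  have t: "snd p \<noteq> 0" if "p \<in> ?U" for p using that by (auto simp: mixing_def DD_alt)
  have "?U - {(y, t). y $ N = 0 \<and> t = 0} = ?U" using t by force
  then have cm: "continuous_on ?U (moving N mass_f)" using continuous_moving_mass[of ?U N] by simp
  show "continuous_on ?U (fan_state N)"
    unfolding fan_state_def[abs_def]
    by (intro continuous_on_Pair continuous_on_scaleR continuous_sigma_of continuous_moving_fields cm continuous_intros)
  show "continuous_on ?U (moving N q_f)" by (rule continuous_moving_fields)
  show "ess_bounded ?U (moving N q_f)" by (rule moving_ess_bounded_mixing[OF continuous_fields(4)]) simp
  have fan: "\<rho>m < moving N mass_f p" "moving N mass_f p < \<rho>p" if "p \<in> ?U" for p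
    using mixing_iff[of p b N L T] that sub by auto
  show "ess_bounded ?U (\<lambda>p. T_plus \<rho>m \<rho>p (fan_state N p))"
    by (rule moving_ess_bounded_mixing[OF continuous_T(1)]) (rule T_fan_state(1)[OF fan])
  show "ess_bounded ?U (\<lambda>p. T_minus \<rho>m \<rho>p (fan_state N p))"
    by (rule moving_ess_bounded_mixing[OF continuous_T(2)]) (rule T_fan_state(2)[OF fan])
  fix p assume p: "p \<in> ?U"
  show "\<rho>m < z_mu (fan_state N p)" "z_mu (fan_state N p) < \<rho>p" using fan[OF p] by simp_all
  show "z_e (fan_state N p) = 1/2 * f_fun \<rho>m \<rho>p g (snd p) (z_mu (fan_state N p)) (z_m (fan_state N p) $ N)"
    by (simp add: moving_e moving_f)
  have d: "moving N m_f p *\<^sub>R axis N 1 - moving N mass_f p *\<^sub>R (g * snd p) *\<^sub>R axis N 1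
     = (- lam * g * snd p * af (moving N mass_f p)) *\<^sub>R (axis N 1 :: real^'n)"
    unfolding moving_m scaleR_scaleR scaleR_left_diff_distrib[symmetric] by (simp add: algebra_simps)
  show "z_h (fan_state N p) = (z_e (fan_state N p) + moving N q_f p) *\<^sub>R z_w (fan_state N p) +
          ((T_plus \<rho>m \<rho>p (fan_state N p) - T_minus \<rho>m \<rho>p (fan_state N p)) / (\<rho>p - \<rho>m)) *\<^sub>R
            (z_m (fan_state N p) - z_mu (fan_state N p) *\<^sub>R z_w (fan_state N p))"
    unfolding T_fan_state[OF fan[OF p]] T_difference fan_state_simps d
    unfolding moving_h scaleR_scaleR scaleR_left_distrib[symmetric]
    by (rule arg_cong[where f="\<lambda>c. c *\<^sub>R axis N 1"]) (simp add: power2_eq_square power3_eq_cube field_simps)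
next
  show "AE p in lebesgue_on (DD b N g L T - mixing b N L T).
      z_m (fan_state N p) = z_mu (fan_state N p) *\<^sub>R z_w (fan_state N p) \<and>
      z_h (fan_state N p) = (z_e (fan_state N p) + moving N q_f p) *\<^sub>R z_w (fan_state N p) \<and>
      z_mu (fan_state N p) *\<^sub>R (\<chi> i j. z_w (fan_state N p) $ i * z_w (fan_state N p) $ j) =
        z_sigma (fan_state N p) + mat (2 / real CARD('n) * z_e (fan_state N p)) \<and>
      z_mu (fan_state N p) \<in> {\<rho>m, \<rho>p}"
  proof (intro AE_I2)
    fix p assume "p \<in> space (lebesgue_on (DD b N g L T - mixing b N L T))"
    then have "p \<in> DD b N g L T" "p \<notin> mixing b N L T" by (auto simp: space_restrict_space)
    then have r: "moving N mass_f p \<in> {\<rho>m, \<rho>p}" using mixing_iff[of p b N L T] moving_mass_mem[of N p] by auto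
    then have a: "af (moving N mass_f p) = 0" by auto
    have f: "moving N f_f p = g\<^sup>2 * (snd p)\<^sup>2 * moving N mass_f p"
      using a by (simp add: moving_def at_mu_def f_f_def mass_f_def)
    have s: "z_sigma (fan_state N p) + mat (2 / real CARD('n) * z_e (fan_state N p)) = (\<chi> i j. if i = N \<and> j = N then moving N f_f p else 0)"
      unfolding fan_state_simps moving_e by (rule pressure_matrix[OF n])
    show "z_m (fan_state N p) = z_mu (fan_state N p) *\<^sub>R z_w (fan_state N p) \<and>
      z_h (fan_state N p) = (z_e (fan_state N p) + moving N q_f p) *\<^sub>R z_w (fan_state N p) \<and>
      z_mu (fan_state N p) *\<^sub>R (\<chi> i j. z_w (fan_state N p) $ i * z_w (fan_state N p) $ j) =
        z_sigma (fan_state N p) + mat (2 / real CARD('n) * z_e (fan_state N p)) \<and>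
      z_mu (fan_state N p) \<in> {\<rho>m, \<rho>p}"
    proof (intro conjI)
      show "z_m (fan_state N p) = z_mu (fan_state N p) *\<^sub>R z_w (fan_state N p)"
        by (simp add: moving_m a mult_ac)
      show "z_h (fan_state N p) = (z_e (fan_state N p) + moving N q_f p) *\<^sub>R z_w (fan_state N p)"
        by (simp add: moving_h a)
      show "z_mu (fan_state N p) *\<^sub>R (\<chi> i j. z_w (fan_state N p) $ i * z_w (fan_state N p) $ j) =
        z_sigma (fan_state N p) + mat (2 / real CARD('n) * z_e (fan_state N p))"
        unfolding s f by (auto simp: vec_eq_iff axis_def power2_eq_square)
      show "z_mu (fan_state N p) \<in> {\<rho>m, \<rho>p}" using r by simp
    qed
  qed
qed

theorem fan_subsolution:
  fixes N :: "'n::finite"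
  assumes "CARD('n) = 2 \<or> CARD('n) = 3" "(speed \<rho>p - 1) * fall g T < L" "0 < L" "0 < T"
  shows "nonstrict_subsolution_1d b N g L T \<rho>m \<rho>p (fan_state N) (moving N q_f) (\<lambda>\<phi>. DDint b N g L T (\<lambda>p. moving N nu_f p * \<phi> p))"
  unfolding nonstrict_subsolution_1d_def
  using fan_admissible[OF assms(1,3,4)] fan_linear_system[OF assms] fan_one_dimensional fan_mixing_zone[OF assms(1)] by blast

section \<open>The total energy\<close>

lemma initial_energy_integral:
  assumes L: "0 < L"
  shows "(LINT s:{-L..L}|lborel. rho0 \<rho>m \<rho>p s * g * s) = g * L\<^sup>2 / 2 * (\<rho>p - \<rho>m)"
proof -
  define F where "F s = g / 2 * (\<rho>m * s\<^sup>2 + (\<rho>p - \<rho>m) * (max 0 s)\<^sup>2)" for s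
  have d: "(F has_real_derivative rho0 \<rho>m \<rho>p s * g * s) (at s)" for s
  proof -
    have D: "(F has_real_derivative g / 2 * (\<rho>m * (2 * s) + (\<rho>p - \<rho>m) * (2 * max 0 s))) (at s)"
      unfolding F_def by (intro DERIV_cmult DERIV_add DERIV_pos_part_sq) (auto intro!: derivative_eq_intros)
    have E: "g / 2 * (\<rho>m * (2 * s) + (\<rho>p - \<rho>m) * (2 * max 0 s)) = rho0 \<rho>m \<rho>p s * g * s"
      by (simp add: rho0_def max_def algebra_simps)
    show ?thesis by (rule DERIV_cong[OF D E])
  qed
  have "(LINT s:{-L..L}|lborel. rho0 \<rho>m \<rho>p s * g * s) = F L - F (- L)"
  proof (rule set_lebesgue_FTC[where S="{}"])
    have c: "continuous_on UNIV (\<lambda>s. g * (\<rho>m * s + (\<rho>p - \<rho>m) * max 0 s))" by (intro continuous_intros)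
    have "(\<lambda>s. g * (\<rho>m * s + (\<rho>p - \<rho>m) * max 0 s)) = (\<lambda>s. rho0 \<rho>m \<rho>p s * g * s)"
      by (auto simp: fun_eq_iff rho0_def max_def algebra_simps)
    then show "set_integrable lborel {-L..L} (\<lambda>s. rho0 \<rho>m \<rho>p s * g * s)"
      using borel_integrable_atLeastAtMost'[OF continuous_on_subset[OF c subset_UNIV]] by simp
    show "continuous_on {-L..L} F" using d by (meson DERIV_isCont continuous_at_imp_continuous_on)
  qed (use d L in auto)
  also have "F L - F (- L) = g * L\<^sup>2 / 2 * (\<rho>p - \<rho>m)" using L by (simp add: F_def algebra_simps)
  finally show ?thesis .
qed

definition energy_f :: "real \<times> real \<times> real \<Rightarrow> real" where
  "energy_f = (\<lambda>(x, t, r). e_f (x, t, r) - m_f (x, t, r) * g * t + r * g * (x + fall g t))"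

text \<open>
  A primitive of the energy density in \<open>x\<close>. In the fan the terms of its derivative that contain \<open>slope\<close> cancel
  because of \<open>x = - \<lambda> a'(\<mu>) \<tau>\<close>.
\<close>

definition energy_primitive :: "real \<times> real \<times> real \<Rightarrow> real" where
  "energy_primitive = (\<lambda>(x, t, r). g * (x\<^sup>2 * r - lam\<^sup>2 * (fall g t)\<^sup>2 * daf2 r) / 2
     + g * fall g t * lam\<^sup>2 * (x * af r + lam * fall g t * daf2 r))"

lemma energy_f_eq: "energy_f (x, t, r) = g * r * x + g * fall g t * lam\<^sup>2 * af r"
  by (simp add: energy_f_def e_f_def f_f_def m_f_def fall_def power2_eq_square field_simps)

lemma continuous_energy:
  "continuous_on states energy_f" "continuous_on states energy_primitive"
  unfolding energy_f_def energy_primitive_def e_f_def f_f_def m_f_def case_prod_unfold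
  by (intro continuous_intros continuous_on_fall continuous_state; simp)+

lemma DERIV_energy_primitive:
  assumes "0 < t" "x / fall g t + 1 \<noteq> speed \<rho>m" "x / fall g t + 1 \<noteq> speed \<rho>p"
  shows "((\<lambda>x. at_mu 1 energy_primitive (x, t)) has_real_derivative at_mu 1 energy_f (x, t)) (at x)"
proof -
  define r where "r = mu 1 x t"
  define sl where "sl = slope 1 x t"
  define d where "d = daf r"
  define u where "u = fall g t"
  note D = DERIV_fields_x[OF assms, folded r_def sl_def, folded d_def]
  let ?R = "g * ((2 * x * r + sl * x\<^sup>2) - lam\<^sup>2 * u\<^sup>2 * (d\<^sup>2 * sl)) / 2
     + g * u * lam\<^sup>2 * ((1 * af r + d * sl * x) + lam * u * (d\<^sup>2 * sl))"
  have x2: "((\<lambda>x. x\<^sup>2) has_real_derivative 2 * x) (at x)" by (auto intro!: derivative_eq_intros)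
  have D1: "((\<lambda>x. g * (x\<^sup>2 * mu 1 x t - lam\<^sup>2 * u\<^sup>2 * daf2 (mu 1 x t)) / 2
     + g * u * lam\<^sup>2 * (x * af (mu 1 x t) + lam * u * daf2 (mu 1 x t))) has_real_derivative ?R) (at x)"
    using DERIV_add[OF DERIV_cdivide[OF DERIV_cmult[OF DERIV_diff[OF DERIV_mult[OF x2 D(1)] DERIV_cmult[OF D(4), of "lam\<^sup>2 * u\<^sup>2"]], of g], of 2]
        DERIV_cmult[OF DERIV_add[OF DERIV_mult[OF DERIV_ident D(2)] DERIV_cmult[OF D(4), of "lam * u"]], of "g * u * lam\<^sup>2"]]
    by (simp only: r_def)
  have E1: "?R = g * r * x + g * u * lam\<^sup>2 * af r"
  proof (cases rule: slope_cases[OF assms])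
    case 1
    then show ?thesis by (simp add: sl_def)
  next
    case 2
    then have x: "x = - lam * d * u" by (simp add: d_def r_def u_def fall_def)
    show ?thesis unfolding x by (simp add: power2_eq_square field_simps)
  qed
  have F: "(\<lambda>x. at_mu 1 energy_primitive (x, t)) = (\<lambda>x. g * (x\<^sup>2 * mu 1 x t - lam\<^sup>2 * u\<^sup>2 * daf2 (mu 1 x t)) / 2
     + g * u * lam\<^sup>2 * (x * af (mu 1 x t) + lam * u * daf2 (mu 1 x t)))"
    by (simp add: at_mu_def energy_primitive_def u_def)
  have G: "at_mu 1 energy_f (x, t) = g * r * x + g * u * lam\<^sup>2 * af r"
    by (simp add: at_mu_def energy_f_eq r_def u_def)
  show ?thesis unfolding F G by (rule DERIV_cong[OF D1 E1])
qed

text \<open>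
  This jump is the only trace that the fan leaves in the total energy, since \<open>a\<close> vanishes at both ends.
\<close>

lemma daf2_jump: "daf2 \<rho>p - daf2 \<rho>m = (\<rho>p - \<rho>m) ^ 3 / (3 * (\<rho>m * \<rho>p))"
  using rho_pos rhop_pos by (simp add: daf2_def power2_eq_square power3_eq_cube field_simps)

lemma energy_integral:
  assumes L: "(speed \<rho>p - 1) * fall g T < L" "0 < L" and t: "0 \<le> t" "t \<le> T"
  shows "(LINT s:{fall g t - L..fall g t + L}|lborel. at_mu 1 energy_f (s - fall g t, t))
    = g * L\<^sup>2 / 2 * (\<rho>p - \<rho>m) + (\<rho>p - \<rho>m) ^ 3 / (12 * \<rho>p * \<rho>m) * (lam - 1/2) * lam\<^sup>2 * g ^ 3 * t ^ 4"
proof (cases "t = 0")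
  case True
  have "at_mu 1 energy_f (s - fall g t, t) = rho0 \<rho>m \<rho>p s * g * s" for s
    by (simp add: True fall_def at_mu_def energy_f_eq mu_0 mult_ac)
  then show ?thesis using initial_energy_integral[OF L(2)] by (simp add: True fall_def)
next
  case False
  then have t0: "0 < t" using t by simp
  have f: "0 < fall g t" by (rule fall_pos[OF False])
  have c: "continuous_on S (\<lambda>s. at_mu 1 \<alpha> (s - fall g t, t))" if "continuous_on states \<alpha>"
    for \<alpha> :: "real \<times> real \<times> real \<Rightarrow> real" and S
    by (rule continuous_on_compose2[OF continuous_at_mu[OF that]]) (use False in \<open>auto intro!: continuous_intros\<close>)
  have "(LINT s:{fall g t - L..fall g t + L}|lborel. at_mu 1 energy_f (s - fall g t, t))
    = at_mu 1 energy_primitive (fall g t + L - fall g t, t) - at_mu 1 energy_primitive (fall g t - L - fall g t, t)"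
  proof (rule set_lebesgue_FTC[where S="{speed \<rho>m * fall g t, speed \<rho>p * fall g t}"])
    fix s assume s: "s \<in> {fall g t - L<..<fall g t + L} - {speed \<rho>m * fall g t, speed \<rho>p * fall g t}"
    have k: "(s - fall g t) / fall g t + 1 \<noteq> speed \<rho>m" "(s - fall g t) / fall g t + 1 \<noteq> speed \<rho>p"
      using s f by (auto simp: field_simps)
    have "((\<lambda>s. s - fall g t) has_real_derivative 1) (at s)" by (auto intro!: derivative_eq_intros)
    from DERIV_chain2[where f="\<lambda>x. at_mu 1 energy_primitive (x, t)", OF DERIV_energy_primitive[OF t0 k] this]
    show "((\<lambda>s. at_mu 1 energy_primitive (s - fall g t, t)) has_real_derivative at_mu 1 energy_f (s - fall g t, t)) (at s)" by simp
  next
    show "set_integrable lborel {fall g t - L..fall g t + L} (\<lambda>s. at_mu 1 energy_f (s - fall g t, t))"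
      by (rule borel_integrable_atLeastAtMost'[OF c[OF continuous_energy(1)]])
    show "continuous_on {fall g t - L..fall g t + L} (\<lambda>s. at_mu 1 energy_primitive (s - fall g t, t))"
      by (rule c[OF continuous_energy(2)])
  qed (use L in auto)
  also have "\<dots> = energy_primitive (L, t, \<rho>p) - energy_primitive (- L, t, \<rho>m)"
    using mu_outer[OF L(1) t] by (simp add: at_mu_def)
  also have "\<dots> = g * L\<^sup>2 / 2 * (\<rho>p - \<rho>m) + g * (fall g t)\<^sup>2 * lam\<^sup>2 * (lam - 1/2) * (daf2 \<rho>p - daf2 \<rho>m)"
    by (simp add: energy_primitive_def power2_eq_square field_simps)
  also have "g * (fall g t)\<^sup>2 * lam\<^sup>2 * (lam - 1/2) * (daf2 \<rho>p - daf2 \<rho>m)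
     = (\<rho>p - \<rho>m) ^ 3 / (12 * \<rho>p * \<rho>m) * (lam - 1/2) * lam\<^sup>2 * g ^ 3 * t ^ 4"
  proof -
    have "(fall g t)\<^sup>2 = g\<^sup>2 * t ^ 4 / 4" by (simp add: fall_def power_mult_distrib power_divide power_mult[symmetric])
    moreover have "g * (g\<^sup>2 * t ^ 4 / 4) * lam\<^sup>2 * B * (A / (3 * (\<rho>m * \<rho>p))) = A / (12 * \<rho>p * \<rho>m) * B * lam\<^sup>2 * g ^ 3 * t ^ 4" for A B
      using rho_pos rhop_pos by (simp add: power2_eq_square power3_eq_cube field_simps)
    ultimately show ?thesis unfolding daf2_jump by (simp only:)
  qed
  finally show ?thesis .
qed

lemma fan_total_energy:
  fixes N :: "'n::finite"
  assumes L: "(speed \<rho>p - 1) * fall g T < L" "0 < L" and t: "0 \<le> t" "t \<le> T"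
  shows "E_tot b N g L (fan_state N) t =
          (LINT y:Omega b N L \<inter> cell N|lebesgue. rho0 \<rho>m \<rho>p (y $ N) * g * y $ N) +
          (\<rho>p - \<rho>m) ^ 3 / (12 * \<rho>p * \<rho>m) * (lam - 1/2) * lam\<^sup>2 * g ^ 3 * t ^ 4"
proof -
  define h where "h s = at_mu 1 energy_f (s - fall g t, t)" for s
  have mE: "at_mu 1 energy_f \<in> borel_measurable borel"
    by (rule borel_measurable_continuous_except_point[OF continuous_at_mu[OF continuous_energy(1)]])
  have mh: "h \<in> borel_measurable borel"
    unfolding h_def by (rule measurable_compose[OF borel_measurable_continuous_onI mE]) (intro continuous_intros)
  have vec: "(\<lambda>y :: real^'n. k (y $ N)) \<in> borel_measurable borel" if "k \<in> borel_measurable borel" for k :: "real \<Rightarrow> real"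
    by (rule measurable_compose[OF borel_measurable_continuous_onI that]) (intro continuous_intros)
  have "compact ({-L..L} \<times> {0..T} \<times> {\<rho>m..\<rho>p})" by (intro compact_Times compact_Icc)
  moreover have "continuous_on ({-L..L} \<times> {0..T} \<times> {\<rho>m..\<rho>p}) energy_f"
    by (rule continuous_on_subset[OF continuous_energy(1)]) auto
  ultimately obtain C where C: "\<And>v. v \<in> {-L..L} \<times> {0..T} \<times> {\<rho>m..\<rho>p} \<Longrightarrow> \<bar>energy_f v\<bar> \<le> C"
    using continuous_compact_bound[of "{-L..L} \<times> {0..T} \<times> {\<rho>m..\<rho>p}" energy_f] by blast
  have bh: "\<bar>h s\<bar> \<le> C" if "\<bar>s - fall g t\<bar> < L" for s
  proof -
    have "(s - fall g t, t, mu 1 (s - fall g t) t) \<in> {-L..L} \<times> {0..T} \<times> {\<rho>m..\<rho>p}"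
      using that t mu_ge mu_le by (simp add: abs_less_iff)
    from C[OF this] show ?thesis by (simp add: h_def at_mu_def)
  qed
  have "E_tot b N g L (fan_state N) t = (LINT y:Dt b N g L t \<inter> cell N|lebesgue. h (y $ N))"
    unfolding E_tot_def h_def by (simp add: moving_def at_mu_def energy_f_def mass_f_def)
  also have "\<dots> = (LINT s:{fall g t - L..fall g t + L}|lborel. h s)"
    unfolding Dt_integral[OF vec[OF mh]] by (rule slab_integral_vertical[OF mh bh])
  also have "\<dots> = g * L\<^sup>2 / 2 * (\<rho>p - \<rho>m) + (\<rho>p - \<rho>m) ^ 3 / (12 * \<rho>p * \<rho>m) * (lam - 1/2) * lam\<^sup>2 * g ^ 3 * t ^ 4"
    unfolding h_def by (rule energy_integral[OF L t])
  also have "g * L\<^sup>2 / 2 * (\<rho>p - \<rho>m) = (LINT y:Omega b N L \<inter> cell N|lebesgue. rho0 \<rho>m \<rho>p (y $ N) * g * y $ N)"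
  proof -
    define k where "k s = rho0 \<rho>m \<rho>p s * g * s" for s
    have k: "k = (\<lambda>s. g * (\<rho>m * s + (\<rho>p - \<rho>m) * max 0 s))" by (auto simp: k_def fun_eq_iff rho0_def max_def algebra_simps)
    have mk: "k \<in> borel_measurable borel" unfolding k by (intro borel_measurable_continuous_onI continuous_intros)
    have bk: "\<bar>k s\<bar> \<le> \<rho>p * g * L" if "\<bar>s - 0\<bar> < L" for s
      unfolding k_def abs_mult using that g_pos rho_pos rho_less
      by (intro mult_mono) (auto simp: rho0_def)
    have "(LINT y:Omega b N L \<inter> cell N|lebesgue. k (y $ N)) = (LINT s:{0 - L..0 + L}|lborel. k s)"
      unfolding Omega_integral[OF vec[OF mk]] by (rule slab_integral_vertical[OF mk bk])
    then show ?thesis using initial_energy_integral[OF L(2)] by (simp add: k_def)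
  qed
  finally show ?thesis .
qed

section \<open>The singularity at the centre of the wave\<close>

lemma closure_DD_time: "closure (DD b N g L T) \<subseteq> {p. 0 \<le> snd p \<and> snd p \<le> T}"
  by (rule closure_minimal) (auto simp: DD_alt intro!: closed_Collect_conj closed_Collect_le continuous_intros)

text \<open>
  The centre of the wave can be approached in the closed domain from above and from below at time \<open>0\<close>. The
  limits of the density are \<open>\<rho>p\<close> and \<open>\<rho>m\<close>, which excludes continuity in \<open>mass_discontinuous\<close>.
\<close>

lemma closure_DD_vertical_shift:
  assumes y: "(y, 0) \<in> closure (DD b N g L T)" "y $ N = 0" and s: "\<bar>s\<bar> < L"
  shows "(y + s *\<^sub>R axis N 1, 0) \<in> closure (DD b N g L T)"
proof -
  obtain P where P: "\<And>n. P n \<in> DD b N g L T" "P \<longlonglongrightarrow> (y, 0)"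
    using y(1) unfolding closure_sequential by blast
  define Q where "Q n = P n + (s *\<^sub>R axis N 1, 0)" for n
  have "Q \<longlonglongrightarrow> (y, 0) + (s *\<^sub>R axis N 1, 0)" unfolding Q_def by (intro tendsto_intros P)
  then have Q: "Q \<longlonglongrightarrow> (y + s *\<^sub>R axis N 1, 0)" by simp
  have "(\<lambda>n. \<bar>fst (Q n) $ N - fall g (snd (Q n))\<bar>) \<longlonglongrightarrow> \<bar>fst (y + s *\<^sub>R axis N 1, 0::real) $ N - fall g (snd (y + s *\<^sub>R axis N 1, 0))\<bar>"
    unfolding fall_def by (intro tendsto_intros Q)
  moreover have "\<bar>fst (y + s *\<^sub>R axis N 1, 0::real) $ N - fall g (snd (y + s *\<^sub>R axis N 1, 0))\<bar> < L"
    using y(2) s by (simp add: fall_def)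
  ultimately have "\<forall>\<^sub>F n in sequentially. \<bar>fst (Q n) $ N - fall g (snd (Q n))\<bar> < L"
    by (rule order_tendstoD(2))
  then have "\<forall>\<^sub>F n in sequentially. Q n \<in> closure (DD b N g L T)"
  proof eventually_elim
    case (elim n)
    have "Q n \<in> DD b N g L T" using P(1)[of n] elim by (auto simp: DD_alt Q_def axis_def)
    then show ?case using closure_subset by blast
  qed
  then show ?thesis using Lim_in_closed_set[OF closed_closure _ _ Q] by simp
qed

lemma mass_discontinuous:
  assumes p: "(y, 0) \<in> closure (DD b N g L T)" "y $ N = 0" and L: "0 < L"
  shows "\<not> continuous (at (y, 0) within closure (DD b N g L T)) (moving N mass_f)"
proof
  let ?C = "closure (DD b N g L T)"
  assume "continuous (at (y, 0) within ?C) (moving N mass_f)"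
  then have lim: "(moving N mass_f \<longlongrightarrow> moving N mass_f (y, 0)) (at (y, 0) within ?C)"
    by (simp add: continuous_within)
  define c where "c s = (y + s *\<^sub>R axis N 1, 0::real)" for s
  have c: "(c \<longlongrightarrow> (y, 0)) (at s0 within S)" if "s0 = 0" for s0 S
  proof -
    have "(c \<longlongrightarrow> (y + 0 *\<^sub>R axis N 1, 0)) (at 0 within S)" unfolding c_def by (intro tendsto_intros)
    then show ?thesis using that by simp
  qed
  have ev: "\<forall>\<^sub>F s in at 0. c s \<in> ?C \<and> c s \<noteq> (y, 0)"
    unfolding eventually_at
  proof (intro exI[of _ L] conjI ballI impI)
    fix s :: real assume s: "s \<noteq> 0 \<and> dist s 0 < L"
    then show "c s \<in> ?C" unfolding c_def by (intro closure_DD_vertical_shift p) simp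
    show "c s \<noteq> (y, 0)" using s by (simp add: c_def axis_eq_0_iff)
  qed (rule L)
  have "filterlim c (at (y, 0) within ?C) (at 0)"
    unfolding filterlim_at using c[of 0 UNIV] ev by simp
  from filterlim_compose[OF lim this]
  have lim0: "((\<lambda>s. moving N mass_f (c s)) \<longlongrightarrow> moving N mass_f (y, 0)) (at 0)" .
  have val: "moving N mass_f (c s) = rho0 \<rho>m \<rho>p s" for s
    using p(2) by (simp add: c_def moving_mass mu_0)
  have "((\<lambda>s. rho0 \<rho>m \<rho>p s) \<longlongrightarrow> moving N mass_f (y, 0)) (at_right 0)" "((\<lambda>s. rho0 \<rho>m \<rho>p s) \<longlongrightarrow> moving N mass_f (y, 0)) (at_left 0)"
    using lim0 unfolding val by (auto simp: filterlim_at_split)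
  moreover have "((\<lambda>s. rho0 \<rho>m \<rho>p s) \<longlongrightarrow> \<rho>p) (at_right 0)"
    by (rule tendsto_eventually) (simp add: eventually_at_filter rho0_def)
  moreover have "((\<lambda>s. rho0 \<rho>m \<rho>p s) \<longlongrightarrow> \<rho>m) (at_left 0)"
    by (rule tendsto_eventually) (simp add: eventually_at_filter rho0_def)
  ultimately have "moving N mass_f (y, 0) = \<rho>p" "moving N mass_f (y, 0) = \<rho>m"
    using tendsto_unique trivial_limit_at_right_real trivial_limit_at_left_real by blast+
  then show False using rho_less by simp
qed

end

section \<open>The rarefaction wave gives a subsolution\<close>

theorem proposition1p10:
  fixes N :: "'n::finite" and b :: lateral and g L T lam \<rho>m \<rho>p :: real
  assumes "CARD('n) = 2 \<or> CARD('n) = 3"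
    and "g > 0" and "L > 0" and "0 < \<rho>m" and "\<rho>m < \<rho>p"
    and "0 < lam" and "lam \<le> 1/2"
    and "T > 0" and "lam * ((\<rho>p - \<rho>m) / \<rho>m) * (g * T\<^sup>2 / 2) < L"
  shows "\<exists>\<mu>.
    entropy_solution (m_flux \<rho>m \<rho>p g lam) {\<rho>m..\<rho>p} T (rho0 \<rho>m \<rho>p) \<mu> \<and>
    (\<forall>v. entropy_solution (m_flux \<rho>m \<rho>p g lam) {\<rho>m..\<rho>p} T (rho0 \<rho>m \<rho>p) v \<longrightarrow>
       (AE p in lebesgue_on (UNIV \<times> {0<..<T}). v p = \<mu> p)) \<and>
    (\<exists>(z :: (real^'n) \<times> real \<Rightarrow> 'n state) (q :: (real^'n) \<times> real \<Rightarrow> real) \<nu>.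
       (\<forall>(y, t) \<in> closure (DD b N g L T).
          z_mu (z (y, t)) = \<mu> (y $ N, t) \<and>
          z_m (z (y, t)) = m_flux \<rho>m \<rho>p g lam t (\<mu> (y $ N, t)) *\<^sub>R axis N 1 \<and>
          \<nu> (y, t) = (1 - 2 * lam) * g * (z_m (z (y, t)) $ N - z_mu (z (y, t)) * g * t) \<and>
          \<nu> (y, t) = lam * (2 * lam - 1) * g\<^sup>2 * t * a_fun \<rho>m \<rho>p (z_mu (z (y, t))) \<and>
          \<nu> (y, t) \<le> 0) \<and>
       nonstrict_subsolution_1d b N g L T \<rho>m \<rho>p z q (\<lambda>\<phi>. DDint b N g L T (\<lambda>p. \<nu> p * \<phi> p)) \<and>
       (\<forall>t \<in> {0..<T}. E_tot b N g L z t =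
          (LINT y:Omega b N L \<inter> cell N|lebesgue. rho0 \<rho>m \<rho>p (y $ N) * g * y $ N) +
          (\<rho>p - \<rho>m) ^ 3 / (12 * \<rho>p * \<rho>m) * (lam - 1/2) * lam\<^sup>2 * g ^ 3 * t ^ 4) \<and>
       continuous_on (closure (DD b N g L T) - {(y, t). y $ N = 0 \<and> t = 0}) (\<lambda>p. z_mu (z p)) \<and>
       (\<forall>p \<in> closure (DD b N g L T) \<inter> {(y, t). y $ N = 0 \<and> t = 0}.
          \<not> continuous (at p within closure (DD b N g L T)) (\<lambda>p. z_mu (z p))) \<and>
       continuous_on (closure (DD b N g L T)) (\<lambda>p. z_w (z p)) \<and>
       continuous_on (closure (DD b N g L T)) (\<lambda>p. z_m (z p)) \<and>
       continuous_on (closure (DD b N g L T)) (\<lambda>p. z_h (z p)) \<and>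
       continuous_on (closure (DD b N g L T)) (\<lambda>p. z_sigma (z p)) \<and>
       continuous_on (closure (DD b N g L T)) (\<lambda>p. z_e (z p)) \<and>
       continuous_on (closure (DD b N g L T)) q \<and>
       continuous_on (closure (DD b N g L T)) \<nu>)"
proof -
  interpret fan g lam \<rho>m \<rho>p by unfold_locales (use assms in auto)
  have "speed \<rho>p - 1 = lam * ((\<rho>p - \<rho>m) / \<rho>m)"
    using \<open>0 < \<rho>m\<close> by (simp add: speed_rhop field_simps)
  then have L: "(speed \<rho>p - 1) * fall g T < L" using assms(9) by (simp add: fall_def)
  let ?C = "closure (DD b N g L T)"
  show ?thesis
  proof (rule exI[of _ "\<lambda>(x, t). mu 0 x t"], intro conjI allI impI,
      goal_cases)
    case 1
    show ?case by (rule entropy_solution_mu[OF \<open>T > 0\<close>])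
  next
    case (2 v)
    show ?case using entropy_solution_unique[OF 2 \<open>T > 0\<close>] by (simp add: case_prod_unfold)
  next
    case 3
    show ?case
    proof (rule exI[of _ "fan_state N"], rule exI[of _ "moving N q_f"], rule exI[of _ "moving N nu_f"], intro conjI ballI, goal_cases)
      case (1 p)
      obtain y t where p: "p = (y, t)" by (cases p)
      have t: "0 \<le> t" using closure_DD_time[of b N L T] 1 by (auto simp: p)
      have a: "a_fun \<rho>m \<rho>p (moving N mass_f (y, t)) = af (moving N mass_f (y, t))"
        using moving_mass_mem[of N "(y, t)"] by (intro a_fun_af) simp
      have "moving N nu_f (y, t) \<le> 0" using moving_nu_nonpos[of "(y, t)" N] t by simp
      moreover have "moving N m_f (y, t) = m_flux \<rho>m \<rho>p g lam t (mu 0 (y $ N) t)"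
        using a by (simp add: moving_m m_flux_def moving_mass)
      moreover have "moving N nu_f (y, t) = (1 - 2 * lam) * g * (moving N m_f (y, t) - moving N mass_f (y, t) * g * t)"
        by (simp add: moving_nu moving_m power2_eq_square algebra_simps)
      moreover have "moving N nu_f (y, t) = lam * (2 * lam - 1) * g\<^sup>2 * t * a_fun \<rho>m \<rho>p (moving N mass_f (y, t))"
        unfolding a by (simp add: moving_nu)
      ultimately show ?case by (simp add: p moving_mass)
    next
      case 2
      show ?case by (rule fan_subsolution[OF assms(1) L assms(3,8)])
    next
      case (3 t)
      then show ?case by (intro fan_total_energy[OF L assms(3)]) auto
    next
      case 4
      show ?case using continuous_moving_mass by simp
    next
      case (5 p)
      then show ?case using mass_discontinuous[OF _ _ assms(3)] by auto
    qed (simp_all add: continuous_intros continuous_moving_fields continuous_sigma_of)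
  qed
qed

end
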